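(* Let $X$ be a Banach space and let $\{T(t)\}_{t>0}\subset\mathcal L(X)$ be a semigroup on $X$ having a Laplace transform $\hat T(\lambda)=\int_0^\infty e^{-\lambda t}T(t)\,dt$ with abscissa of convergence $\omega_0$. Then $\hat T(\lambda)$ is the resolvent $R(\lambda,A)$ of a (multivalued) operator $A$ in $X$, with $(\omega_0,\infty)\subset\rho(A)$. Moreover, for any numbers $\gamma\ge0$ and $0\le\beta<1$ the following assertions are equivalent: (i) The semigroup $T$ has a holomorphic extension into the open right half-plane, and for each $\alpha>\gamma$ there exist $M>0$ and $\omega\ge0$ such that $$\|T(z)\|\le M e^{\omega|z|}\frac{|z|^\alpha}{(\mathrm{Re}\,z)^{\alpha+\beta}},\qquad \mathrm{Re}\,z>0 .$$ (ii) For each $\alpha>\gamma$, $A$ is the generator of a holomorphic $(\alpha+\beta)$-times integrated semigroup $S_{\alpha+\beta}$ in the open right half-plane, admitting boundary values on $i\mathbb R$, and there exist $M,\omega>0$ such that $$\|S_{\alpha+\beta}(z)\|\le M e^{\omega|z|}|z|^\alpha,\qquad \mathrm{Re}\,z\ge0 .$$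
   Context: A semigroup $\{T(t)\}_{t>0}\subset\mathcal L(X)$ is a family of bounded operators satisfying $T(t+s)=T(t)T(s)$ for $t,s>0$; no convergence as $t\to0$ is assumed. Laplace integrals are understood strongly. A multivalued linear operator $A$ in $X$ has $\lambda\in\rho(A)$ when $R(\lambda,A)=(\lambda-A)^{-1}$ is a univalent bounded operator defined on all of $X$; every pseudo-resolvent (family of bounded operators satisfying the resolvent equation) is the resolvent of a multivalued operator. For $\kappa\ge0$, a (possibly multivalued) closed linear operator $A$ on $X$ with nonempty resolvent set generates a $\kappa$-times integrated semigroup $S$ if there exist $\omega_1\ge0$ and a strongly continuous function $S:[0,\infty)\to\mathcal L(X)$ having a Laplace transform for $\lambda>\omega_1$ such that $(\omega_1,\infty)\subset\rho(A)$ and $R(\lambda,A)=\lambda^\kappa\int_0^\infty e^{-\lambda t}S(t)\,dt$ for $\lambda>\omega_1$. If $S$ is only strongly continuous on $(0,\infty)$, with the other properties unchanged, one speaks of a $\kappa$-times integrated semigroup in the extended sense. A $\kappa$-times integrated semigroup (in either sense) is called holomorphic in the open right half-plane if it admits a holomorphic extension to $\{z\in\mathbb C:\mathrm{Re}\,z>0\}$. It admits boundary values on $i\mathbb R$ if this holomorphic function extends to a continuous function on the closed right half-plane $\{\mathrm{Re}\,z\ge0\}$; the extension is denoted by the same symbol. *)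

theory Defs
  imports "HOL-Analysis.Analysis"
begin

class complex_normed_vector = real_normed_vector +
  fixes scaleC :: "complex \<Rightarrow> 'a \<Rightarrow> 'a"  (infixr \<open>*\<^sub>C\<close> 75)
  assumes scaleC_add_right: "c *\<^sub>C (x + y) = c *\<^sub>C x + c *\<^sub>C y"
    and scaleC_add_left: "(c + d) *\<^sub>C x = c *\<^sub>C x + d *\<^sub>C x"
    and scaleC_scaleC: "c *\<^sub>C (d *\<^sub>C x) = (c * d) *\<^sub>C x"
    and scaleC_of_real: "complex_of_real r *\<^sub>C x = r *\<^sub>R x"
    and norm_scaleC: "norm (c *\<^sub>C x) = cmod c * norm x"

class complex_banach = complex_normed_vector + banach

text \<open>
  The type of real-linear bounded maps into a complex Banach space is itself a complex Banach
  space under pointwise scaling; the bounded complex-linear operators form its closed subspace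
  \<open>cblin_ops\<close>, which is the operator space written L(X) in the literature.
\<close>

lemma bounded_linear_scaleC: "bounded_linear (\<lambda>x::'a::complex_normed_vector. c *\<^sub>C x)"
proof (rule bounded_linear_intro[where K = "cmod c"])
  fix r :: real and x :: 'a
  show "c *\<^sub>C (r *\<^sub>R x) = r *\<^sub>R (c *\<^sub>C x)"
    by (simp flip: scaleC_of_real add: scaleC_scaleC mult.commute)
qed (simp_all add: scaleC_add_right norm_scaleC mult.commute)

instantiation blinfun :: (real_normed_vector, complex_normed_vector) complex_normed_vector
begin

lift_definition scaleC_blinfun :: "complex \<Rightarrow> 'a \<Rightarrow>\<^sub>L 'b \<Rightarrow> 'a \<Rightarrow>\<^sub>L 'b" is "\<lambda>c f x. c *\<^sub>C f x"
  by (rule bounded_linear_compose[OF bounded_linear_scaleC])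

instance
proof
  fix c d :: complex and r :: real and f g :: "'a \<Rightarrow>\<^sub>L 'b"
  show "c *\<^sub>C (f + g) = c *\<^sub>C f + c *\<^sub>C g"
    by transfer (simp add: scaleC_add_right)
  show "(c + d) *\<^sub>C f = c *\<^sub>C f + d *\<^sub>C f"
    by transfer (simp add: scaleC_add_left)
  show "c *\<^sub>C (d *\<^sub>C f) = (c * d) *\<^sub>C f"
    by transfer (simp add: scaleC_scaleC)
  show "complex_of_real r *\<^sub>C f = r *\<^sub>R f"
    by transfer (simp add: scaleC_of_real)
  have "onorm (\<lambda>x. c *\<^sub>C h x) = cmod c * onorm h" if "bounded_linear h" for h :: "'a \<Rightarrow> 'b"
  proof -
    have "onorm (\<lambda>x. c *\<^sub>C h x) = onorm (\<lambda>x. cmod c *\<^sub>R h x)"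
      by (simp add: onorm_def norm_scaleC)
    then show ?thesis
      using onorm_scaleR[OF that, of "cmod c"] by simp
  qed
  then show "norm (c *\<^sub>C f) = cmod c * norm f"
    by transfer
qed

end

instance blinfun :: (real_normed_vector, complex_banach) complex_banach ..

definition cblin_ops :: "('a::complex_banach \<Rightarrow>\<^sub>L 'a) set" where
  "cblin_ops = {B. \<forall>c x. blinfun_apply B (c *\<^sub>C x) = c *\<^sub>C blinfun_apply B x}"

text \<open>Holomorphy for functions with values in a complex Banach space (for operator-valued
  functions this is holomorphy in the operator norm).\<close>

definition vholomorphic_on :: "(complex \<Rightarrow> 'b::complex_banach) \<Rightarrow> complex set \<Rightarrow> bool" where
  "vholomorphic_on f S \<longleftrightarrow>
     (\<forall>z\<in>S. \<exists>D. (f has_derivative (\<lambda>h. h *\<^sub>C D)) (at z within S))"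

text \<open>The library's \<open>has_bochner_integral\<close> is restricted to second countable (i.e. separable) target
  spaces.  This is the same definition for an arbitrary Banach space.\<close>

definition has_bochner_int :: "'m measure \<Rightarrow> ('m \<Rightarrow> 'b::banach) \<Rightarrow> 'b \<Rightarrow> bool" where
  "has_bochner_int M f x \<longleftrightarrow>
     f \<in> borel_measurable M \<and>
     (\<exists>s. (\<forall>i. Bochner_Integration.simple_bochner_integrable M (s i)) \<and>
          (\<lambda>i. \<integral>\<^sup>+t. ennreal (norm (f t - s i t)) \<partial>M) \<longlonglongrightarrow> 0 \<and>
          (\<lambda>i::nat. Bochner_Integration.simple_bochner_integral M (s i)) \<longlonglongrightarrow> x)"

definition bochner_int :: "'m measure \<Rightarrow> ('m \<Rightarrow> 'b::banach) \<Rightarrow> 'b" where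
  "bochner_int M f = (THE x. has_bochner_int M f x)"

text \<open>\<open>f\<close> is in \<open>L\<^sup>1\<^sub>l\<^sub>o\<^sub>c\<close> of the closed half-line; the value \<open>f 0\<close> is irrelevant.\<close>

definition loc_bochner_integrable :: "(real \<Rightarrow> 'b::banach) \<Rightarrow> bool" where
  "loc_bochner_integrable f \<longleftrightarrow> (\<forall>\<tau>>0. \<exists>x. has_bochner_int (lebesgue_on {0<..\<tau>}) f x)"

text \<open>The Laplace integral converges at \<open>\<mu>\<close>, as an improper integral at infinity, to \<open>y\<close>.\<close>

definition has_laplace :: "(real \<Rightarrow> 'b::banach) \<Rightarrow> real \<Rightarrow> 'b \<Rightarrow> bool" where
  "has_laplace f \<mu> y \<longleftrightarrow>
     loc_bochner_integrable f \<and>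
     ((\<lambda>\<tau>. bochner_int (lebesgue_on {0<..\<tau>}) (\<lambda>t. exp (- (\<mu> * t)) *\<^sub>R f t)) \<longlongrightarrow> y) at_top"

definition op_has_laplace ::
    "(real \<Rightarrow> 'a::complex_banach \<Rightarrow>\<^sub>L 'a) \<Rightarrow> real \<Rightarrow> ('a \<Rightarrow>\<^sub>L 'a) \<Rightarrow> bool" where
  "op_has_laplace T \<mu> L \<longleftrightarrow>
     L \<in> cblin_ops \<and>
     (\<forall>x. has_laplace (\<lambda>t. blinfun_apply (T t) x) \<mu> (blinfun_apply L x))"

definition laplace_convergence_set :: "(real \<Rightarrow> 'a::complex_banach \<Rightarrow>\<^sub>L 'a) \<Rightarrow> real set" where
  "laplace_convergence_set T = {\<mu>. \<forall>x. \<exists>y. has_laplace (\<lambda>t. blinfun_apply (T t) x) \<mu> y}"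

text \<open>The abscissa of convergence; it may be \<open>-\<infinity>\<close>.\<close>

definition laplace_abscissa :: "(real \<Rightarrow> 'a::complex_banach \<Rightarrow>\<^sub>L 'a) \<Rightarrow> ereal" where
  "laplace_abscissa T = (INF \<mu>\<in>laplace_convergence_set T. ereal \<mu>)"

text \<open>Only the values at positive times matter.\<close>

definition op_semigroup :: "(real \<Rightarrow> 'a::complex_banach \<Rightarrow>\<^sub>L 'a) \<Rightarrow> bool" where
  "op_semigroup T \<longleftrightarrow>
     (\<forall>t>0. T t \<in> cblin_ops) \<and>
     (\<forall>t>0. \<forall>s>0. T (t + s) = T t o\<^sub>L T s)"

text \<open>A multivalued operator is identified with its graph.\<close>

definition mv_linear :: "('a::complex_banach \<times> 'a) set \<Rightarrow> bool" where
  "mv_linear A \<longleftrightarrow>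
     (0, 0) \<in> A \<and>
     (\<forall>x y u v. (x, y) \<in> A \<longrightarrow> (u, v) \<in> A \<longrightarrow> (x + u, y + v) \<in> A) \<and>
     (\<forall>c x y. (x, y) \<in> A \<longrightarrow> (c *\<^sub>C x, c *\<^sub>C y) \<in> A)"

text \<open>The relation \<open>(\<mu> - A)\<^sup>-\<^sup>1\<close>.\<close>

definition mv_resolvent :: "('a::complex_banach \<times> 'a) set \<Rightarrow> complex \<Rightarrow> ('a \<times> 'a) set" where
  "mv_resolvent A \<mu> = {(\<mu> *\<^sub>C x - y, x) | x y. (x, y) \<in> A}"

definition is_resolvent ::
    "('a::complex_banach \<times> 'a) set \<Rightarrow> complex \<Rightarrow> ('a \<Rightarrow>\<^sub>L 'a) \<Rightarrow> bool" where
  "is_resolvent A \<mu> R \<longleftrightarrow> R \<in> cblin_ops \<and> mv_resolvent A \<mu> = {(u, blinfun_apply R u) | u. True}"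

definition resolvent_set :: "('a::complex_banach \<times> 'a) set \<Rightarrow> complex set" where
  "resolvent_set A = {\<mu>. \<exists>R. is_resolvent A \<mu> R}"

definition resolvent :: "('a::complex_banach \<times> 'a) set \<Rightarrow> complex \<Rightarrow> 'a \<Rightarrow>\<^sub>L 'a" where
  "resolvent A \<mu> = (THE R. is_resolvent A \<mu> R)"

definition generates_integrated_semigroup ::
    "('a::complex_banach \<times> 'a) set \<Rightarrow> real \<Rightarrow> (real \<Rightarrow> 'a \<Rightarrow>\<^sub>L 'a) \<Rightarrow> bool" where
  "generates_integrated_semigroup A \<kappa> S \<longleftrightarrow>
     mv_linear A \<and> closed A \<and> resolvent_set A \<noteq> {} \<and>
     (\<forall>t\<ge>0. S t \<in> cblin_ops) \<and>
     (\<forall>x. continuous_on {0..} (\<lambda>t. blinfun_apply (S t) x)) \<and>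
     (\<exists>\<omega>1\<ge>0. \<forall>\<mu>>\<omega>1.
        complex_of_real \<mu> \<in> resolvent_set A \<and>
        (\<exists>L. op_has_laplace S \<mu> L \<and> resolvent A (complex_of_real \<mu>) = (\<mu> powr \<kappa>) *\<^sub>R L))"

text \<open>\<open>S\<close>, given on the closed right half-plane, is the holomorphic extension, together with its
  boundary values, of a \<open>\<kappa>\<close>-times integrated semigroup generated by \<open>A\<close>.\<close>

definition generates_holomorphic_bv ::
    "('a::complex_banach \<times> 'a) set \<Rightarrow> real \<Rightarrow> (complex \<Rightarrow> 'a \<Rightarrow>\<^sub>L 'a) \<Rightarrow> bool" where
  "generates_holomorphic_bv A \<kappa> S \<longleftrightarrow>
     generates_integrated_semigroup A \<kappa> (\<lambda>t. S (complex_of_real t)) \<and>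
     (\<forall>z. 0 \<le> Re z \<longrightarrow> S z \<in> cblin_ops) \<and>
     vholomorphic_on S {z. 0 < Re z} \<and>
     continuous_on {z. 0 \<le> Re z} S"

end

(* T(t) R(lambda) x is exp (lambda t) times the tail of the Laplace integral of T(.) x, and one
   integration by parts turns this into the resolvent equation for the Laplace transform.

   Holomorphic extension implies integrated semigroup: S is the fractional integral of order
   alpha + beta of T along rays from 0.  The growth hypothesis for an exponent slightly smaller than
   alpha bounds S'(z) by an integrable power of Re z, so S extends continuously to the imaginary axis.

   Conversely, the fractional integral of S of order n - (alpha + beta), with n the least integer
   above alpha + beta, is by uniqueness of Laplace transforms the n-fold integral of T on (0, oo), and
   its n-th derivative is the extension of T; Cauchy estimates on discs of radius comparable to Re z
   give the growth bound.  The identity theorem shows that the extension does not depend on alpha. *)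

theory Submission
  imports Defs "HOL-Complex_Analysis.Complex_Analysis"
begin

text \<open>Orbits are only known to be locally Bochner integrable and X may be nonseparable, so
  scalar theorems are transferred through functionals of norm at most 1, with constants that do not
  depend on the functional. On the half-plane one kind of estimate is propagated, by exp (\<omega>
  |z|) |z|^a (Re z)^(-b). Its degree a - b is the exponent along rays from 0; for the extension of T
  it is -\<beta>, and \<beta> < 1 makes the ray integrals converge at 0. Differentiation turns (a,
  b) into (a, b + 1). The hard point is that differentiating a fractional integral of order q < b +
  1 gives (a, b + 1 - q): the gain of q must appear in the power of Re z, where the trivial estimate
  puts it in the power of |z|. With b = a + \<beta>, q = \<alpha> + \<beta> and a < \<alpha>, the
  exponent of Re z in S' is -(1 - (\<alpha> - a)), which is integrable; a = \<alpha> would miss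
  this. In the converse the n derivatives and the order n - (\<alpha> + \<beta>) add up to the
  exponent \<alpha> + \<beta> with no loss.\<close>

lemma scaleC_zero_left [simp]: "0 *\<^sub>C x = (0::'a::complex_normed_vector)"
  using scaleC_of_real[of 0 x] by simp

lemma scaleC_zero_right [simp]: "c *\<^sub>C 0 = (0::'a::complex_normed_vector)"
  using norm_scaleC[of c "0::'a"] by simp

lemma scaleC_one [simp]: "1 *\<^sub>C x = (x::'a::complex_normed_vector)"
  using scaleC_of_real[of 1 x] by simp

lemma scaleC_scaleR: "c *\<^sub>C (r *\<^sub>R x) = r *\<^sub>R (c *\<^sub>C (x::'a::complex_normed_vector))"
  using linear_scale[OF bounded_linear.linear[OF bounded_linear_scaleC]] .

lemma scaleR_scaleC_left: "(r *\<^sub>R c) *\<^sub>C x = r *\<^sub>R (c *\<^sub>C (x::'a::complex_normed_vector))"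
  by (simp add: scaleR_conv_of_real flip: scaleC_of_real scaleC_scaleC)

lemma scaleC_diff_right: "c *\<^sub>C (x - y) = c *\<^sub>C x - c *\<^sub>C (y::'a::complex_normed_vector)"
  using linear_diff[OF bounded_linear.linear[OF bounded_linear_scaleC]] .

lemma scaleC_minus_left: "(- c) *\<^sub>C x = - (c *\<^sub>C (x::'a::complex_normed_vector))"
  using scaleC_add_left[of c "- c" x] by (simp add: eq_neg_iff_add_eq_0 add.commute)

lemma bounded_bilinear_scaleC:
  "bounded_bilinear (\<lambda>c (x::'a::complex_normed_vector). c *\<^sub>C x)"
proof
  show "\<exists>K. \<forall>a (b::'a). norm (a *\<^sub>C b) \<le> norm a * norm b * K"
    by (intro exI[of _ 1]) (simp add: norm_scaleC)
qed (auto simp: scaleC_add_left scaleC_add_right scaleC_scaleR scaleR_scaleC_left)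

lemmas continuous_on_scaleC [continuous_intros] =
  bounded_bilinear.continuous_on[OF bounded_bilinear_scaleC]

lemmas tendsto_scaleC = bounded_bilinear.tendsto[OF bounded_bilinear_scaleC]

section \<open>Norming functionals\<close>

text \<open>Partial functionals dominated by the norm are encoded as subspaces \<open>G\<close> of the graph space
  with \<open>r \<le> norm x\<close> for \<open>(x, r) \<in> G\<close>; single-valuedness is then automatic.\<close>

lemma dominated_graph_extend:
  fixes G :: "('a::real_normed_vector \<times> real) set"
  assumes G: "subspace G" and dom: "\<And>y r. (y, r) \<in> G \<Longrightarrow> r \<le> norm y"
  shows "\<exists>c. \<exists>G'. subspace G' \<and> G \<subseteq> G' \<and> (x, c) \<in> G' \<and> (\<forall>(y, r) \<in> G'. r \<le> norm y)"
proof -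
  \<comment> \<open>Left sides bound the value at \<open>x\<close> from below, right sides from
    above. Every lower bound lies below every upper one, so any number between them is admissible;
    the supremum of the lower bounds is taken. Upper bounds settle positive multiples of
    \<open>x\<close>, lower bounds negative ones.\<close>
  have *: "r - norm (y - x) \<le> norm (z + x) - s" if "(y, r) \<in> G" "(z, s) \<in> G" for y r z s
  proof -
    have "(y + z, r + s) \<in> G"
      using subspace_add[OF G that] by simp
    then have "r + s \<le> norm (y + z)"
      by (rule dom)
    also have "\<dots> = norm ((y - x) + (z + x))" by (simp add: algebra_simps)
    also have "\<dots> \<le> norm (y - x) + norm (z + x)" by (rule norm_triangle_ineq)
    finally show ?thesis by simp
  qed
  define c where "c = (SUP p\<in>G. snd p - norm (fst p - x))"
  have z: "(0, 0) \<in> G" using subspace_0[OF G] by (simp add: zero_prod_def)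
  have bdd: "bdd_above ((\<lambda>p. snd p - norm (fst p - x)) ` G)"
    using *[OF _ z] by (auto simp: bdd_above_def intro!: exI[of _ "norm x"])
  have c1: "r - norm (y - x) \<le> c" if "(y, r) \<in> G" for y r
    unfolding c_def using that by (intro cSUP_upper2[OF bdd that]) auto
  have c2: "c \<le> norm (z + x) - s" if "(z, s) \<in> G" for z s
    unfolding c_def using that * z by (intro cSUP_least) auto
  define G' where "G' = {(y + t *\<^sub>R x, r + t * c) | y r t. (y, r) \<in> G}"
  have "subspace G'"
    unfolding subspace_def
  proof (intro conjI ballI allI)
    show "0 \<in> G'"
      unfolding G'_def zero_prod_def using z by (auto intro!: exI[of _ 0])
  next
    fix p q assume "p \<in> G'" "q \<in> G'"
    then obtain y r t z s u where "p = (y + t *\<^sub>R x, r + t * c)" "(y, r) \<in> G"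
      "q = (z + u *\<^sub>R x, s + u * c)" "(z, s) \<in> G"
      unfolding G'_def by blast
    moreover have "(y + z, r + s) \<in> G"
      using subspace_add[OF G \<open>(y, r) \<in> G\<close> \<open>(z, s) \<in> G\<close>] by simp
    ultimately show "p + q \<in> G'"
      unfolding G'_def mem_Collect_eq
      by (intro exI[of _ "y + z"] exI[of _ "r + s"] exI[of _ "t + u"]) (simp add: algebra_simps)
  next
    fix p a assume "p \<in> G'"
    then obtain y r t where "p = (y + t *\<^sub>R x, r + t * c)" "(y, r) \<in> G"
      unfolding G'_def by blast
    moreover have "(a *\<^sub>R y, a * r) \<in> G"
      using subspace_scale[OF G \<open>(y, r) \<in> G\<close>, of a] by simp
    ultimately show "a *\<^sub>R p \<in> G'"
      unfolding G'_def mem_Collect_eq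
      by (intro exI[of _ "a *\<^sub>R y"] exI[of _ "a * r"] exI[of _ "a * t"]) (simp add: algebra_simps)
  qed
  moreover have "G \<subseteq> G'"
    unfolding G'_def by (force intro: exI[of _ 0])
  moreover have "(x, c) \<in> G'"
    unfolding G'_def mem_Collect_eq using z by (intro exI[of _ 0] exI[of _ 1]) simp
  moreover have "r + t * c \<le> norm (y + t *\<^sub>R x)" if "(y, r) \<in> G" for y r t
  proof -
    have sc: "(a *\<^sub>R y, a * r) \<in> G" for a
      using subspace_scale[OF G that, of a] by simp
    consider "t = 0" | "t > 0" | "t < 0" by linarith
    then show ?thesis
    proof cases
      case 1
      then show ?thesis using dom[OF that] by simp
    next
      case 2
      have "c \<le> norm ((1/t) *\<^sub>R y + x) - r / t" using c2[OF sc[of "1/t"]] by simp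
      then have "t * c \<le> t * (norm ((1/t) *\<^sub>R y + x) - r / t)"
        using 2 by (intro mult_left_mono) auto
      also have "\<dots> = norm (t *\<^sub>R ((1/t) *\<^sub>R y + x)) - r"
        using 2 by (simp add: right_diff_distrib)
      also have "t *\<^sub>R ((1/t) *\<^sub>R y + x) = y + t *\<^sub>R x" using 2 by (simp add: algebra_simps)
      finally show ?thesis by simp
    next
      case 3
      define s where "s = - t"
      have s: "s > 0" using 3 by (simp add: s_def)
      have "r / s - norm ((1/s) *\<^sub>R y - x) \<le> c" using c1[OF sc[of "1/s"]] by simp
      then have "s * (r / s - norm ((1/s) *\<^sub>R y - x)) \<le> s * c"
        using s by (intro mult_left_mono) auto
      moreover have "s * (r / s - norm ((1/s) *\<^sub>R y - x)) = r - norm (s *\<^sub>R ((1/s) *\<^sub>R y - x))"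
        using s by (simp add: right_diff_distrib)
      moreover have "s *\<^sub>R ((1/s) *\<^sub>R y - x) = y + t *\<^sub>R x"
        using s by (simp add: algebra_simps s_def)
      moreover have "s * c = - (t * c)" by (simp add: s_def)
      ultimately show ?thesis by simp
    qed
  qed
  then have "\<forall>(y, r) \<in> G'. r \<le> norm y" unfolding G'_def by auto
  ultimately show ?thesis by blast
qed

text \<open>Hahn-Banach by Zorn's lemma on graphs: a maximal dominated subspace containing
  \<open>(x, norm x)\<close> has full domain, since otherwise it could be extended by one more
  vector. Replacing \<open>y\<close> by \<open>- y\<close> turns the one-sided domination into a
  bound on the absolute value.\<close>

lemma norming_functional_real:
  fixes x :: "'a::real_normed_vector"
  shows "\<exists>f::'a \<Rightarrow> real. linear f \<and> (\<forall>y. \<bar>f y\<bar> \<le> norm y) \<and> f x = norm x"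
proof -
  define P where "P G \<longleftrightarrow> subspace G \<and> (x, norm x) \<in> G \<and> (\<forall>(y, r) \<in> G. r \<le> norm y)"
    for G :: "('a \<times> real) set"
  define G0 where "G0 = range (\<lambda>t. t *\<^sub>R (x, norm x))"
  have "P G0"
    unfolding P_def
  proof (intro conjI)
    show "subspace G0"
      unfolding G0_def by (intro linear_subspace_image subspace_UNIV)
        (auto intro!: linearI simp: algebra_simps)
    show "(x, norm x) \<in> G0" unfolding G0_def by (auto intro!: image_eqI[of _ _ 1])
    show "\<forall>(y, r) \<in> G0. r \<le> norm y" unfolding G0_def by (auto intro!: mult_right_mono)
  qed
  have "\<exists>M\<in>Collect P. \<forall>X\<in>Collect P. M \<subseteq> X \<longrightarrow> X = M"
  proof (rule subset_Zorn)
    fix C assume C: "subset.chain (Collect P) C"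
    show "\<exists>U\<in>Collect P. \<forall>X\<in>C. X \<subseteq> U"
    proof (cases "C = {}")
      case True
      then show ?thesis using \<open>P G0\<close> by auto
    next
      case False
      have PC: "P X" if "X \<in> C" for X using C that unfolding subset.chain_def by auto
      have ch: "X \<subseteq> Y \<or> Y \<subseteq> X" if "X \<in> C" "Y \<in> C" for X Y
        using C that unfolding subset.chain_def by blast
      have "P (\<Union>C)"
        unfolding P_def
      proof (intro conjI)
        show "subspace (\<Union>C)"
          unfolding subspace_def
        proof (intro conjI ballI allI)
          show "0 \<in> \<Union>C" using False PC unfolding P_def subspace_def by blast
        next
          fix p q assume "p \<in> \<Union>C" "q \<in> \<Union>C"
          then obtain X where "X \<in> C" "p \<in> X" "q \<in> X" using ch by (meson UnionE subsetD)
          then show "p + q \<in> \<Union>C" using PC[of X] unfolding P_def subspace_def by blast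
        next
          fix c p assume "p \<in> \<Union>C"
          then show "c *\<^sub>R p \<in> \<Union>C" using PC unfolding P_def subspace_def by blast
        qed
        show "(x, norm x) \<in> \<Union>C" using False PC unfolding P_def by blast
        show "\<forall>(y, r) \<in> \<Union>C. r \<le> norm y" using PC unfolding P_def by blast
      qed
      then show ?thesis by auto
    qed
  qed
  then obtain M where M: "P M" and max: "\<And>X. P X \<Longrightarrow> M \<subseteq> X \<Longrightarrow> X = M" by blast
  have sub: "subspace M" and dom: "\<And>y r. (y, r) \<in> M \<Longrightarrow> r \<le> norm y" and xM: "(x, norm x) \<in> M"
    using M unfolding P_def by auto
  have total: "\<exists>c. (y, c) \<in> M" for y
  proof -
    obtain c G' where G': "subspace G'" "M \<subseteq> G'" "(y, c) \<in> G'" "\<forall>(y, r) \<in> G'. r \<le> norm y"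
      using dominated_graph_extend[OF sub dom, of y] by blast
    then have "P G'" unfolding P_def using xM by auto
    from max[OF this G'(2)] G'(3) show ?thesis by auto
  qed
  have abs: "\<bar>r\<bar> \<le> norm y" if "(y, r) \<in> M" for y r
  proof -
    have "(- y, - r) \<in> M" using subspace_neg[OF sub that] by simp
    from dom[OF this] dom[OF that] show ?thesis by auto
  qed
  \<comment> \<open>The difference of two values at \<open>y\<close> is a value at 0, hence has
    absolute value at most \<open>norm 0\<close>.\<close>
  have uniq: "r = s" if "(y, r) \<in> M" "(y, s) \<in> M" for y r s
    using abs[of 0 "r - s"] subspace_diff[OF sub that] by simp
  define f where "f y = (THE r. (y, r) \<in> M)" for y
  have f: "(y, f y) \<in> M" for y
    unfolding f_def using total[of y] uniq by (metis theI)
  have "linear f"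
  proof (rule linearI)
    fix y z show "f (y + z) = f y + f z"
      using subspace_add[OF sub f[of y] f[of z]] f[of "y + z"] uniq by simp
  next
    fix c y show "f (c *\<^sub>R y) = c *\<^sub>R f y"
      using subspace_scale[OF sub f[of y], of c] f[of "c *\<^sub>R y"] uniq by simp
  qed
  moreover have "f x = norm x" using uniq[OF f xM] .
  ultimately show ?thesis using abs[OF f] by blast
qed

text \<open>The closed unit ball of the complex dual. Having the bound 1 built in lets a single
  scalar estimate, valid for all of these functionals, be read back as a norm estimate with the same
  constant.\<close>

definition contractive_functional :: "('a::complex_normed_vector \<Rightarrow> complex) \<Rightarrow> bool" where
  "contractive_functional \<phi> \<longleftrightarrow>
     bounded_linear \<phi> \<and> (\<forall>c x. \<phi> (c *\<^sub>C x) = c * \<phi> x) \<and> (\<forall>x. norm (\<phi> x) \<le> norm x)"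

text \<open>The complexification of a real functional f is f(y) - i f(iy). Its norm does not
  increase: a unimodular factor rotates the value at \<open>y\<close> onto the positive real axis,
  where it equals a value of f.\<close>

lemma norming_functional:
  fixes x :: "'a::complex_normed_vector"
  shows "\<exists>\<phi>. contractive_functional \<phi> \<and> \<phi> x = norm x"
proof -
  obtain f :: "'a \<Rightarrow> real" where lin: "linear f" and f: "\<And>y. \<bar>f y\<bar> \<le> norm y" "f x = norm x"
    using norming_functional_real by blast
  define \<phi> where "\<phi> y = Complex (f y) (- f (\<i> *\<^sub>C y))" for y
  have add: "\<phi> (y + z) = \<phi> y + \<phi> z" for y z
    by (simp add: \<phi>_def complex_eq_iff linear_add[OF lin] scaleC_add_right)
  have real: "\<phi> (r *\<^sub>R y) = r *\<^sub>R \<phi> y" for r y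
    by (simp add: \<phi>_def complex_eq_iff linear_scale[OF lin] scaleC_scaleR)
  have i: "\<phi> (\<i> *\<^sub>C y) = \<i> * \<phi> y" for y
    by (simp add: \<phi>_def complex_eq_iff scaleC_scaleC scaleC_minus_left linear_neg[OF lin])
  have hom: "\<phi> (c *\<^sub>C y) = c * \<phi> y" for c y
  proof -
    have "c *\<^sub>C y = (complex_of_real (Re c) + complex_of_real (Im c) * \<i>) *\<^sub>C y"
      using complex_eq[of c] by (simp add: mult.commute)
    also have "\<dots> = Re c *\<^sub>R y + Im c *\<^sub>R (\<i> *\<^sub>C y)"
      by (simp add: scaleC_add_left scaleC_of_real flip: scaleC_scaleC)
    finally have "\<phi> (c *\<^sub>C y) = Re c *\<^sub>R \<phi> y + Im c *\<^sub>R (\<i> * \<phi> y)"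
      by (simp add: add real i)
    then show ?thesis by (simp add: complex_eq_iff algebra_simps)
  qed
  have bd: "norm (\<phi> y) \<le> norm y" for y
  proof (cases "\<phi> y = 0")
    case False
    define u where "u = cnj (sgn (\<phi> y))"
    have u: "u * \<phi> y = of_real (norm (\<phi> y))"
      unfolding u_def sgn_eq using False complex_norm_square[of "\<phi> y"]
      by (simp add: field_simps power2_eq_square)
    have "norm (\<phi> y) = Re (\<phi> (u *\<^sub>C y))" by (simp add: hom u)
    also have "\<dots> \<le> norm (u *\<^sub>C y)" unfolding \<phi>_def using f(1)[of "u *\<^sub>C y"] by simp
    also have "\<dots> = norm y" using False by (simp add: norm_scaleC u_def norm_sgn)
    finally show ?thesis .
  qed simp
  have "bounded_linear \<phi>"
    by (rule bounded_linear_intro[where K = 1]) (use add real bd in auto)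
  moreover have "\<phi> x = norm x"
  proof -
    \<comment> \<open>The real part already exhausts the bound \<open>norm x\<close> on the modulus,
      so nothing is left for the imaginary part.\<close>
    have "Re (\<phi> x) = norm x" using f by (simp add: \<phi>_def)
    with bd[of x] have "norm (\<phi> x) = Re (\<phi> x)"
      using complex_Re_le_cmod[of "\<phi> x"] by simp
    then have "Im (\<phi> x) = 0"
      using complex_Re_le_cmod[of "\<phi> x"] cmod_power2[of "\<phi> x"] by simp
    then show ?thesis using \<open>Re (\<phi> x) = norm x\<close> by (simp add: complex_eq_iff)
  qed
  ultimately show ?thesis unfolding contractive_functional_def using hom bd by blast
qed

lemma norm_le_functionalI:
  fixes x :: "'a::complex_normed_vector"
  assumes "\<And>\<phi>. contractive_functional \<phi> \<Longrightarrow> norm (\<phi> x) \<le> B"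
  shows "norm x \<le> B"
  using norming_functional[of x] assms by (metis norm_of_real abs_norm_cancel)

lemma eq_functionalI:
  fixes x y :: "'a::complex_normed_vector"
  assumes "\<And>\<phi>. contractive_functional \<phi> \<Longrightarrow> \<phi> x = \<phi> y"
  shows "x = y"
proof -
  have "norm (x - y) \<le> 0"
    by (rule norm_le_functionalI)
       (use assms in \<open>auto simp: contractive_functional_def bounded_linear.linear linear_diff\<close>)
  then show ?thesis by simp
qed

section \<open>Holomorphic functions with values in a complex Banach space\<close>

definition has_cderiv :: "(complex \<Rightarrow> 'b::complex_normed_vector) \<Rightarrow> 'b \<Rightarrow> complex \<Rightarrow> bool" where
  "has_cderiv f D z \<longleftrightarrow> (f has_derivative (\<lambda>h. h *\<^sub>C D)) (at z)"

definition vderiv :: "(complex \<Rightarrow> 'b::complex_normed_vector) \<Rightarrow> complex \<Rightarrow> 'b" where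
  "vderiv f z = (THE D. has_cderiv f D z)"

lemma has_cderiv_unique: "has_cderiv f D z \<Longrightarrow> has_cderiv f E z \<Longrightarrow> D = E"
  unfolding has_cderiv_def using has_derivative_unique by (metis scaleC_one)

lemma vderiv_eq: "has_cderiv f D z \<Longrightarrow> vderiv f z = D"
  unfolding vderiv_def by (blast intro: has_cderiv_unique)

lemma vholomorphic_on_open:
  assumes "open S"
  shows "vholomorphic_on f S \<longleftrightarrow> (\<forall>z\<in>S. has_cderiv f (vderiv f z) z)"
proof -
  have "vholomorphic_on f S \<longleftrightarrow> (\<forall>z\<in>S. \<exists>D. has_cderiv f D z)"
    unfolding vholomorphic_on_def has_cderiv_def using assms by (metis at_within_open)
  then show ?thesis by (metis vderiv_eq)
qed

lemma vholomorphic_on_imp_continuous_on: "vholomorphic_on f S \<Longrightarrow> continuous_on S f"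
  unfolding vholomorphic_on_def continuous_on_eq_continuous_within
  using has_derivative_continuous by blast

lemma has_cderiv_linear:
  assumes "has_cderiv f D z" "bounded_linear L" "\<And>c v. L (c *\<^sub>C v) = c *\<^sub>C L v"
  shows "has_cderiv (\<lambda>w. L (f w)) (L D) z"
  using bounded_linear.has_derivative[OF assms(2) assms(1)[unfolded has_cderiv_def]]
  by (simp add: has_cderiv_def assms(3))

lemma has_cderiv_functional:
  assumes "has_cderiv f D z" "contractive_functional \<phi>"
  shows "((\<lambda>w. \<phi> (f w)) has_field_derivative \<phi> D) (at z)"
proof -
  have "bounded_linear \<phi>" "\<And>c v. \<phi> (c *\<^sub>C v) = c * \<phi> v"
    using assms(2) by (auto simp: contractive_functional_def)
  from bounded_linear.has_derivative[OF this(1) assms(1)[unfolded has_cderiv_def]] this(2)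
  show ?thesis by (simp add: has_field_derivative_def mult_commute_abs)
qed

lemma has_cderiv_line:
  assumes "has_cderiv f D (w + of_real t * d)"
  shows "((\<lambda>t. f (w + of_real t * d)) has_vector_derivative d *\<^sub>C D) (at t)"
proof -
  have "((\<lambda>t. w + of_real t * d) has_derivative (\<lambda>h. of_real h * d)) (at t)"
    by (auto intro!: derivative_eq_intros)
  from has_derivative_compose[OF this assms[unfolded has_cderiv_def]]
  show ?thesis
    by (simp add: has_vector_derivative_def scaleC_of_real flip: scaleC_scaleC)
qed

lemma has_cderiv_scaleC:
  assumes "(c has_field_derivative c') (at z)" "has_cderiv f D z"
  shows "has_cderiv (\<lambda>w. c w *\<^sub>C f w) (c' *\<^sub>C f z + c z *\<^sub>C D) z"
proof -
  have "(c has_derivative (\<lambda>h. h * c')) (at z)"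
    using assms(1) by (simp add: has_field_derivative_def mult_commute_abs)
  from bounded_bilinear.FDERIV[OF bounded_bilinear_scaleC this assms(2)[unfolded has_cderiv_def]]
  show ?thesis
    by (simp add: has_cderiv_def scaleC_scaleC scaleC_add_right add.commute mult.commute)
qed

lemma functional_diff: "contractive_functional \<phi> \<Longrightarrow> \<phi> (x - y) = \<phi> x - \<phi> y"
  by (simp add: contractive_functional_def bounded_linear.linear linear_diff)

lemma functional_scaleC: "contractive_functional \<phi> \<Longrightarrow> \<phi> (c *\<^sub>C x) = c * \<phi> x"
  by (simp add: contractive_functional_def)

lemma functional_bound: "contractive_functional \<phi> \<Longrightarrow> norm (\<phi> x) \<le> norm x"
  by (simp add: contractive_functional_def)

lemma vholomorphic_on_functional:
  assumes "open S" "vholomorphic_on f S" "contractive_functional \<phi>"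
  shows "(\<lambda>z. \<phi> (f z)) holomorphic_on S"
    and "z \<in> S \<Longrightarrow> deriv (\<lambda>w. \<phi> (f w)) z = \<phi> (vderiv f z)"
proof -
  have *: "((\<lambda>w. \<phi> (f w)) has_field_derivative \<phi> (vderiv f z)) (at z)" if "z \<in> S" for z
    using assms that by (intro has_cderiv_functional) (auto simp: vholomorphic_on_open)
  then show "(\<lambda>z. \<phi> (f z)) holomorphic_on S"
    using assms(1) by (auto simp: holomorphic_on_open)
  show "z \<in> S \<Longrightarrow> deriv (\<lambda>w. \<phi> (f w)) z = \<phi> (vderiv f z)"
    using * by (intro DERIV_imp_deriv) auto
qed

text \<open>Cauchy's inequality bounds the second derivative on the half disc, and Taylor's formula
  of order one does the rest. The circles have radius r/4 so that they stay inside the ball, and 32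
  is 2! divided by (1/4)^2.\<close>

lemma holomorphic_remainder_bound:
  assumes h: "h holomorphic_on ball z r" and B: "\<And>w. w \<in> ball z r \<Longrightarrow> cmod (h w) \<le> B"
    and k: "cmod k < r / 2"
  shows "cmod (h (z + k) - h z - k * deriv h z) \<le> 32 * B / r\<^sup>2 * (cmod k)\<^sup>2"
proof -
  have r: "r > 0" using k norm_ge_zero[of k] by linarith
  have sub: "cball w (r/4) \<subseteq> ball z r" if "w \<in> ball z (r/2)" for w
  proof
    fix v assume "v \<in> cball w (r/4)"
    then show "v \<in> ball z r" using that r dist_triangle[of z v w] by (simp add: dist_commute)
  qed
  have b2: "cmod (deriv (deriv h) w) \<le> 32 * B / r\<^sup>2" if w: "w \<in> ball z (r/2)" for w
  proof -
    have "cmod ((deriv ^^ 2) h w) \<le> fact 2 * B / (r/4)^2"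
    proof (rule Cauchy_inequality)
      show "h holomorphic_on ball w (r/4)"
        using h sub[OF w] ball_subset_cball by (metis holomorphic_on_subset order_trans)
      show "continuous_on (cball w (r/4)) h"
        using h sub[OF w] by (meson continuous_on_subset holomorphic_on_imp_continuous_on)
      show "cmod (h x) \<le> B" if "cmod (w - x) = r/4" for x
        using sub[OF w] that by (intro B) (auto simp: dist_norm)
    qed (use r in auto)
    then show ?thesis by (simp add: numeral_2_eq_2 power2_eq_square)
  qed
  define g where "g i = (deriv ^^ i) h" for i
  have "cmod (g 0 (z + k) - (\<Sum>i\<le>1. g i z * ((z + k) - z) ^ i / fact i)) \<le>
      32 * B / r\<^sup>2 * cmod ((z + k) - z) ^ Suc 1 / fact 1"
  proof (rule complex_Taylor[of "ball z (r/2)"])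
    show "(g i has_field_derivative g (Suc i) x) (at x within ball z (r/2))"
      if "x \<in> ball z (r/2)" "i \<le> 1" for i x
    proof -
      have "g i holomorphic_on ball z r"
        unfolding g_def using h by (intro holomorphic_higher_deriv) auto
      moreover have "x \<in> ball z r" using that(1) r by simp
      ultimately have "(g i has_field_derivative deriv (g i) x) (at x)"
        by (intro holomorphic_derivI) auto
      then show ?thesis unfolding g_def by (auto intro: has_field_derivative_at_within)
    qed
  qed (use k r b2 in \<open>auto simp: g_def dist_norm\<close>)
  then show ?thesis by (simp add: g_def algebra_simps power2_eq_square)
qed

text \<open>The constant involves only a bound for \<open>f\<close> on the disc, hence is the same
  for all contractive functionals. This quantitative form of differentiability is what permits
  differentiating under the ray integrals below.\<close>

lemma vholomorphic_remainder_bound: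
  fixes f :: "complex \<Rightarrow> 'b::complex_banach"
  assumes "open S" "vholomorphic_on f S" "ball z r \<subseteq> S"
    and "\<And>w. w \<in> ball z r \<Longrightarrow> norm (f w) \<le> B" and k: "cmod k < r / 2"
  shows "norm (f (z + k) - f z - k *\<^sub>C vderiv f z) \<le> 32 * B / r\<^sup>2 * (cmod k)\<^sup>2"
proof (rule norm_le_functionalI)
  fix \<phi> :: "'b \<Rightarrow> complex" assume \<phi>: "contractive_functional \<phi>"
  have "r > 0" using k norm_ge_zero[of k] by linarith
  then have "z \<in> S" using assms(3) by auto
  have "cmod (\<phi> (f (z + k)) - \<phi> (f z) - k * deriv (\<lambda>w. \<phi> (f w)) z) \<le> 32 * B / r\<^sup>2 * (cmod k)\<^sup>2"
    using assms order_trans[OF functional_bound[OF \<phi>]]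
    by (intro holomorphic_remainder_bound holomorphic_on_subset[OF vholomorphic_on_functional(1)[OF _ _ \<phi>]])
       auto
  also have "deriv (\<lambda>w. \<phi> (f w)) z = \<phi> (vderiv f z)"
    using vholomorphic_on_functional(2)[OF assms(1,2) \<phi> \<open>z \<in> S\<close>] .
  finally show "cmod (\<phi> (f (z + k) - f z - k *\<^sub>C vderiv f z)) \<le> 32 * B / r\<^sup>2 * (cmod k)\<^sup>2"
    by (simp add: functional_diff[OF \<phi>] functional_scaleC[OF \<phi>])
qed

lemma has_cderivI_quadratic:
  fixes f :: "complex \<Rightarrow> 'b::complex_normed_vector"
  assumes "r > 0"
    and "\<And>k. k \<noteq> 0 \<Longrightarrow> cmod k < r \<Longrightarrow> norm (f (z + k) - f z - k *\<^sub>C D) \<le> C * (cmod k)\<^sup>2"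
  shows "has_cderiv f D z"
  unfolding has_cderiv_def has_derivative_at
proof
  show "bounded_linear (\<lambda>h. h *\<^sub>C D)"
    using bounded_bilinear.bounded_linear_left[OF bounded_bilinear_scaleC] .
  have "((\<lambda>h. C * cmod h) \<longlongrightarrow> C * 0) (at 0)"
    by (intro tendsto_intros tendsto_norm_zero)
  then have lim: "((\<lambda>h. C * cmod h) \<longlongrightarrow> 0) (at 0)" by simp
  show "(\<lambda>h. norm (f (z + h) - f z - h *\<^sub>C D) / norm h) \<midarrow>0\<rightarrow> 0"
  proof (rule tendsto_sandwich[OF _ _ tendsto_const lim])
    show "\<forall>\<^sub>F h in at 0. norm (f (z + h) - f z - h *\<^sub>C D) / norm h \<le> C * cmod h"
      unfolding eventually_at
      using assms by (intro exI[of _ r]) (auto simp: divide_le_eq power2_eq_square mult.assoc)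
  qed auto
qed

text \<open>The difference quotients are a Cauchy net in norm because the scalar estimate is uniform
  over the contractive functionals.\<close>

lemma vholomorphic_onI_weak:
  fixes f :: "complex \<Rightarrow> 'b::complex_banach"
  assumes S: "open S"
    and hol: "\<And>\<phi>. contractive_functional \<phi> \<Longrightarrow> (\<lambda>z. \<phi> (f z)) holomorphic_on S"
    and bdd: "\<And>z. z \<in> S \<Longrightarrow> \<exists>r>0. \<exists>B. \<forall>w\<in>ball z r. norm (f w) \<le> B"
  shows "vholomorphic_on f S"
proof -
  have "\<exists>D. has_cderiv f D z" if z: "z \<in> S" for z
  proof -
    obtain r1 B where r1: "r1 > 0" "\<And>w. w \<in> ball z r1 \<Longrightarrow> norm (f w) \<le> B" using bdd[OF z] by blast
    obtain r2 where r2: "r2 > 0" "ball z r2 \<subseteq> S" using S z openE by blast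
    define r where "r = min r1 r2"
    have r: "r > 0" "ball z r \<subseteq> S" "\<And>w. w \<in> ball z r \<Longrightarrow> norm (f w) \<le> B"
      using r1 r2 by (auto simp: r_def)
    define C where "C = 32 * B / r\<^sup>2"
    define Q where "Q k = inverse k *\<^sub>C (f (z + k) - f z)" for k
    have sc: "cmod (\<phi> (Q k) - deriv (\<lambda>w. \<phi> (f w)) z) \<le> C * cmod k"
      if \<phi>: "contractive_functional \<phi>" and k: "k \<noteq> 0" "cmod k < r/2" for \<phi> k
    proof -
      have "cmod (\<phi> (f (z + k)) - \<phi> (f z) - k * deriv (\<lambda>w. \<phi> (f w)) z) \<le> C * (cmod k)\<^sup>2"
        unfolding C_def
      proof (rule holomorphic_remainder_bound[OF _ _ k(2)])
        show "(\<lambda>w. \<phi> (f w)) holomorphic_on ball z r"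
          using hol[OF \<phi>] r(2) holomorphic_on_subset by blast
        show "cmod (\<phi> (f w)) \<le> B" if "w \<in> ball z r" for w
          using r(3)[OF that] functional_bound[OF \<phi>, of "f w"] by linarith
      qed
      also have "\<phi> (f (z + k)) - \<phi> (f z) - k * deriv (\<lambda>w. \<phi> (f w)) z =
          k * (\<phi> (Q k) - deriv (\<lambda>w. \<phi> (f w)) z)"
        using k by (simp add: Q_def functional_diff[OF \<phi>] functional_scaleC[OF \<phi>] field_simps)
      finally show ?thesis
        using k by (simp add: norm_mult power2_eq_square mult.left_commute)
    qed
    have QQ: "norm (Q k - Q l) \<le> C * (cmod k + cmod l)"
      if "k \<noteq> 0" "cmod k < r/2" "l \<noteq> 0" "cmod l < r/2" for k l
    proof (rule norm_le_functionalI)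
      fix \<phi> :: "'b \<Rightarrow> complex" assume \<phi>: "contractive_functional \<phi>"
      let ?d = "deriv (\<lambda>w. \<phi> (f w)) z"
      have "cmod (\<phi> (Q k - Q l)) = cmod ((\<phi> (Q k) - ?d) - (\<phi> (Q l) - ?d))"
        by (simp add: functional_diff[OF \<phi>])
      also have "\<dots> \<le> cmod (\<phi> (Q k) - ?d) + cmod (\<phi> (Q l) - ?d)" by (rule norm_triangle_ineq4)
      also have "\<dots> \<le> C * (cmod k + cmod l)"
        using sc[OF \<phi> that(1,2)] sc[OF \<phi> that(3,4)] by (simp add: algebra_simps)
      finally show "cmod (\<phi> (Q k - Q l)) \<le> C * (cmod k + cmod l)" .
    qed
    have "B \<ge> 0" using r(3)[of z] r(1) by (smt (verit) centre_in_ball norm_ge_zero)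
    then have C: "C \<ge> 0" by (simp add: C_def)
    define l where "l n = complex_of_real (r / (2 * (real n + 2)))" for n :: nat
    have lr: "l n \<noteq> 0" "cmod (l n) < r/2" for n
    proof -
      have "r / (2 * (real n + 2)) \<noteq> 0" using r(1) by simp
      then show "l n \<noteq> 0" unfolding l_def of_real_eq_0_iff .
      have "cmod (l n) = r / (2 * (real n + 2))"
        unfolding l_def norm_of_real using r(1) by simp
      also have "\<dots> < r / 2" using r(1) by (intro divide_strict_left_mono) auto
      finally show "cmod (l n) < r/2" .
    qed
    have l0: "(\<lambda>n. cmod (l n)) \<longlonglongrightarrow> 0"
      unfolding l_def norm_of_real using r(1) by real_asymp
    have "Cauchy (\<lambda>n. Q (l n))"
    proof (rule metric_CauchyI)
      fix e :: real assume "e > 0"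
      have "(\<lambda>n. 2 * (C * cmod (l n))) \<longlonglongrightarrow> 2 * (C * 0)" by (intro tendsto_intros l0)
      then have "\<forall>\<^sub>F n in sequentially. 2 * (C * cmod (l n)) < e"
        by (rule order_tendstoD(2)) (use \<open>e > 0\<close> in simp)
      then obtain N where N: "\<And>n. n \<ge> N \<Longrightarrow> 2 * (C * cmod (l n)) < e"
        by (auto simp: eventually_sequentially)
      show "\<exists>M. \<forall>m\<ge>M. \<forall>n\<ge>M. dist (Q (l m)) (Q (l n)) < e"
      proof (intro exI[of _ N] allI impI)
        fix m n assume "N \<le> m" "N \<le> n"
        then show "dist (Q (l m)) (Q (l n)) < e"
          using QQ[OF lr(1,2)[of m] lr(1,2)[of n]] N[of m] N[of n]
          by (simp add: dist_norm algebra_simps)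
      qed
    qed
    then obtain D where D: "(\<lambda>n. Q (l n)) \<longlonglongrightarrow> D" using Cauchy_convergent convergent_def by blast
    \<comment> \<open>Letting the second increment run along \<open>l\<close> keeps the first one
      arbitrary, so the limit along one sequence controls every difference quotient, with a linear
      rate.\<close>
    have "norm (Q k - D) \<le> C * cmod k" if k: "k \<noteq> 0" "cmod k < r/2" for k
    proof (rule tendsto_le)
      show "(\<lambda>n. norm (Q k - Q (l n))) \<longlonglongrightarrow> norm (Q k - D)" by (intro tendsto_intros D)
      have "(\<lambda>n. C * (cmod k + cmod (l n))) \<longlonglongrightarrow> C * (cmod k + 0)" by (intro tendsto_intros l0)
      then show "(\<lambda>n. C * (cmod k + cmod (l n))) \<longlonglongrightarrow> C * cmod k" by simp
      show "\<forall>\<^sub>F n in sequentially. norm (Q k - Q (l n)) \<le> C * (cmod k + cmod (l n))"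
        using QQ[OF k lr] by simp
    qed simp
    moreover have "f (z + k) - f z - k *\<^sub>C D = k *\<^sub>C (Q k - D)" if "k \<noteq> 0" for k
      using that by (simp add: Q_def scaleC_diff_right scaleC_scaleC)
    ultimately have "has_cderiv f D z"
      using r(1) by (intro has_cderivI_quadratic[of "r/2" _ _ _ C])
        (auto simp: norm_scaleC power2_eq_square mult_left_mono mult.left_commute)
    then show ?thesis by blast
  qed
  then show ?thesis
    unfolding vholomorphic_on_open[OF S] by (metis vderiv_eq)
qed

lemma continuous_on_imp_locally_bounded:
  fixes f :: "complex \<Rightarrow> 'b::real_normed_vector"
  assumes "open S" "continuous_on S f" "z \<in> S"
  shows "\<exists>r>0. \<exists>B. \<forall>w\<in>ball z r. norm (f w) \<le> B"
proof -
  obtain r where r: "r > 0" "cball z r \<subseteq> S" using assms(1,3) open_contains_cball by blast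
  then have "compact (f ` cball z r)"
    using assms(2) by (intro compact_continuous_image) (auto intro: continuous_on_subset)
  then obtain B where "\<And>y. y \<in> f ` cball z r \<Longrightarrow> norm y \<le> B"
    using compact_imp_bounded bounded_iff by metis
  then show ?thesis using r(1) by (intro exI[of _ r] conjI exI[of _ B]) auto
qed

lemma norm_vderiv_le:
  fixes f :: "complex \<Rightarrow> 'b::complex_banach"
  assumes "open S" "vholomorphic_on f S" "r > 0" "cball z r \<subseteq> S"
    and B: "\<And>w. w \<in> cball z r \<Longrightarrow> norm (f w) \<le> B"
  shows "norm (vderiv f z) \<le> B / r"
proof (rule norm_le_functionalI)
  fix \<phi> :: "'b \<Rightarrow> complex" assume \<phi>: "contractive_functional \<phi>"
  have hol: "(\<lambda>w. \<phi> (f w)) holomorphic_on cball z r"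
    using vholomorphic_on_functional(1)[OF assms(1,2) \<phi>] assms(4) holomorphic_on_subset by blast
  have "cmod ((deriv ^^ 1) (\<lambda>w. \<phi> (f w)) z) \<le> fact 1 * B / r ^ 1"
  proof (rule Cauchy_inequality)
    show "cmod (\<phi> (f x)) \<le> B" if "cmod (z - x) = r" for x
      using B[of x] functional_bound[OF \<phi>, of "f x"] that by (simp add: dist_norm)
  qed (use hol assms(3) in \<open>auto intro: holomorphic_on_subset holomorphic_on_imp_continuous_on\<close>)
  moreover have "z \<in> S" using assms(3,4) by auto
  ultimately show "cmod (\<phi> (vderiv f z)) \<le> B / r"
    using vholomorphic_on_functional(2)[OF assms(1,2) \<phi>] by simp
qed

text \<open>Composed with a functional, the derivative is the derivative of a scalar holomorphic
  function. The local bound required by the weak criterion comes from Cauchy's inequality on discs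
  of a quarter of the radius.\<close>

lemma vholomorphic_on_vderiv:
  fixes f :: "complex \<Rightarrow> 'b::complex_banach"
  assumes S: "open S" and f: "vholomorphic_on f S"
  shows "vholomorphic_on (vderiv f) S"
proof (rule vholomorphic_onI_weak[OF S])
  fix \<phi> :: "'b \<Rightarrow> complex" assume \<phi>: "contractive_functional \<phi>"
  have "deriv (\<lambda>w. \<phi> (f w)) holomorphic_on S"
    using vholomorphic_on_functional(1)[OF S f \<phi>] S by (rule holomorphic_deriv)
  then show "(\<lambda>z. \<phi> (vderiv f z)) holomorphic_on S"
    using vholomorphic_on_functional(2)[OF S f \<phi>] by (simp cong: holomorphic_cong)
next
  fix z assume z: "z \<in> S"
  obtain r1 B where r1: "r1 > 0" "\<And>w. w \<in> ball z r1 \<Longrightarrow> norm (f w) \<le> B"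
    using continuous_on_imp_locally_bounded[OF S vholomorphic_on_imp_continuous_on[OF f] z] by blast
  obtain r2 where r2: "r2 > 0" "ball z r2 \<subseteq> S" using S z openE by blast
  define r where "r = min r1 r2"
  have r: "r > 0" "ball z r \<subseteq> S" "\<And>w. w \<in> ball z r \<Longrightarrow> norm (f w) \<le> B"
    using r1 r2 by (auto simp: r_def)
  have "norm (vderiv f w) \<le> B / (r/4)" if "w \<in> ball z (r/2)" for w
  proof -
    have sub: "cball w (r/4) \<subseteq> ball z r"
    proof
      fix v assume "v \<in> cball w (r/4)"
      then show "v \<in> ball z r" using that r(1) dist_triangle[of z v w] by (simp add: dist_commute)
    qed
    show ?thesis
      using r sub by (intro norm_vderiv_le[OF S f]) auto
  qed
  then show "\<exists>r>0. \<exists>B. \<forall>w\<in>ball z r. norm (vderiv f w) \<le> B"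
    using r(1) by (intro exI[of _ "r/2"] conjI exI[of _ "B / (r/4)"]) auto
qed

lemma vholomorphic_on_funpow_vderiv:
  fixes f :: "complex \<Rightarrow> 'b::complex_banach"
  assumes "open S" "vholomorphic_on f S"
  shows "vholomorphic_on ((vderiv ^^ n) f) S"
  using assms by (induction n) (auto intro: vholomorphic_on_vderiv)

lemma vholomorphic_on_identity:
  fixes f g :: "complex \<Rightarrow> 'b::complex_banach"
  assumes "open S" "connected S" "vholomorphic_on f S" "vholomorphic_on g S"
    and U: "U \<subseteq> S" "\<xi> \<in> S" "\<xi> islimpt U" "\<And>z. z \<in> U \<Longrightarrow> f z = g z" and w: "w \<in> S"
  shows "f w = g w"
proof (rule eq_functionalI)
  fix \<phi> :: "'b \<Rightarrow> complex" assume \<phi>: "contractive_functional \<phi>"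
  have "(\<lambda>z. \<phi> (f z) - \<phi> (g z)) holomorphic_on S"
    by (intro holomorphic_intros vholomorphic_on_functional(1)[OF assms(1) _ \<phi>] assms)
  from analytic_continuation[OF this assms(1,2) U(1,2,3) _ w] U(4)
  show "\<phi> (f w) = \<phi> (g w)" by simp
qed

lemma vholomorphic_on_cong:
  assumes "\<And>z. z \<in> S \<Longrightarrow> f z = g z"
  shows "vholomorphic_on f S \<longleftrightarrow> vholomorphic_on g S"
proof -
  have "(f has_derivative F) (at z within S) \<longleftrightarrow> (g has_derivative F) (at z within S)"
    if "z \<in> S" for z F
    using that assms has_derivative_transform[of z S f g F] has_derivative_transform[of z S g f F]
    by metis
  then show ?thesis unfolding vholomorphic_on_def by simp
qed

lemma has_cderiv_cong:
  assumes "open S" "z \<in> S" "\<And>w. w \<in> S \<Longrightarrow> f w = g w" "has_cderiv f D z"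
  shows "has_cderiv g D z"
  using assms has_derivative_transform_within_open[of f _ z UNIV S g]
  by (simp add: has_cderiv_def)

section \<open>Henstock-Kurzweil integrals of Banach-space valued functions\<close>

text \<open>The pointwise bound turns the difference of the Riemann sums of \<open>f\<close> and
  \<open>g n\<close> into a Riemann sum of the real function \<open>h n\<close>, so a gauge that is
  good for both \<open>g n\<close> and \<open>h n\<close> suffices. Through this estimate Bochner
  approximations and truncations enter the Henstock-Kurzweil theory.\<close>

lemma has_integral_L1_limit:
  fixes f :: "'n::euclidean_space \<Rightarrow> 'b::real_normed_vector"
  assumes g: "\<And>n. (g n has_integral I n) (cbox a b)"
    and h: "\<And>n. h n integrable_on cbox a b"
    and le: "\<And>n x. x \<in> cbox a b \<Longrightarrow> norm (f x - g n x) \<le> h n x"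
    and h0: "(\<lambda>n. integral (cbox a b) (h n)) \<longlonglongrightarrow> 0" and I: "I \<longlonglongrightarrow> y"
  shows "(f has_integral y) (cbox a b)"
  unfolding has_integral
proof (intro allI impI)
  fix e :: real assume e: "e > 0"
  have "\<forall>\<^sub>F n in sequentially. integral (cbox a b) (h n) < e/4"
    by (rule order_tendstoD(2)[OF h0]) (use e in simp)
  moreover have "\<forall>\<^sub>F n in sequentially. dist (I n) y < e/4"
    by (rule tendstoD[OF I]) (use e in simp)
  ultimately obtain n where n: "integral (cbox a b) (h n) < e/4" "norm (I n - y) < e/4"
    unfolding dist_norm by (metis (mono_tags, lifting) eventually_conj eventually_sequentially order_refl)
  have e4: "e/4 > 0" using e by simp
  obtain \<gamma>1 where \<gamma>1: "gauge \<gamma>1" "\<And>D. D tagged_division_of cbox a b \<Longrightarrow> \<gamma>1 fine D \<Longrightarrow>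
      norm ((\<Sum>(x,k)\<in>D. measure lborel k *\<^sub>R g n x) - I n) < e/4"
    using g[of n, unfolded has_integral] e4 by metis
  obtain \<gamma>2 where \<gamma>2: "gauge \<gamma>2" "\<And>D. D tagged_division_of cbox a b \<Longrightarrow> \<gamma>2 fine D \<Longrightarrow>
      norm ((\<Sum>(x,k)\<in>D. measure lborel k *\<^sub>R h n x) - integral (cbox a b) (h n)) < e/4"
    using integrable_integral[OF h[of n], unfolded has_integral] e4 by metis
  show "\<exists>\<gamma>. gauge \<gamma> \<and> (\<forall>D. D tagged_division_of cbox a b \<and> \<gamma> fine D \<longrightarrow>
      norm ((\<Sum>(x,k)\<in>D. measure lborel k *\<^sub>R f x) - y) < e)"
  proof (intro exI[of _ "\<lambda>x. \<gamma>1 x \<inter> \<gamma>2 x"] conjI allI impI gauge_Int \<gamma>1(1) \<gamma>2(1))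
    fix D assume D: "D tagged_division_of cbox a b \<and> (\<lambda>x. \<gamma>1 x \<inter> \<gamma>2 x) fine D"
    then have fine: "\<gamma>1 fine D" "\<gamma>2 fine D" by (auto simp: fine_Int)
    have "norm ((\<Sum>(x,k)\<in>D. measure lborel k *\<^sub>R f x) - (\<Sum>(x,k)\<in>D. measure lborel k *\<^sub>R g n x)) =
        norm (\<Sum>(x,k)\<in>D. measure lborel k *\<^sub>R (f x - g n x))"
      by (simp add: sum_subtractf split_def scaleR_diff_right)
    also have "\<dots> \<le> (\<Sum>(x,k)\<in>D. measure lborel k *\<^sub>R h n x)"
    proof (rule sum_norm_le, clarify)
      fix x k assume "(x, k) \<in> D"
      then have "x \<in> cbox a b" using D by (meson tag_in_interval)
      then show "norm (measure lborel k *\<^sub>R (f x - g n x)) \<le> measure lborel k *\<^sub>R h n x"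
        using le[of x n] by (simp add: mult_left_mono)
    qed
    also have "\<dots> < e/2"
      using \<gamma>2(2)[OF conjunct1[OF D] fine(2)] n(1) unfolding real_norm_def abs_less_iff by linarith
    finally have 1: "norm ((\<Sum>(x,k)\<in>D. measure lborel k *\<^sub>R f x) - (\<Sum>(x,k)\<in>D. measure lborel k *\<^sub>R g n x)) < e/2" .
    have "(\<Sum>(x,k)\<in>D. measure lborel k *\<^sub>R f x) - y =
      ((\<Sum>(x,k)\<in>D. measure lborel k *\<^sub>R f x) - (\<Sum>(x,k)\<in>D. measure lborel k *\<^sub>R g n x)) +
      (((\<Sum>(x,k)\<in>D. measure lborel k *\<^sub>R g n x) - I n) + (I n - y))" by simp
    also have "norm \<dots> \<le> norm ((\<Sum>(x,k)\<in>D. measure lborel k *\<^sub>R f x) - (\<Sum>(x,k)\<in>D. measure lborel k *\<^sub>R g n x)) +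
        (norm ((\<Sum>(x,k)\<in>D. measure lborel k *\<^sub>R g n x) - I n) + norm (I n - y))"
      by (intro norm_triangle_mono order_refl norm_triangle_ineq)
    finally show "norm ((\<Sum>(x,k)\<in>D. measure lborel k *\<^sub>R f x) - y) < e"
      using 1 \<gamma>1(2)[OF conjunct1[OF D] fine(1)] n(2) by linarith
  qed
qed

text \<open>Completeness supplies the value: \<open>g n\<close> and \<open>g m\<close> differ by at
  most \<open>h n + h m\<close>, so their integrals form a Cauchy sequence.\<close>

lemma integrable_L1_limit:
  fixes f :: "'n::euclidean_space \<Rightarrow> 'b::banach"
  assumes g: "\<And>n. g n integrable_on cbox a b"
    and h: "\<And>n. h n integrable_on cbox a b"
    and le: "\<And>n x. x \<in> cbox a b \<Longrightarrow> norm (f x - g n x) \<le> h n x"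
    and h0: "(\<lambda>n. integral (cbox a b) (h n)) \<longlonglongrightarrow> 0"
  shows "f integrable_on cbox a b"
proof -
  let ?I = "\<lambda>n. integral (cbox a b) (g n)"
  have gg: "norm (?I n - ?I m) \<le> integral (cbox a b) (h n) + integral (cbox a b) (h m)" for n m
  proof -
    have "norm (?I n - ?I m) = norm (integral (cbox a b) (\<lambda>x. g n x - g m x))"
      by (simp add: integral_diff g)
    also have "\<dots> \<le> integral (cbox a b) (\<lambda>x. h n x + h m x)"
    proof (rule Henstock_Kurzweil_Integration.integral_norm_bound_integral)
      fix x assume x: "x \<in> cbox a b"
      have "norm (g n x - g m x) = norm ((f x - g m x) - (f x - g n x))" by simp
      also have "\<dots> \<le> h n x + h m x"
        using le[OF x, of n] le[OF x, of m] norm_triangle_ineq4[of "f x - g m x" "f x - g n x"]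
        by linarith
      finally show "norm (g n x - g m x) \<le> h n x + h m x" .
    qed (intro integrable_diff integrable_add g h)+
    also have "\<dots> = integral (cbox a b) (h n) + integral (cbox a b) (h m)"
      by (simp add: integral_add h)
    finally show ?thesis .
  qed
  have "Cauchy ?I"
  proof (rule metric_CauchyI)
    fix e :: real assume e: "e > 0"
    have "\<forall>\<^sub>F n in sequentially. integral (cbox a b) (h n) < e/2"
      by (rule order_tendstoD(2)[OF h0]) (use e in simp)
    then obtain N where N: "\<And>n. n \<ge> N \<Longrightarrow> integral (cbox a b) (h n) < e/2"
      by (auto simp: eventually_sequentially)
    show "\<exists>M. \<forall>m\<ge>M. \<forall>n\<ge>M. dist (?I m) (?I n) < e"
    proof (intro exI[of _ N] allI impI)
      fix m n assume "N \<le> m" "N \<le> n"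
      then show "dist (?I m) (?I n) < e"
        using gg[of m n] N[of m] N[of n] by (simp add: dist_norm)
    qed
  qed
  then obtain y where "?I \<longlonglongrightarrow> y" using Cauchy_convergent convergent_def by blast
  from has_integral_L1_limit[OF integrable_integral[OF g] h le h0 this]
  show ?thesis by blast
qed

text \<open>This handles singularities at both endpoints. Cutting \<open>f\<close> off near them
  costs no more than the integral of \<open>h\<close> over the removed pieces, which tends to 0
  because indefinite integrals are continuous. All later integrals with weights (1 - u)^(q - 1) or
  with F(uz) near u = 0 rest on it.\<close>

lemma integrable_continuous_dominated:
  fixes f :: "real \<Rightarrow> 'b::banach"
  assumes f: "continuous_on {a<..<b} f" and h: "h integrable_on {a..b}"
    and le: "\<And>x. a < x \<Longrightarrow> x < b \<Longrightarrow> norm (f x) \<le> h x"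
  shows "f integrable_on {a..b}" "norm (integral {a..b} f) \<le> integral {a..b} h"
proof -
  have "f integrable_on {a..b}" if "a < b"
  proof -
    \<comment> \<open>The summand 3 keeps \<open>d n\<close> below half of the length, so the
      truncated interval is nondegenerate already for n = 0.\<close>
    define d where "d n = (b - a) / (real n + 3)" for n :: nat
    have d: "d n > 0" "a + d n < b - d n" for n
    proof -
      show "d n > 0" using that by (simp add: d_def)
      have "d n < (b - a) / 2" using that unfolding d_def by (intro divide_strict_left_mono) auto
      then show "a + d n < b - d n" by (simp add: field_simps)
    qed
    have d0: "d \<longlonglongrightarrow> 0" unfolding d_def by real_asymp
    define f' where "f' x = (if x \<in> {a<..<b} then f x else 0)" for x
    define h' where "h' x = (if x \<in> {a<..<b} then h x else 0)" for x
    define g where "g n x = (if x \<in> {a + d n..b - d n} then f x else 0)" for n x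
    define k where "k n x = (if x \<in> {a + d n..b - d n} then h x else 0)" for n x
    have h': "(h' has_integral integral {a..b} h) {a..b}"
    proof (rule has_integral_spike_finite[OF _ _ integrable_integral[OF h]])
      show "finite {a, b}" by simp
      show "h' x = h x" if "x \<in> {a..b} - {a, b}" for x using that by (auto simp: h'_def)
    qed
    have sub: "{a + d n..b - d n} \<subseteq> {a..b}" "{a + d n..b - d n} \<subseteq> {a<..<b}" for n
      using d(1)[of n] by auto
    have g: "g n integrable_on {a..b}" for n
    proof -
      have "f integrable_on {a + d n..b - d n}"
        using f sub(2) by (intro integrable_continuous_real) (rule continuous_on_subset)
      then show ?thesis
        unfolding g_def integrable_restrict_Int Int_absorb2[OF sub(1)] .
    qed
    have k: "(k n has_integral integral {a + d n..b - d n} h) {a..b}" for n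
      unfolding k_def has_integral_restrict_Int Int_absorb2[OF sub(1)]
      by (rule integrable_integral[OF integrable_on_subinterval[OF h sub(1)]])
    have lim: "(\<lambda>n. integral {a + d n..b - d n} h) \<longlonglongrightarrow> integral {a..b} h"
    proof -
      let ?F = "\<lambda>t. integral {a..t} h"
      have cF: "continuous_on {a..b} ?F" by (rule indefinite_integral_continuous_1[OF h])
      have mem: "a + d n \<in> {a..b}" "b - d n \<in> {a..b}" for n using d[of n] by auto
      have "(\<lambda>n. ?F (b - d n)) \<longlonglongrightarrow> ?F b"
        by (rule continuous_on_tendsto_compose[OF cF])
          (use mem that in \<open>auto intro!: tendsto_eq_intros d0\<close>)
      moreover have "(\<lambda>n. ?F (a + d n)) \<longlonglongrightarrow> ?F a"
        by (rule continuous_on_tendsto_compose[OF cF])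
          (use mem that in \<open>auto intro!: tendsto_eq_intros d0\<close>)
      ultimately have "(\<lambda>n. ?F (b - d n) - ?F (a + d n)) \<longlonglongrightarrow> ?F b - ?F a" by (rule tendsto_diff)
      moreover have "?F (b - d n) - ?F (a + d n) = integral {a + d n..b - d n} h" for n
      proof -
        have "?F (a + d n) + integral {a + d n..b - d n} h = ?F (b - d n)"
          using d[of n]
          by (intro Henstock_Kurzweil_Integration.integral_combine integrable_on_subinterval[OF h]) auto
        then show ?thesis by simp
      qed
      ultimately show ?thesis by simp
    qed
    have "f' integrable_on cbox a b"
    proof (rule integrable_L1_limit[where g = g and h = "\<lambda>n x. h' x - k n x"])
      show "g n integrable_on cbox a b" for n using g by simp
      show "(\<lambda>x. h' x - k n x) integrable_on cbox a b" for n
        using has_integral_diff[OF h' k[of n]] by (auto simp: integrable_on_def)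
      show "norm (f' x - g n x) \<le> h' x - k n x" if "x \<in> cbox a b" for n x
        using le[of x] sub(2)[of n] by (auto simp: f'_def g_def h'_def k_def)
      have "integral (cbox a b) (\<lambda>x. h' x - k n x) = integral {a..b} h - integral {a + d n..b - d n} h" for n
        using integral_unique[OF has_integral_diff[OF h' k[of n]]] by simp
      then show "(\<lambda>n. integral (cbox a b) (\<lambda>x. h' x - k n x)) \<longlonglongrightarrow> 0"
        using tendsto_diff[OF tendsto_const lim, of "integral {a..b} h"] by simp
    qed
    then have f': "f' integrable_on {a..b}" by simp
    show ?thesis
      by (rule integrable_spike_finite[OF _ _ f', of "{a, b}"]) (auto simp: f'_def)
  qed
  then show int: "f integrable_on {a..b}"
  proof (cases "a < b")
    case False
    then show ?thesis using integrable_on_refl[of f b] by (cases "a = b") auto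
  qed
  \<comment> \<open>Domination is assumed in the open interval only, so both functions are set to 0
    at the endpoints before their integrals are compared.\<close>
  have f2: "(\<lambda>x. if x \<in> {a, b} then 0 else f x) integrable_on {a..b}"
    by (rule integrable_spike_finite[OF _ _ int, of "{a, b}"]) auto
  have h2: "(\<lambda>x. if x \<in> {a, b} then 0 else h x) integrable_on {a..b}"
    by (rule integrable_spike_finite[OF _ _ h, of "{a, b}"]) auto
  have "norm (integral {a..b} f) = norm (integral {a..b} (\<lambda>x. if x \<in> {a, b} then 0 else f x))"
    by (intro arg_cong[of _ _ norm] integral_spike[of "{a, b}"]) auto
  also have "\<dots> \<le> integral {a..b} (\<lambda>x. if x \<in> {a, b} then 0 else h x)"
    by (rule Henstock_Kurzweil_Integration.integral_norm_bound_integral[OF f2 h2]) (use le in auto)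
  also have "\<dots> = integral {a..b} h"
    by (rule integral_spike[of "{a, b}"]) auto
  finally show "norm (integral {a..b} f) \<le> integral {a..b} h" .
qed

lemma integral_scaleC:
  fixes f :: "'n::euclidean_space \<Rightarrow> 'b::complex_banach"
  assumes "f integrable_on S"
  shows "(\<lambda>x. c *\<^sub>C f x) integrable_on S" "integral S (\<lambda>x. c *\<^sub>C f x) = c *\<^sub>C integral S f"
  using integrable_linear[OF assms bounded_linear_scaleC[of c]]
    integral_linear[OF assms bounded_linear_scaleC[of c]] by (simp_all add: o_def)

section \<open>Bochner integrals over bounded intervals\<close>

lemma has_integral_Ioc_iff:
  fixes f :: "real \<Rightarrow> 'b::banach"
  shows "(f has_integral y) {a<..b} \<longleftrightarrow> (f has_integral y) {a..b}"
  by (rule has_integral_spike_set_eq; rule negligible_subset[of "{a}"]) auto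

lemma integrable_on_Ioc_iff:
  fixes f :: "real \<Rightarrow> 'b::banach"
  shows "f integrable_on {a<..b} \<longleftrightarrow> f integrable_on {a..b}"
  by (simp add: integrable_on_def has_integral_Ioc_iff)

lemma integral_Ioc_eq:
  fixes f :: "real \<Rightarrow> 'b::banach"
  shows "integral {a<..b} f = integral {a..b} f"
  by (simp add: integral_def integrable_on_Ioc_iff has_integral_Ioc_iff)

lemma integrable_lebesgue_on_Ioc_has_integral:
  fixes f :: "real \<Rightarrow> 'b::euclidean_space"
  assumes "integrable (lebesgue_on {a<..b}) f"
  shows "(f has_integral integral\<^sup>L (lebesgue_on {a<..b}) f) {a..b}"
  using has_integral_integral_lebesgue_on[OF assms] by (simp add: has_integral_Ioc_iff)

text \<open>In a nonseparable space sums and products of Borel functions need not be Borel. If one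
  of the two functions takes finitely many values, freezing that value reduces the question to maps
  of a single measurable function.\<close>

lemma measurable_simple_function_split:
  assumes s: "simple_function M s" and F: "\<And>y. F y \<in> measurable M N"
  shows "(\<lambda>x. F (s x) x) \<in> measurable M N"
proof (rule measurable_compose_countable'[where I = "s ` space M"])
  show "s \<in> M \<rightarrow>\<^sub>M count_space (s ` space M)"
    using simple_functionD[OF s] by (subst measurable_count_space_eq2) auto
  show "countable (s ` space M)" using simple_functionD(1)[OF s] by (rule countable_finite)
qed (use F in simp)

lemma measurable_norm_diff_simple:
  fixes f :: "'m \<Rightarrow> 'b::real_normed_vector"
  assumes f: "f \<in> borel_measurable M" and s: "simple_function M s"
  shows "(\<lambda>x. norm (f x - s x)) \<in> borel_measurable M"
proof (rule measurable_simple_function_split[OF s])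
  fix y
  show "(\<lambda>x. norm (f x - y)) \<in> borel_measurable M"
    by (rule measurable_compose[OF f])
      (intro borel_measurable_continuous_onI continuous_intros)
qed

lemma finite_measure_lebesgue_on_Ioc: "finite_measure (lebesgue_on {a<..b::real})"
  by (intro finite_measure_lebesgue_on bounded_set_imp_lmeasurable) auto

lemma simple_bochner_integrable_has_integral:
  fixes s :: "real \<Rightarrow> 'b::banach"
  assumes s: "Bochner_Integration.simple_bochner_integrable (lebesgue_on {a<..b}) s"
  shows "(s has_integral Bochner_Integration.simple_bochner_integral (lebesgue_on {a<..b}) s) {a..b}"
proof -
  let ?M = "lebesgue_on {a<..b}"
  have sf: "simple_function ?M s" using s by (rule simple_bochner_integrable.cases)
  let ?A = "\<lambda>y. {x\<in>space ?M. s x = y}"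
  have A: "?A y \<in> sets ?M" for y
    using simple_functionD(2)[OF sf, of "{y}"] by (simp add: vimage_def Int_def conj_commute)
  have "((\<lambda>x. indicat_real (?A y) x *\<^sub>R y) has_integral measure ?M (?A y) *\<^sub>R y) {a..b}" for y
  proof (rule has_integral_scaleR_left)
    have "integrable ?M (indicat_real (?A y))"
      using A finite_measure.emeasure_finite[OF finite_measure_lebesgue_on_Ioc, of a b "?A y"]
      by (intro integrable_real_indicator) (simp_all add: less_top)
    moreover have "?A y \<inter> space ?M = ?A y" by blast
    ultimately show "(indicat_real (?A y) has_integral measure ?M (?A y)) {a..b}"
      using integrable_lebesgue_on_Ioc_has_integral[of a b "indicat_real (?A y)"]
      by (simp only: Bochner_Integration.integral_indicator)
  qed
  then have "((\<lambda>x. \<Sum>y\<in>s ` space ?M. indicat_real (?A y) x *\<^sub>R y) has_integral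
      (\<Sum>y\<in>s ` space ?M. measure ?M (?A y) *\<^sub>R y)) {a..b}"
    using simple_functionD(1)[OF sf] by (intro has_integral_sum) auto
  moreover have "(\<Sum>y\<in>s ` space ?M. indicat_real (?A y) x *\<^sub>R y) = s x" if "x \<in> {a<..b}" for x
  proof -
    have "(\<Sum>y\<in>s ` space ?M. indicat_real (?A y) x *\<^sub>R y) =
        (\<Sum>y\<in>s ` space ?M. if y = s x then y else 0)"
      using that by (intro sum.cong) (auto simp: indicator_def)
    also have "\<dots> = s x"
      using that simple_functionD(1)[OF sf] by (subst sum.delta) auto
    finally show ?thesis .
  qed
  ultimately have "(s has_integral (\<Sum>y\<in>s ` space ?M. measure ?M (?A y) *\<^sub>R y)) {a<..b}"
    by (subst (asm) has_integral_Ioc_iff[symmetric]) (erule has_integral_eq[rotated], simp)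
  then show ?thesis
    by (simp add: has_integral_Ioc_iff simple_bochner_integral_def)
qed

lemma simple_bochner_integrable_lebesgue_on:
  "simple_function (lebesgue_on {a<..b::real}) s \<Longrightarrow>
    Bochner_Integration.simple_bochner_integrable (lebesgue_on {a<..b}) s"
  using finite_measure.emeasure_finite[OF finite_measure_lebesgue_on_Ioc, of a b]
  by (intro simple_bochner_integrable.intros) simp_all

lemma has_bochner_int_approx:
  fixes f :: "real \<Rightarrow> 'b::banach"
  assumes "has_bochner_int (lebesgue_on {a<..b}) f x"
  obtains s where "\<And>i. simple_function (lebesgue_on {a<..b}) (s i)"
    "\<And>i. integrable (lebesgue_on {a<..b}) (\<lambda>t. norm (f t - s i t))"
    "(\<lambda>i. integral\<^sup>L (lebesgue_on {a<..b}) (\<lambda>t. norm (f t - s i t))) \<longlonglongrightarrow> 0"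
    "(\<lambda>i. Bochner_Integration.simple_bochner_integral (lebesgue_on {a<..b}) (s i)) \<longlonglongrightarrow> x"
proof -
  let ?M = "lebesgue_on {a<..b}"
  from assms obtain s where f: "f \<in> borel_measurable ?M"
    and s: "\<And>i. Bochner_Integration.simple_bochner_integrable ?M (s i)"
    and n0: "(\<lambda>i. \<integral>\<^sup>+t. ennreal (norm (f t - s i t)) \<partial>?M) \<longlonglongrightarrow> 0"
    and sx: "(\<lambda>i::nat. Bochner_Integration.simple_bochner_integral ?M (s i)) \<longlonglongrightarrow> x"
    unfolding has_bochner_int_def by blast
  have sf: "simple_function ?M (s i)" for i using s[of i] by (rule simple_bochner_integrable.cases)
  have "\<forall>\<^sub>F i in sequentially. (\<integral>\<^sup>+t. ennreal (norm (f t - s i t)) \<partial>?M) < \<infinity>"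
    by (rule order_tendstoD(2)[OF n0]) simp
  then obtain N where N: "\<And>i. i \<ge> N \<Longrightarrow> (\<integral>\<^sup>+t. ennreal (norm (f t - s i t)) \<partial>?M) < \<infinity>"
    by (auto simp: eventually_sequentially)
  \<comment> \<open>Finitely many approximants may be at infinite mean distance from
    \<open>f\<close>. Dropping them turns the extended nonnegative integrals into real Lebesgue
    integrals.\<close>
  define r where "r i = s (i + N)" for i
  have int: "integrable ?M (\<lambda>t. norm (f t - r i t))" for i
    using N[of "i + N"] measurable_norm_diff_simple[OF f sf]
    by (intro integrableI_bounded) (auto simp: r_def)
  have "(\<lambda>i. ennreal (integral\<^sup>L ?M (\<lambda>t. norm (f t - r i t)))) \<longlonglongrightarrow> ennreal 0"
    using LIMSEQ_ignore_initial_segment[OF n0, of N]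
    by (subst nn_integral_eq_integral[OF int, symmetric]) (auto simp: r_def)
  then have "(\<lambda>i. integral\<^sup>L ?M (\<lambda>t. norm (f t - r i t))) \<longlonglongrightarrow> 0"
    by (subst (asm) tendsto_ennreal_iff) auto
  moreover have "(\<lambda>i. Bochner_Integration.simple_bochner_integral ?M (r i)) \<longlonglongrightarrow> x"
    unfolding r_def using LIMSEQ_ignore_initial_segment[OF sx, of N] .
  ultimately show ?thesis using that[of r] int sf by (simp add: r_def)
qed

text \<open>The approximating simple functions serve as \<open>g n\<close> and their pointwise
  distances to \<open>f\<close> as \<open>h n\<close> in the limit theorem for Henstock-Kurzweil
  integrals.\<close>

lemma has_bochner_int_imp_has_integral:
  fixes f :: "real \<Rightarrow> 'b::banach"
  assumes "has_bochner_int (lebesgue_on {a<..b}) f x"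
  shows "(f has_integral x) {a..b}"
proof -
  let ?M = "lebesgue_on {a<..b}"
  obtain s where s: "\<And>i. simple_function ?M (s i)"
    and int: "\<And>i. integrable ?M (\<lambda>t. norm (f t - s i t))"
    and n0: "(\<lambda>i. integral\<^sup>L ?M (\<lambda>t. norm (f t - s i t))) \<longlonglongrightarrow> 0"
    and sx: "(\<lambda>i. Bochner_Integration.simple_bochner_integral ?M (s i)) \<longlonglongrightarrow> x"
    using has_bochner_int_approx[OF assms] by blast
  have h: "((\<lambda>t. norm (f t - s i t)) has_integral integral\<^sup>L ?M (\<lambda>t. norm (f t - s i t))) {a..b}" for i
    by (rule integrable_lebesgue_on_Ioc_has_integral[OF int])
  have "(f has_integral x) (cbox a b)"
  proof (rule has_integral_L1_limit[OF _ _ order_refl _ sx])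
    show "(s i has_integral Bochner_Integration.simple_bochner_integral ?M (s i)) (cbox a b)" for i
      using simple_bochner_integrable_has_integral[OF simple_bochner_integrable_lebesgue_on[OF s]]
      by simp
    show "(\<lambda>t. norm (f t - s i t)) integrable_on cbox a b" for i using h by auto
    show "(\<lambda>i. integral (cbox a b) (\<lambda>t. norm (f t - s i t))) \<longlonglongrightarrow> 0"
      using n0 integral_unique[OF h] by simp
  qed
  then show ?thesis by simp
qed

lemma bochner_int_eq_integral:
  fixes f :: "real \<Rightarrow> 'b::banach"
  assumes "has_bochner_int (lebesgue_on {a<..b}) f x"
  shows "bochner_int (lebesgue_on {a<..b}) f = integral {a..b} f"
  unfolding bochner_int_def
  using assms has_bochner_int_imp_has_integral integral_unique by (metis theI)

text \<open>The value need not be guessed: approximation in mean by simple functions already makes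
  \<open>f\<close> Henstock-Kurzweil integrable, and the simple integrals converge to that integral.
  The majorants \<open>h\<close> spare an exact computation of the mean distances.\<close>

lemma has_bochner_intI:
  fixes f :: "real \<Rightarrow> 'b::banach"
  assumes f: "f \<in> borel_measurable (lebesgue_on {a<..b})"
    and s: "\<And>i. simple_function (lebesgue_on {a<..b}) (s i)"
    and h: "\<And>i. integrable (lebesgue_on {a<..b}) (h i)"
    and le: "\<And>i t. a < t \<Longrightarrow> t \<le> b \<Longrightarrow> norm (f t - s i t) \<le> h i t"
    and h0: "(\<lambda>i. integral\<^sup>L (lebesgue_on {a<..b}) (h i)) \<longlonglongrightarrow> 0"
  shows "\<exists>x. has_bochner_int (lebesgue_on {a<..b}) f x"
proof -
  let ?M = "lebesgue_on {a<..b}"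
  let ?I = "\<lambda>i. Bochner_Integration.simple_bochner_integral ?M (s i)"
  have int: "integrable ?M (\<lambda>t. norm (f t - s i t))" for i
    by (rule Bochner_Integration.integrable_bound[OF h measurable_norm_diff_simple[OF f s]])
      (auto intro!: AE_I2 order_trans[OF le abs_ge_self])
  have "integral\<^sup>L ?M (\<lambda>t. norm (f t - s i t)) \<le> integral\<^sup>L ?M (h i)" for i
    by (rule integral_mono[OF int h]) (use le in auto)
  then have n0: "(\<lambda>i. integral\<^sup>L ?M (\<lambda>t. norm (f t - s i t))) \<longlonglongrightarrow> 0"
    by (intro tendsto_sandwich[OF _ _ tendsto_const h0]) auto
  have hi: "((\<lambda>t. norm (f t - s i t)) has_integral integral\<^sup>L ?M (\<lambda>t. norm (f t - s i t))) (cbox a b)" for i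
    using integrable_lebesgue_on_Ioc_has_integral[OF int] by simp
  have si: "(s i has_integral ?I i) (cbox a b)" for i
    using simple_bochner_integrable_has_integral[OF simple_bochner_integrable_lebesgue_on[OF s]] by simp
  have h0': "(\<lambda>i. integral (cbox a b) (\<lambda>t. norm (f t - s i t))) \<longlonglongrightarrow> 0"
    unfolding integral_unique[OF hi] by (rule n0)
  have fint: "f integrable_on cbox a b"
    by (rule integrable_L1_limit[OF has_integral_integrable[OF si] has_integral_integrable[OF hi]
      order_refl h0'])
  have "?I \<longlonglongrightarrow> integral (cbox a b) f"
  proof (rule LIM_zero_cancel, rule Lim_null_comparison)
    show "\<forall>\<^sub>F i in sequentially. norm (?I i - integral (cbox a b) f) \<le>
        integral (cbox a b) (\<lambda>t. norm (f t - s i t))"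
    proof (intro always_eventually allI)
      fix i
      have "norm (?I i - integral (cbox a b) f) = norm (integral (cbox a b) (\<lambda>t. f t - s i t))"
        unfolding integral_diff[OF fint has_integral_integrable[OF si]] integral_unique[OF si]
        by (rule norm_minus_commute)
      also have "\<dots> \<le> integral (cbox a b) (\<lambda>t. norm (f t - s i t))"
        by (rule Henstock_Kurzweil_Integration.integral_norm_bound_integral)
          (rule integrable_diff[OF fint has_integral_integrable[OF si]],
            rule has_integral_integrable[OF hi], rule order_refl)
      finally show "norm (?I i - integral (cbox a b) f) \<le>
        integral (cbox a b) (\<lambda>t. norm (f t - s i t))" .
    qed
  qed (rule h0')
  moreover have "(\<lambda>i. \<integral>\<^sup>+t. ennreal (norm (f t - s i t)) \<partial>?M) \<longlonglongrightarrow> 0"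
    using tendsto_ennrealI[OF n0] by (subst nn_integral_eq_integral[OF int]) auto
  ultimately show ?thesis
    unfolding has_bochner_int_def using f simple_bochner_integrable_lebesgue_on[OF s] by blast
qed

lemma continuous_approx_simple:
  fixes f :: "real \<Rightarrow> 'b::real_normed_vector"
  assumes f: "continuous_on {a..b} f" and e: "e > 0"
  shows "\<exists>s. simple_function (lebesgue_on {a<..b}) s \<and> (\<forall>t. a < t \<longrightarrow> t \<le> b \<longrightarrow> norm (f t - s t) \<le> e)"
proof -
  let ?M = "lebesgue_on {a<..b}"
  have "uniformly_continuous_on {a..b} f" using f by (intro compact_uniformly_continuous) auto
  then obtain d where d: "d > 0"
    and fd: "\<And>x y. x \<in> {a..b} \<Longrightarrow> y \<in> {a..b} \<Longrightarrow> dist y x < d \<Longrightarrow> dist (f y) (f x) < e"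
    using e unfolding uniformly_continuous_on_def by metis
  \<comment> \<open>Index of the grid cell of length d/2 that contains \<open>t\<close>. The step
    function takes the value of \<open>f\<close> at the left end of the cell, at distance below
    \<open>d\<close> from \<open>t\<close>.\<close>
  define k where "k t = \<lfloor>2 * (t - a) / d\<rfloor>" for t :: real
  define s where "s t = f (a + real_of_int (k t) * d / 2)" for t
  have "simple_function ?M (\<lambda>t. real_of_int (k t))"
  proof (rule simple_function_borel_measurable)
    have "(\<lambda>t. 2 * (t - a) / d) \<in> borel_measurable ?M"
      by (rule continuous_imp_measurable_on_sets_lebesgue)
        (use d in \<open>auto intro!: continuous_intros\<close>)
    from measurable_compose[OF this borel_measurable_real_floor]
    show "(\<lambda>t. real_of_int (k t)) \<in> borel_measurable ?M" unfolding k_def .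
    have "k t \<in> {0..k b}" if "t \<in> {a<..b}" for t
      unfolding k_def using that d by (auto intro!: floor_mono divide_right_mono)
    then have "(\<lambda>t. real_of_int (k t)) ` space ?M \<subseteq> real_of_int ` {0..k b}" by auto
    then show "finite ((\<lambda>t. real_of_int (k t)) ` space ?M)" by (rule finite_subset) simp
  qed
  then have "simple_function ?M s"
    unfolding s_def by (rule simple_function_compose1)
  moreover have "norm (f t - s t) \<le> e" if t: "a < t" "t \<le> b" for t
  proof -
    define u where "u = real_of_int (k t) * d / 2"
    have k: "real_of_int (k t) \<le> 2 * (t - a) / d" "2 * (t - a) / d < real_of_int (k t) + 1"
      "k t \<ge> 0"
      unfolding k_def using t d by (auto simp: floor_le_iff le_floor_iff)
    from k(1) have "u \<le> t - a" using d by (simp add: u_def field_simps)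
    moreover from k(2) have "t - a < u + d / 2" using d by (simp add: u_def field_simps)
    moreover have "u \<ge> 0" using k(3) d by (simp add: u_def)
    ultimately have "dist (f (a + u)) (f t) < e"
      using t d by (intro fd) (auto simp: dist_norm)
    then show ?thesis by (simp add: s_def u_def dist_norm norm_minus_commute)
  qed
  ultimately show ?thesis by blast
qed

lemma loc_bochner_continuous:
  fixes f :: "real \<Rightarrow> 'b::banach"
  assumes f: "continuous_on {0..} f"
  shows "loc_bochner_integrable f"
  unfolding loc_bochner_integrable_def
proof (intro allI impI)
  fix \<tau> :: real assume \<tau>: "\<tau> > 0"
  have "\<forall>i. \<exists>s. simple_function (lebesgue_on {0<..\<tau>}) s \<and>
      (\<forall>t. 0 < t \<longrightarrow> t \<le> \<tau> \<longrightarrow> norm (f t - s t) \<le> inverse (real (Suc i)))"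
    using f by (intro allI continuous_approx_simple) (auto intro: continuous_on_subset[OF f])
  then obtain s where s: "\<And>i. simple_function (lebesgue_on {0<..\<tau>}) (s i)"
    "\<And>i t. 0 < t \<Longrightarrow> t \<le> \<tau> \<Longrightarrow> norm (f t - s i t) \<le> inverse (real (Suc i))" by metis
  interpret finite_measure "lebesgue_on {0<..\<tau>}" by (rule finite_measure_lebesgue_on_Ioc)
  show "\<exists>x. has_bochner_int (lebesgue_on {0<..\<tau>}) f x"
  proof (rule has_bochner_intI[OF _ s(1) _ s(2)])
    show "f \<in> borel_measurable (lebesgue_on {0<..\<tau>})"
      using f by (intro continuous_imp_measurable_on_sets_lebesgue) (auto intro: continuous_on_subset[OF f])
    have "(\<lambda>i. measure (lebesgue_on {0<..\<tau>}) {0<..\<tau>} * inverse (real (Suc i))) \<longlonglongrightarrow> 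
       measure (lebesgue_on {0<..\<tau>}) {0<..\<tau>} * 0"
      by (intro tendsto_intros LIMSEQ_inverse_real_of_nat)
    then show "(\<lambda>i. integral\<^sup>L (lebesgue_on {0<..\<tau>}) (\<lambda>t. inverse (real (Suc i)))) \<longlonglongrightarrow> 0"
      by simp
  qed simp_all
qed

text \<open>The triangle inequality through one approximant: its distance to \<open>f\<close> is
  integrable, and it takes finitely many values on an interval of finite measure.\<close>

lemma has_bochner_int_norm_integrable:
  fixes f :: "real \<Rightarrow> 'b::banach"
  assumes x: "has_bochner_int (lebesgue_on {a<..b}) f x"
  shows "integrable (lebesgue_on {a<..b}) (\<lambda>t. norm (f t))"
proof -
  let ?M = "lebesgue_on {a<..b}"
  have fm: "f \<in> borel_measurable ?M" using x by (simp add: has_bochner_int_def)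
  obtain s where s: "\<And>i. simple_function ?M (s i)"
    and int: "\<And>i. integrable ?M (\<lambda>t. norm (f t - s i t))"
    and "(\<lambda>i. integral\<^sup>L ?M (\<lambda>t. norm (f t - s i t))) \<longlonglongrightarrow> 0"
    and "(\<lambda>i. Bochner_Integration.simple_bochner_integral ?M (s i)) \<longlonglongrightarrow> x"
    by (rule has_bochner_int_approx[OF x]) (rule that)
  show ?thesis
  proof (rule Bochner_Integration.integrable_bound)
    interpret finite_measure ?M by (rule finite_measure_lebesgue_on_Ioc)
    have "integrable ?M (\<lambda>t. norm (s 0 t))"
    proof (rule integrable_const_bound)
      have fin: "finite (norm ` s 0 ` space ?M)"
        by (rule finite_imageI[OF simple_functionD(1)[OF s]])
      show "AE t in ?M. norm (norm (s 0 t)) \<le> Max (norm ` s 0 ` space ?M)"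
      proof (rule AE_I2)
        fix t assume "t \<in> space ?M"
        then have "norm (s 0 t) \<le> Max (norm ` s 0 ` space ?M)"
          by (intro Max_ge[OF fin] imageI)
        then show "norm (norm (s 0 t)) \<le> Max (norm ` s 0 ` space ?M)" by (simp only: real_norm_def abs_norm_cancel)
      qed
      show "(\<lambda>t. norm (s 0 t)) \<in> borel_measurable ?M"
        by (intro borel_measurable_simple_function simple_function_compose1[OF s])
    qed
    then show "integrable ?M (\<lambda>t. norm (f t - s 0 t) + norm (s 0 t))"
      by (intro Bochner_Integration.integrable_add int)
    show "(\<lambda>t. norm (f t)) \<in> borel_measurable ?M"
      using measurable_norm_diff_simple[OF fm, of "\<lambda>_. 0"] by simp
    show "AE t in ?M. norm (norm (f t)) \<le> norm (norm (f t - s 0 t) + norm (s 0 t))"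
    proof (rule AE_I2)
      fix t
      show "norm (norm (f t)) \<le> norm (norm (f t - s 0 t) + norm (s 0 t))"
        using norm_triangle_ineq[of "f t - s 0 t" "s 0 t"] by simp
    qed
  qed
qed

text \<open>Both factors are approximated by simple functions. Measurability of the product is
  obtained as a pointwise limit of products in which the scalar factor is simple, which is safe in
  nonseparable spaces.\<close>

lemma loc_bochner_scaleR:
  fixes f :: "real \<Rightarrow> 'b::banach"
  assumes f: "loc_bochner_integrable f" and g: "continuous_on UNIV (g::real \<Rightarrow> real)"
  shows "loc_bochner_integrable (\<lambda>t. g t *\<^sub>R f t)"
  unfolding loc_bochner_integrable_def
proof (intro allI impI)
  fix \<tau> :: real assume \<tau>: "\<tau> > 0"
  let ?M = "lebesgue_on {0<..\<tau>}"
  obtain x where x: "has_bochner_int ?M f x"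
    using f \<tau> unfolding loc_bochner_integrable_def by blast
  have fm: "f \<in> borel_measurable ?M" using x by (simp add: has_bochner_int_def)
  obtain s where s: "\<And>i. simple_function ?M (s i)"
    and int: "\<And>i. integrable ?M (\<lambda>t. norm (f t - s i t))"
    and n0: "(\<lambda>i. integral\<^sup>L ?M (\<lambda>t. norm (f t - s i t))) \<longlonglongrightarrow> 0"
    and "(\<lambda>i. Bochner_Integration.simple_bochner_integral ?M (s i)) \<longlonglongrightarrow> x"
    by (rule has_bochner_int_approx[OF x]) (rule that)
  have "\<forall>i. \<exists>e. simple_function ?M e \<and>
      (\<forall>t. 0 < t \<longrightarrow> t \<le> \<tau> \<longrightarrow> norm (g t - e t) \<le> inverse (real (Suc i)))"
    using g by (intro allI continuous_approx_simple) (auto intro: continuous_on_subset[OF g])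
  then obtain e where e: "\<And>i. simple_function ?M (e i)"
    "\<And>i t. 0 < t \<Longrightarrow> t \<le> \<tau> \<Longrightarrow> norm (g t - e i t) \<le> inverse (real (Suc i))" by metis
  have "compact (g ` {0..\<tau>})" using g by (intro compact_continuous_image) (auto intro: continuous_on_subset[OF g])
  then obtain C where C: "\<And>t. t \<in> {0..\<tau>} \<Longrightarrow> norm (g t) \<le> C"
    using compact_imp_bounded bounded_iff by (metis image_eqI)
  have "C \<ge> 0" using C[of 0] \<tau> norm_ge_zero[of "g 0"] by auto
  have nf: "integrable ?M (\<lambda>t. norm (f t))" by (rule has_bochner_int_norm_integrable[OF x])
  \<comment> \<open>The error splits as e(f - s) + (g - e)f; the scalar approximant is bounded by
    \<open>C\<close> plus its own error.\<close>
  define h where "h i t = (C + inverse (real (Suc i))) * norm (f t - s i t) +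
      inverse (real (Suc i)) * norm (f t)" for i t
  have emeas: "(\<lambda>t. e i t *\<^sub>R f t) \<in> borel_measurable ?M" for i
    by (rule measurable_simple_function_split[OF e(1)], rule measurable_compose[OF fm])
      (intro borel_measurable_continuous_onI continuous_intros)
  have elim: "(\<lambda>i. e i t) \<longlonglongrightarrow> g t" if "0 < t" "t \<le> \<tau>" for t
    by (rule LIM_zero_cancel, rule Lim_null_comparison[OF _ LIMSEQ_inverse_real_of_nat])
      (use e(2)[OF that] in \<open>simp add: abs_minus_commute\<close>)
  show "\<exists>x. has_bochner_int ?M (\<lambda>t. g t *\<^sub>R f t) x"
  proof (rule has_bochner_intI[where s = "\<lambda>i t. e i t *\<^sub>R s i t" and h = h])
    show "(\<lambda>t. g t *\<^sub>R f t) \<in> borel_measurable ?M"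
      by (rule borel_measurable_LIMSEQ_metric[OF emeas])
        (use elim in \<open>auto intro!: tendsto_intros\<close>)
    show "simple_function ?M (\<lambda>t. e i t *\<^sub>R s i t)" for i
      by (rule simple_function_compose2[OF e(1) s])
    show "integrable ?M (h i)" for i
      unfolding h_def by (intro Bochner_Integration.integrable_add integrable_mult_right int nf)
    show "norm (g t *\<^sub>R f t - e i t *\<^sub>R s i t) \<le> h i t" if t: "0 < t" "t \<le> \<tau>" for i t
    proof -
      have "g t *\<^sub>R f t - e i t *\<^sub>R s i t = e i t *\<^sub>R (f t - s i t) + (g t - e i t) *\<^sub>R f t"
        by (simp add: algebra_simps)
      also have "norm \<dots> \<le> \<bar>e i t\<bar> * norm (f t - s i t) + \<bar>g t - e i t\<bar> * norm (f t)"
        using norm_triangle_ineq[of "e i t *\<^sub>R (f t - s i t)" "(g t - e i t) *\<^sub>R f t"] by simp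
      also have "\<dots> \<le> h i t"
        unfolding h_def using C[of t] e(2)[OF t, of i] t
        by (intro add_mono mult_right_mono) auto
      finally show ?thesis .
    qed
    have "integral\<^sup>L ?M (h i) = (C + inverse (real (Suc i))) * integral\<^sup>L ?M (\<lambda>t. norm (f t - s i t)) +
        inverse (real (Suc i)) * integral\<^sup>L ?M (\<lambda>t. norm (f t))" for i
      unfolding h_def using int[of i] nf
      by (subst Bochner_Integration.integral_add) auto
    moreover have "(\<lambda>i. (C + inverse (real (Suc i))) * integral\<^sup>L ?M (\<lambda>t. norm (f t - s i t)) +
        inverse (real (Suc i)) * integral\<^sup>L ?M (\<lambda>t. norm (f t))) \<longlonglongrightarrow>
        (C + 0) * 0 + 0 * integral\<^sup>L ?M (\<lambda>t. norm (f t))"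
      by (intro tendsto_intros LIMSEQ_inverse_real_of_nat n0)
    ultimately show "(\<lambda>i. integral\<^sup>L ?M (h i)) \<longlonglongrightarrow> 0" by simp
  qed
qed

lemma loc_bochner_integrable_on:
  assumes f: "loc_bochner_integrable f" and "0 \<le> a"
  shows "f integrable_on {a..b}"
proof (cases "b > 0")
  case True
  then obtain x where "has_bochner_int (lebesgue_on {0<..b}) f x"
    using f unfolding loc_bochner_integrable_def by blast
  from has_bochner_int_imp_has_integral[OF this] show ?thesis
    using assms(2) by (auto intro: integrable_on_subinterval)
next
  case False
  then show ?thesis
    using assms(2) integrable_on_refl[of f a] by (cases "a = b") auto
qed

lemma loc_bochner_norm:
  assumes f: "loc_bochner_integrable f"
  shows "loc_bochner_integrable (\<lambda>t. norm (f t))"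
  unfolding loc_bochner_integrable_def
proof (intro allI impI)
  fix \<tau> :: real assume \<tau>: "\<tau> > 0"
  let ?M = "lebesgue_on {0<..\<tau>}"
  obtain x where x: "has_bochner_int ?M f x"
    using f \<tau> unfolding loc_bochner_integrable_def by blast
  obtain s where s: "\<And>i. simple_function ?M (s i)"
    and int: "\<And>i. integrable ?M (\<lambda>t. norm (f t - s i t))"
    and n0: "(\<lambda>i. integral\<^sup>L ?M (\<lambda>t. norm (f t - s i t))) \<longlonglongrightarrow> 0"
    and "(\<lambda>i. Bochner_Integration.simple_bochner_integral ?M (s i)) \<longlonglongrightarrow> x"
    by (rule has_bochner_int_approx[OF x]) (rule that)
  show "\<exists>x. has_bochner_int ?M (\<lambda>t. norm (f t)) x"
  proof (rule has_bochner_intI[OF _ _ int _ n0])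
    show "(\<lambda>t. norm (f t)) \<in> borel_measurable ?M"
      using x measurable_norm_diff_simple[of f ?M "\<lambda>_. 0"] by (simp add: has_bochner_int_def)
    show "simple_function ?M (\<lambda>t. norm (s i t))" for i by (rule simple_function_compose1[OF s])
    show "norm (norm (f t) - norm (s i t)) \<le> norm (f t - s i t)" for i t
      by (simp add: norm_triangle_ineq3)
  qed
qed

text \<open>From here on Laplace transforms are improper Henstock-Kurzweil integrals. The
  exponential factor preserves local Bochner integrability, and this identifies the two integrals on
  every bounded interval.\<close>

lemma has_laplace_iff:
  fixes f :: "real \<Rightarrow> 'b::banach"
  shows "has_laplace f \<mu> y \<longleftrightarrow> loc_bochner_integrable f \<and>
    ((\<lambda>\<tau>. integral {0..\<tau>} (\<lambda>t. exp (- (\<mu> * t)) *\<^sub>R f t)) \<longlongrightarrow> y) at_top"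
proof -
  have "((\<lambda>\<tau>. bochner_int (lebesgue_on {0<..\<tau>}) (\<lambda>t. exp (- (\<mu> * t)) *\<^sub>R f t)) \<longlongrightarrow> y) at_top \<longleftrightarrow>
    ((\<lambda>\<tau>. integral {0..\<tau>} (\<lambda>t. exp (- (\<mu> * t)) *\<^sub>R f t)) \<longlongrightarrow> y) at_top"
    if f: "loc_bochner_integrable f"
  proof (rule tendsto_cong)
    have "loc_bochner_integrable (\<lambda>t. exp (- (\<mu> * t)) *\<^sub>R f t)"
      by (rule loc_bochner_scaleR[OF f]) (intro continuous_intros)
    then have "bochner_int (lebesgue_on {0<..\<tau>}) (\<lambda>t. exp (- (\<mu> * t)) *\<^sub>R f t) =
        integral {0..\<tau>} (\<lambda>t. exp (- (\<mu> * t)) *\<^sub>R f t)" if "\<tau> > 0" for \<tau>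
      using that by (auto simp: loc_bochner_integrable_def intro: bochner_int_eq_integral)
    then show "\<forall>\<^sub>F \<tau> in at_top. bochner_int (lebesgue_on {0<..\<tau>}) (\<lambda>t. exp (- (\<mu> * t)) *\<^sub>R f t) =
        integral {0..\<tau>} (\<lambda>t. exp (- (\<mu> * t)) *\<^sub>R f t)"
      by (intro eventually_mono[OF eventually_gt_at_top[of "0::real"]]) auto
  qed
  then show ?thesis unfolding has_laplace_def by blast
qed

section \<open>Vanishing of locally integrable functions\<close>

text \<open>Henstock's lemma bounds the sum of the distances between the Riemann terms and the
  integrals over their pieces. Here those integrals vanish, so what is bounded is a Riemann sum of
  the absolute value.\<close>

lemma abs_has_integral_0_if_interval_integrals_0:
  fixes g :: "real \<Rightarrow> real"
  assumes g: "g integrable_on {a..b}"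
    and 0: "\<And>u v. a \<le> u \<Longrightarrow> u \<le> v \<Longrightarrow> v \<le> b \<Longrightarrow> integral {u..v} g = 0"
  shows "((\<lambda>t. \<bar>g t\<bar>) has_integral 0) {a..b}"
proof -
  have "((\<lambda>t. \<bar>g t\<bar>) has_integral 0) (cbox a b)"
    unfolding has_integral
  proof (intro allI impI)
    fix e :: real assume "e > 0"
    then obtain \<gamma> where \<gamma>: "gauge \<gamma>" "\<And>p. p tagged_partial_division_of (cbox a b) \<Longrightarrow> \<gamma> fine p \<Longrightarrow>
        (\<Sum>(x,K)\<in>p. norm (measure lborel K *\<^sub>R g x - integral K g)) < e"
      using Henstock_lemma[of g a b e] g by auto
    show "\<exists>\<gamma>. gauge \<gamma> \<and> (\<forall>D. D tagged_division_of cbox a b \<and> \<gamma> fine D \<longrightarrow>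
        norm ((\<Sum>(x,k)\<in>D. measure lborel k *\<^sub>R \<bar>g x\<bar>) - 0) < e)"
    proof (intro exI[of _ \<gamma>] conjI allI impI \<gamma>(1))
      fix D assume D: "D tagged_division_of cbox a b \<and> \<gamma> fine D"
      then have "(\<Sum>(x,K)\<in>D. norm (measure lborel K *\<^sub>R g x - integral K g)) < e"
        by (intro \<gamma>(2)) (auto simp: tagged_division_of_def)
      also have "(\<Sum>(x,K)\<in>D. norm (measure lborel K *\<^sub>R g x - integral K g)) =
          (\<Sum>(x,k)\<in>D. measure lborel k *\<^sub>R \<bar>g x\<bar>)"
      proof (intro sum.cong refl, clarify)
        fix x K assume xK: "(x, K) \<in> D"
        then obtain u v where K: "K = cbox u v" using D by (meson tagged_division_ofD(4))
        moreover have "K \<subseteq> cbox a b" using D xK by (meson tagged_division_ofD(3))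
        moreover have "K \<noteq> {}" using D xK by (metis empty_iff tagged_division_ofD(2))
        ultimately have "integral K g = 0" using 0[of u v] by auto
        then show "norm (measure lborel K *\<^sub>R g x - integral K g) = measure lborel K *\<^sub>R \<bar>g x\<bar>"
          by (simp add: abs_mult)
      qed
      finally show "norm ((\<Sum>(x,k)\<in>D. measure lborel k *\<^sub>R \<bar>g x\<bar>) - 0) < e"
        by (simp add: sum_nonneg split_def)
    qed
  qed
  then show ?thesis by simp
qed

text \<open>Pettis integrability would not suffice here: the pointwise bound on \<open>norm (f t)\<close> uses finitely
  many functionals, namely those norming the values of an approximating simple function.\<close>

lemma loc_bochner_zero_integrals:
  fixes f :: "real \<Rightarrow> 'b::banach"
  assumes f: "loc_bochner_integrable f" and r: "r > 0"
    and 0: "\<And>t. 0 \<le> t \<Longrightarrow> t \<le> r \<Longrightarrow> integral {0..t} f = 0"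
  shows "\<exists>t. 0 < t \<and> t < r \<and> f t = 0"
proof -
  let ?M = "lebesgue_on {0<..r}"
  have fi: "f integrable_on {u..v}" if "0 \<le> u" for u v
    using loc_bochner_integrable_on[OF f that] .
  have 00: "integral {u..v} f = 0" if "0 \<le> u" "u \<le> v" "v \<le> r" for u v
    using Henstock_Kurzweil_Integration.integral_combine[OF that(1,2) fi[of 0 v]] 0[of u] 0[of v] that
    by simp
  obtain x where x: "has_bochner_int ?M f x"
    using f r unfolding loc_bochner_integrable_def by blast
  obtain s where s: "\<And>i. simple_function ?M (s i)"
    and int: "\<And>i. integrable ?M (\<lambda>t. norm (f t - s i t))"
    and n0: "(\<lambda>i. integral\<^sup>L ?M (\<lambda>t. norm (f t - s i t))) \<longlonglongrightarrow> 0"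
    and "(\<lambda>i. Bochner_Integration.simple_bochner_integral ?M (s i)) \<longlonglongrightarrow> x"
    by (rule has_bochner_int_approx[OF x]) (rule that)
  have nfI: "integrable ?M (\<lambda>t. norm (f t))" by (rule has_bochner_int_norm_integrable[OF x])
  have nf: "((\<lambda>t. norm (f t)) has_integral integral\<^sup>L ?M (\<lambda>t. norm (f t))) {0<..r}"
    using integrable_lebesgue_on_Ioc_has_integral[OF nfI] by (simp add: has_integral_Ioc_iff)
  obtain F where F: "\<And>y::'b. linear (F y)" "\<And>y z. \<bar>F y z\<bar> \<le> norm z" "\<And>y. F y y = norm y"
    using norming_functional_real by metis
  have bF: "bounded_linear (F y)" for y
    using F(1,2) by (intro bounded_linear_intro[where K = 1]) (auto simp: linear_add linear_scale)
  have F0: "((\<lambda>t. \<bar>F y (f t)\<bar>) has_integral 0) {0..r}" for y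
  proof (rule abs_has_integral_0_if_interval_integrals_0)
    show "(\<lambda>t. F y (f t)) integrable_on {0..r}"
      using integrable_linear[OF fi[OF order_refl, of r] bF[of y]] by (simp add: o_def)
    show "integral {u..v} (\<lambda>t. F y (f t)) = 0" if "0 \<le> u" "u \<le> v" "v \<le> r" for u v
      using integral_linear[OF fi[OF that(1), of v] bF[of y]] 00[OF that] linear_0[OF F(1)]
      by (simp add: o_def)
  qed
  \<comment> \<open>At each \<open>t\<close> the functional norming \<open>s i t\<close> gives norm
    (s i t) <= norm (f t - s i t) + |F (s i t) (f t)|. The last term is at most a finite sum of
    functions with integral 0, so the norm of \<open>f\<close> integrates to at most twice the mean
    distance, which tends to 0.\<close>
  have le: "integral\<^sup>L ?M (\<lambda>t. norm (f t)) \<le> 2 * integral\<^sup>L ?M (\<lambda>t. norm (f t - s i t))" for i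
  proof -
    let ?Y = "s i ` {0<..r}"
    have fin: "finite ?Y" using simple_functionD(1)[OF s[of i]] by simp
    have "((\<lambda>t. 2 * norm (f t - s i t) + (\<Sum>y\<in>?Y. \<bar>F y (f t)\<bar>)) has_integral
        2 * integral\<^sup>L ?M (\<lambda>t. norm (f t - s i t)) + (\<Sum>y\<in>?Y. 0)) {0..r}"
      by (intro has_integral_add has_integral_mult_right has_integral_sum fin F0
          integrable_lebesgue_on_Ioc_has_integral[OF int])
    then have A: "((\<lambda>t. 2 * norm (f t - s i t) + (\<Sum>y\<in>?Y. \<bar>F y (f t)\<bar>)) has_integral
        2 * integral\<^sup>L ?M (\<lambda>t. norm (f t - s i t))) {0<..r}" by (simp add: has_integral_Ioc_iff)
    show ?thesis
    proof (rule has_integral_le[OF nf A])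
      fix t assume t: "t \<in> {0<..r}"
      have "norm (s i t) = F (s i t) (s i t - f t) + F (s i t) (f t)"
        using F(1,3) by (simp add: linear_diff)
      also have "\<dots> \<le> norm (f t - s i t) + \<bar>F (s i t) (f t)\<bar>"
        using F(2)[of "s i t" "s i t - f t"] by (simp add: norm_minus_commute)
      also have "\<bar>F (s i t) (f t)\<bar> \<le> (\<Sum>y\<in>?Y. \<bar>F y (f t)\<bar>)"
        using t by (intro member_le_sum[of "s i t" ?Y "\<lambda>y. \<bar>F y (f t)\<bar>"] fin) auto
      finally show "norm (f t) \<le> 2 * norm (f t - s i t) + (\<Sum>y\<in>?Y. \<bar>F y (f t)\<bar>)"
        using norm_triangle_ineq[of "f t - s i t" "s i t"] by simp
    qed
  qed
  have "integral\<^sup>L ?M (\<lambda>t. norm (f t)) \<le> 2 * 0"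
    by (rule LIMSEQ_le_const[OF tendsto_mult_left[OF n0]]) (use le in auto)
  moreover have "integral\<^sup>L ?M (\<lambda>t. norm (f t)) \<ge> 0" by (rule integral_nonneg_AE) simp
  ultimately have "integral\<^sup>L ?M (\<lambda>t. norm (f t)) = 0" by simp
  then have "AE t in ?M. norm (f t) = 0"
    by (subst (asm) integral_nonneg_eq_0_iff_AE[OF nfI]) auto
  then obtain N where N: "\<And>t. t \<in> space ?M - N \<Longrightarrow> norm (f t) = 0" "N \<in> null_sets ?M"
    by (rule AE_E3) (rule that)
  show ?thesis
  proof (rule ccontr)
    assume "\<not> ?thesis"
    then have "{0<..<r} \<subseteq> N" using N(1) by force
    then have "emeasure ?M {0<..<r} \<le> emeasure ?M N"
      using N(2) by (intro emeasure_mono) auto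
    moreover have "emeasure ?M {0<..<r} = ennreal r"
      using r by (subst emeasure_restrict_space) (auto simp: subset_iff)
    ultimately show False using N(2) r by auto
  qed
qed

section \<open>Laplace transforms of locally integrable functions\<close>

lemma integral_loc_bochner_continuous:
  assumes "loc_bochner_integrable f"
  shows "continuous_on {0..} (\<lambda>t. integral {0..t} f)"
  unfolding continuous_on_eq_continuous_within
proof
  fix x :: real assume x: "x \<in> {0..}"
  have "continuous_on {0..x+1} (\<lambda>t. integral {0..t} f)"
    by (rule indefinite_integral_continuous_1) (rule loc_bochner_integrable_on[OF assms order_refl])
  then have "continuous (at x within {0..x+1}) (\<lambda>t. integral {0..t} f)"
    using x by (auto simp: continuous_on_eq_continuous_within)
  moreover have "at x within {0..x+1} = at x within {0..}"
    by (rule at_within_nhd[of _ "{..<x+1}"]) auto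
  ultimately show "continuous (at x within {0..}) (\<lambda>t. integral {0..t} f)"
    by (simp add: continuous_within)
qed

lemma loc_bochner_exp:
  "loc_bochner_integrable f \<Longrightarrow> loc_bochner_integrable (\<lambda>t. exp (- (c * t)) *\<^sub>R f t)"
  by (erule loc_bochner_scaleR) (intro continuous_intros)

lemma integral_diff_loc_bochner:
  assumes "loc_bochner_integrable f" "0 \<le> s" "s \<le> t"
  shows "integral {0..t} f - integral {0..s} f = integral {s..t} f"
  using Henstock_Kurzweil_Integration.integral_combine[OF assms(2,3)
      loc_bochner_integrable_on[OF assms(1) order_refl]] by (metis add_diff_cancel_left')

lemma norm_integral_loc_bochner_le:
  fixes f :: "real \<Rightarrow> 'b::banach"
  assumes "loc_bochner_integrable f" "0 \<le> s" "\<And>x. s \<le> x \<Longrightarrow> x \<le> t \<Longrightarrow> norm (f x) \<le> g x"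
    "g integrable_on {s..t}"
  shows "norm (integral {s..t} f) \<le> integral {s..t} g"
  using assms
  by (intro Henstock_Kurzweil_Integration.integral_norm_bound_integral
      loc_bochner_integrable_on[OF assms(1,2)]) auto

lemma has_derivative_zeroI:
  fixes H :: "real \<Rightarrow> 'b::real_normed_vector"
  assumes \<Phi>: "continuous (at x within S) \<Phi>"
    and le: "\<And>y. y \<in> S \<Longrightarrow> norm (H y - H x) \<le> C * \<bar>y - x\<bar> * \<bar>\<Phi> y - \<Phi> x\<bar>"
  shows "(H has_derivative (\<lambda>h. 0)) (at x within S)"
  unfolding has_derivative_within
proof
  show "((\<lambda>y. (1 / norm (y - x)) *\<^sub>R (H y - (H x + 0))) \<longlongrightarrow> 0) (at x within S)"
  proof (rule Lim_null_comparison)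
    show "\<forall>\<^sub>F y in at x within S. norm ((1 / norm (y - x)) *\<^sub>R (H y - (H x + 0))) \<le> C * \<bar>\<Phi> y - \<Phi> x\<bar>"
      unfolding eventually_at_topological
    proof (intro exI[of _ UNIV] conjI ballI impI)
      fix y assume "y \<noteq> x" "y \<in> S"
      then show "norm ((1 / norm (y - x)) *\<^sub>R (H y - (H x + 0))) \<le> C * \<bar>\<Phi> y - \<Phi> x\<bar>"
        using le[of y]
        by (simp del: scaleR_right_diff_distrib add: scaleR_right_diff_distrib[symmetric] divide_simps mult_ac)
    qed auto
    have "((\<lambda>y. C * \<bar>\<Phi> y - \<Phi> x\<bar>) \<longlongrightarrow> C * \<bar>\<Phi> x - \<Phi> x\<bar>) (at x within S)"
      using \<Phi> by (intro tendsto_intros) (simp add: continuous_within)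
    then show "((\<lambda>y. C * \<bar>\<Phi> y - \<Phi> x\<bar>) \<longlongrightarrow> 0) (at x within S)" by simp
  qed
qed simp

text \<open>\<open>f\<close> need not be continuous, so the product rule is unavailable; the difference \<open>H\<close> of the two
  sides has increments of order \<open>\<bar>y - x\<bar> * \<bar>\<Phi> y - \<Phi> x\<bar>\<close> with \<open>\<Phi>\<close> the integral of the norm of \<open>f\<close>.\<close>

lemma integral_exp_by_parts:
  fixes f :: "real \<Rightarrow> 'b::banach"
  assumes f: "loc_bochner_integrable f" and \<tau>: "0 \<le> \<tau>"
  shows "integral {0..\<tau>} (\<lambda>t. exp (- (c * t)) *\<^sub>R f t) =
    exp (- (c * \<tau>)) *\<^sub>R integral {0..\<tau>} f +
    c *\<^sub>R integral {0..\<tau>} (\<lambda>t. exp (- (c * t)) *\<^sub>R integral {0..t} f)"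
proof -
  define e where "e t = exp (- (c * t))" for t :: real
  define F where "F t = integral {0..t} f" for t
  define \<Phi> where "\<Phi> t = integral {0..t} (\<lambda>t. norm (f t))" for t
  define H where "H t = e t *\<^sub>R F t + c *\<^sub>R integral {0..t} (\<lambda>s. e s *\<^sub>R F s) - integral {0..t} (\<lambda>s. e s *\<^sub>R f s)" for t
  have nf: "loc_bochner_integrable (\<lambda>t. norm (f t))" by (rule loc_bochner_norm[OF f])
  have ef: "loc_bochner_integrable (\<lambda>t. e t *\<^sub>R f t)" unfolding e_def by (rule loc_bochner_exp[OF f])
  have cF: "continuous_on {0..} F" unfolding F_def by (rule integral_loc_bochner_continuous[OF f])
  have eF: "loc_bochner_integrable (\<lambda>t. e t *\<^sub>R F t)"
    unfolding e_def by (rule loc_bochner_exp[OF loc_bochner_continuous[OF cF]])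
  have c\<Phi>: "continuous_on {0..} \<Phi>" unfolding \<Phi>_def by (rule integral_loc_bochner_continuous[OF nf])
  have ce: "continuous_on S e" for S unfolding e_def by (intro continuous_intros)
  have F_le: "norm (F y - F x) \<le> \<Phi> y - \<Phi> x" if "0 \<le> x" "x \<le> y" for x y
    unfolding F_def \<Phi>_def using that
    by (subst (1 2) integral_diff_loc_bochner[OF _ that])
      (auto intro!: f nf norm_integral_loc_bochner_le loc_bochner_integrable_on)
  define B where "B = exp (\<bar>c\<bar> * \<tau>)"
  have e_le: "\<bar>e t\<bar> \<le> B" if "t \<in> {0..\<tau>}" for t
  proof -
    have "- (c * t) \<le> \<bar>c\<bar> * t" using that by (simp add: abs_if mult_right_mono)
    also have "\<dots> \<le> \<bar>c\<bar> * \<tau>" using that by (intro mult_left_mono) auto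
    finally show ?thesis by (simp add: e_def B_def)
  qed
  have e_int: "(e has_integral (e x - e y) / c) {x..y}" if "x \<le> y" "c \<noteq> 0" for x y
  proof -
    have "(e has_integral (- e y / c) - (- e x / c)) {x..y}"
      unfolding e_def
      by (rule fundamental_theorem_of_calculus[OF that(1)])
        (auto intro!: derivative_eq_intros simp: that(2) has_real_derivative_iff_has_vector_derivative[symmetric])
    then show ?thesis by (simp add: diff_divide_distrib)
  qed
  have e_int': "c * integral {x..y} e = e x - e y" if "x \<le> y" for x y
  proof (cases "c = 0")
    case True
    then show ?thesis by (simp add: e_def)
  next
    case False
    then show ?thesis using integral_unique[OF e_int[OF that False]] by simp
  qed
  have inte: "e integrable_on {x..y}" for x y by (rule integrable_continuous_real[OF ce])
  have e_lip: "\<bar>e x - e y\<bar> \<le> \<bar>c\<bar> * (B * (y - x))" if "0 \<le> x" "x \<le> y" "y \<le> \<tau>" for x y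
  proof -
    have "norm (integral {x..y} e) \<le> B * (y - x)"
      using that e_le by (intro integral_bound ce) auto
    then show ?thesis
      unfolding e_int'[OF that(2), symmetric] abs_mult by (intro mult_left_mono) auto
  qed
  \<comment> \<open>The increment is rearranged into one integral of (e y - e s) f(s) and one of
    e(s) (F s - F x). In the first the exponential contributes the factor y - x and f the increment
    of \<Phi>; in the second the length contributes y - x and F - F x the increment of
    \<Phi>.\<close>
  have step: "norm (H y - H x) \<le> (2 * \<bar>c\<bar> * B) * \<bar>y - x\<bar> * \<bar>\<Phi> y - \<Phi> x\<bar>"
    if xy: "0 \<le> x" "x \<le> y" "y \<le> \<tau>" for x y
  proof -
    note if1 = loc_bochner_integrable_on[OF f xy(1)] and if2 = loc_bochner_integrable_on[OF ef xy(1)]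
      and if3 = loc_bochner_integrable_on[OF eF xy(1)] and if4 = loc_bochner_integrable_on[OF nf xy(1)]
    have "H y - H x = (e y *\<^sub>R F y - e x *\<^sub>R F x)
       + c *\<^sub>R (integral {0..y} (\<lambda>s. e s *\<^sub>R F s) - integral {0..x} (\<lambda>s. e s *\<^sub>R F s))
       - (integral {0..y} (\<lambda>s. e s *\<^sub>R f s) - integral {0..x} (\<lambda>s. e s *\<^sub>R f s))"
      unfolding H_def by (simp add: algebra_simps)
    also have "\<dots> = (e y *\<^sub>R F y - e x *\<^sub>R F x) + c *\<^sub>R integral {x..y} (\<lambda>s. e s *\<^sub>R F s)
       - integral {x..y} (\<lambda>s. e s *\<^sub>R f s)"
      using integral_diff_loc_bochner[OF ef xy(1,2)] integral_diff_loc_bochner[OF eF xy(1,2)] by simp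
    also have "e y *\<^sub>R F y - e x *\<^sub>R F x = e y *\<^sub>R (F y - F x) - (e x - e y) *\<^sub>R F x"
      by (simp add: algebra_simps)
    also have "F y - F x = integral {x..y} f"
      unfolding F_def by (rule integral_diff_loc_bochner[OF f xy(1,2)])
    also have "(e x - e y) *\<^sub>R F x = c *\<^sub>R integral {x..y} (\<lambda>s. e s *\<^sub>R F x)"
      using integral_linear[OF inte[of x y] bounded_linear_scaleR_left[of "F x"]] e_int'[OF xy(2)]
      by (simp add: o_def)
    also have "e y *\<^sub>R integral {x..y} f = integral {x..y} (\<lambda>s. e y *\<^sub>R f s)" by simp
    also have "integral {x..y} (\<lambda>s. e y *\<^sub>R f s) - c *\<^sub>R integral {x..y} (\<lambda>s. e s *\<^sub>R F x)
        + c *\<^sub>R integral {x..y} (\<lambda>s. e s *\<^sub>R F s) - integral {x..y} (\<lambda>s. e s *\<^sub>R f s)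
      = (integral {x..y} (\<lambda>s. e y *\<^sub>R f s) - integral {x..y} (\<lambda>s. e s *\<^sub>R f s))
       + c *\<^sub>R (integral {x..y} (\<lambda>s. e s *\<^sub>R F s) - integral {x..y} (\<lambda>s. e s *\<^sub>R F x))"
      by (simp add: algebra_simps)
    also have "integral {x..y} (\<lambda>s. e y *\<^sub>R f s) - integral {x..y} (\<lambda>s. e s *\<^sub>R f s) =
        integral {x..y} (\<lambda>s. (e y - e s) *\<^sub>R f s)"
      using if1[of y] if2[of y]
      by (subst Henstock_Kurzweil_Integration.integral_diff[symmetric])
        (auto intro: integrable_cmul simp: scaleR_diff_left)
    also have "integral {x..y} (\<lambda>s. e s *\<^sub>R F s) - integral {x..y} (\<lambda>s. e s *\<^sub>R F x) =
        integral {x..y} (\<lambda>s. e s *\<^sub>R (F s - F x))"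
      using if3[of y] integrable_linear[OF inte[of x y] bounded_linear_scaleR_left[of "F x"]]
      by (subst Henstock_Kurzweil_Integration.integral_diff[symmetric])
        (auto simp: scaleR_diff_right o_def)
    finally have eq: "H y - H x = integral {x..y} (\<lambda>s. (e y - e s) *\<^sub>R f s) +
      c *\<^sub>R integral {x..y} (\<lambda>s. e s *\<^sub>R (F s - F x))" .
    have "norm (integral {x..y} (\<lambda>s. (e y - e s) *\<^sub>R f s)) \<le>
        integral {x..y} (\<lambda>s. (\<bar>c\<bar> * (B * (y - x))) * norm (f s))"
    proof (rule Henstock_Kurzweil_Integration.integral_norm_bound_integral)
      have "(\<lambda>s. e y *\<^sub>R f s - e s *\<^sub>R f s) integrable_on {x..y}"
        by (intro integrable_diff integrable_cmul if1 if2)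
      then show "(\<lambda>s. (e y - e s) *\<^sub>R f s) integrable_on {x..y}" by (simp add: scaleR_diff_left)
      show "(\<lambda>s. (\<bar>c\<bar> * (B * (y - x))) * norm (f s)) integrable_on {x..y}"
        using integrable_cmul[OF if4] by simp
      fix s assume s: "s \<in> {x..y}"
      have "\<bar>e y - e s\<bar> \<le> \<bar>c\<bar> * (B * (y - s))" using e_lip[of s y] s xy by (simp add: abs_minus_commute)
      also have "\<dots> \<le> \<bar>c\<bar> * (B * (y - x))" using s by (intro mult_left_mono) (auto simp: B_def)
      finally show "norm ((e y - e s) *\<^sub>R f s) \<le> (\<bar>c\<bar> * (B * (y - x))) * norm (f s)"
        by (simp add: mult_right_mono)
    qed
    also have "\<dots> = (\<bar>c\<bar> * (B * (y - x))) * (\<Phi> y - \<Phi> x)"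
      unfolding \<Phi>_def integral_diff_loc_bochner[OF nf xy(1,2)] by simp
    finally have 1: "norm (integral {x..y} (\<lambda>s. (e y - e s) *\<^sub>R f s)) \<le>
      (\<bar>c\<bar> * (B * (y - x))) * (\<Phi> y - \<Phi> x)" .
    have \<Phi>_mono: "\<Phi> s \<le> \<Phi> y" "\<Phi> x \<le> \<Phi> s" if "s \<in> {x..y}" for s
      using F_le[of s y] F_le[of x s] that xy norm_ge_zero order_trans by (smt (verit) atLeastAtMost_iff)+
    have 2: "norm (integral {x..y} (\<lambda>s. e s *\<^sub>R (F s - F x))) \<le> (B * (\<Phi> y - \<Phi> x)) * (y - x)"
    proof (rule integral_bound)
      show "continuous_on {x..y} (\<lambda>s. e s *\<^sub>R (F s - F x))"
        using xy by (intro continuous_intros ce continuous_on_subset[OF cF]) auto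
      fix s assume s: "s \<in> {x..y}"
      have "\<bar>e s\<bar> * norm (F s - F x) \<le> B * (\<Phi> y - \<Phi> x)"
        using s xy e_le[of s] F_le[of x s] \<Phi>_mono[of s] by (intro mult_mono) (auto simp: B_def)
      then show "norm (e s *\<^sub>R (F s - F x)) \<le> B * (\<Phi> y - \<Phi> x)" by simp
    qed (use xy in auto)
    have "norm (H y - H x) \<le> norm (integral {x..y} (\<lambda>s. (e y - e s) *\<^sub>R f s)) +
       \<bar>c\<bar> * norm (integral {x..y} (\<lambda>s. e s *\<^sub>R (F s - F x)))"
      unfolding eq by (rule order_trans[OF norm_triangle_ineq]) simp
    also have "\<dots> \<le> (\<bar>c\<bar> * (B * (y - x))) * (\<Phi> y - \<Phi> x) + \<bar>c\<bar> * ((B * (\<Phi> y - \<Phi> x)) * (y - x))"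
      using 1 2 by (intro add_mono mult_left_mono) auto
    also have "\<dots> = (2 * \<bar>c\<bar> * B) * \<bar>y - x\<bar> * \<bar>\<Phi> y - \<Phi> x\<bar>"
      using xy \<Phi>_mono[of y] by (simp add: algebra_simps)
    finally show ?thesis .
  qed
  have "H \<tau> = 0"
  proof (rule has_derivative_zero_unique_strong_interval[of "{}" 0 \<tau> H 0])
    have le: "norm (H y - H x) \<le> (2 * \<bar>c\<bar> * B) * \<bar>y - x\<bar> * \<bar>\<Phi> y - \<Phi> x\<bar>"
      if "x \<in> {0..\<tau>}" "y \<in> {0..\<tau>}" for x y
      using step[of x y] step[of y x] that by (cases "x \<le> y") (auto simp: norm_minus_commute abs_minus_commute)
    show *: "(H has_derivative (\<lambda>h. 0)) (at x within {0..\<tau>})" if "x \<in> {0..\<tau>} - {}" for x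
    proof (rule has_derivative_zeroI[where \<Phi> = \<Phi>])
      show "continuous (at x within {0..\<tau>}) \<Phi>"
        using continuous_on_subset[OF c\<Phi>, of "{0..\<tau>}"] that by (auto simp: continuous_on_eq_continuous_within)
    qed (use le that in auto)
    show "continuous_on {0..\<tau>} H"
      using * by (intro has_derivative_continuous_on) auto
  qed (use \<tau> in \<open>auto simp: H_def F_def\<close>)
  then show ?thesis by (simp add: H_def e_def F_def)
qed

lemma tendsto_at_top_CauchyI:
  fixes I :: "real \<Rightarrow> 'b::banach"
  assumes le: "\<And>s t. 0 \<le> s \<Longrightarrow> s \<le> t \<Longrightarrow> norm (I t - I s) \<le> b s" and b: "(b \<longlongrightarrow> 0) at_top"
  shows "\<exists>y. (I \<longlongrightarrow> y) at_top"
proof -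
  have bs: "(\<lambda>n. b (real n)) \<longlonglongrightarrow> 0"
    using filterlim_compose[OF b filterlim_real_sequentially] .
  have "Cauchy (\<lambda>n. I (real n))"
  proof (rule metric_CauchyI)
    fix e :: real assume e: "e > 0"
    then have "\<forall>\<^sub>F n in sequentially. b (real n) < e / 2" by (intro order_tendstoD(2)[OF bs]) auto
    then obtain N where N: "\<And>n. n \<ge> N \<Longrightarrow> b (real n) < e / 2" by (auto simp: eventually_sequentially)
    show "\<exists>M. \<forall>m\<ge>M. \<forall>n\<ge>M. dist (I (real m)) (I (real n)) < e"
    proof (intro exI[of _ N] allI impI)
      fix m n assume mn: "N \<le> m" "N \<le> n"
      have "dist (I (real m)) (I (real N)) < e / 2" "dist (I (real n)) (I (real N)) < e / 2"
        using le[of "real N" "real m"] le[of "real N" "real n"] N[of N] mn by (auto simp: dist_norm)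
      then show "dist (I (real m)) (I (real n)) < e" by (rule dist_triangle_half_l)
    qed
  qed
  then obtain y where y: "(\<lambda>n. I (real n)) \<longlonglongrightarrow> y" using Cauchy_convergent convergent_def by blast
  have "norm (I s - y) \<le> b s" if s: "0 \<le> s" for s
  proof (rule LIMSEQ_le_const2)
    show "(\<lambda>n. norm (I s - I (real n))) \<longlonglongrightarrow> norm (I s - y)" by (intro tendsto_intros y)
    show "\<exists>N. \<forall>n\<ge>N. norm (I s - I (real n)) \<le> b s"
    proof (intro exI[of _ "nat \<lceil>s\<rceil>"] allI impI)
      fix n assume "nat \<lceil>s\<rceil> \<le> n"
      then have "s \<le> real n" by linarith
      then show "norm (I s - I (real n)) \<le> b s"
        using le[OF s, of "real n"] by (simp add: norm_minus_commute)
    qed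
  qed
  then have "((\<lambda>s. I s - y) \<longlongrightarrow> 0) at_top"
    by (intro Lim_null_comparison[OF _ b] eventually_mono[OF eventually_ge_at_top[of 0]]) auto
  then show ?thesis using LIM_zero_cancel by blast
qed

lemma has_integral_exp_neg:
  assumes "c \<noteq> 0" "s \<le> t"
  shows "((\<lambda>x. exp (- (c * x))) has_integral (exp (- (c * s)) - exp (- (c * t))) / c) {s..t::real}"
proof -
  have "((\<lambda>x. exp (- (c * x))) has_integral (- exp (- (c * t)) / c) - (- exp (- (c * s)) / c)) {s..t}"
    by (rule fundamental_theorem_of_calculus[OF assms(2)])
      (use assms in \<open>auto intro!: derivative_eq_intros simp: has_real_derivative_iff_has_vector_derivative[symmetric]\<close>)
  then show ?thesis by (simp add: diff_divide_distrib)
qed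

lemma exp_neg_tendsto_0: "c > 0 \<Longrightarrow> ((\<lambda>t::real. exp (- (c * t))) \<longlongrightarrow> 0) at_top"
  by real_asymp

lemma laplace_exponential_bound:
  fixes f :: "real \<Rightarrow> 'b::banach"
  assumes f: "loc_bochner_integrable f" and K: "\<And>t. t > 0 \<Longrightarrow> norm (f t) \<le> K * exp (\<omega> * t)"
    and \<mu>: "\<mu> > \<omega>"
  shows "\<exists>y. has_laplace f \<mu> y"
proof -
  have "K * exp (\<omega> * 1) \<ge> 0" using K[of 1] norm_ge_zero[of "f 1"] by linarith
  then have K0: "K \<ge> 0" by (simp add: zero_le_mult_iff)
  have ef: "loc_bochner_integrable (\<lambda>t. exp (- (\<mu> * t)) *\<^sub>R f t)" by (rule loc_bochner_exp[OF f])
  have "\<exists>y. ((\<lambda>\<tau>. integral {0..\<tau>} (\<lambda>t. exp (- (\<mu> * t)) *\<^sub>R f t)) \<longlongrightarrow> y) at_top"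
  proof (rule tendsto_at_top_CauchyI)
    define b where "b s = K / (\<mu> - \<omega>) * exp (- ((\<mu> - \<omega>) * s))" for s
    \<comment> \<open>Growth is assumed for positive times only, so the arbitrary value at 0 is put
      into the majorant at that one point, which does not change its integral.\<close>
    define b' where "b' s = (if s = 0 then norm (f 0) else 0) + K * exp (- ((\<mu> - \<omega>) * s))" for s
    show "norm (integral {0..t} (\<lambda>t. exp (- (\<mu> * t)) *\<^sub>R f t) - integral {0..s} (\<lambda>t. exp (- (\<mu> * t)) *\<^sub>R f t)) \<le> b s"
      if st: "0 \<le> s" "s \<le> t" for s t
    proof -
      have hi: "((\<lambda>x. K * exp (- ((\<mu> - \<omega>) * x))) has_integral
          K * ((exp (- ((\<mu> - \<omega>) * s)) - exp (- ((\<mu> - \<omega>) * t))) / (\<mu> - \<omega>))) {s..t}"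
        using \<mu> st by (intro has_integral_mult_right has_integral_exp_neg) auto
      have hi': "(b' has_integral
          K * ((exp (- ((\<mu> - \<omega>) * s)) - exp (- ((\<mu> - \<omega>) * t))) / (\<mu> - \<omega>))) {s..t}"
        by (rule has_integral_spike_finite[OF _ _ hi, of "{0}"]) (auto simp: b'_def)
      have "norm (integral {s..t} (\<lambda>t. exp (- (\<mu> * t)) *\<^sub>R f t)) \<le> integral {s..t} b'"
      proof (rule norm_integral_loc_bochner_le[OF ef st(1)])
        show "norm (exp (- (\<mu> * x)) *\<^sub>R f x) \<le> b' x" if x: "s \<le> x" "x \<le> t" for x
        proof (cases "x = 0")
          case True
          then show ?thesis using K0 by (simp add: b'_def)
        next
          case False
          then have "exp (- (\<mu> * x)) * norm (f x) \<le> exp (- (\<mu> * x)) * (K * exp (\<omega> * x))"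
            using x st by (intro mult_left_mono K) auto
          also have "\<dots> = K * exp (- ((\<mu> - \<omega>) * x))"
            by (simp add: algebra_simps flip: exp_add)
          finally show ?thesis using False by (simp add: b'_def)
        qed
      qed (use hi' in auto)
      also have "\<dots> = K * ((exp (- ((\<mu> - \<omega>) * s)) - exp (- ((\<mu> - \<omega>) * t))) / (\<mu> - \<omega>))"
        by (rule integral_unique[OF hi'])
      also have "\<dots> \<le> K * (exp (- ((\<mu> - \<omega>) * s)) / (\<mu> - \<omega>))"
        using \<mu> K0 by (intro mult_left_mono divide_right_mono) auto
      finally show ?thesis unfolding integral_diff_loc_bochner[OF ef st] by (simp add: b_def)
    qed
    show "(b \<longlongrightarrow> 0) at_top"
      unfolding b_def using tendsto_mult_left[OF exp_neg_tendsto_0[of "\<mu> - \<omega>"], of "K / (\<mu> - \<omega>)"] \<mu>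
      by simp
  qed
  then show ?thesis using f by (auto simp: has_laplace_iff)
qed

lemma has_laplace_unique: "has_laplace f \<mu> y \<Longrightarrow> has_laplace f \<mu> z \<Longrightarrow> y = z"
  unfolding has_laplace_def using tendsto_unique trivial_limit_at_top_linorder by blast

lemma continuous_convergent_bounded:
  fixes F :: "real \<Rightarrow> 'b::real_normed_vector"
  assumes F: "continuous_on {0..} F" and y: "(F \<longlongrightarrow> y) at_top"
  shows "\<exists>K. \<forall>t\<ge>0. norm (F t) \<le> K"
proof -
  have "\<forall>\<^sub>F t in at_top. dist (F t) y < 1" by (rule tendstoD[OF y]) simp
  then obtain N where N: "\<And>t. t \<ge> N \<Longrightarrow> dist (F t) y < 1" by (auto simp: eventually_at_top_linorder)
  have "compact (F ` {0..N})"
    by (intro compact_continuous_image continuous_on_subset[OF F]) auto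
  then obtain K where K: "\<And>v. v \<in> F ` {0..N} \<Longrightarrow> norm v \<le> K"
    using compact_imp_bounded bounded_iff by metis
  show ?thesis
  proof (intro exI[of _ "max K (norm y + 1)"] allI impI)
    fix t :: real assume t: "t \<ge> 0"
    show "norm (F t) \<le> max K (norm y + 1)"
    proof (cases "t \<le> N")
      case True
      then show ?thesis using K[of "F t"] t by auto
    next
      case False
      then have "norm (F t - y) < 1" using N[of t] by (simp add: dist_norm)
      then show ?thesis using norm_triangle_ineq2[of "F t" y] by linarith
    qed
  qed
qed

lemma has_laplace_bounded_integral:
  assumes "has_laplace f \<mu> y"
  shows "\<exists>K. \<forall>t\<ge>0. norm (integral {0..t} (\<lambda>s. exp (- (\<mu> * s)) *\<^sub>R f s)) \<le> K"
  using assms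
  by (intro continuous_convergent_bounded[of _ y] integral_loc_bochner_continuous loc_bochner_exp)
    (auto simp: has_laplace_iff)

text \<open>Convergence at \<mu>0 may be conditional, but it makes the partial integrals bounded.
  Integration by parts then expresses the transform at \<mu> by the absolutely convergent transform
  of these partial integrals at \<mu> - \<mu>0. The same formula later identifies a term of the
  resolvent equation.\<close>

lemma has_laplace_shift:
  fixes f :: "real \<Rightarrow> 'b::banach"
  assumes f: "has_laplace f \<mu>0 y0" and \<mu>: "\<mu> > \<mu>0"
  shows "\<exists>Y. has_laplace (\<lambda>t. integral {0..t} (\<lambda>s. exp (- (\<mu>0 * s)) *\<^sub>R f s)) (\<mu> - \<mu>0) Y \<and>
    has_laplace f \<mu> ((\<mu> - \<mu>0) *\<^sub>R Y)"
proof -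
  define g where "g t = exp (- (\<mu>0 * t)) *\<^sub>R f t" for t
  define F where "F t = integral {0..t} g" for t
  have lf: "loc_bochner_integrable f" using f by (simp add: has_laplace_def)
  have lg: "loc_bochner_integrable g" unfolding g_def by (rule loc_bochner_exp[OF lf])
  have cF: "continuous_on {0..} F" unfolding F_def by (rule integral_loc_bochner_continuous[OF lg])
  obtain K where K: "\<And>t. t \<ge> 0 \<Longrightarrow> norm (F t) \<le> K"
    using has_laplace_bounded_integral[OF f] unfolding F_def g_def by blast
  obtain Y where Y: "has_laplace F (\<mu> - \<mu>0) Y"
    using laplace_exponential_bound[OF loc_bochner_continuous[OF cF], of K 0 "\<mu> - \<mu>0"] K \<mu> by auto
  have "((\<lambda>\<tau>. exp (- ((\<mu> - \<mu>0) * \<tau>)) *\<^sub>R F \<tau> +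
      (\<mu> - \<mu>0) *\<^sub>R integral {0..\<tau>} (\<lambda>t. exp (- ((\<mu> - \<mu>0) * t)) *\<^sub>R F t)) \<longlongrightarrow> 0 *\<^sub>R y0 + (\<mu> - \<mu>0) *\<^sub>R Y) at_top"
    using Y f \<mu> by (intro tendsto_intros exp_neg_tendsto_0) (auto simp: has_laplace_iff F_def[abs_def] g_def[abs_def])
  moreover have "\<forall>\<^sub>F \<tau> in at_top. exp (- ((\<mu> - \<mu>0) * \<tau>)) *\<^sub>R F \<tau> +
      (\<mu> - \<mu>0) *\<^sub>R integral {0..\<tau>} (\<lambda>t. exp (- ((\<mu> - \<mu>0) * t)) *\<^sub>R F t) =
      integral {0..\<tau>} (\<lambda>t. exp (- (\<mu> * t)) *\<^sub>R f t)"
  proof (rule eventually_mono[OF eventually_ge_at_top[of 0]])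
    fix \<tau> :: real assume "0 \<le> \<tau>"
    from integral_exp_by_parts[OF lg this, of "\<mu> - \<mu>0"]
    show "exp (- ((\<mu> - \<mu>0) * \<tau>)) *\<^sub>R F \<tau> +
      (\<mu> - \<mu>0) *\<^sub>R integral {0..\<tau>} (\<lambda>t. exp (- ((\<mu> - \<mu>0) * t)) *\<^sub>R F t) =
      integral {0..\<tau>} (\<lambda>t. exp (- (\<mu> * t)) *\<^sub>R f t)"
      by (simp add: F_def g_def algebra_simps flip: exp_add)
  qed
  ultimately have "((\<lambda>\<tau>. integral {0..\<tau>} (\<lambda>t. exp (- (\<mu> * t)) *\<^sub>R f t)) \<longlongrightarrow>
      0 *\<^sub>R y0 + (\<mu> - \<mu>0) *\<^sub>R Y) at_top"
    by (rule Lim_transform_eventually)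
  then show ?thesis using Y lf unfolding F_def g_def by (auto simp: has_laplace_iff)
qed

text \<open>For \<mu>0 > 0 the antiderivative grows at most like exp (\<mu>0 t), so for larger \<mu>
  the boundary term of the integration by parts vanishes at infinity and integration amounts to
  division by \<mu>.\<close>

lemma has_laplace_integral:
  fixes f :: "real \<Rightarrow> 'b::banach"
  assumes f: "has_laplace f \<mu>0 y0" and \<mu>0: "\<mu>0 > 0"
  shows "\<exists>K. \<forall>t\<ge>0. norm (integral {0..t} f) \<le> K * exp (\<mu>0 * t)"
    and "\<mu> > \<mu>0 \<Longrightarrow> has_laplace f \<mu> y \<Longrightarrow> has_laplace (\<lambda>t. integral {0..t} f) \<mu> ((1 / \<mu>) *\<^sub>R y)"
proof -
  define g where "g t = exp (- (\<mu>0 * t)) *\<^sub>R f t" for t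
  define G where "G t = integral {0..t} g" for t
  define F where "F t = integral {0..t} f" for t
  have lf: "loc_bochner_integrable f" using f by (simp add: has_laplace_def)
  have lg: "loc_bochner_integrable g" unfolding g_def by (rule loc_bochner_exp[OF lf])
  have cG: "continuous_on {0..} G" unfolding G_def by (rule integral_loc_bochner_continuous[OF lg])
  have cF: "continuous_on {0..} F" unfolding F_def by (rule integral_loc_bochner_continuous[OF lf])
  obtain K where K: "\<And>t. t \<ge> 0 \<Longrightarrow> norm (G t) \<le> K"
    using has_laplace_bounded_integral[OF f] unfolding G_def g_def by blast
  have K0: "K \<ge> 0" using K[of 0] norm_ge_zero[of "G 0"] by linarith
  have bd: "norm (F t) \<le> (2 * K) * exp (\<mu>0 * t)" if t: "t \<ge> 0" for t
  proof -
    have hi: "((\<lambda>x. K * exp (\<mu>0 * x)) has_integral K * ((exp (- (- \<mu>0 * 0)) - exp (- (- \<mu>0 * t))) / - \<mu>0)) {0..t}"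
      using has_integral_mult_right[OF has_integral_exp_neg[of "- \<mu>0" 0 t], of K] \<mu>0 t by simp
    \<comment> \<open>Integration by parts with the rate - \<mu>0 removes the exponential weight and
      recovers \<open>F\<close> from the bounded function \<open>G\<close>.\<close>
    have "F t = exp (\<mu>0 * t) *\<^sub>R G t - \<mu>0 *\<^sub>R integral {0..t} (\<lambda>x. exp (\<mu>0 * x) *\<^sub>R G x)"
      using integral_exp_by_parts[OF lg t, of "- \<mu>0"]
      by (simp add: F_def G_def g_def flip: exp_add)
    then have "norm (F t) \<le> exp (\<mu>0 * t) * norm (G t) +
        \<mu>0 * norm (integral {0..t} (\<lambda>x. exp (\<mu>0 * x) *\<^sub>R G x))"
      using norm_triangle_ineq4[of "exp (\<mu>0 * t) *\<^sub>R G t" "\<mu>0 *\<^sub>R integral {0..t} (\<lambda>x. exp (\<mu>0 * x) *\<^sub>R G x)"] \<mu>0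
      by simp
    also have "norm (integral {0..t} (\<lambda>x. exp (\<mu>0 * x) *\<^sub>R G x)) \<le> integral {0..t} (\<lambda>x. K * exp (\<mu>0 * x))"
    proof (rule Henstock_Kurzweil_Integration.integral_norm_bound_integral)
      show "(\<lambda>x. exp (\<mu>0 * x) *\<^sub>R G x) integrable_on {0..t}"
        by (intro integrable_continuous_real continuous_intros continuous_on_subset[OF cG]) auto
      show "(\<lambda>x. K * exp (\<mu>0 * x)) integrable_on {0..t}" using hi by blast
      show "norm (exp (\<mu>0 * x) *\<^sub>R G x) \<le> K * exp (\<mu>0 * x)" if "x \<in> {0..t}" for x
        using K[of x] that by (simp add: mult.commute mult_right_mono)
    qed
    also have "\<dots> = K * (exp (\<mu>0 * t) - 1) / \<mu>0"
      unfolding integral_unique[OF hi] using \<mu>0 by (simp add: field_simps)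
    also have "exp (\<mu>0 * t) * norm (G t) + \<mu>0 * (K * (exp (\<mu>0 * t) - 1) / \<mu>0) \<le>
        exp (\<mu>0 * t) * K + K * exp (\<mu>0 * t)"
    proof (rule add_mono)
      have "\<mu>0 * (K * (exp (\<mu>0 * t) - 1) / \<mu>0) = K * (exp (\<mu>0 * t) - 1)" using \<mu>0 by simp
      also have "\<dots> \<le> K * exp (\<mu>0 * t)" using K0 by (intro mult_left_mono) auto
      finally show "\<mu>0 * (K * (exp (\<mu>0 * t) - 1) / \<mu>0) \<le> K * exp (\<mu>0 * t)" .
    qed (use K[OF t] in simp)
    finally show ?thesis using \<mu>0 by (simp add: mult_left_mono algebra_simps)
  qed
  then show "\<exists>K. \<forall>t\<ge>0. norm (integral {0..t} f) \<le> K * exp (\<mu>0 * t)" unfolding F_def by blast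
  assume \<mu>: "\<mu> > \<mu>0" and y: "has_laplace f \<mu> y"
  have "((\<lambda>\<tau>. (1 / \<mu>) *\<^sub>R (integral {0..\<tau>} (\<lambda>t. exp (- (\<mu> * t)) *\<^sub>R f t) - exp (- (\<mu> * \<tau>)) *\<^sub>R F \<tau>)) \<longlongrightarrow>
      (1 / \<mu>) *\<^sub>R (y - 0)) at_top"
  proof (intro tendsto_intros)
    show "((\<lambda>\<tau>. integral {0..\<tau>} (\<lambda>t. exp (- (\<mu> * t)) *\<^sub>R f t)) \<longlongrightarrow> y) at_top"
      using y by (simp add: has_laplace_iff)
    show "((\<lambda>\<tau>. exp (- (\<mu> * \<tau>)) *\<^sub>R F \<tau>) \<longlongrightarrow> 0) at_top"
    proof (rule Lim_null_comparison)
      show "((\<lambda>t. (2 * K) * exp (- ((\<mu> - \<mu>0) * t))) \<longlongrightarrow> 0) at_top"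
        using tendsto_mult_left[OF exp_neg_tendsto_0[of "\<mu> - \<mu>0"], of "2 * K"] \<mu> by simp
      show "\<forall>\<^sub>F t in at_top. norm (exp (- (\<mu> * t)) *\<^sub>R F t) \<le> (2 * K) * exp (- ((\<mu> - \<mu>0) * t))"
      proof (rule eventually_mono[OF eventually_ge_at_top[of 0]])
        fix t :: real assume "0 \<le> t"
        then have "exp (- (\<mu> * t)) * norm (F t) \<le> exp (- (\<mu> * t)) * ((2 * K) * exp (\<mu>0 * t))"
          by (intro mult_left_mono bd) auto
        also have "\<dots> = (2 * K) * exp (- ((\<mu> - \<mu>0) * t))"
          by (simp add: algebra_simps flip: exp_add)
        finally show "norm (exp (- (\<mu> * t)) *\<^sub>R F t) \<le> (2 * K) * exp (- ((\<mu> - \<mu>0) * t))" by simp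
      qed
    qed
  qed
  moreover have "\<forall>\<^sub>F \<tau> in at_top. (1 / \<mu>) *\<^sub>R (integral {0..\<tau>} (\<lambda>t. exp (- (\<mu> * t)) *\<^sub>R f t) - exp (- (\<mu> * \<tau>)) *\<^sub>R F \<tau>) =
     integral {0..\<tau>} (\<lambda>t. exp (- (\<mu> * t)) *\<^sub>R F t)"
    by (rule eventually_mono[OF eventually_ge_at_top[of 0]])
      (use integral_exp_by_parts[OF lf, of _ \<mu>] \<mu> \<mu>0 in \<open>simp add: F_def\<close>)
  ultimately have "((\<lambda>\<tau>. integral {0..\<tau>} (\<lambda>t. exp (- (\<mu> * t)) *\<^sub>R F t)) \<longlongrightarrow> (1 / \<mu>) *\<^sub>R (y - 0)) at_top"
    by (rule Lim_transform_eventually)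
  then show "has_laplace (\<lambda>t. integral {0..t} f) \<mu> ((1 / \<mu>) *\<^sub>R y)"
    using loc_bochner_continuous[OF cF] by (simp add: has_laplace_iff F_def[abs_def])
qed

section \<open>The resolvent of a semigroup having a Laplace transform\<close>

text \<open>The Baire category argument behind the uniform boundedness principle: the closed
  sublevel sets cover the space, so one of them contains a ball. It is applied to a seminorm given
  by an integral and to one given by a supremum.\<close>

lemma closed_sublevel_seminorm_bounded:
  fixes p :: "'a::banach \<Rightarrow> real"
  assumes add: "\<And>x y. p (x + y) \<le> p x + p y" and scale: "\<And>c x. p (c *\<^sub>R x) = \<bar>c\<bar> * p x"
    and closed: "\<And>c. closed {x. p x \<le> c}"
  shows "\<exists>C. \<forall>x. p x \<le> C * norm x"
proof -
  have "\<exists>n::nat. interior {x. p x \<le> real n} \<noteq> {}"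
  proof (rule ccontr)
    assume none: "\<not> ?thesis"
    have "Met_TC.mtopology interior_of \<Union>(range (\<lambda>n::nat. {x. p x \<le> real n})) = {}"
      by (rule Met_TC.metric_Baire_category_alt) (use none closed in \<open>auto simp: complete_UNIV\<close>)
    moreover have "\<Union>(range (\<lambda>n::nat. {x. p x \<le> real n})) = UNIV"
      using real_arch_simple by auto
    ultimately show False by simp
  qed
  then obtain n x0 where "x0 \<in> interior {x. p x \<le> real (n::nat)}" by blast
  then obtain r where r: "r > 0" "ball x0 r \<subseteq> {x. p x \<le> real n}" by (auto simp: mem_interior)
  have p0: "p 0 = 0" using scale[of 0 0] by simp
  have neg: "p (- x) = p x" for x using scale[of "-1" x] by simp
  \<comment> \<open>Subadditivity and symmetry move the ball from \<open>x0\<close> to the origin at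
    the cost of a factor 2.\<close>
  have small: "p y \<le> 2 * real n" if "norm y < r" for y
  proof -
    have "p y \<le> p (x0 + y) + p (- x0)" using add[of "x0 + y" "- x0"] by simp
    have "x0 + y \<in> ball x0 r" "x0 \<in> ball x0 r" using that r(1) by (auto simp: dist_norm)
    then have "p (x0 + y) \<le> real n" "p x0 \<le> real n" using subsetD[OF r(2)] by blast+
    with \<open>p y \<le> p (x0 + y) + p (- x0)\<close> show ?thesis using neg[of x0] by linarith
  qed
  have "p x \<le> (4 * real n / r) * norm x" for x
  proof (cases "x = 0")
    case False
    define c where "c = r / (2 * norm x)"
    have c: "c > 0" using r(1) False by (simp add: c_def)
    have "norm (c *\<^sub>R x) < r" using r(1) False by (simp add: c_def)
    from small[OF this] have "c * p x \<le> 2 * real n" using c by (simp add: scale)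
    then have "p x \<le> 2 * real n / c" using c by (simp add: field_simps)
    also have "\<dots> = (4 * real n / r) * norm x" by (simp add: c_def)
    finally show ?thesis .
  qed (simp add: p0)
  then show ?thesis by blast
qed

text \<open>Strong integrability gives no integrable bound for the operator norms. Instead x
  \<mapsto> integral of norm (T t x) is a finite seminorm, and Fatou's lemma makes its sublevel sets
  closed.\<close>

lemma blinfun_norm_integral_bounded:
  fixes T :: "real \<Rightarrow> 'a::banach \<Rightarrow>\<^sub>L 'b::banach"
  assumes T: "\<And>x. loc_bochner_integrable (\<lambda>t. blinfun_apply (T t) x)" and \<tau>: "\<tau> > 0"
  shows "\<exists>C. \<forall>x. integral {0..\<tau>} (\<lambda>t. norm (blinfun_apply (T t) x)) \<le> C * norm x"
proof (rule closed_sublevel_seminorm_bounded)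
  let ?p = "\<lambda>x. integral {0..\<tau>} (\<lambda>t. norm (blinfun_apply (T t) x))"
  have int: "(\<lambda>t. norm (blinfun_apply (T t) x)) integrable_on {0..\<tau>}" for x
    by (rule loc_bochner_integrable_on[OF loc_bochner_norm[OF T]]) simp
  show "?p (x + y) \<le> ?p x + ?p y" for x y
  proof -
    have "?p (x + y) \<le> integral {0..\<tau>} (\<lambda>t. norm (blinfun_apply (T t) x) + norm (blinfun_apply (T t) y))"
      by (intro integral_le int integrable_add) (simp add: blinfun.add_right norm_triangle_ineq)
    then show ?thesis by (simp add: Henstock_Kurzweil_Integration.integral_add int)
  qed
  show "?p (c *\<^sub>R x) = \<bar>c\<bar> * ?p x" for c x
    by (simp add: blinfun.scaleR_right)
  have lint: "integrable (lebesgue_on {0<..\<tau>}) (\<lambda>t. norm (blinfun_apply (T t) x))" for x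
    using T[of x] \<tau> has_bochner_int_norm_integrable unfolding loc_bochner_integrable_def by blast
  have peq: "?p x = integral\<^sup>L (lebesgue_on {0<..\<tau>}) (\<lambda>t. norm (blinfun_apply (T t) x))" for x
    by (rule integral_unique[OF integrable_lebesgue_on_Ioc_has_integral[OF lint]])
  have nn: "(\<integral>\<^sup>+t. ennreal (norm (blinfun_apply (T t) x)) \<partial>lebesgue_on {0<..\<tau>}) = ennreal (?p x)" for x
    unfolding peq by (rule nn_integral_eq_integral[OF lint]) simp
  show "closed {x. ?p x \<le> c}" for c
    unfolding closed_sequential_limits
  proof (intro allI impI)
    fix X x assume "(\<forall>n. X n \<in> {x. ?p x \<le> c}) \<and> X \<longlonglongrightarrow> x"
    then have X: "\<forall>n. X n \<in> {x. ?p x \<le> c}" "X \<longlonglongrightarrow> x" by auto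
    have "(\<lambda>n. ennreal (norm (blinfun_apply (T t) (X n)))) \<longlonglongrightarrow> ennreal (norm (blinfun_apply (T t) x))" for t
      by (intro tendsto_ennrealI tendsto_norm blinfun.tendsto tendsto_const X(2))
    then have "liminf (\<lambda>n. ennreal (norm (blinfun_apply (T t) (X n)))) = ennreal (norm (blinfun_apply (T t) x))" for t
      by (intro lim_imp_Liminf) auto
    then have "ennreal (?p x) = (\<integral>\<^sup>+t. liminf (\<lambda>n. ennreal (norm (blinfun_apply (T t) (X n)))) \<partial>lebesgue_on {0<..\<tau>})"
      by (simp add: nn)
    also have "\<dots> \<le> liminf (\<lambda>n. \<integral>\<^sup>+t. ennreal (norm (blinfun_apply (T t) (X n))) \<partial>lebesgue_on {0<..\<tau>})"
      by (rule nn_integral_liminf) (use lint in \<open>auto dest: borel_measurable_integrable\<close>)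
    also have "\<dots> \<le> liminf (\<lambda>n. ennreal c)"
      unfolding nn using X(1) by (intro Liminf_mono always_eventually) (auto intro: ennreal_leI)
    also have "\<dots> = ennreal c" by (simp add: Liminf_const)
    finally have le: "ennreal (?p x) \<le> ennreal c" .
    have "0 \<le> ?p (X 0)" by (rule integral_nonneg[OF int]) simp
    then have "c \<ge> 0" using X(1) by (auto intro: order_trans)
    then show "x \<in> {x. ?p x \<le> c}" using le by simp
  qed
qed

text \<open>Baire is used twice. Each truncated transform is bounded by the integral seminorm of the
  preceding lemma; their supremum over the truncation is then a seminorm, finite because the
  integrals converge, whose sublevel sets are intersections of closed sets.\<close>

lemma laplace_bounded:
  fixes T :: "real \<Rightarrow> 'a::banach \<Rightarrow>\<^sub>L 'b::banach"
  assumes R: "\<And>x. has_laplace (\<lambda>t. blinfun_apply (T t) x) \<mu> (R x)"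
  shows "\<exists>C. \<forall>x. norm (R x) \<le> C * norm x"
proof -
  define F where "F \<tau> x = integral {0..\<tau>} (\<lambda>t. exp (- (\<mu> * t)) *\<^sub>R blinfun_apply (T t) x)" for \<tau> x
  have T: "loc_bochner_integrable (\<lambda>t. blinfun_apply (T t) x)" for x
    using R by (simp add: has_laplace_def)
  have int: "(\<lambda>t. exp (- (\<mu> * t)) *\<^sub>R blinfun_apply (T t) x) integrable_on {0..\<tau>}" for x \<tau>
    by (rule loc_bochner_integrable_on[OF loc_bochner_exp[OF T]]) simp
  have Fadd: "F \<tau> (x + y) = F \<tau> x + F \<tau> y" for \<tau> x y
    unfolding F_def by (simp add: blinfun.add_right scaleR_add_right Henstock_Kurzweil_Integration.integral_add int)
  have Fscale: "F \<tau> (c *\<^sub>R x) = c *\<^sub>R F \<tau> x" for \<tau> c x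
    unfolding F_def
    by (simp add: blinfun.scaleR_right scaleR_left_commute[of _ c] del: scaleR_scaleR)
  have Fbd: "\<exists>C. \<forall>x. norm (F \<tau> x) \<le> C * norm x" if \<tau>: "\<tau> > 0" for \<tau>
  proof -
    obtain C where C: "\<And>x. integral {0..\<tau>} (\<lambda>t. norm (blinfun_apply (T t) x)) \<le> C * norm x"
      using blinfun_norm_integral_bounded[of T, OF T \<tau>] by blast
    have "norm (F \<tau> x) \<le> (exp (\<bar>\<mu>\<bar> * \<tau>) * C) * norm x" for x
    proof -
      have nint: "(\<lambda>t. norm (blinfun_apply (T t) x)) integrable_on {0..\<tau>}"
        by (rule loc_bochner_integrable_on[OF loc_bochner_norm[OF T]]) simp
      have "norm (F \<tau> x) \<le> integral {0..\<tau>} (\<lambda>t. exp (\<bar>\<mu>\<bar> * \<tau>) * norm (blinfun_apply (T t) x))"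
        unfolding F_def
      proof (rule Henstock_Kurzweil_Integration.integral_norm_bound_integral[OF int])
        show "(\<lambda>t. exp (\<bar>\<mu>\<bar> * \<tau>) * norm (blinfun_apply (T t) x)) integrable_on {0..\<tau>}"
          using integrable_cmul[OF nint] by simp
        fix t assume t: "t \<in> {0..\<tau>}"
        have "- (\<mu> * t) \<le> \<bar>\<mu>\<bar> * t" using t by (simp add: abs_if mult_right_mono)
        also have "\<dots> \<le> \<bar>\<mu>\<bar> * \<tau>" using t by (intro mult_left_mono) auto
        finally show "norm (exp (- (\<mu> * t)) *\<^sub>R blinfun_apply (T t) x) \<le> exp (\<bar>\<mu>\<bar> * \<tau>) * norm (blinfun_apply (T t) x)"
          by (simp add: mult_right_mono)
      qed
      also have "\<dots> \<le> exp (\<bar>\<mu>\<bar> * \<tau>) * (C * norm x)" using C[of x] by simp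
      finally show ?thesis by simp
    qed
    then show ?thesis by blast
  qed
  have Fblin: "bounded_linear (F \<tau>)" if "\<tau> > 0" for \<tau>
    using Fbd[OF that] Fadd Fscale by (metis bounded_linear_intro mult.commute)
  have lim: "((\<lambda>\<tau>. F \<tau> x) \<longlongrightarrow> R x) at_top" for x
    using R[of x] by (simp add: has_laplace_iff F_def)
  have bdd: "bdd_above ((\<lambda>\<tau>. norm (F \<tau> x)) ` {0<..})" for x
  proof -
    obtain K where "\<And>\<tau>. \<tau> \<ge> 0 \<Longrightarrow> norm (F \<tau> x) \<le> K"
      using has_laplace_bounded_integral[OF R[of x]] unfolding F_def by blast
    then show ?thesis by (auto simp: bdd_above_def intro!: exI[of _ K])
  qed
  have le: "norm (F \<tau> x) \<le> (SUP \<tau>\<in>{0<..}. norm (F \<tau> x))" if "\<tau> > 0" for \<tau> x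
    using that by (intro cSUP_upper bdd) auto
  have "\<exists>C. \<forall>x. (SUP \<tau>\<in>{0<..}. norm (F \<tau> x)) \<le> C * norm x"
  proof (rule closed_sublevel_seminorm_bounded)
    have ne: "{0::real<..} \<noteq> {}" using greaterThan_non_empty by blast
    show "(SUP \<tau>\<in>{0<..}. norm (F \<tau> (x + y))) \<le> (SUP \<tau>\<in>{0<..}. norm (F \<tau> x)) + (SUP \<tau>\<in>{0<..}. norm (F \<tau> y))" for x y
    proof (rule cSUP_least[OF ne])
      fix \<tau> :: real assume "\<tau> \<in> {0<..}"
      then show "norm (F \<tau> (x + y)) \<le> (SUP \<tau>\<in>{0<..}. norm (F \<tau> x)) + (SUP \<tau>\<in>{0<..}. norm (F \<tau> y))"
        using le[of \<tau> x] le[of \<tau> y] norm_triangle_ineq[of "F \<tau> x" "F \<tau> y"] by (simp add: Fadd)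
    qed
    have closed1: "closed {x. norm (F \<tau> x) \<le> c}" if "\<tau> > 0" for \<tau> c
      using linear_continuous_on[OF Fblin[OF that], of UNIV]
      by (intro closed_Collect_le continuous_on_norm continuous_on_const)
    show "closed {x. (SUP \<tau>\<in>{0<..}. norm (F \<tau> x)) \<le> c}" for c
    proof -
      have "{x. (SUP \<tau>\<in>{0<..}. norm (F \<tau> x)) \<le> c} = (\<Inter>\<tau>\<in>{0<..}. {x. norm (F \<tau> x) \<le> c})"
        using le by (auto intro: order_trans intro!: cSUP_least[OF ne])
      then show ?thesis using closed1 by auto
    qed
    \<comment> \<open>One inequality suffices for homogeneity: applied to 1/c and the vector c x it
      yields the reverse one.\<close>
    have half: "(SUP \<tau>\<in>{0<..}. norm (F \<tau> (c *\<^sub>R x))) \<le> \<bar>c\<bar> * (SUP \<tau>\<in>{0<..}. norm (F \<tau> x))" for c x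
      using le by (intro cSUP_least[OF ne]) (simp add: Fscale mult_left_mono)
    show "(SUP \<tau>\<in>{0<..}. norm (F \<tau> (c *\<^sub>R x))) = \<bar>c\<bar> * (SUP \<tau>\<in>{0<..}. norm (F \<tau> x))" for c x
    proof (cases "c = 0")
      case True
      then show ?thesis using Fscale[of _ 0 0] ne by simp
    next
      case False
      from half[of "1/c" "c *\<^sub>R x"] False
      have "(SUP \<tau>\<in>{0<..}. norm (F \<tau> x)) \<le> (SUP \<tau>\<in>{0<..}. norm (F \<tau> (c *\<^sub>R x))) / \<bar>c\<bar>" by simp
      then have "\<bar>c\<bar> * (SUP \<tau>\<in>{0<..}. norm (F \<tau> x)) \<le> (SUP \<tau>\<in>{0<..}. norm (F \<tau> (c *\<^sub>R x)))"
        using False by (simp add: field_simps)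
      with half[of c x] show ?thesis by simp
    qed
  qed
  then obtain C where C: "\<And>x. (SUP \<tau>\<in>{0<..}. norm (F \<tau> x)) \<le> C * norm x" by blast
  have "norm (R x) \<le> C * norm x" for x
  proof (rule tendsto_upperbound[OF tendsto_norm[OF lim]])
    show "\<forall>\<^sub>F \<tau> in at_top. norm (F \<tau> x) \<le> C * norm x"
      by (rule eventually_mono[OF eventually_gt_at_top[of 0]]) (use le C in \<open>blast intro: order_trans\<close>)
  qed simp
  then show ?thesis by blast
qed

lemma laplace_op_exists:
  fixes T :: "real \<Rightarrow> 'a::complex_banach \<Rightarrow>\<^sub>L 'a"
  assumes cb: "\<And>t. t > 0 \<Longrightarrow> T t \<in> cblin_ops"
    and \<mu>: "\<And>x. \<exists>y. has_laplace (\<lambda>t. blinfun_apply (T t) x) \<mu> y"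
  shows "\<exists>L. op_has_laplace T \<mu> L"
proof -
  obtain R where R: "\<And>x. has_laplace (\<lambda>t. blinfun_apply (T t) x) \<mu> (R x)" using \<mu> by metis
  define F where "F \<tau> x = integral {0..\<tau>} (\<lambda>t. exp (- (\<mu> * t)) *\<^sub>R blinfun_apply (T t) x)" for \<tau> x
  have T: "loc_bochner_integrable (\<lambda>t. blinfun_apply (T t) x)" for x
    using R by (simp add: has_laplace_def)
  have int: "(\<lambda>t. exp (- (\<mu> * t)) *\<^sub>R blinfun_apply (T t) x) integrable_on {0..\<tau>}" for x \<tau>
    by (rule loc_bochner_integrable_on[OF loc_bochner_exp[OF T]]) simp
  have lim: "((\<lambda>\<tau>. F \<tau> x) \<longlongrightarrow> R x) at_top" for x
    using R[of x] by (simp add: has_laplace_iff F_def)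
  have Fadd: "F \<tau> (x + y) = F \<tau> x + F \<tau> y" for \<tau> x y
    unfolding F_def by (simp add: blinfun.add_right scaleR_add_right Henstock_Kurzweil_Integration.integral_add int)
  have FC: "F \<tau> (c *\<^sub>C x) = c *\<^sub>C F \<tau> x" for \<tau> c x
  proof -
    have "F \<tau> (c *\<^sub>C x) = integral {0..\<tau>} (\<lambda>t. c *\<^sub>C (exp (- (\<mu> * t)) *\<^sub>R blinfun_apply (T t) x))"
      unfolding F_def
    \<comment> \<open>Operators at positive times commute with complex scalars; \<open>T 0\<close>
      is unconstrained, so the point 0 is excluded.\<close>
    proof (rule integral_spike[of "{0}"])
      show "c *\<^sub>C exp (- (\<mu> * t)) *\<^sub>R blinfun_apply (T t) x = exp (- (\<mu> * t)) *\<^sub>R blinfun_apply (T t) (c *\<^sub>C x)"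
        if "t \<in> {0..\<tau>} - {0}" for t
        using cb[of t] that by (auto simp: cblin_ops_def scaleC_scaleR)
    qed simp
    then show ?thesis unfolding F_def by (simp add: integral_scaleC int)
  qed
  have Radd: "R (x + y) = R x + R y" for x y
    using tendsto_unique[OF _ lim[of "x + y"]] tendsto_add[OF lim[of x] lim[of y]] by (simp add: Fadd)
  have RC: "R (c *\<^sub>C x) = c *\<^sub>C R x" for c x
    using tendsto_unique[OF _ lim[of "c *\<^sub>C x"]] tendsto_scaleC[OF tendsto_const lim[of x]] by (simp add: FC)
  obtain C where C: "\<And>x. norm (R x) \<le> C * norm x" using laplace_bounded[OF R] by blast
  have "bounded_linear R"
  proof (rule bounded_linear_intro[where K = C])
    show "R (r *\<^sub>R x) = r *\<^sub>R R x" for r x using RC[of "of_real r" x] by (simp add: scaleC_of_real)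
  qed (use Radd C in \<open>auto simp: mult.commute\<close>)
  then have "blinfun_apply (Blinfun R) = R" by (rule bounded_linear_Blinfun_apply)
  then have "op_has_laplace T \<mu> (Blinfun R)"
    unfolding op_has_laplace_def cblin_ops_def using R RC by simp
  then show ?thesis by blast
qed

lemma laplace_abscissa_less:
  assumes "laplace_abscissa T < ereal \<mu>"
  obtains \<mu>0 where "\<mu>0 < \<mu>" "\<mu>0 \<in> laplace_convergence_set T"
  using assms unfolding laplace_abscissa_def by (auto simp: INF_less_iff)

lemma laplace_beyond_abscissa:
  fixes T :: "real \<Rightarrow> 'a::complex_banach \<Rightarrow>\<^sub>L 'a"
  assumes "laplace_abscissa T < ereal \<mu>"
  shows "\<exists>y. has_laplace (\<lambda>t. blinfun_apply (T t) x) \<mu> y"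
proof -
  obtain \<mu>0 where \<mu>0: "\<mu>0 < \<mu>" "\<mu>0 \<in> laplace_convergence_set T"
    using laplace_abscissa_less[OF assms] by blast
  then obtain y where "has_laplace (\<lambda>t. blinfun_apply (T t) x) \<mu>0 y"
    unfolding laplace_convergence_set_def by blast
  from has_laplace_shift[OF this \<mu>0(1)] show ?thesis by blast
qed

text \<open>\<open>T t (R \<nu> x)\<close> is \<open>exp (\<nu> t)\<close> times the tail of the Laplace integral of \<open>x\<close>, so the resolvent
  equation only needs an integration by parts instead of a double integral.\<close>

lemma semigroup_laplace_tail:
  fixes T :: "real \<Rightarrow> 'a::complex_banach \<Rightarrow>\<^sub>L 'a"
  assumes sg: "op_semigroup T" and y: "has_laplace (\<lambda>t. blinfun_apply (T t) x) \<mu> y" and t: "t > 0"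
  shows "blinfun_apply (T t) y =
    exp (\<mu> * t) *\<^sub>R (y - integral {0..t} (\<lambda>s. exp (- (\<mu> * s)) *\<^sub>R blinfun_apply (T s) x))"
proof -
  define g where "g s = exp (- (\<mu> * s)) *\<^sub>R blinfun_apply (T s) x" for s
  define F where "F \<tau> = integral {0..\<tau>} g" for \<tau>
  have lg: "loc_bochner_integrable g"
    unfolding g_def using y by (intro loc_bochner_exp) (simp add: has_laplace_def)
  have lim: "(F \<longlongrightarrow> y) at_top" using y by (simp add: has_laplace_iff F_def[abs_def] g_def[abs_def])
  have "blinfun_apply (T t) (F \<tau>) = exp (\<mu> * t) *\<^sub>R (F (\<tau> + t) - F t)" if \<tau>: "\<tau> \<ge> 0" for \<tau>
  proof -
    have "blinfun_apply (T t) (F \<tau>) = integral {0..\<tau>} (\<lambda>s. blinfun_apply (T t) (g s))"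
      unfolding F_def
      using integral_linear[OF loc_bochner_integrable_on[OF lg order_refl, of \<tau>] blinfun.bounded_linear_right[of "T t"]]
      by (simp add: o_def)
    also have "\<dots> = integral {0..\<tau>} (\<lambda>s. exp (\<mu> * t) *\<^sub>R (g \<circ> (+) t) s)"
    proof (rule integral_spike[of "{0}"])
      fix s assume "s \<in> {0..\<tau>} - {0}"
      then have "T (t + s) = T t o\<^sub>L T s" using sg t by (auto simp: op_semigroup_def)
      then show "exp (\<mu> * t) *\<^sub>R (g \<circ> (+) t) s = blinfun_apply (T t) (g s)"
        by (simp add: g_def blinfun.scaleR_right algebra_simps flip: exp_add)
    qed simp
    also have "\<dots> = exp (\<mu> * t) *\<^sub>R integral {t..\<tau> + t} g"
      using integral_shift_Icc_real[of 0 \<tau> g t] by (simp add: o_def)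
    also have "integral {t..\<tau> + t} g = F (\<tau> + t) - F t"
      unfolding F_def using t \<tau> by (intro integral_diff_loc_bochner[symmetric] lg) auto
    finally show ?thesis .
  qed
  then have ev: "\<forall>\<^sub>F \<tau> in at_top. exp (\<mu> * t) *\<^sub>R (F (\<tau> + t) - F t) = blinfun_apply (T t) (F \<tau>)"
    by (intro eventually_mono[OF eventually_ge_at_top[of 0]]) simp
  have "((\<lambda>\<tau>. exp (\<mu> * t) *\<^sub>R (F (\<tau> + t) - F t)) \<longlongrightarrow> exp (\<mu> * t) *\<^sub>R (y - F t)) at_top"
    by (intro tendsto_intros filterlim_compose[OF lim]) real_asymp
  from Lim_transform_eventually[OF this ev]
  have "((\<lambda>\<tau>. blinfun_apply (T t) (F \<tau>)) \<longlongrightarrow> exp (\<mu> * t) *\<^sub>R (y - F t)) at_top" .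
  moreover have "((\<lambda>\<tau>. blinfun_apply (T t) (F \<tau>)) \<longlongrightarrow> blinfun_apply (T t) y) at_top"
    by (intro blinfun.tendsto tendsto_const lim)
  ultimately show ?thesis
    unfolding F_def g_def using tendsto_unique trivial_limit_at_top_linorder by blast
qed

text \<open>By the tail formula T(t)y = exp (\<nu> t) (y - F t). The transform at \<mu> therefore
  becomes the integral of exp (-(\<mu> - \<nu>) t) (y - F t), that is y / (\<mu> - \<nu>) minus the
  transform of \<open>F\<close> at \<mu> - \<nu>, and the latter is z / (\<mu> - \<nu>) by the shift
  formula.\<close>

lemma semigroup_laplace_resolvent_eq:
  fixes T :: "real \<Rightarrow> 'a::complex_banach \<Rightarrow>\<^sub>L 'a"
  assumes sg: "op_semigroup T" and y: "has_laplace (\<lambda>t. blinfun_apply (T t) x) \<nu> y" and \<mu>: "\<mu> > \<nu>"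
    and z: "has_laplace (\<lambda>t. blinfun_apply (T t) x) \<mu> z"
    and w: "has_laplace (\<lambda>t. blinfun_apply (T t) y) \<mu> w"
  shows "(\<mu> - \<nu>) *\<^sub>R w = y - z"
proof -
  define F where "F \<tau> = integral {0..\<tau>} (\<lambda>s. exp (- (\<nu> * s)) *\<^sub>R blinfun_apply (T s) x)" for \<tau>
  let ?c = "\<mu> - \<nu>"
  have lg: "loc_bochner_integrable (\<lambda>s. exp (- (\<nu> * s)) *\<^sub>R blinfun_apply (T s) x)"
    using y by (intro loc_bochner_exp) (simp add: has_laplace_def)
  have cF: "continuous_on {0..} F" unfolding F_def by (rule integral_loc_bochner_continuous[OF lg])
  obtain Y where Y: "has_laplace F ?c Y" "z = ?c *\<^sub>R Y"
    using has_laplace_shift[OF y \<mu>] has_laplace_unique[OF z] unfolding F_def by blast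
  have eq: "integral {0..\<tau>} (\<lambda>t. exp (- (\<mu> * t)) *\<^sub>R blinfun_apply (T t) y) =
      ((1 - exp (- (?c * \<tau>))) / ?c) *\<^sub>R y - integral {0..\<tau>} (\<lambda>t. exp (- (?c * t)) *\<^sub>R F t)" if "\<tau> \<ge> 0" for \<tau>
  proof -
    have "integral {0..\<tau>} (\<lambda>t. exp (- (\<mu> * t)) *\<^sub>R blinfun_apply (T t) y) =
        integral {0..\<tau>} (\<lambda>t. exp (- (?c * t)) *\<^sub>R y - exp (- (?c * t)) *\<^sub>R F t)"
    proof (rule integral_spike[of "{0}"])
      fix t assume "t \<in> {0..\<tau>} - {0}"
      then have "exp (- (\<mu> * t)) *\<^sub>R blinfun_apply (T t) y = (exp (- (\<mu> * t)) * exp (\<nu> * t)) *\<^sub>R (y - F t)"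
        using semigroup_laplace_tail[OF sg y, of t, folded F_def] by simp
      also have "exp (- (\<mu> * t)) * exp (\<nu> * t) = exp (- (?c * t))"
        by (simp add: algebra_simps flip: exp_add)
      finally show "exp (- (?c * t)) *\<^sub>R y - exp (- (?c * t)) *\<^sub>R F t = exp (- (\<mu> * t)) *\<^sub>R blinfun_apply (T t) y"
        by (simp add: scaleR_diff_right)
    qed simp
    also have "\<dots> = integral {0..\<tau>} (\<lambda>t. exp (- (?c * t)) *\<^sub>R y) - integral {0..\<tau>} (\<lambda>t. exp (- (?c * t)) *\<^sub>R F t)"
      by (intro Henstock_Kurzweil_Integration.integral_diff integrable_continuous_real continuous_intros
          continuous_on_subset[OF cF]) auto
    also have "integral {0..\<tau>} (\<lambda>t. exp (- (?c * t)) *\<^sub>R y) = ((1 - exp (- (?c * \<tau>))) / ?c) *\<^sub>R y"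
      using has_integral_scaleR_left[OF has_integral_exp_neg[of ?c 0 \<tau>], of y] that \<mu>
      by (simp add: integral_unique)
    finally show ?thesis .
  qed
  have "((\<lambda>\<tau>. ((1 - exp (- (?c * \<tau>))) / ?c) *\<^sub>R y - integral {0..\<tau>} (\<lambda>t. exp (- (?c * t)) *\<^sub>R F t)) \<longlongrightarrow>
      ((1 - 0) / ?c) *\<^sub>R y - Y) at_top"
    using Y(1) \<mu> by (intro tendsto_intros exp_neg_tendsto_0) (auto simp: has_laplace_iff)
  then have "((\<lambda>\<tau>. integral {0..\<tau>} (\<lambda>t. exp (- (\<mu> * t)) *\<^sub>R blinfun_apply (T t) y)) \<longlongrightarrow>
      ((1 - 0) / ?c) *\<^sub>R y - Y) at_top"
    by (rule Lim_transform_eventually)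
      (rule eventually_mono[OF eventually_ge_at_top[of 0]], simp only: eq)
  moreover have "((\<lambda>\<tau>. integral {0..\<tau>} (\<lambda>t. exp (- (\<mu> * t)) *\<^sub>R blinfun_apply (T t) y)) \<longlongrightarrow> w) at_top"
    using w by (simp add: has_laplace_iff)
  ultimately have "w = ((1 - 0) / ?c) *\<^sub>R y - Y"
    using tendsto_unique trivial_limit_at_top_linorder by blast
  then show ?thesis using \<mu> Y(2) by (simp add: scaleR_diff_right)
qed

text \<open>T(t) and T(s) commute because both products are T(t + s). This passes to the Laplace
  integrals, first for one factor and then for the other. It supplies the resolvent equation when
  the two points are in the opposite order.\<close>

lemma semigroup_laplace_commute:
  fixes T :: "real \<Rightarrow> 'a::complex_banach \<Rightarrow>\<^sub>L 'a"
  assumes sg: "op_semigroup T" and R: "op_has_laplace T \<nu> R" and Q: "op_has_laplace T \<mu> Q"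
  shows "blinfun_apply R (blinfun_apply Q x) = blinfun_apply Q (blinfun_apply R x)"
proof -
  have l: "loc_bochner_integrable (\<lambda>s. blinfun_apply (T s) x)" for x
    using R by (auto simp: op_has_laplace_def has_laplace_def)
  have int: "(\<lambda>s. exp (- (\<mu> * s)) *\<^sub>R blinfun_apply (T s) x) integrable_on {0..\<tau>}" for x \<tau> \<mu>
    by (rule loc_bochner_integrable_on[OF loc_bochner_exp[OF l]]) simp
  have lR: "((\<lambda>\<tau>. integral {0..\<tau>} (\<lambda>s. exp (- (\<nu> * s)) *\<^sub>R blinfun_apply (T s) x)) \<longlongrightarrow> blinfun_apply R x) at_top" for x
    using R by (auto simp: op_has_laplace_def has_laplace_iff)
  have lQ: "((\<lambda>\<tau>. integral {0..\<tau>} (\<lambda>s. exp (- (\<mu> * s)) *\<^sub>R blinfun_apply (T s) x)) \<longlongrightarrow> blinfun_apply Q x) at_top" for x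
    using Q by (auto simp: op_has_laplace_def has_laplace_iff)
  have TQ: "blinfun_apply (T t) (blinfun_apply Q x) = blinfun_apply Q (blinfun_apply (T t) x)" if t: "t > 0" for t x
  proof -
    have "blinfun_apply (T t) (integral {0..\<tau>} (\<lambda>s. exp (- (\<mu> * s)) *\<^sub>R blinfun_apply (T s) x)) =
        integral {0..\<tau>} (\<lambda>s. exp (- (\<mu> * s)) *\<^sub>R blinfun_apply (T s) (blinfun_apply (T t) x))" for \<tau>
    proof -
      have "blinfun_apply (T t) (integral {0..\<tau>} (\<lambda>s. exp (- (\<mu> * s)) *\<^sub>R blinfun_apply (T s) x)) =
        integral {0..\<tau>} (\<lambda>s. blinfun_apply (T t) (exp (- (\<mu> * s)) *\<^sub>R blinfun_apply (T s) x))"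
        using integral_linear[OF int blinfun.bounded_linear_right[of "T t"]] by (simp add: o_def)
      also have "\<dots> = integral {0..\<tau>} (\<lambda>s. exp (- (\<mu> * s)) *\<^sub>R blinfun_apply (T s) (blinfun_apply (T t) x))"
      proof (rule integral_spike[of "{0}"])
        fix s assume "s \<in> {0..\<tau>} - {0}"
        then have "T (t + s) = T t o\<^sub>L T s" "T (s + t) = T s o\<^sub>L T t"
          using sg t by (auto simp: op_semigroup_def)
        then have "T s o\<^sub>L T t = T t o\<^sub>L T s" by (simp add: add.commute)
        then have "blinfun_apply (T s o\<^sub>L T t) x = blinfun_apply (T t o\<^sub>L T s) x" by simp
        then show "exp (- (\<mu> * s)) *\<^sub>R blinfun_apply (T s) (blinfun_apply (T t) x) =
            blinfun_apply (T t) (exp (- (\<mu> * s)) *\<^sub>R blinfun_apply (T s) x)"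
          by (simp add: blinfun.scaleR_right)
      qed simp
      finally show ?thesis .
    qed
    then have "((\<lambda>\<tau>. integral {0..\<tau>} (\<lambda>s. exp (- (\<mu> * s)) *\<^sub>R blinfun_apply (T s) (blinfun_apply (T t) x))) \<longlongrightarrow>
        blinfun_apply (T t) (blinfun_apply Q x)) at_top"
      using blinfun.tendsto[OF tendsto_const lQ, of "T t" x] by simp
    then show ?thesis using lQ tendsto_unique trivial_limit_at_top_linorder by blast
  qed
  have "integral {0..\<tau>} (\<lambda>s. exp (- (\<nu> * s)) *\<^sub>R blinfun_apply (T s) (blinfun_apply Q x)) =
      blinfun_apply Q (integral {0..\<tau>} (\<lambda>s. exp (- (\<nu> * s)) *\<^sub>R blinfun_apply (T s) x))" for \<tau>
  proof -
    have "integral {0..\<tau>} (\<lambda>s. exp (- (\<nu> * s)) *\<^sub>R blinfun_apply (T s) (blinfun_apply Q x)) =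
        integral {0..\<tau>} (\<lambda>s. blinfun_apply Q (exp (- (\<nu> * s)) *\<^sub>R blinfun_apply (T s) x))"
      by (rule integral_spike[of "{0}"]) (auto simp: TQ blinfun.scaleR_right)
    then show ?thesis
      using integral_linear[OF int blinfun.bounded_linear_right[of Q]] by (simp add: o_def)
  qed
  then have "((\<lambda>\<tau>. blinfun_apply Q (integral {0..\<tau>} (\<lambda>s. exp (- (\<nu> * s)) *\<^sub>R blinfun_apply (T s) x))) \<longlongrightarrow>
     blinfun_apply R (blinfun_apply Q x)) at_top"
    using lR[of "blinfun_apply Q x"] by simp
  moreover have "((\<lambda>\<tau>. blinfun_apply Q (integral {0..\<tau>} (\<lambda>s. exp (- (\<nu> * s)) *\<^sub>R blinfun_apply (T s) x))) \<longlongrightarrow>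
     blinfun_apply Q (blinfun_apply R x)) at_top"
    by (intro blinfun.tendsto tendsto_const lR)
  ultimately show ?thesis using tendsto_unique trivial_limit_at_top_linorder by blast
qed

section \<open>Multivalued operators with a given pseudo-resolvent\<close>

lemma is_resolvent_unique:
  assumes "is_resolvent A \<mu> R" "is_resolvent A \<mu> Q"
  shows "R = Q"
proof (rule blinfun_eqI)
  fix u
  have "(u, blinfun_apply R u) \<in> {(u, blinfun_apply Q u) | u. True}"
    using assms by (auto simp: is_resolvent_def)
  then show "blinfun_apply R u = blinfun_apply Q u" by auto
qed

lemma resolvent_eqI:
  assumes "is_resolvent A \<mu> R"
  shows "\<mu> \<in> resolvent_set A" "resolvent A \<mu> = R"
  using assms is_resolvent_unique unfolding resolvent_set_def resolvent_def by blast+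

text \<open>The operator is \<nu> - R(\<nu>)^(-1) as a relation for one fixed \<nu>; it is
  multivalued when R(\<nu>) is not injective. The resolvent equation, used in both orders, gives the
  two inclusions between graphs at every other point.\<close>

lemma pseudo_resolvent_generator:
  fixes R :: "real \<Rightarrow> 'a::complex_banach \<Rightarrow>\<^sub>L 'a"
  assumes cb: "\<And>\<mu>. \<mu> \<in> I \<Longrightarrow> R \<mu> \<in> cblin_ops" and "I \<noteq> {}"
    and res: "\<And>\<nu> \<mu> x. \<nu> \<in> I \<Longrightarrow> \<mu> \<in> I \<Longrightarrow>
      (\<mu> - \<nu>) *\<^sub>R blinfun_apply (R \<mu>) (blinfun_apply (R \<nu>) x) = blinfun_apply (R \<nu>) x - blinfun_apply (R \<mu>) x"
  shows "\<exists>A. mv_linear A \<and> closed A \<and> (\<forall>\<mu>\<in>I. is_resolvent A (complex_of_real \<mu>) (R \<mu>))"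
proof -
  obtain \<nu> where \<nu>: "\<nu> \<in> I" using \<open>I \<noteq> {}\<close> by blast
  define r where "r = blinfun_apply (R \<nu>)"
  define A where "A = {(x, y). x = r (\<nu> *\<^sub>R x - y)}"
  have rC: "r (c *\<^sub>C x) = c *\<^sub>C r x" for c x using cb[OF \<nu>] by (simp add: r_def cblin_ops_def)
  have radd: "r (x + y) = r x + r y" "r (x - y) = r x - r y" "r 0 = 0" "r (c *\<^sub>R x) = c *\<^sub>R r x" for x y c
    by (simp_all add: r_def blinfun.bilinear_simps)
  have rA: "(r u, \<nu> *\<^sub>R r u - u) \<in> A" for u by (simp add: A_def)
  have Ar: "\<exists>u. x = r u \<and> y = \<nu> *\<^sub>R r u - u" if "(x, y) \<in> A" for x y
    using that by (intro exI[of _ "\<nu> *\<^sub>R x - y"]) (auto simp: A_def)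
  have "mv_linear A"
    unfolding mv_linear_def
  proof (intro conjI allI impI)
    show "(0, 0) \<in> A" by (simp add: A_def radd)
    show "(x + u, y + v) \<in> A" if "(x, y) \<in> A" "(u, v) \<in> A" for x y u v
    proof -
      have "\<nu> *\<^sub>R (x + u) - (y + v) = (\<nu> *\<^sub>R x - y) + (\<nu> *\<^sub>R u - v)" by (simp add: algebra_simps)
      then show ?thesis using that unfolding A_def by (simp only: mem_Collect_eq case_prod_conv radd(1))
    qed
    show "(c *\<^sub>C x, c *\<^sub>C y) \<in> A" if "(x, y) \<in> A" for c x y
    proof -
      have "\<nu> *\<^sub>R (c *\<^sub>C x) - c *\<^sub>C y = c *\<^sub>C (\<nu> *\<^sub>R x - y)"
        by (simp add: scaleC_diff_right scaleC_scaleR)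
      then show ?thesis using that by (simp add: A_def rC)
    qed
  qed
  moreover have "closed A"
  proof -
    have "closed {p. fst p = r (\<nu> *\<^sub>R fst p - snd p)}"
      unfolding r_def by (intro closed_Collect_eq continuous_intros)
    then show ?thesis by (simp add: A_def case_prod_beta')
  qed
  moreover have "is_resolvent A (complex_of_real \<mu>) (R \<mu>)" if \<mu>: "\<mu> \<in> I" for \<mu>
    unfolding is_resolvent_def
  proof
    show "R \<mu> \<in> cblin_ops" by (rule cb[OF \<mu>])
    show "mv_resolvent A (complex_of_real \<mu>) = {(u, blinfun_apply (R \<mu>) u) |u. True}"
    proof (intro set_eqI iffI)
      fix p assume "p \<in> mv_resolvent A (complex_of_real \<mu>)"
      then obtain u where p: "p = (\<mu> *\<^sub>R r u - (\<nu> *\<^sub>R r u - u), r u)"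
        unfolding mv_resolvent_def scaleC_of_real using Ar by blast
      have "\<mu> *\<^sub>R r u - (\<nu> *\<^sub>R r u - u) = (\<mu> - \<nu>) *\<^sub>R r u + u" by (simp add: algebra_simps)
      then have "blinfun_apply (R \<mu>) (\<mu> *\<^sub>R r u - (\<nu> *\<^sub>R r u - u)) =
          (\<mu> - \<nu>) *\<^sub>R blinfun_apply (R \<mu>) (r u) + blinfun_apply (R \<mu>) u"
        by (simp only: blinfun.add_right blinfun.scaleR_right)
      also have "\<dots> = r u" using res[OF \<nu> \<mu>] by (simp add: r_def)
      finally show "p \<in> {(u, blinfun_apply (R \<mu>) u) |u. True}" using p by auto
    next
      fix p assume "p \<in> {(u, blinfun_apply (R \<mu>) u) |u. True}"
      then obtain v where p: "p = (v, blinfun_apply (R \<mu>) v)" by auto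
      \<comment> \<open>The preimage is found by solving \<mu> r(u) - (\<nu> r(u) - u) = v with r(u)
        replaced by R(\<mu>)v; the resolvent equation confirms that replacement.\<close>
      define u where "u = v - (\<mu> - \<nu>) *\<^sub>R blinfun_apply (R \<mu>) v"
      have "r u = r v + (\<nu> - \<mu>) *\<^sub>R r (blinfun_apply (R \<mu>) v)"
        by (simp add: u_def radd algebra_simps)
      also have "\<dots> = blinfun_apply (R \<mu>) v" using res[OF \<mu> \<nu>] by (simp add: r_def)
      finally have ru: "r u = blinfun_apply (R \<mu>) v" .
      have "(complex_of_real \<mu> *\<^sub>C r u - (\<nu> *\<^sub>R r u - u), r u) \<in> mv_resolvent A (complex_of_real \<mu>)"
        unfolding mv_resolvent_def using rA[of u] by blast
      moreover have "complex_of_real \<mu> *\<^sub>C r u - (\<nu> *\<^sub>R r u - u) = v"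
        unfolding scaleC_of_real ru by (simp add: u_def algebra_simps)
      ultimately show "p \<in> mv_resolvent A (complex_of_real \<mu>)" using p ru by simp
    qed
  qed
  ultimately show ?thesis by blast
qed

lemma semigroup_generator_exists:
  fixes T :: "real \<Rightarrow> 'a::complex_banach \<Rightarrow>\<^sub>L 'a"
  assumes sg: "op_semigroup T" and ne: "laplace_convergence_set T \<noteq> {}"
  shows "\<exists>A. mv_linear A \<and> closed A \<and>
    (\<forall>\<mu>. laplace_abscissa T < ereal \<mu> \<longrightarrow>
       complex_of_real \<mu> \<in> resolvent_set A \<and>
       op_has_laplace T \<mu> (resolvent A (complex_of_real \<mu>)))"
proof -
  define I where "I = {\<mu>. laplace_abscissa T < ereal \<mu>}"
  have "\<exists>L. op_has_laplace T \<mu> L" if "\<mu> \<in> I" for \<mu>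
  proof (rule laplace_op_exists)
    show "T t \<in> cblin_ops" if "t > 0" for t using sg that by (simp add: op_semigroup_def)
    show "\<exists>y. has_laplace (\<lambda>t. blinfun_apply (T t) x) \<mu> y" for x
      using that by (intro laplace_beyond_abscissa) (simp add: I_def)
  qed
  then obtain R where R: "\<And>\<mu>. \<mu> \<in> I \<Longrightarrow> op_has_laplace T \<mu> (R \<mu>)" by metis
  have Rx: "has_laplace (\<lambda>t. blinfun_apply (T t) x) \<mu> (blinfun_apply (R \<mu>) x)" if "\<mu> \<in> I" for \<mu> x
    using R[OF that] by (simp add: op_has_laplace_def)
  have less: "(\<mu> - \<nu>) *\<^sub>R blinfun_apply (R \<mu>) (blinfun_apply (R \<nu>) x) = blinfun_apply (R \<nu>) x - blinfun_apply (R \<mu>) x"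
    if "\<nu> \<in> I" "\<mu> \<in> I" "\<nu> < \<mu>" for \<nu> \<mu> x
    by (rule semigroup_laplace_resolvent_eq[OF sg Rx[OF that(1)] that(3) Rx[OF that(2)] Rx[OF that(2)]])
  have res: "(\<mu> - \<nu>) *\<^sub>R blinfun_apply (R \<mu>) (blinfun_apply (R \<nu>) x) = blinfun_apply (R \<nu>) x - blinfun_apply (R \<mu>) x"
    if "\<nu> \<in> I" "\<mu> \<in> I" for \<nu> \<mu> x
  proof -
    consider "\<nu> < \<mu>" | "\<nu> = \<mu>" | "\<mu> < \<nu>" by linarith
    then show ?thesis
    proof cases
      case 3
      from less[OF that(2,1) this, of x] semigroup_laplace_commute[OF sg R[OF that(1)] R[OF that(2)], of x]
      have "(\<nu> - \<mu>) *\<^sub>R blinfun_apply (R \<mu>) (blinfun_apply (R \<nu>) x) = blinfun_apply (R \<mu>) x - blinfun_apply (R \<nu>) x"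
        by simp
      then have "- ((\<nu> - \<mu>) *\<^sub>R blinfun_apply (R \<mu>) (blinfun_apply (R \<nu>) x)) = blinfun_apply (R \<nu>) x - blinfun_apply (R \<mu>) x"
        by simp
      then show ?thesis by (simp flip: scaleR_minus_left)
    qed (use less that in auto)
  qed
  have "I \<noteq> {}"
  proof -
    obtain \<mu>0 where "\<mu>0 \<in> laplace_convergence_set T" using ne by blast
    then have "laplace_abscissa T \<le> ereal \<mu>0" unfolding laplace_abscissa_def by (rule INF_lower)
    also have "\<dots> < ereal (\<mu>0 + 1)" by simp
    finally show ?thesis by (auto simp: I_def)
  qed
  have cb: "R \<mu> \<in> cblin_ops" if "\<mu> \<in> I" for \<mu> using R[OF that] by (simp add: op_has_laplace_def)
  obtain A where A: "mv_linear A" "closed A" "\<And>\<mu>. \<mu> \<in> I \<Longrightarrow> is_resolvent A (complex_of_real \<mu>) (R \<mu>)"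
    using pseudo_resolvent_generator[OF cb \<open>I \<noteq> {}\<close> res] by blast
  then show ?thesis
    using R resolvent_eqI[OF A(3)] by (intro exI[of _ A]) (auto simp: I_def)
qed

section \<open>Growth bounds on the right half-plane\<close>

abbreviation (input) rhp :: "complex set" where "rhp \<equiv> {z. 0 < Re z}"

lemma open_rhp: "open rhp"
  using open_halfspace_Re_gt[of 0] by simp

text \<open>The exponential takes care of large |z|, the first power of 0, the second of the
  imaginary axis. The exponents are kept independent because differentiation and fractional
  integration change them separately; their difference is the degree along rays.\<close>

definition growth_bound :: "(complex \<Rightarrow> 'b::real_normed_vector) \<Rightarrow> real \<Rightarrow> real \<Rightarrow> bool" where
  "growth_bound f a b \<longleftrightarrow> (\<exists>M\<ge>0. \<exists>\<omega>\<ge>0. \<forall>z. 0 < Re z \<longrightarrow>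
     norm (f z) \<le> M * exp (\<omega> * cmod z) * (cmod z powr a * Re z powr (- b)))"

lemma growth_boundI:
  assumes "M \<ge> 0" "\<omega> \<ge> 0"
    "\<And>z. 0 < Re z \<Longrightarrow> norm (f z) \<le> M * exp (\<omega> * cmod z) * (cmod z powr a * Re z powr (- b))"
  shows "growth_bound f a b"
  using assms unfolding growth_bound_def by blast

lemma growth_bound_cong:
  assumes "growth_bound f a b" "\<And>z. 0 < Re z \<Longrightarrow> norm (g z) = norm (f z)"
  shows "growth_bound g a b"
  using assms unfolding growth_bound_def by simp

text \<open>On the disc, |w| is at most 2u|z| and Re w at least u Re z / 2, which costs the factors
  2^a and 2^b and doubles \<omega>. Uniformity in \<open>u\<close>, with the explicit power u^(a -
  b), is what integration along the ray needs.\<close>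

lemma growth_bound_ball:
  assumes gb: "growth_bound f a b" and a: "a \<ge> 0" and b: "b \<ge> 0"
  obtains M \<omega> where "M \<ge> 0" "\<omega> \<ge> 0"
    "\<And>z u w. 0 < Re z \<Longrightarrow> 0 < u \<Longrightarrow> u \<le> 1 \<Longrightarrow> w \<in> cball (of_real u * z) (u * Re z / 2) \<Longrightarrow>
      norm (f w) \<le> M * exp (\<omega> * cmod z) * (cmod z powr a * Re z powr (- b)) * u powr (a - b)"
proof -
  obtain M \<omega> where M: "M \<ge> 0" "\<omega> \<ge> 0" and f: "\<And>z. 0 < Re z \<Longrightarrow>
     norm (f z) \<le> M * exp (\<omega> * cmod z) * (cmod z powr a * Re z powr (- b))"
    using gb unfolding growth_bound_def by blast
  show ?thesis
  proof (rule that[of "M * (2 powr a * 2 powr b)" "2 * \<omega>"])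
    fix z w :: complex and u :: real
    assume z: "0 < Re z" and u: "0 < u" "u \<le> 1" and w: "w \<in> cball (of_real u * z) (u * Re z / 2)"
    have d: "cmod (of_real u * z - w) \<le> u * Re z / 2" using w by (simp add: dist_norm)
    have "\<bar>Re (of_real u * z - w)\<bar> \<le> u * Re z / 2" using abs_Re_le_cmod d order_trans by blast
    moreover have "Re (of_real u * z - w) = u * Re z - Re w" by simp
    ultimately have Rew: "u * (Re z / 2) \<le> Re w" by linarith
    then have Rew0: "Re w > 0" using z u by (smt (verit) half_gt_zero mult_pos_pos)
    have "cmod w \<le> cmod (of_real u * z) + cmod (of_real u * z - w)"
      using norm_triangle_ineq4[of "of_real u * z" "of_real u * z - w"] by simp
    also have "\<dots> \<le> u * cmod z + u * Re z / 2" using d u by (simp add: norm_mult)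
    also have "\<dots> \<le> 2 * (u * cmod z)"
    proof -
      have "u * Re z \<le> u * cmod z" "0 \<le> u * cmod z"
        using complex_Re_le_cmod[of z] u by (simp_all add: mult_left_mono)
      then show ?thesis by linarith
    qed
    finally have cw: "cmod w \<le> u * (2 * cmod z)" by simp
    also have "\<dots> \<le> 1 * (2 * cmod z)" using u by (intro mult_right_mono) auto
    finally have cw1: "cmod w \<le> 2 * cmod z" by simp
    have "norm (f w) \<le> M * exp (\<omega> * cmod w) * (cmod w powr a * Re w powr (- b))"
      by (rule f[OF Rew0])
    also have "\<dots> \<le> M * exp (2 * \<omega> * cmod z) * ((u * (2 * cmod z)) powr a * (u * (Re z / 2)) powr (- b))"
    proof (intro mult_mono)
      show "exp (\<omega> * cmod w) \<le> exp (2 * \<omega> * cmod z)" using M(2) mult_left_mono[OF cw1 M(2)] by simp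
      show "cmod w powr a \<le> (u * (2 * cmod z)) powr a" using a cw by (intro powr_mono2) auto
      show "Re w powr (- b) \<le> (u * (Re z / 2)) powr (- b)"
        using b Rew z u by (intro powr_mono2') auto
    qed (use M in auto)
    also have "(u * (2 * cmod z)) powr a = u powr a * (2 powr a * cmod z powr a)"
      using u by (simp add: powr_mult)
    also have "(u * (Re z / 2)) powr (- b) = u powr (- b) * (2 powr b * Re z powr (- b))"
      using u z by (simp add: powr_mult powr_divide powr_minus field_simps)
    also have "u powr a * (2 powr a * cmod z powr a) * (u powr (- b) * (2 powr b * Re z powr (- b))) =
        (2 powr a * 2 powr b) * (cmod z powr a * Re z powr (- b)) * (u powr a * u powr (- b))"
      by (simp add: mult_ac)
    also have "u powr a * u powr (- b) = u powr (a - b)" using u by (simp flip: powr_add)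
    finally show "norm (f w) \<le> M * (2 powr a * 2 powr b) * exp (2 * \<omega> * cmod z) *
        (cmod z powr a * Re z powr (- b)) * u powr (a - b)" by (simp only: mult_ac)
  qed (use M in auto)
qed

lemma cball_subset_rhp: "0 < Re z \<Longrightarrow> 0 < u \<Longrightarrow> cball (of_real u * z) (u * Re z / 2) \<subseteq> rhp"
proof
  fix w assume z: "0 < Re z" "0 < u" and w: "w \<in> cball (of_real u * z) (u * Re z / 2)"
  then have "\<bar>Re (of_real u * z - w)\<bar> \<le> u * Re z / 2"
    using abs_Re_le_cmod[of "of_real u * z - w"] by (simp add: dist_norm)
  moreover have "Re (of_real u * z - w) = u * Re z - Re w" by simp
  ultimately have "u * Re z / 2 \<le> Re w" by linarith
  moreover have "0 < u * Re z / 2" using z by simp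
  ultimately show "w \<in> rhp" by simp
qed

text \<open>Cauchy's inequality on the disc of radius Re z / 2, on which the bound changes only by
  constants; dividing by the radius costs one power of Re z.\<close>

lemma growth_bound_vderiv:
  fixes f :: "complex \<Rightarrow> 'b::complex_banach"
  assumes hol: "vholomorphic_on f rhp" and gb: "growth_bound f a b" and a: "a \<ge> 0" and b: "b \<ge> 0"
  shows "growth_bound (vderiv f) a (b + 1)"
proof -
  obtain M \<omega> where M: "M \<ge> 0" "\<omega> \<ge> 0" and f: "\<And>z u w. 0 < Re z \<Longrightarrow> 0 < u \<Longrightarrow> u \<le> 1 \<Longrightarrow>
      w \<in> cball (of_real u * z) (u * Re z / 2) \<Longrightarrow>
      norm (f w) \<le> M * exp (\<omega> * cmod z) * (cmod z powr a * Re z powr (- b)) * u powr (a - b)"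
    by (rule growth_bound_ball[OF gb a b]) (rule that)
  show ?thesis
  proof (rule growth_boundI[of "2 * M" \<omega>])
    fix z :: complex assume z: "0 < Re z"
    have "norm (vderiv f z) \<le> M * exp (\<omega> * cmod z) * (cmod z powr a * Re z powr (- b)) / (Re z / 2)"
      using f[OF z, of 1] cball_subset_rhp[OF z, of 1] z
      by (intro norm_vderiv_le[OF open_rhp hol]) auto
    also have "\<dots> = 2 * M * exp (\<omega> * cmod z) * (cmod z powr a * (Re z powr (- b) / Re z))" by simp
    also have "Re z powr (- b) / Re z = Re z powr (- (b + 1))"
      using z powr_diff[of "Re z" "- b" 1] by simp
    finally show "norm (vderiv f z) \<le> 2 * M * exp (\<omega> * cmod z) * (cmod z powr a * Re z powr (- (b + 1)))" .
  qed (use M in auto)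
qed

text \<open>Horizontal segments move away from the imaginary axis. For s > 0 the base point z may
  lie on that axis, which is the case used for boundary values.\<close>

lemma horizontal_difference:
  fixes G :: "complex \<Rightarrow> 'b::complex_banach"
  assumes hol: "vholomorphic_on G rhp" and st: "0 \<le> s" "s \<le> t" and z: "0 < Re z + s"
    and le: "\<And>\<sigma>. s < \<sigma> \<Longrightarrow> \<sigma> < t \<Longrightarrow> norm (vderiv G (z + of_real \<sigma>)) \<le> h \<sigma>"
    and h: "h integrable_on {s..t}"
  shows "norm (G (z + of_real t) - G (z + of_real s)) \<le> integral {s..t} h"
proof -
  have rhp: "z + of_real \<sigma> \<in> rhp" if "s \<le> \<sigma>" for \<sigma> using that z by simp
  have "((\<lambda>\<sigma>. vderiv G (z + of_real \<sigma>)) has_integral G (z + of_real t) - G (z + of_real s)) {s..t}"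
  proof (rule fundamental_theorem_of_calculus[OF st(2)])
    fix \<sigma> assume "\<sigma> \<in> {s..t}"
    then have "has_cderiv G (vderiv G (z + of_real \<sigma> * 1)) (z + of_real \<sigma> * 1)"
      using hol rhp[of \<sigma>] by (simp add: vholomorphic_on_open[OF open_rhp])
    from has_cderiv_line[OF this]
    show "((\<lambda>\<sigma>. G (z + of_real \<sigma>)) has_vector_derivative vderiv G (z + of_real \<sigma>)) (at \<sigma> within {s..t})"
      by (simp add: has_vector_derivative_at_within)
  qed
  moreover have "continuous_on {s<..<t} (\<lambda>\<sigma>. vderiv G (z + of_real \<sigma>))"
    by (rule continuous_on_compose2[OF vholomorphic_on_imp_continuous_on[OF vholomorphic_on_vderiv[OF open_rhp hol]]])
      (use z in \<open>auto intro!: continuous_intros\<close>)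
  ultimately show ?thesis
    using integrable_continuous_dominated(2)[OF _ h] le integral_unique by metis
qed

lemma has_integral_powr_shift:
  assumes "c \<noteq> 0" "0 < x" "0 \<le> (r::real)"
  shows "((\<lambda>s. (x + s) powr (c - 1)) has_integral ((x + r) powr c - x powr c) / c) {0..r}"
proof -
  have "((\<lambda>s. (x + s) powr (c - 1)) has_integral (x + r) powr c / c - (x + 0) powr c / c) {0..r}"
  proof (rule fundamental_theorem_of_calculus[OF assms(3)])
    fix s assume "s \<in> {0..r}"
    then have "((\<lambda>s. (x + s) powr c / c) has_real_derivative (x + s) powr (c - 1)) (at s)"
      using assms
        DERIV_cdivide[OF DERIV_fun_powr[of "\<lambda>s. x + s" 1 s c], of c] by (auto intro!: derivative_eq_intros)
    then show "((\<lambda>s. (x + s) powr c / c) has_vector_derivative (x + s) powr (c - 1)) (at s within {0..r})"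
      by (simp add: has_real_derivative_iff_has_vector_derivative has_vector_derivative_at_within)
  qed
  then show ?thesis by (simp add: diff_divide_distrib)
qed

text \<open>Compare z with z + |z|. At the latter point the real part is at least |z|, so any bound
  of the same degree serves there. Along the segment between them the integral of (x + s)^(-c - 1)
  is at most x^(-c) / c, which is where c > 0 enters.\<close>

lemma growth_bound_integrate:
  fixes G :: "complex \<Rightarrow> 'b::complex_banach"
  assumes hol: "vholomorphic_on G rhp" and gb': "growth_bound (vderiv G) a (c + 1)" and a: "a \<ge> 0" and c: "c > 0"
    and gb: "growth_bound G a' c'" "a' \<ge> 0" "c' \<ge> 0" "a' - c' = a - c"
  shows "growth_bound G a c"
proof -
  obtain M \<omega> where M: "M \<ge> 0" "\<omega> \<ge> 0" and G': "\<And>z. 0 < Re z \<Longrightarrow>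
     norm (vderiv G z) \<le> M * exp (\<omega> * cmod z) * (cmod z powr a * Re z powr (- (c + 1)))"
    using gb' unfolding growth_bound_def by blast
  obtain N \<nu> where N: "N \<ge> 0" "\<nu> \<ge> 0" and G: "\<And>z. 0 < Re z \<Longrightarrow>
     norm (G z) \<le> N * exp (\<nu> * cmod z) * (cmod z powr a' * Re z powr (- c'))"
    using gb(1) unfolding growth_bound_def by blast
  show ?thesis
  proof (rule growth_boundI[of "N * 2 powr a' + M * 2 powr a / c" "2 * \<nu> + 2 * \<omega>"])
    fix z :: complex assume z: "0 < Re z"
    define r where "r = cmod z"
    define x where "x = Re z"
    have x: "0 < x" "x \<le> r" using z complex_Re_le_cmod[of z] by (auto simp: x_def r_def)
    have r: "r > 0" using x by linarith
    have cz: "cmod (z + of_real s) \<le> 2 * r" if "0 \<le> s" "s \<le> r" for s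
      using norm_triangle_ineq[of z "of_real s"] that by (simp add: r_def)
    have "norm (G (z + of_real r)) \<le> N * exp (\<nu> * cmod (z + of_real r)) *
        (cmod (z + of_real r) powr a' * Re (z + of_real r) powr (- c'))"
      using z r by (intro G) simp
    also have "\<dots> \<le> N * exp (\<nu> * (2 * r)) * ((2 * r) powr a' * r powr (- c'))"
      using N cz[of r] gb(2,3) r x
      by (intro mult_mono powr_mono2 powr_mono2') (auto intro: mult_left_mono simp: x_def[symmetric])
    also have "(2 * r) powr a' * r powr (- c') = 2 powr a' * r powr (a - c)"
      using r gb(4) by (simp add: powr_mult flip: powr_add)
    also have "r powr (a - c) \<le> r powr a * x powr (- c)"
      unfolding diff_conv_add_uminus powr_add using x c r by (intro mult_left_mono powr_mono2') auto
    finally have 1: "norm (G (z + of_real r)) \<le> N * exp (\<nu> * (2 * r)) * (2 powr a' * (r powr a * x powr (- c)))"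
      using N by (simp add: mult_left_mono)
    define K where "K = M * exp (\<omega> * (2 * r)) * (2 * r) powr a"
    have K: "K \<ge> 0" using M by (simp add: K_def)
    have hi: "((\<lambda>s. K * (x + s) powr (- c - 1)) has_integral K * (((x + r) powr (- c) - x powr (- c)) / (- c))) {0..r}"
      using has_integral_powr_shift[of "- c" x r] c x r by (intro has_integral_mult_right) auto
    have "norm (G (z + of_real r) - G (z + of_real 0)) \<le> integral {0..r} (\<lambda>s. K * (x + s) powr (- c - 1))"
    proof (rule horizontal_difference[OF hol])
      fix s :: real assume s: "0 < s" "s < r"
      have "norm (vderiv G (z + of_real s)) \<le> M * exp (\<omega> * cmod (z + of_real s)) *
          (cmod (z + of_real s) powr a * Re (z + of_real s) powr (- (c + 1)))"
        using z s by (intro G') simp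
      also have "\<dots> \<le> M * exp (\<omega> * (2 * r)) * ((2 * r) powr a * (x + s) powr (- (c + 1)))"
      proof -
        have "Re (z + of_real s) = x + s" by (simp add: x_def)
        then show ?thesis
          using M cz[of s] a s
          by (simp only:) (intro mult_mono order_refl powr_mono2, auto intro: mult_left_mono)
      qed
      also have "- (c + 1) = - c - 1" by simp
      finally show "norm (vderiv G (z + of_real s)) \<le> K * (x + s) powr (- c - 1)"
        by (simp add: K_def mult.assoc)
    qed (use z r hi in auto)
    also have "\<dots> = K * ((x powr (- c) - (x + r) powr (- c)) / c)"
      unfolding integral_unique[OF hi] using c by (simp add: field_simps)
    also have "\<dots> \<le> K * (x powr (- c) / c)"
      using K c by (intro mult_left_mono divide_right_mono) auto
    finally have 2: "norm (G (z + of_real r) - G z) \<le> M * exp (\<omega> * (2 * r)) * (2 powr a / c * (r powr a * x powr (- c)))"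
      using r by (simp add: K_def powr_mult mult_ac)
    let ?E = "exp ((2 * \<nu> + 2 * \<omega>) * r)" and ?P = "r powr a * x powr (- c)"
    have "norm (G z) \<le> norm (G (z + of_real r)) + norm (G (z + of_real r) - G z)"
      using norm_triangle_ineq4[of "G (z + of_real r)" "G (z + of_real r) - G z"] by simp
    also have "\<dots> \<le> N * ?E * (2 powr a' * ?P) + M * ?E * (2 powr a / c * ?P)"
    proof (rule add_mono)
      have "exp (\<nu> * (2 * r)) \<le> ?E" "exp (\<omega> * (2 * r)) \<le> ?E"
        using N M r by (auto simp: algebra_simps)
      note E = this
      show "norm (G (z + of_real r)) \<le> N * ?E * (2 powr a' * ?P)"
        by (rule order_trans[OF 1], intro mult_right_mono mult_left_mono) (use N E in auto)
      show "norm (G (z + of_real r) - G z) \<le> M * ?E * (2 powr a / c * ?P)"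
        by (rule order_trans[OF 2], intro mult_right_mono mult_left_mono) (use M c E in auto)
    qed
    also have "\<dots> = (N * 2 powr a' + M * 2 powr a / c) * ?E * ?P" by (simp add: algebra_simps)
    finally show "norm (G z) \<le> (N * 2 powr a' + M * 2 powr a / c) * exp ((2 * \<nu> + 2 * \<omega>) * cmod z) *
        (cmod z powr a * Re z powr (- c))" by (simp add: r_def x_def)
  qed (use N M c in auto)
qed

section \<open>Fractional integration along rays\<close>

text \<open>The Riemann-Liouville integral of order \<open>q\<close> along the segment from 0 to
  \<open>z\<close>, parametrised by w = uz. The fixed interval {0..1} allows differentiation in
  \<open>z\<close> under the integral sign.\<close>

definition frac_int :: "real \<Rightarrow> (complex \<Rightarrow> 'b::complex_banach) \<Rightarrow> complex \<Rightarrow> 'b" where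
  "frac_int q F z = (z powr of_real q / of_real (Gamma q)) *\<^sub>C
     integral {0..1} (\<lambda>u. (1 - u) powr (q - 1) *\<^sub>R F (of_real u * z))"

lemma ray_integrable:
  fixes F :: "complex \<Rightarrow> 'b::complex_banach"
  assumes F: "continuous_on rhp F" and z: "0 < Re z" and c: "0 \<le> c"
    and B: "\<And>u. c < u \<Longrightarrow> u < d \<Longrightarrow> norm (F (of_real u * z)) \<le> B * u powr p"
    and g: "continuous_on {c<..<d} g" and gi: "(\<lambda>u. \<bar>g u\<bar> * u powr p) integrable_on {c..d}"
  shows "(\<lambda>u. g u *\<^sub>R F (of_real u * z)) integrable_on {c..d}"
    and "norm (integral {c..d} (\<lambda>u. g u *\<^sub>R F (of_real u * z))) \<le> B * integral {c..d} (\<lambda>u. \<bar>g u\<bar> * u powr p)"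
proof -
  have cont: "continuous_on {c<..<d} (\<lambda>u. g u *\<^sub>R F (of_real u * z))"
    by (intro continuous_intros g continuous_on_compose2[OF F]) (use z c in \<open>auto intro!: mult_pos_pos\<close>)
  have hi: "(\<lambda>u. B * (\<bar>g u\<bar> * u powr p)) integrable_on {c..d}"
    using integrable_cmul[OF gi, of B] by simp
  have le: "norm (g u *\<^sub>R F (of_real u * z)) \<le> B * (\<bar>g u\<bar> * u powr p)" if "c < u" "u < d" for u
    using mult_left_mono[OF B[OF that], of "\<bar>g u\<bar>"] by (simp add: mult_ac)
  from integrable_continuous_dominated[OF cont hi le]
  show "(\<lambda>u. g u *\<^sub>R F (of_real u * z)) integrable_on {c..d}"
    "norm (integral {c..d} (\<lambda>u. g u *\<^sub>R F (of_real u * z))) \<le> B * integral {c..d} (\<lambda>u. \<bar>g u\<bar> * u powr p)"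
    by simp_all
qed

lemma frac_weight_integrable:
  assumes "p > -1" "q > (0::real)"
  shows "((\<lambda>u. \<bar>(1 - u) powr (q - 1)\<bar> * u powr p) has_integral Beta (p + 1) q) {0..1}"
  using has_integral_Beta_real[of "p + 1" q] assms by (simp add: mult.commute)

lemma frac_weight_continuous: "continuous_on {c<..<1} (\<lambda>u::real. (1 - u) powr s)"
  by (intro continuous_intros) auto

lemma growth_bound_ray:
  assumes "growth_bound f a b" "a \<ge> 0" "b \<ge> 0"
  obtains M \<omega> where "M \<ge> 0" "\<omega> \<ge> 0"
    "\<And>z u. 0 < Re z \<Longrightarrow> 0 < u \<Longrightarrow> u \<le> 1 \<Longrightarrow> norm (f (of_real u * z)) \<le>
      M * exp (\<omega> * cmod z) * (cmod z powr a * Re z powr (- b)) * u powr (a - b)"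
proof -
  obtain M \<omega> where M: "M \<ge> 0" "\<omega> \<ge> 0" and f:
    "\<And>z u w. 0 < Re z \<Longrightarrow> 0 < u \<Longrightarrow> u \<le> 1 \<Longrightarrow> w \<in> cball (of_real u * z) (u * Re z / 2) \<Longrightarrow>
      norm (f w) \<le> M * exp (\<omega> * cmod z) * (cmod z powr a * Re z powr (- b)) * u powr (a - b)"
    by (rule growth_bound_ball[OF assms]) (rule that)
  show ?thesis
  proof (rule that[OF M])
    fix z :: complex and u :: real assume "0 < Re z" "0 < u" "u \<le> 1"
    then show "norm (f (of_real u * z)) \<le>
        M * exp (\<omega> * cmod z) * (cmod z powr a * Re z powr (- b)) * u powr (a - b)"
      by (intro f) auto
  qed
qed

lemma frac_integrable:
  fixes F :: "complex \<Rightarrow> 'b::complex_banach"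
  assumes hol: "vholomorphic_on F rhp" and gb: "growth_bound F a b" and ab: "a \<ge> 0" "b \<ge> 0" "a - b > -1"
    and q: "q > 0" and z: "0 < Re z"
  shows "(\<lambda>u. (1 - u) powr (q - 1) *\<^sub>R F (of_real u * z)) integrable_on {0..1}"
proof -
  obtain M \<omega> where "M \<ge> 0" "\<omega> \<ge> 0" and F: "\<And>z u. 0 < Re z \<Longrightarrow> 0 < u \<Longrightarrow> u \<le> 1 \<Longrightarrow> norm (F (of_real u * z)) \<le>
      M * exp (\<omega> * cmod z) * (cmod z powr a * Re z powr (- b)) * u powr (a - b)"
    by (rule growth_bound_ray[OF gb ab(1,2)]) (rule that)
  show ?thesis
  proof (rule ray_integrable(1)[OF vholomorphic_on_imp_continuous_on[OF hol] z order_refl])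
    show "norm (F (of_real u * z)) \<le> M * exp (\<omega> * cmod z) * (cmod z powr a * Re z powr (- b)) * u powr (a - b)"
      if "0 < u" "u < 1" for u using F[OF z, of u] that by simp
  qed (use frac_weight_integrable[OF ab(3) q] frac_weight_continuous in auto)
qed

text \<open>The u-integral is a Beta integral, finite since a - b > -1, and the prefactor z^q
  supplies the gain. This bound raises only the power of |z|; it is used where Re z is comparable to
  |z|.\<close>

lemma growth_bound_frac_int:
  fixes F :: "complex \<Rightarrow> 'b::complex_banach"
  assumes hol: "vholomorphic_on F rhp" and gb: "growth_bound F a b" and ab: "a \<ge> 0" "b \<ge> 0" "a - b > -1"
    and q: "q > 0"
  shows "growth_bound (frac_int q F) (a + q) b"
proof -
  obtain M \<omega> where M: "M \<ge> 0" "\<omega> \<ge> 0" and F: "\<And>z u. 0 < Re z \<Longrightarrow> 0 < u \<Longrightarrow> u \<le> 1 \<Longrightarrow> norm (F (of_real u * z)) \<le>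
      M * exp (\<omega> * cmod z) * (cmod z powr a * Re z powr (- b)) * u powr (a - b)"
    by (rule growth_bound_ray[OF gb ab(1,2)]) (rule that)
  have Beta: "Beta (a - b + 1) q \<ge> 0"
    using has_integral_nonneg[OF frac_weight_integrable[OF ab(3) q]] by simp
  have G: "Gamma q > 0" using q by (rule Gamma_real_pos)
  show ?thesis
  proof (rule growth_boundI[of "M * Beta (a - b + 1) q / Gamma q" \<omega>])
    fix z :: complex assume z: "0 < Re z"
    let ?B = "M * exp (\<omega> * cmod z) * (cmod z powr a * Re z powr (- b))"
    have "norm (integral {0..1} (\<lambda>u. (1 - u) powr (q - 1) *\<^sub>R F (of_real u * z))) \<le>
        ?B * integral {0..1} (\<lambda>u. \<bar>(1 - u) powr (q - 1)\<bar> * u powr (a - b))"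
      using z frac_weight_integrable[OF ab(3) q] F
      by (intro ray_integrable(2)[OF vholomorphic_on_imp_continuous_on[OF hol]] frac_weight_continuous) auto
    also have "\<dots> = ?B * Beta (a - b + 1) q"
      by (simp only: integral_unique[OF frac_weight_integrable[OF ab(3) q]])
    finally have "norm (frac_int q F z) \<le> cmod z powr q / Gamma q * (?B * Beta (a - b + 1) q)"
      unfolding frac_int_def norm_scaleC using G
      by (simp add: norm_divide norm_powr_real_powr' divide_right_mono mult_left_mono)
    then show "norm (frac_int q F z) \<le> M * Beta (a - b + 1) q / Gamma q * exp (\<omega> * cmod z) *
        (cmod z powr (a + q) * Re z powr (- b))"
      by (simp add: powr_add mult_ac)
  qed (use M Beta G in auto)
qed

text \<open>At the point uz the increment is uk and the available disc has radius u Re z / 2, so the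
  powers of \<open>u\<close> in the quadratic remainder cancel. What remains is u^(a - b),
  integrable against |g| by hypothesis.\<close>

lemma ray_integral_has_cderiv:
  fixes F :: "complex \<Rightarrow> 'b::complex_banach"
  assumes hol: "vholomorphic_on F rhp" and gb: "growth_bound F a b" and ab: "a \<ge> 0" "b \<ge> 0"
    and z: "0 < Re z" and g: "continuous_on {0<..<1} g"
    and gi: "(\<lambda>u. \<bar>g u\<bar> * u powr (a - b)) integrable_on {0..1}"
  shows "(\<lambda>u. (g u * u) *\<^sub>R vderiv F (of_real u * z)) integrable_on {0..1}"
    and "has_cderiv (\<lambda>w. integral {0..1} (\<lambda>u. g u *\<^sub>R F (of_real u * w)))
      (integral {0..1} (\<lambda>u. (g u * u) *\<^sub>R vderiv F (of_real u * z))) z"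
proof -
  obtain M \<omega> where M: "M \<ge> 0" "\<omega> \<ge> 0" and F: "\<And>z u w. 0 < Re z \<Longrightarrow> 0 < u \<Longrightarrow> u \<le> 1 \<Longrightarrow>
      w \<in> cball (of_real u * z) (u * Re z / 2) \<Longrightarrow>
      norm (F w) \<le> M * exp (\<omega> * cmod z) * (cmod z powr a * Re z powr (- b)) * u powr (a - b)"
    by (rule growth_bound_ball[OF gb ab(1,2)]) (rule that)
  have hol': "vholomorphic_on (vderiv F) rhp" by (rule vholomorphic_on_vderiv[OF open_rhp hol])
  have cF: "continuous_on rhp F" "continuous_on rhp (vderiv F)"
    using hol hol' vholomorphic_on_imp_continuous_on by blast+
  have b1: "b + 1 \<ge> 0" using ab(2) by simp
  obtain M' \<omega>' where "M' \<ge> 0" "\<omega>' \<ge> 0" and F': "\<And>z u. 0 < Re z \<Longrightarrow> 0 < u \<Longrightarrow> u \<le> 1 \<Longrightarrow> norm (vderiv F (of_real u * z)) \<le>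
      M' * exp (\<omega>' * cmod z) * (cmod z powr a * Re z powr (- (b + 1))) * u powr (a - (b + 1))"
    by (rule growth_bound_ray[OF growth_bound_vderiv[OF hol gb ab(1,2)] ab(1) b1]) (rule that)
  define B where "B = (\<lambda>z. M * exp (\<omega> * cmod z) * (cmod z powr a * Re z powr (- b)))"
  have B: "B z \<ge> 0" unfolding B_def using M by simp
  have int: "(\<lambda>u. g u *\<^sub>R F (of_real u * w)) integrable_on {0..1}" if w: "0 < Re w" for w
  proof (rule ray_integrable(1)[OF cF(1) w order_refl _ g gi])
    show "norm (F (of_real u * w)) \<le> B w * u powr (a - b)" if "0 < u" "u < 1" for u
      using F[OF w, of u "of_real u * w"] that w by (simp add: B_def)
  qed
  show int': "(\<lambda>u. (g u * u) *\<^sub>R vderiv F (of_real u * z)) integrable_on {0..1}"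
  proof (rule ray_integrable(1)[OF cF(2) z order_refl, where p = "a - (b + 1)"])
    show "continuous_on {0<..<1} (\<lambda>u. g u * u)" by (intro continuous_intros g)
    show "(\<lambda>u. \<bar>g u * u\<bar> * u powr (a - (b + 1))) integrable_on {0..1}"
    proof (rule integrable_spike_finite[OF _ _ gi, of "{0}"])
      fix u :: real assume "u \<in> {0..1} - {0}"
      then show "\<bar>g u * u\<bar> * u powr (a - (b + 1)) = \<bar>g u\<bar> * u powr (a - b)"
        by (simp add: abs_mult powr_diff powr_add)
    qed simp
    show "norm (vderiv F (of_real u * z)) \<le> M' * exp (\<omega>' * cmod z) * (cmod z powr a * Re z powr (- (b + 1))) * u powr (a - (b + 1))"
      if "0 < u" "u < 1" for u using F'[OF z, of u] that by simp
  qed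
  define D where "D = integral {0..1} (\<lambda>u. (g u * u) *\<^sub>R vderiv F (of_real u * z))"
  define C where "C = 128 * B z / (Re z)\<^sup>2 * integral {0..1} (\<lambda>u. \<bar>g u\<bar> * u powr (a - b))"
  have "has_cderiv (\<lambda>w. integral {0..1} (\<lambda>u. g u *\<^sub>R F (of_real u * w))) D z"
  proof (rule has_cderivI_quadratic[of "Re z / 4"])
    fix k :: complex assume k: "cmod k < Re z / 4"
    have zk: "0 < Re (z + k)" using abs_Re_le_cmod[of k] k z by simp
    let ?r = "\<lambda>u. F (of_real u * z + of_real u * k) - F (of_real u * z) - (of_real u * k) *\<^sub>C vderiv F (of_real u * z)"
    have "integral {0..1} (\<lambda>u. g u *\<^sub>R F (of_real u * (z + k))) - integral {0..1} (\<lambda>u. g u *\<^sub>R F (of_real u * z)) - k *\<^sub>C D =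
       integral {0..1} (\<lambda>u. g u *\<^sub>R F (of_real u * (z + k)) - g u *\<^sub>R F (of_real u * z) - k *\<^sub>C ((g u * u) *\<^sub>R vderiv F (of_real u * z)))"
      unfolding D_def integral_scaleC(2)[OF int', symmetric]
      by (simp add: Henstock_Kurzweil_Integration.integral_diff integrable_diff int[OF zk] int[OF z] integral_scaleC(1)[OF int'])
    also have "(\<lambda>u. g u *\<^sub>R F (of_real u * (z + k)) - g u *\<^sub>R F (of_real u * z) - k *\<^sub>C ((g u * u) *\<^sub>R vderiv F (of_real u * z))) =
      (\<lambda>u. g u *\<^sub>R ?r u)"
      by (rule ext) (simp add: scaleR_diff_right scaleC_scaleR distrib_left scaleC_of_real flip: scaleC_scaleC)
    finally have eq: "integral {0..1} (\<lambda>u. g u *\<^sub>R F (of_real u * (z + k))) - integral {0..1} (\<lambda>u. g u *\<^sub>R F (of_real u * z)) - k *\<^sub>C D =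
       integral {0..1} (\<lambda>u. g u *\<^sub>R ?r u)" .
    \<comment> \<open>128 is the 32 of the remainder estimate times 4, from the square of the radius
      u Re z / 2.\<close>
    let ?K = "128 * B z / (Re z)\<^sup>2 * (cmod k)\<^sup>2"
    have rem: "norm (?r u) \<le> ?K * u powr (a - b)" if u: "0 < u" "u < 1" for u
    proof -
      have "norm (?r u) \<le> 32 * (B z * u powr (a - b)) / (u * Re z / 2)\<^sup>2 * (cmod (of_real u * k))\<^sup>2"
      proof (rule vholomorphic_remainder_bound[OF open_rhp hol])
        show "ball (of_real u * z) (u * Re z / 2) \<subseteq> rhp"
          using cball_subset_rhp[OF z u(1)] ball_subset_cball by blast
        show "norm (F w) \<le> B z * u powr (a - b)" if "w \<in> ball (of_real u * z) (u * Re z / 2)" for w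
          using F[OF z u(1), of w] u that by (simp add: B_def)
        show "cmod (of_real u * k) < u * Re z / 2 / 2" using k u by (simp add: norm_mult)
      qed
      also have "\<dots> = ?K * u powr (a - b)"
        using u z by (simp add: norm_mult power2_eq_square field_simps)
      finally show ?thesis .
    qed
    have cont: "continuous_on {0<..<1} (\<lambda>u. g u *\<^sub>R ?r u)"
      by (intro continuous_intros g continuous_on_compose2[OF cF(1)] continuous_on_compose2[OF cF(2)])
        (use z zk in \<open>auto intro!: mult_pos_pos simp flip: distrib_left\<close>)
    have "norm (integral {0..1} (\<lambda>u. g u *\<^sub>R ?r u)) \<le> integral {0..1} (\<lambda>u. ?K * (\<bar>g u\<bar> * u powr (a - b)))"
    proof (rule integrable_continuous_dominated(2)[OF cont])
      show "(\<lambda>u. ?K * (\<bar>g u\<bar> * u powr (a - b))) integrable_on {0..1}"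
        using integrable_cmul[OF gi, of ?K] by simp
      show "norm (g u *\<^sub>R ?r u) \<le> ?K * (\<bar>g u\<bar> * u powr (a - b))" if "0 < u" "u < 1" for u
        using mult_left_mono[OF rem[OF that], of "\<bar>g u\<bar>"] by (simp add: mult_ac)
    qed
    also have "\<dots> = C * (cmod k)\<^sup>2" by (simp add: C_def)
    finally show "norm (integral {0..1} (\<lambda>u. g u *\<^sub>R F (of_real u * (z + k))) - integral {0..1} (\<lambda>u. g u *\<^sub>R F (of_real u * z)) - k *\<^sub>C D) \<le> C * (cmod k)\<^sup>2"
      unfolding eq .
  qed (use z in simp)
  then show "has_cderiv (\<lambda>w. integral {0..1} (\<lambda>u. g u *\<^sub>R F (of_real u * w)))
      (integral {0..1} (\<lambda>u. (g u * u) *\<^sub>R vderiv F (of_real u * z))) z"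
    unfolding D_def .
qed

section \<open>Derivatives of fractional integrals\<close>

lemma not_nonpos_Reals_rhp: "0 < Re z \<Longrightarrow> z \<notin> \<real>\<^sub>\<le>\<^sub>0"
  by (auto simp: complex_nonpos_Reals_iff)

lemma frac_int_has_cderiv:
  fixes F :: "complex \<Rightarrow> 'b::complex_banach"
  assumes hol: "vholomorphic_on F rhp" and gb: "growth_bound F a b" and ab: "a \<ge> 0" "b \<ge> 0" "a - b > -1"
    and q: "q > 0" and z: "0 < Re z"
  shows "(\<lambda>u. ((1 - u) powr (q - 1) * u) *\<^sub>R vderiv F (of_real u * z)) integrable_on {0..1}"
    and "has_cderiv (frac_int q F) ((z powr of_real (q - 1) / of_real (Gamma q)) *\<^sub>C
      (q *\<^sub>R integral {0..1} (\<lambda>u. (1 - u) powr (q - 1) *\<^sub>R F (of_real u * z)) +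
       z *\<^sub>C integral {0..1} (\<lambda>u. ((1 - u) powr (q - 1) * u) *\<^sub>R vderiv F (of_real u * z)))) z"
proof -
  let ?I = "\<lambda>w. integral {0..1} (\<lambda>u. (1 - u) powr (q - 1) *\<^sub>R F (of_real u * w))"
  let ?I' = "integral {0..1} (\<lambda>u. ((1 - u) powr (q - 1) * u) *\<^sub>R vderiv F (of_real u * z))"
  have gi: "(\<lambda>u. \<bar>(1 - u) powr (q - 1)\<bar> * u powr (a - b)) integrable_on {0..1}"
    using frac_weight_integrable[OF ab(3) q] by blast
  note ray = ray_integral_has_cderiv[OF hol gb ab(1,2) z frac_weight_continuous gi]
  show "(\<lambda>u. ((1 - u) powr (q - 1) * u) *\<^sub>R vderiv F (of_real u * z)) integrable_on {0..1}" by (rule ray(1))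
  have "z \<noteq> 0" using z by auto
  have "((\<lambda>w. w powr of_real q) has_field_derivative of_real q * z powr (of_real q - 1)) (at z)"
    by (rule has_field_derivative_powr[OF not_nonpos_Reals_rhp[OF z]])
  from DERIV_cdivide[OF this, of "of_real (Gamma q)"]
  have "((\<lambda>w. w powr of_real q / of_real (Gamma q)) has_field_derivative
      of_real q * z powr of_real (q - 1) / of_real (Gamma q)) (at z)" by simp
  from has_cderiv_scaleC[OF this ray(2)]
  have "has_cderiv (frac_int q F) ((of_real q * z powr of_real (q - 1) / of_real (Gamma q)) *\<^sub>C ?I z +
      (z powr of_real q / of_real (Gamma q)) *\<^sub>C ?I') z"
    by (simp add: frac_int_def[abs_def])
  moreover have "z powr of_real q = z powr of_real (q - 1) * z"
    using \<open>z \<noteq> 0\<close> by (simp add: powr_diff)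
  ultimately show "has_cderiv (frac_int q F) ((z powr of_real (q - 1) / of_real (Gamma q)) *\<^sub>C (q *\<^sub>R ?I z + z *\<^sub>C ?I')) z"
    by (simp add: scaleC_add_right scaleC_scaleC mult_ac flip: scaleC_of_real)
qed

lemma vholomorphic_frac_int:
  assumes "vholomorphic_on F rhp" "growth_bound F a b" "a \<ge> 0" "b \<ge> 0" "a - b > -1" "q > 0"
  shows "vholomorphic_on (frac_int q F) rhp"
  unfolding vholomorphic_on_open[OF open_rhp]
proof
  fix z assume "z \<in> rhp"
  then have "0 < Re z" by simp
  note d = frac_int_has_cderiv(2)[OF assms this]
  show "has_cderiv (frac_int q F) (vderiv (frac_int q F) z) z" unfolding vderiv_eq[OF d] by (rule d)
qed

text \<open>The function differentiated along the ray is u \<psi>(u) F(uz). The additional factor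
  \<open>u\<close> makes it vanish at 0, since u^(p + 1) tends to 0, and it matches the factor
  \<open>u\<close> that differentiating F(uz) in z produces.\<close>

lemma ray_by_parts:
  fixes F :: "complex \<Rightarrow> 'b::complex_banach"
  assumes hol: "vholomorphic_on F rhp" and z: "0 < Re z" and p: "p > -1" and c: "0 < c"
    and B: "\<And>u. 0 < u \<Longrightarrow> u \<le> c \<Longrightarrow> norm (F (of_real u * z)) \<le> B * u powr p"
    and \<psi>: "continuous_on {0..c} \<psi>"
    and \<psi>': "\<And>u. 0 < u \<Longrightarrow> u < c \<Longrightarrow> (\<psi> has_real_derivative \<psi>' u) (at u)"
  shows "((\<lambda>u. (\<psi> u + u * \<psi>' u) *\<^sub>R F (of_real u * z) + (u * \<psi> u) *\<^sub>R (z *\<^sub>C vderiv F (of_real u * z)))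
    has_integral (c * \<psi> c) *\<^sub>R F (of_real c * z)) {0..c}"
proof -
  let ?h = "\<lambda>u. (u * \<psi> u) *\<^sub>R F (of_real u * z)"
  have "((\<lambda>u. (\<psi> u + u * \<psi>' u) *\<^sub>R F (of_real u * z) + (u * \<psi> u) *\<^sub>R (z *\<^sub>C vderiv F (of_real u * z)))
    has_integral ?h c - ?h 0) {0..c}"
  proof (rule fundamental_theorem_of_calculus_interior)
    show "0 \<le> c" using c by simp
    fix u assume u: "u \<in> {0<..<c}"
    have "has_cderiv F (vderiv F (0 + of_real u * z)) (0 + of_real u * z)"
      using hol u z by (auto simp: vholomorphic_on_open[OF open_rhp])
    from has_cderiv_line[OF this]
    have v: "((\<lambda>u. F (of_real u * z)) has_vector_derivative z *\<^sub>C vderiv F (of_real u * z)) (at u)" by simp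
    have r: "((\<lambda>u. u * \<psi> u) has_real_derivative \<psi> u + u * \<psi>' u) (at u)"
      using \<psi>'[of u] u by (auto intro!: derivative_eq_intros)
    show "(?h has_vector_derivative (\<psi> u + u * \<psi>' u) *\<^sub>R F (of_real u * z) +
        (u * \<psi> u) *\<^sub>R (z *\<^sub>C vderiv F (of_real u * z))) (at u)"
      by (subst add.commute) (rule has_vector_derivative_scaleR[OF r v])
  next
    have "compact (\<psi> ` {0..c})" by (intro compact_continuous_image \<psi>) simp
    then obtain K where K: "\<And>u. u \<in> {0..c} \<Longrightarrow> \<bar>\<psi> u\<bar> \<le> K"
      using compact_imp_bounded bounded_iff by (metis image_eqI real_norm_def)
    have "continuous (at u within {0..c}) ?h" if u: "u \<in> {0..c}" for u
    proof (cases "u = 0")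
      case False
      have "continuous_on {0<..c} ?h"
        using z by (intro continuous_intros continuous_on_subset[OF \<psi>]
            continuous_on_compose2[OF vholomorphic_on_imp_continuous_on[OF hol]]) auto
      then have "continuous (at u within {0<..c}) ?h"
        using u False by (simp add: continuous_on_eq_continuous_within)
      moreover have "at u within {0<..c} = at u within {0..c}"
        using u False by (intro at_within_nhd[of _ "{0<..}"]) auto
      ultimately show ?thesis by (simp add: continuous_within)
    next
      case True
      have "(?h \<longlongrightarrow> 0) (at 0 within {0..c})"
      proof (rule Lim_null_comparison)
        have "((\<lambda>u. u powr (p + 1)) \<longlongrightarrow> 0) (at 0 within {0..c})"
        proof (rule tendsto_zero_powrI[OF tendsto_ident_at tendsto_const])
          show "\<forall>\<^sub>F x in at 0 within {0..c}. 0 \<le> x"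
            unfolding eventually_at_topological by (intro exI[of _ UNIV]) auto
        qed (use p in simp)
        from tendsto_mult_left[OF this, of "K * B"]
        show "((\<lambda>u. K * B * u powr (p + 1)) \<longlongrightarrow> 0) (at 0 within {0..c})" by simp
        show "\<forall>\<^sub>F u in at 0 within {0..c}. norm (?h u) \<le> K * B * u powr (p + 1)"
          unfolding eventually_at_topological
        proof (intro exI[of _ UNIV] conjI ballI impI)
          fix u assume "u \<noteq> 0" "u \<in> {0..c}"
          then have u: "0 < u" "u \<le> c" by auto
          have "norm (?h u) = u * (\<bar>\<psi> u\<bar> * norm (F (of_real u * z)))"
            using u by (simp add: abs_mult)
          also have "\<dots> \<le> u * (K * (B * u powr p))"
            using K[of u] B[OF u] u by (intro mult_left_mono mult_mono) (auto intro: order_trans[OF abs_ge_zero])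
          also have "\<dots> = K * B * u powr (p + 1)" using u by (simp add: powr_add)
          finally show "norm (?h u) \<le> K * B * u powr (p + 1)" .
        qed auto
      qed
      then show ?thesis using True by (simp add: continuous_within)
    qed
    then show "continuous_on {0..c} ?h" by (simp add: continuous_on_eq_continuous_within)
  qed
  then show ?thesis by simp
qed

text \<open>This is \<psi> + u \<psi>' for \<psi>(u) = (1 - u)^(q - 1), rewritten with u = 1 - (1 -
  u). At u = 1 it relies on \<open>0 powr s\<close> being 0.\<close>

lemma frac_kernel_identity:
  assumes "u \<le> (1::real)"
  shows "(1 - u) powr (q - 1) + u * (- ((q - 1) * (1 - u) powr (q - 2))) =
    q * (1 - u) powr (q - 1) - (q - 1) * (1 - u) powr (q - 2)"
proof -
  have E: "(1 - u) powr (q - 1) = (1 - u) * (1 - u) powr (q - 2)"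
    using assms powr_mult_base[of "1 - u" "q - 2"] by (cases "u = 1") auto
  show ?thesis unfolding E by (simp add: algebra_simps)
qed

text \<open>Integration by parts with \<psi>(u) = (1 - u)^(q - 1), whose boundary value at 1
  vanishes for q > 1, turns q I + z I' into (q - 1) K, and \<Gamma>(q) = (q - 1) \<Gamma>(q - 1)
  adjusts the constant.\<close>

lemma frac_int_has_cderiv_gt1:
  fixes F :: "complex \<Rightarrow> 'b::complex_banach"
  assumes hol: "vholomorphic_on F rhp" and gb: "growth_bound F a b" and ab: "a \<ge> 0" "b \<ge> 0" "a - b > -1"
    and q: "q > 1" and z: "0 < Re z"
  shows "has_cderiv (frac_int q F) (frac_int (q - 1) F z) z"
proof -
  obtain M \<omega> where "M \<ge> 0" "\<omega> \<ge> 0" and F: "\<And>z u. 0 < Re z \<Longrightarrow> 0 < u \<Longrightarrow> u \<le> 1 \<Longrightarrow> norm (F (of_real u * z)) \<le>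
      M * exp (\<omega> * cmod z) * (cmod z powr a * Re z powr (- b)) * u powr (a - b)"
    by (rule growth_bound_ray[OF gb ab(1,2)]) (rule that)
  have q0: "q > 0" "q - 1 > 0" using q by auto
  note der = frac_int_has_cderiv[OF hol gb ab q0(1) z]
  let ?I = "integral {0..1} (\<lambda>u. (1 - u) powr (q - 1) *\<^sub>R F (of_real u * z))"
  let ?K = "integral {0..1} (\<lambda>u. (1 - u) powr (q - 1 - 1) *\<^sub>R F (of_real u * z))"
  let ?I' = "integral {0..1} (\<lambda>u. ((1 - u) powr (q - 1) * u) *\<^sub>R vderiv F (of_real u * z))"
  have parts: "((\<lambda>u. ((1 - u) powr (q - 1) + u * (- ((q - 1) * (1 - u) powr (q - 2)))) *\<^sub>R F (of_real u * z) +
      (u * (1 - u) powr (q - 1)) *\<^sub>R (z *\<^sub>C vderiv F (of_real u * z)))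
    has_integral (1 * (1 - 1) powr (q - 1)) *\<^sub>R F (of_real 1 * z)) {0..1}"
  proof (rule ray_by_parts[OF hol z ab(3) zero_less_one F[OF z]])
    show "continuous_on {0..1} (\<lambda>u. (1 - u) powr (q - 1))"
      using q by (intro continuous_on_powr' continuous_intros) auto
    show "((\<lambda>u. (1 - u) powr (q - 1)) has_real_derivative - ((q - 1) * (1 - u) powr (q - 2))) (at u)"
      if "0 < u" "u < 1" for u
      using that by (auto intro!: derivative_eq_intros)
  qed
  have I: "((\<lambda>u. (1 - u) powr (q - 1) *\<^sub>R F (of_real u * z)) has_integral ?I) {0..1}"
    by (rule integrable_integral[OF frac_integrable[OF hol gb ab q0(1) z]])
  have K: "((\<lambda>u. (1 - u) powr (q - 1 - 1) *\<^sub>R F (of_real u * z)) has_integral ?K) {0..1}"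
    by (rule integrable_integral[OF frac_integrable[OF hol gb ab q0(2) z]])
  have I': "((\<lambda>u. z *\<^sub>C (((1 - u) powr (q - 1) * u) *\<^sub>R vderiv F (of_real u * z))) has_integral z *\<^sub>C ?I') {0..1}"
    using has_integral_linear[OF integrable_integral[OF der(1)] bounded_linear_scaleC[of z]] by (simp add: o_def)
  have "((\<lambda>u. ((1 - u) powr (q - 1) + u * (- ((q - 1) * (1 - u) powr (q - 2)))) *\<^sub>R F (of_real u * z) +
      (u * (1 - u) powr (q - 1)) *\<^sub>R (z *\<^sub>C vderiv F (of_real u * z)))
    has_integral q *\<^sub>R ?I - (q - 1) *\<^sub>R ?K + z *\<^sub>C ?I') {0..1}"
  proof (rule has_integral_eq[rotated])
    show "((\<lambda>u. q *\<^sub>R ((1 - u) powr (q - 1) *\<^sub>R F (of_real u * z)) - (q - 1) *\<^sub>R ((1 - u) powr (q - 1 - 1) *\<^sub>R F (of_real u * z))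
        + z *\<^sub>C (((1 - u) powr (q - 1) * u) *\<^sub>R vderiv F (of_real u * z)))
      has_integral q *\<^sub>R ?I - (q - 1) *\<^sub>R ?K + z *\<^sub>C ?I') {0..1}"
      by (intro has_integral_add has_integral_diff has_integral_cmul I K I')
    fix u :: real assume u: "u \<in> {0..1}"
    from u have "u \<le> 1" by simp
    note frac_kernel_identity[OF this, of q]
    then show "q *\<^sub>R ((1 - u) powr (q - 1) *\<^sub>R F (of_real u * z)) - (q - 1) *\<^sub>R ((1 - u) powr (q - 1 - 1) *\<^sub>R F (of_real u * z))
        + z *\<^sub>C (((1 - u) powr (q - 1) * u) *\<^sub>R vderiv F (of_real u * z)) =
      ((1 - u) powr (q - 1) + u * (- ((q - 1) * (1 - u) powr (q - 2)))) *\<^sub>R F (of_real u * z) +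
      (u * (1 - u) powr (q - 1)) *\<^sub>R (z *\<^sub>C vderiv F (of_real u * z))"
      by (simp add: scaleR_diff_left scaleC_scaleR mult.commute)
  qed
  from has_integral_unique[OF this parts] have "q *\<^sub>R ?I + z *\<^sub>C ?I' = (q - 1) *\<^sub>R ?K"
    by (simp add: algebra_simps)
  moreover have "Gamma q = (q - 1) * Gamma (q - 1)"
    using Gamma_plus1[of "q - 1"] q0 by (force simp: nonpos_Ints_def)
  ultimately have "(z powr of_real (q - 1) / of_real (Gamma q)) *\<^sub>C (q *\<^sub>R ?I + z *\<^sub>C ?I') =
      frac_int (q - 1) F z"
    unfolding frac_int_def using q0 by (simp add: scaleC_scaleC flip: scaleC_of_real)
  with der(2) show ?thesis by simp
qed

lemma frac_int_has_cderiv_1: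
  fixes F :: "complex \<Rightarrow> 'b::complex_banach"
  assumes hol: "vholomorphic_on F rhp" and gb: "growth_bound F a b" and ab: "a \<ge> 0" "b \<ge> 0" "a - b > -1"
    and z: "0 < Re z"
  shows "has_cderiv (frac_int 1 F) (F z) z"
proof -
  obtain M \<omega> where "M \<ge> 0" "\<omega> \<ge> 0" and F: "\<And>z u. 0 < Re z \<Longrightarrow> 0 < u \<Longrightarrow> u \<le> 1 \<Longrightarrow> norm (F (of_real u * z)) \<le>
      M * exp (\<omega> * cmod z) * (cmod z powr a * Re z powr (- b)) * u powr (a - b)"
    by (rule growth_bound_ray[OF gb ab(1,2)]) (rule that)
  note der = frac_int_has_cderiv[OF hol gb ab zero_less_one z]
  let ?I = "integral {0..1} (\<lambda>u. (1 - u) powr (1 - 1) *\<^sub>R F (of_real u * z))"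
  let ?I' = "integral {0..1} (\<lambda>u. ((1 - u) powr (1 - 1) * u) *\<^sub>R vderiv F (of_real u * z))"
  have "((\<lambda>u. (1 + u * 0) *\<^sub>R F (of_real u * z) + (u * 1) *\<^sub>R (z *\<^sub>C vderiv F (of_real u * z)))
    has_integral (1 * 1) *\<^sub>R F (of_real 1 * z)) {0..1}"
    by (rule ray_by_parts[OF hol z ab(3) zero_less_one F[OF z]]) (auto intro!: derivative_eq_intros)
  then have parts: "((\<lambda>u. F (of_real u * z) + u *\<^sub>R (z *\<^sub>C vderiv F (of_real u * z))) has_integral F z) {0..1}"
    by simp
  have I: "((\<lambda>u. (1 - u) powr (1 - 1) *\<^sub>R F (of_real u * z)) has_integral ?I) {0..1}"
    by (rule integrable_integral[OF frac_integrable[OF hol gb ab zero_less_one z]])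
  have I': "((\<lambda>u. z *\<^sub>C (((1 - u) powr (1 - 1) * u) *\<^sub>R vderiv F (of_real u * z))) has_integral z *\<^sub>C ?I') {0..1}"
    using has_integral_linear[OF integrable_integral[OF der(1)] bounded_linear_scaleC[of z]] by (simp add: o_def)
  \<comment> \<open>The weight \<open>(1 - u) powr 0\<close> is 1 except at u = 1, where
    \<open>0 powr 0\<close> is 0; hence the exceptional point.\<close>
  have "((\<lambda>u. F (of_real u * z) + u *\<^sub>R (z *\<^sub>C vderiv F (of_real u * z))) has_integral ?I + z *\<^sub>C ?I') {0..1}"
    by (rule has_integral_spike_finite[OF _ _ has_integral_add[OF I I'], of "{1}"]) (auto simp: scaleC_scaleR)
  from has_integral_unique[OF this parts] have eq: "?I + z *\<^sub>C ?I' = F z" .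
  have "z powr of_real (1 - 1) / of_real (Gamma 1) = 1" using z by auto
  then show ?thesis using der(2) unfolding scaleR_one eq by simp
qed

text \<open>Only the part of the ray within distance \<open>Re z / 2\<close> of \<open>z\<close> is estimated through \<open>vderiv F\<close>; on the
  rest an integration by parts moves the derivative onto the kernel.\<close>

lemma growth_bound_vderiv_frac_int_less1:
  fixes F :: "complex \<Rightarrow> 'b::complex_banach"
  assumes hol: "vholomorphic_on F rhp" and gb: "growth_bound F a b" and ab: "a \<ge> 0" "b \<ge> 0" "a - b > -1"
    and q: "0 < q" "q < 1"
  shows "growth_bound (vderiv (frac_int q F)) a (b + 1 - q)"
proof -
  define p where "p = a - b"
  have p: "p > -1" using ab by (simp add: p_def)
  obtain M \<omega> where M: "M \<ge> 0" "\<omega> \<ge> 0" and F: "\<And>z u. 0 < Re z \<Longrightarrow> 0 < u \<Longrightarrow> u \<le> 1 \<Longrightarrow> norm (F (of_real u * z)) \<le>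
      M * exp (\<omega> * cmod z) * (cmod z powr a * Re z powr (- b)) * u powr (a - b)"
    by (rule growth_bound_ray[OF gb ab(1,2)]) (rule that)
  have b1: "b + 1 \<ge> 0" using ab(2) by simp
  obtain N \<nu> where N: "N \<ge> 0" "\<nu> \<ge> 0" and F': "\<And>z u. 0 < Re z \<Longrightarrow> 0 < u \<Longrightarrow> u \<le> 1 \<Longrightarrow> norm (vderiv F (of_real u * z)) \<le>
      N * exp (\<nu> * cmod z) * (cmod z powr a * Re z powr (- (b + 1))) * u powr (a - (b + 1))"
    by (rule growth_bound_ray[OF growth_bound_vderiv[OF hol gb ab(1,2)] ab(1) b1]) (rule that)
  have cF: "continuous_on rhp F" "continuous_on rhp (vderiv F)"
    using hol vholomorphic_on_vderiv[OF open_rhp hol] vholomorphic_on_imp_continuous_on by blast+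
  have G: "Gamma q > 0" using q by (intro Gamma_real_pos)
  \<comment> \<open>Bounds u^p for u between 1/2 and 1, whatever the sign of
    \<open>p\<close>.\<close>
  define P where "P = 2 powr \<bar>p\<bar>"
  have P1: "P \<ge> 1" unfolding P_def using powr_mono[of 0 "\<bar>p\<bar>" 2] by simp
  have uP: "u powr p \<le> P" if "1/2 \<le> u" "u \<le> 1" for u
  proof -
    have "u powr p \<le> u powr (- \<bar>p\<bar>)" using that by (intro powr_mono') auto
    also have "\<dots> \<le> (1/2) powr (- \<bar>p\<bar>)" using that by (intro powr_mono2') auto
    also have "\<dots> = P" by (simp add: P_def powr_divide powr_minus_divide)
    finally show ?thesis .
  qed
  \<comment> \<open>The estimates \<open>t1\<close>, \<open>t2\<close> and \<open>t3\<close> below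
    contribute 4 / (p + 1) + P, P and P.\<close>
  define C1 where "C1 = 4 / (p + 1) + 3 * P"
  have C1: "C1 \<ge> 0" using p P1 by (simp add: C1_def)
  show ?thesis
  proof (rule growth_boundI[of "(2 * C1 * M + P / q * N) / Gamma q" "\<omega> + \<nu>"])
    fix z :: complex assume z: "0 < Re z"
    define x where "x = Re z"
    define r where "r = cmod z"
    \<comment> \<open>The piece of the ray between cz and z has length \<delta> |z| = Re z / 2.
      Since \<delta> is at most 1/2, the cut \<open>c\<close> is at least 1/2.\<close>
    define \<delta> where "\<delta> = x / (2 * r)"
    define c where "c = 1 - \<delta>"
    have x: "0 < x" "x \<le> r" using z complex_Re_le_cmod[of z] by (auto simp: x_def r_def)
    have r: "r > 0" using x by linarith
    have \<delta>: "0 < \<delta>" "\<delta> \<le> 1/2" using x r by (auto simp: \<delta>_def divide_simps)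
    have c: "1/2 \<le> c" "c < 1" "1 - c = \<delta>" using \<delta> by (auto simp: c_def)
    define B where "B = M * exp (\<omega> * r) * (r powr a * x powr (- b))"
    define B' where "B' = N * exp (\<nu> * r) * (r powr a * x powr (- (b + 1)))"
    have B: "B \<ge> 0" "B' \<ge> 0" using M N by (simp_all add: B_def B'_def)
    have FB: "norm (F (of_real u * z)) \<le> B * u powr p" if "0 < u" "u \<le> 1" for u
      using F[OF z that] by (simp add: B_def p_def x_def r_def)
    have FB': "norm (vderiv F (of_real u * z)) \<le> B' * u powr (p - 1)" if "0 < u" "u \<le> 1" for u
      using F'[OF z that] by (simp add: B'_def p_def x_def r_def diff_diff_eq)
    define E where "E = \<delta> powr (q - 1)"
    have E1: "E \<ge> 1" unfolding E_def using powr_mono'[of "q - 1" 0 \<delta>] \<delta> q by simp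
    have \<delta>E: "\<delta> powr q \<le> E" unfolding E_def using \<delta> q by (intro powr_mono') auto
    note der = frac_int_has_cderiv[OF hol gb ab q(1) z]
    define g where "g u = (1 - u) powr (q - 1) *\<^sub>R F (of_real u * z)" for u
    \<comment> \<open>Integration by parts lowers the kernel exponent to q - 2 < -1, which is not
      integrable at u = 1; therefore \<open>k\<close> is integrated only up to
      \<open>c\<close>.\<close>
    define k where "k u = (1 - u) powr (q - 2) *\<^sub>R F (of_real u * z)" for u
    define g' where "g' u = ((1 - u) powr (q - 1) * u) *\<^sub>R vderiv F (of_real u * z)" for u
    have gI: "g integrable_on {0..1}" unfolding g_def by (rule frac_integrable[OF hol gb ab q(1) z])
    have g'I: "g' integrable_on {0..1}" unfolding g'_def by (rule der(1))
    have sub: "{0..c} \<subseteq> {0..1}" "{c..1} \<subseteq> {0..1}" using c by auto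
    note gI1 = integrable_on_subinterval[OF gI sub(1)] and gI2 = integrable_on_subinterval[OF gI sub(2)]
    note g'I1 = integrable_on_subinterval[OF g'I sub(1)] and g'I2 = integrable_on_subinterval[OF g'I sub(2)]
    have powr1: "((\<lambda>u. u powr p) has_integral c powr (p + 1) / (p + 1)) {0..c}"
      using has_integral_powr_from_0[OF p, of c] c by simp
    have powr2: "((\<lambda>u. (1 - u) powr (s - 1)) has_integral ((1 - c') powr s - (1 - d) powr s) / s) {c'..d}"
      if "s \<noteq> 0" "c' \<le> d" "d < 1" for s c' d :: real
    proof -
      have "((\<lambda>u. (1 - u) powr (s - 1)) has_integral (- ((1 - d) powr s) / s) - (- ((1 - c') powr s) / s)) {c'..d}"
      proof (rule fundamental_theorem_of_calculus[OF that(2)])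
        fix u assume "u \<in> {c'..d}"
        then have "((\<lambda>u. - ((1 - u) powr s) / s) has_real_derivative (1 - u) powr (s - 1)) (at u)"
          using that by (auto intro!: derivative_eq_intros)
        then show "((\<lambda>u. - ((1 - u) powr s) / s) has_vector_derivative (1 - u) powr (s - 1)) (at u within {c'..d})"
          by (simp add: has_real_derivative_iff_has_vector_derivative has_vector_derivative_at_within)
      qed
      then show ?thesis by (simp add: diff_divide_distrib)
    qed
    have powr3: "((\<lambda>u. (1 - u) powr (q - 1)) has_integral \<delta> powr q / q) {c..1}"
    proof -
      have "((\<lambda>u. (1 - u) powr (q - 1)) has_integral (- ((1 - 1) powr q) / q) - (- ((1 - c) powr q) / q)) {c..1}"
      proof (rule fundamental_theorem_of_calculus_interior)
        show "continuous_on {c..1} (\<lambda>u. - ((1 - u) powr q) / q)"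
          using q by (intro continuous_intros continuous_on_powr') auto
        fix u assume "u \<in> {c<..<1}"
        then have "((\<lambda>u. - ((1 - u) powr q) / q) has_real_derivative (1 - u) powr (q - 1)) (at u)"
          using q by (auto intro!: derivative_eq_intros)
        then show "((\<lambda>u. - ((1 - u) powr q) / q) has_vector_derivative (1 - u) powr (q - 1)) (at u)"
          by (simp add: has_real_derivative_iff_has_vector_derivative)
      qed (use c in simp)
      then show ?thesis using c by simp
    qed
    have kdom: "((\<lambda>u. B * (4 * u powr p + P * (1 - u) powr ((q - 1) - 1))) has_integral
        B * (4 * (c powr (p + 1) / (p + 1)) + P * (((1 - 0) powr (q - 1) - (1 - c) powr (q - 1)) / (q - 1)))) {0..c}"
      using c q by (intro has_integral_mult_right has_integral_add powr1 powr2) auto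
    have kle: "norm (k u) \<le> B * (4 * u powr p + P * (1 - u) powr ((q - 1) - 1))" if u: "0 < u" "u < c" for u
    proof -
      have "(1 - u) powr (q - 2) * u powr p \<le> 4 * u powr p + P * (1 - u) powr (q - 2)"
      \<comment> \<open>Each singular factor is bounded where the other one is large: the kernel by
        (1/2)^(-2) = 4 on the left half, u^p by \<open>P\<close> on the right half.\<close>
      proof (cases "u \<le> 1/2")
        case True
        have "(1 - u) powr (q - 2) \<le> (1/2) powr (q - 2)" using True q by (intro powr_mono2') auto
        also have "\<dots> \<le> (1/2) powr (- 2)" using q by (intro powr_mono') auto
        also have "\<dots> = 4" by (simp add: powr_minus powr_numeral power2_eq_square)
        finally have "(1 - u) powr (q - 2) * u powr p \<le> 4 * u powr p" by (intro mult_right_mono) auto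
        then show ?thesis using P1 by (simp add: add_increasing2)
      next
        case False
        then have "(1 - u) powr (q - 2) * u powr p \<le> (1 - u) powr (q - 2) * P"
          using u c by (intro mult_left_mono uP) auto
        then show ?thesis by (simp add: mult.commute add_increasing)
      qed
      then have "(1 - u) powr (q - 2) * (B * u powr p) \<le> B * (4 * u powr p + P * (1 - u) powr (q - 2))"
        using mult_left_mono[OF _ B(1)] by (simp only: mult.left_commute)
      moreover have "norm (k u) \<le> (1 - u) powr (q - 2) * (B * u powr p)"
        unfolding k_def using FB[of u] u c by (simp add: mult_left_mono)
      ultimately show ?thesis by simp
    qed
    have kcont: "continuous_on {0<..<c} k"
      unfolding k_def
      by (intro continuous_intros continuous_on_compose2[OF cF(1)]) (use z c in \<open>auto intro!: mult_pos_pos\<close>)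
    have kI: "k integrable_on {0..c}"
      using integrable_continuous_dominated(1)[OF kcont _ kle] kdom by blast
    have "norm (integral {0..c} k) \<le> integral {0..c} (\<lambda>u. B * (4 * u powr p + P * (1 - u) powr ((q - 1) - 1)))"
      using integrable_continuous_dominated(2)[OF kcont _ kle] kdom by blast
    also have "\<dots> = B * (4 * (c powr (p + 1) / (p + 1)) + P * ((E - 1) / (1 - q)))"
    proof -
      have "((1 - 0) powr (q - 1) - (1 - c) powr (q - 1)) / (q - 1) = (E - 1) / (1 - q)"
        unfolding c(3) E_def[symmetric] using q by (simp add: divide_simps) (simp add: algebra_simps)
      then show ?thesis unfolding integral_unique[OF kdom] by simp
    qed
    \<comment> \<open>The factor 1 - q in front of the integral of \<open>k\<close> cancels the
      denominator that comes from integrating (1 - u)^(q - 2).\<close>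
    finally have "(1 - q) * norm (integral {0..c} k) \<le> (1 - q) * (B * (4 * (c powr (p + 1) / (p + 1)) + P * ((E - 1) / (1 - q))))"
      using q by (intro mult_left_mono) auto
    also have "\<dots> = B * ((1 - q) * (4 * c powr (p + 1) / (p + 1)) + P * (E - 1))"
      using q by (simp add: field_simps)
    also have "\<dots> \<le> B * (4 / (p + 1) * E + P * E)"
    proof (intro mult_left_mono B add_mono)
      have "c powr (p + 1) \<le> 1" using c p by (intro powr_le1) auto
      then have "(1 - q) * (4 * c powr (p + 1) / (p + 1)) \<le> 1 * (4 * 1 / (p + 1))"
        using q p by (intro mult_mono divide_right_mono) auto
      also have "\<dots> \<le> 4 / (p + 1) * E" using E1 p mult_left_mono[of 1 E "4 / (p + 1)"] by simp
      finally show "(1 - q) * (4 * c powr (p + 1) / (p + 1)) \<le> 4 / (p + 1) * E" .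
    qed (use P1 in auto)
    finally have t1: "norm ((q - 1) *\<^sub>R integral {0..c} k) \<le> B * (4 / (p + 1) * E + P * E)"
      using q by simp
    have gle: "norm (g u) \<le> (B * P) * (1 - u) powr (q - 1)" if u: "c \<le> u" "u \<le> 1" for u
    proof -
      have "norm (g u) \<le> (1 - u) powr (q - 1) * (B * u powr p)"
        unfolding g_def using FB[of u] u c by (simp add: mult_left_mono)
      also have "\<dots> \<le> (1 - u) powr (q - 1) * (B * P)"
        using u c B by (intro mult_left_mono uP) auto
      finally show ?thesis by (simp add: mult.commute)
    qed
    have "norm (integral {c..1} g) \<le> integral {c..1} (\<lambda>u. (B * P) * (1 - u) powr (q - 1))"
      by (rule Henstock_Kurzweil_Integration.integral_norm_bound_integral[OF gI2])
        (use gle has_integral_mult_right[OF powr3, of "B * P"] in auto)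
    also have "\<dots> = B * P * (\<delta> powr q / q)" by (rule integral_unique[OF has_integral_mult_right[OF powr3]])
    finally have "q * norm (integral {c..1} g) \<le> q * (B * P * (\<delta> powr q / q))" using q by (intro mult_left_mono) auto
    also have "\<dots> = B * P * \<delta> powr q" using q by simp
    also have "\<dots> \<le> B * (P * E)" using \<delta>E B P1 by (simp add: mult_left_mono mult.assoc)
    finally have t2: "norm (q *\<^sub>R integral {c..1} g) \<le> B * (P * E)" using q by simp
    have "norm ((c * (1 - c) powr (q - 1)) *\<^sub>R F (of_real c * z)) = c * E * norm (F (of_real c * z))"
      using c by (simp add: E_def abs_mult)
    also have "\<dots> \<le> 1 * E * (B * P)"
    proof (intro mult_mono)
      have "norm (F (of_real c * z)) \<le> B * c powr p" using c by (intro FB) auto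
      also have "\<dots> \<le> B * P" using c B by (intro mult_left_mono uP) auto
      finally show "norm (F (of_real c * z)) \<le> B * P" .
    qed (use c E1 in auto)
    finally have t3: "norm ((c * (1 - c) powr (q - 1)) *\<^sub>R F (of_real c * z)) \<le> B * (P * E)" by (simp add: mult_ac)
    have g'le: "norm (g' u) \<le> (B' * P) * (1 - u) powr (q - 1)" if u: "c \<le> u" "u \<le> 1" for u
    proof -
      have u0: "u > 0" using u c by linarith
      have "norm (g' u) \<le> ((1 - u) powr (q - 1) * u) * (B' * u powr (p - 1))"
        unfolding g'_def using FB'[of u] u u0 by (simp add: mult_left_mono abs_mult)
      also have "\<dots> = (1 - u) powr (q - 1) * (B' * u powr p)" using u0 by (simp add: powr_diff)
      also have "\<dots> \<le> (1 - u) powr (q - 1) * (B' * P)"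
        using u c B by (intro mult_left_mono uP) auto
      finally show ?thesis by (simp add: mult.commute)
    qed
    have "norm (integral {c..1} g') \<le> integral {c..1} (\<lambda>u. (B' * P) * (1 - u) powr (q - 1))"
      by (rule Henstock_Kurzweil_Integration.integral_norm_bound_integral[OF g'I2])
        (use g'le has_integral_mult_right[OF powr3, of "B' * P"] in auto)
    also have "\<dots> = B' * P * (\<delta> powr q / q)" by (rule integral_unique[OF has_integral_mult_right[OF powr3]])
    finally have t4: "norm (z *\<^sub>C integral {c..1} g') \<le> r * (B' * P * (\<delta> powr q / q))"
      unfolding norm_scaleC r_def[symmetric] using r by (intro mult_left_mono) auto
    have parts: "((\<lambda>u. ((1 - u) powr (q - 1) + u * (- ((q - 1) * (1 - u) powr (q - 2)))) *\<^sub>R F (of_real u * z) +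
        (u * (1 - u) powr (q - 1)) *\<^sub>R (z *\<^sub>C vderiv F (of_real u * z)))
      has_integral (c * (1 - c) powr (q - 1)) *\<^sub>R F (of_real c * z)) {0..c}"
    proof (rule ray_by_parts[OF hol z p])
      show "norm (F (of_real u * z)) \<le> B * u powr p" if "0 < u" "u \<le> c" for u
        using that c by (intro FB) auto
      show "continuous_on {0..c} (\<lambda>u. (1 - u) powr (q - 1))"
        using c by (intro continuous_intros) auto
      show "((\<lambda>u. (1 - u) powr (q - 1)) has_real_derivative - ((q - 1) * (1 - u) powr (q - 2))) (at u)"
        if "0 < u" "u < c" for u
        using that c by (auto intro!: derivative_eq_intros)
    qed (use c in simp)
    have I': "((\<lambda>u. z *\<^sub>C g' u) has_integral z *\<^sub>C integral {0..c} g') {0..c}"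
      using has_integral_linear[OF integrable_integral[OF g'I1] bounded_linear_scaleC[of z]] by (simp add: o_def)
    have "((\<lambda>u. ((1 - u) powr (q - 1) + u * (- ((q - 1) * (1 - u) powr (q - 2)))) *\<^sub>R F (of_real u * z) +
        (u * (1 - u) powr (q - 1)) *\<^sub>R (z *\<^sub>C vderiv F (of_real u * z)))
      has_integral q *\<^sub>R integral {0..c} g - (q - 1) *\<^sub>R integral {0..c} k + z *\<^sub>C integral {0..c} g') {0..c}"
    proof (rule has_integral_eq[rotated])
      show "((\<lambda>u. q *\<^sub>R g u - (q - 1) *\<^sub>R k u + z *\<^sub>C g' u)
        has_integral q *\<^sub>R integral {0..c} g - (q - 1) *\<^sub>R integral {0..c} k + z *\<^sub>C integral {0..c} g') {0..c}"
        by (intro has_integral_add has_integral_diff has_integral_cmul integrable_integral gI1 kI I')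
      fix u :: real assume u: "u \<in> {0..c}"
      from u c have "u \<le> 1" by simp
      note frac_kernel_identity[OF this, of q]
      then show "q *\<^sub>R g u - (q - 1) *\<^sub>R k u + z *\<^sub>C g' u =
        ((1 - u) powr (q - 1) + u * (- ((q - 1) * (1 - u) powr (q - 2)))) *\<^sub>R F (of_real u * z) +
        (u * (1 - u) powr (q - 1)) *\<^sub>R (z *\<^sub>C vderiv F (of_real u * z))"
        by (simp add: g_def k_def g'_def scaleR_diff_left scaleC_scaleR mult.commute)
    qed
    from has_integral_unique[OF this parts]
    have low: "q *\<^sub>R integral {0..c} g + z *\<^sub>C integral {0..c} g' =
        (q - 1) *\<^sub>R integral {0..c} k + (c * (1 - c) powr (q - 1)) *\<^sub>R F (of_real c * z)"
      by (simp add: algebra_simps)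
    have c01: "0 \<le> c" "c \<le> 1" using c by auto
    have split: "integral {0..1} g = integral {0..c} g + integral {c..1} g"
      "integral {0..1} g' = integral {0..c} g' + integral {c..1} g'"
      by (simp_all add: Henstock_Kurzweil_Integration.integral_combine[OF c01 gI]
          Henstock_Kurzweil_Integration.integral_combine[OF c01 g'I])
    have "q *\<^sub>R integral {0..1} g + z *\<^sub>C integral {0..1} g' =
        (q *\<^sub>R integral {0..c} g + z *\<^sub>C integral {0..c} g') + q *\<^sub>R integral {c..1} g + z *\<^sub>C integral {c..1} g'"
      by (simp add: split scaleR_add_right scaleC_add_right)
    also have "\<dots> = (q - 1) *\<^sub>R integral {0..c} k + (c * (1 - c) powr (q - 1)) *\<^sub>R F (of_real c * z) +
        q *\<^sub>R integral {c..1} g + z *\<^sub>C integral {c..1} g'" by (simp only: low)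
    also have "norm \<dots> \<le> B * (4 / (p + 1) * E + P * E) + B * (P * E) + B * (P * E) + r * (B' * P * (\<delta> powr q / q))"
      by (intro norm_triangle_mono t1 t2 t3 t4)
    also have "\<dots> = C1 * (B * E) + P / q * (r * B' * \<delta> powr q)"
      by (simp add: C1_def algebra_simps)
    finally have total: "norm (q *\<^sub>R integral {0..1} g + z *\<^sub>C integral {0..1} g') \<le>
      C1 * (B * E) + P / q * (r * B' * \<delta> powr q)" .
    have "vderiv (frac_int q F) z = (z powr of_real (q - 1) / of_real (Gamma q)) *\<^sub>C
        (q *\<^sub>R integral {0..1} g + z *\<^sub>C integral {0..1} g')"
      using vderiv_eq[OF der(2)] by (simp add: g_def[abs_def] g'_def[abs_def])
    then have "norm (vderiv (frac_int q F) z) = r powr (q - 1) / Gamma q *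
        norm (q *\<^sub>R integral {0..1} g + z *\<^sub>C integral {0..1} g')"
      using G by (simp add: norm_scaleC norm_divide norm_powr_real_powr' r_def)
    also have "\<dots> \<le> r powr (q - 1) / Gamma q * (C1 * (B * E) + P / q * (r * B' * \<delta> powr q))"
      using G by (intro mult_left_mono total) auto
    also have "\<dots> = (C1 * (B * (r powr (q - 1) * E)) + P / q * (B' * (r powr (q - 1) * r * \<delta> powr q))) / Gamma q"
      by (simp add: algebra_simps add_divide_distrib)
    \<comment> \<open>Here powers of |z| become powers of Re z: \<delta> was chosen such that |z|
      \<delta> = Re z / 2.\<close>
    also have "r powr (q - 1) * E = (r * \<delta>) powr (q - 1)" using r \<delta> by (simp add: E_def powr_mult)
    also have "r powr (q - 1) * r = r powr q" using r powr_mult_base[of r "q - 1"] by (simp add: mult.commute)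
    also have "r powr q * \<delta> powr q = (r * \<delta>) powr q" using r \<delta> by (simp add: powr_mult)
    also have "r * \<delta> = x / 2" using r by (simp add: \<delta>_def)
    also have "(C1 * (B * (x / 2) powr (q - 1)) + P / q * (B' * (x / 2) powr q)) / Gamma q \<le>
      (C1 * (B * (2 * x powr (q - 1))) + P / q * (B' * x powr q)) / Gamma q"
    proof (intro divide_right_mono add_mono mult_left_mono)
      have "(x / 2) powr (q - 1) = x powr (q - 1) * 2 powr (1 - q)"
        using x by (simp add: powr_divide powr_diff)
      also have "\<dots> \<le> x powr (q - 1) * 2 powr 1" using q by (intro mult_left_mono powr_mono) auto
      finally show "(x / 2) powr (q - 1) \<le> 2 * x powr (q - 1)" by (simp add: mult.commute)
      show "(x / 2) powr q \<le> x powr q" using x q by (intro powr_mono2) auto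
    qed (use B C1 P1 G q in auto)
    also have "B * (2 * x powr (q - 1)) = 2 * M * exp (\<omega> * r) * (r powr a * (x powr (- b) * x powr (q - 1)))"
      by (simp add: B_def mult_ac)
    also have "x powr (- b) * x powr (q - 1) = x powr (- (b + 1 - q))"
      by (simp flip: powr_add add: algebra_simps)
    also have "B' * x powr q = N * exp (\<nu> * r) * (r powr a * (x powr (- (b + 1)) * x powr q))"
      by (simp add: B'_def mult_ac)
    also have "x powr (- (b + 1)) * x powr q = x powr (- (b + 1 - q))"
      by (simp flip: powr_add add: algebra_simps)
    also have "(C1 * (2 * M * exp (\<omega> * r) * (r powr a * x powr (- (b + 1 - q)))) +
        P / q * (N * exp (\<nu> * r) * (r powr a * x powr (- (b + 1 - q))))) / Gamma q \<le>
      (C1 * (2 * M * exp ((\<omega> + \<nu>) * r) * (r powr a * x powr (- (b + 1 - q)))) +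
        P / q * (N * exp ((\<omega> + \<nu>) * r) * (r powr a * x powr (- (b + 1 - q))))) / Gamma q"
      using M N r C1 P1 G q
      by (intro divide_right_mono add_mono mult_left_mono mult_right_mono) (auto simp: distrib_right)
    also have "\<dots> = (2 * C1 * M + P / q * N) / Gamma q * exp ((\<omega> + \<nu>) * r) * (r powr a * x powr (- (b + 1 - q)))"
      by (simp add: algebra_simps)
    finally show "norm (vderiv (frac_int q F) z) \<le> (2 * C1 * M + P / q * N) / Gamma q * exp ((\<omega> + \<nu>) * cmod z) *
        (cmod z powr a * Re z powr (- (b + 1 - q)))" by (simp only: r_def x_def)
  qed (use M N C1 P1 G q in auto)
qed

text \<open>Induction on the size of the order. For q > 1 the derivative is the integral of order q
  - 1, and integrating the inductive bound for the derivative of the latter gives the claim. The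
  trivial bound (a + q - 1, b) has the required degree, and q < b + 1 keeps the resulting exponent b
  + 1 - q positive.\<close>

lemma growth_bound_vderiv_frac_int:
  fixes F :: "complex \<Rightarrow> 'b::complex_banach"
  assumes hol: "vholomorphic_on F rhp" and gb: "growth_bound F a b" and ab: "a \<ge> 0" "b \<ge> 0" "a - b > -1"
    and q: "0 < q" "q < b + 1"
  shows "growth_bound (vderiv (frac_int q F)) a (b + 1 - q)"
proof -
  have main: "growth_bound (vderiv (frac_int q F)) a (b + 1 - q)" if "0 < q" "q < b + 1" "q \<le> real n + 1" for n q
    using that
  proof (induction n arbitrary: q)
    case 0
    show ?case
    proof (cases "q = 1")
      case True
      have "vderiv (frac_int 1 F) z = F z" if "0 < Re z" for z
        by (rule vderiv_eq[OF frac_int_has_cderiv_1[OF hol gb ab that]])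
      then have "growth_bound (vderiv (frac_int 1 F)) a b" by (intro growth_bound_cong[OF gb]) simp
      then show ?thesis using True by simp
    next
      case False
      then show ?thesis using 0 by (intro growth_bound_vderiv_frac_int_less1[OF hol gb ab]) auto
    qed
  next
    case (Suc n)
    show ?case
    proof (cases "q \<le> 1")
      case True
      then show ?thesis using Suc by (intro Suc.IH) auto
    next
      case False
      have q: "q - 1 > 0" "q > 1" using False by auto
      have "growth_bound (vderiv (frac_int (q - 1) F)) a (b + 1 - (q - 1))"
        using Suc q by (intro Suc.IH) auto
      then have 1: "growth_bound (vderiv (frac_int (q - 1) F)) a ((b + 1 - q) + 1)" by (simp add: algebra_simps)
      have "growth_bound (frac_int (q - 1) F) a (b + 1 - q)"
        by (rule growth_bound_integrate[OF vholomorphic_frac_int[OF hol gb ab q(1)] 1 ab(1) _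
              growth_bound_frac_int[OF hol gb ab q(1)]])
          (use Suc ab q in auto)
      then have gb1: "growth_bound (frac_int (q - 1) F) a (b + 1 - q)" .
      have eq: "vderiv (frac_int q F) z = frac_int (q - 1) F z" if "0 < Re z" for z
        by (rule vderiv_eq[OF frac_int_has_cderiv_gt1[OF hol gb ab q(2) that]])
      show ?thesis by (rule growth_bound_cong[OF gb1]) (simp add: eq)
    qed
  qed
  obtain n where "q \<le> real n" using real_arch_simple[of q] by blast
  then show ?thesis using main[of q n] q by simp
qed

section \<open>Laplace transforms of fractional integrals\<close>

lemma nn_integral_gamma_kernel:
  assumes q: "q > 0" and \<mu>: "\<mu> > (0::real)"
  shows "(\<integral>\<^sup>+r. ennreal (indicator {0<..} r * (r powr (q - 1) * exp (- (\<mu> * r)))) \<partial>lborel) =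
    ennreal (Gamma q * \<mu> powr (- q))"
proof -
  let ?k = "\<lambda>r. ennreal (indicator {0<..} r * (r powr (q - 1) * exp (- (\<mu> * r))))"
  have "(\<integral>\<^sup>+r. ?k r \<partial>lborel) = ennreal \<bar>1 / \<mu>\<bar> * (\<integral>\<^sup>+x. ?k (0 + 1 / \<mu> * x) \<partial>lborel)"
    using \<mu> by (intro nn_integral_real_affine) auto
  also have "(\<integral>\<^sup>+x. ?k (0 + 1 / \<mu> * x) \<partial>lborel) =
      (\<integral>\<^sup>+x. ennreal (\<mu> powr (1 - q)) * ennreal (indicator {0..} x * x powr (q - 1) / exp x) \<partial>lborel)"
  proof (rule nn_integral_cong_AE)
    have "AE x in lborel. x \<noteq> (0::real)" by (rule AE_lborel_singleton)
    then show "AE x in lborel. ?k (0 + 1 / \<mu> * x) = ennreal (\<mu> powr (1 - q)) * ennreal (indicator {0..} x * x powr (q - 1) / exp x)"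
    proof eventually_elim
      case (elim x)
      show ?case
      proof (cases "x > 0")
        case True
        then have "(1 / \<mu> * x) powr (q - 1) = \<mu> powr (1 - q) * x powr (q - 1)"
          using \<mu> by (simp add: powr_divide powr_diff)
        then show ?thesis
          using True \<mu> by (simp add: indicator_def exp_minus field_simps flip: ennreal_mult')
      next
        case False
        then show ?thesis using elim \<mu> by (simp add: indicator_def divide_less_0_iff zero_less_divide_iff)
      qed
    qed
  qed
  also have "\<dots> = ennreal (\<mu> powr (1 - q)) * ennreal (Gamma q)"
    by (subst nn_integral_cmult) (auto simp: Gamma_conv_nn_integral_real[OF q])
  also have "ennreal \<bar>1 / \<mu>\<bar> * (ennreal (\<mu> powr (1 - q)) * ennreal (Gamma q)) = ennreal (Gamma q * \<mu> powr (- q))"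
    using \<mu> Gamma_real_pos[OF q]
    by (simp add: powr_diff powr_minus field_simps flip: ennreal_mult')
  finally show ?thesis .
qed

lemma nn_integral_convolution:
  fixes k \<phi> :: "real \<Rightarrow> ennreal"
  assumes [measurable]: "k \<in> borel_measurable borel" "\<phi> \<in> borel_measurable borel"
  shows "(\<integral>\<^sup>+t. (\<integral>\<^sup>+s. k (t - s) * \<phi> s \<partial>lborel) \<partial>lborel) = (\<integral>\<^sup>+s. \<phi> s \<partial>lborel) * (\<integral>\<^sup>+r. k r \<partial>lborel)"
proof -
  have "(\<integral>\<^sup>+t. (\<integral>\<^sup>+s. k (t - s) * \<phi> s \<partial>lborel) \<partial>lborel) = (\<integral>\<^sup>+s. (\<integral>\<^sup>+t. k (t - s) * \<phi> s \<partial>lborel) \<partial>lborel)"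
    by (rule lborel_pair.Fubini') measurable
  also have "\<dots> = (\<integral>\<^sup>+s. \<phi> s * (\<integral>\<^sup>+r. k r \<partial>lborel) \<partial>lborel)"
  proof (rule nn_integral_cong)
    fix s
    have "(\<integral>\<^sup>+t. k (t - s) * \<phi> s \<partial>lborel) = (\<integral>\<^sup>+t. k (t - s) \<partial>lborel) * \<phi> s"
      by (rule nn_integral_multc) measurable
    also have "(\<integral>\<^sup>+t. k (t - s) \<partial>lborel) = (\<integral>\<^sup>+r. k r \<partial>lborel)"
      using nn_integral_real_affine[of k 1 "- s"] by simp
    finally show "(\<integral>\<^sup>+t. k (t - s) * \<phi> s \<partial>lborel) = \<phi> s * (\<integral>\<^sup>+r. k r \<partial>lborel)" by (simp add: mult.commute)
  qed
  also have "\<dots> = (\<integral>\<^sup>+s. \<phi> s \<partial>lborel) * (\<integral>\<^sup>+r. k r \<partial>lborel)"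
    by (rule nn_integral_multc) measurable
  finally show ?thesis .
qed

text \<open>The Riemann-Liouville integral on the half-line, with the substitution s = ut. It is
  applied to single orbits and to their images under functionals, where the Laplace transform can be
  computed by scalar means.\<close>

definition frac_ray :: "real \<Rightarrow> (real \<Rightarrow> 'b::banach) \<Rightarrow> real \<Rightarrow> 'b" where
  "frac_ray q f t = (t powr q / Gamma q) *\<^sub>R integral {0..1} (\<lambda>u. (1 - u) powr (q - 1) *\<^sub>R f (u * t))"

lemma frac_ray_integrable:
  fixes f :: "real \<Rightarrow> 'b::banach"
  assumes f: "continuous_on {0<..} f" and K: "\<And>t. 0 < t \<Longrightarrow> norm (f t) \<le> K * exp (\<omega> * t) * t powr c"
    and c: "c > -1" and q: "q > 0" and t: "t > 0" and \<omega>: "\<omega> \<ge> 0"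
  shows "(\<lambda>u. (1 - u) powr (q - 1) *\<^sub>R f (u * t)) integrable_on {0..1}"
proof (rule integrable_continuous_dominated(1))
  have K0: "K \<ge> 0"
  proof -
    have "0 \<le> K * exp (\<omega> * 1) * 1 powr c" using K[of 1] norm_ge_zero[of "f 1"] by linarith
    then show ?thesis by (simp add: zero_le_mult_iff)
  qed
  show "continuous_on {0<..<1} (\<lambda>u. (1 - u) powr (q - 1) *\<^sub>R f (u * t))"
    by (intro continuous_intros continuous_on_compose2[OF f]) (use t in auto)
  show "(\<lambda>u. (K * exp (\<omega> * t) * t powr c) * (\<bar>(1 - u) powr (q - 1)\<bar> * u powr c)) integrable_on {0..1}"
    using has_integral_mult_right[OF frac_weight_integrable[OF c q]] by blast
  fix u :: real assume u: "0 < u" "u < 1"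
  have "norm (f (u * t)) \<le> K * exp (\<omega> * (u * t)) * (u * t) powr c" using u t by (intro K) auto
  also have "\<dots> \<le> K * exp (\<omega> * t) * (u * t) powr c"
  proof (intro mult_right_mono mult_left_mono K0)
    have "u * t \<le> t" using u t by simp
    then show "exp (\<omega> * (u * t)) \<le> exp (\<omega> * t)" using \<omega> by (simp add: mult_left_mono)
  qed auto
  finally have "norm (f (u * t)) \<le> K * exp (\<omega> * t) * (u * t) powr c" .
  then show "norm ((1 - u) powr (q - 1) *\<^sub>R f (u * t)) \<le> (K * exp (\<omega> * t) * t powr c) * (\<bar>(1 - u) powr (q - 1)\<bar> * u powr c)"
    using u t mult_left_mono[of "norm (f (u * t))" _ "(1 - u) powr (q - 1)"]
    by (simp add: powr_mult mult_ac)
qed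

text \<open>Up to \<Gamma>(q), exp (-\<mu> t) times the fractional integral is the convolution of
  the Gamma kernel r^(q - 1) exp (-\<mu> r) with exp (-\<mu> s) f(s). As everything is nonnegative,
  Tonelli's theorem delivers integrability together with the product formula.\<close>

lemma laplace_frac_ray_nonneg:
  fixes f :: "real \<Rightarrow> real"
  assumes f: "continuous_on {0<..} f" and pos: "\<And>t. 0 < t \<Longrightarrow> 0 \<le> f t"
    and K: "\<And>t. 0 < t \<Longrightarrow> norm (f t) \<le> K * exp (\<omega> * t) * t powr c"
    and c: "c > -1" and q: "q > 0" and \<omega>: "\<omega> \<ge> 0" and \<mu>: "\<mu> > \<omega>"
  shows "integrable lborel (\<lambda>t. indicator {0<..} t * (exp (- (\<mu> * t)) * f t))"
    and "integrable lborel (\<lambda>t. indicator {0<..} t * (exp (- (\<mu> * t)) * frac_ray q f t))"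
    and "(\<integral>t. indicator {0<..} t * (exp (- (\<mu> * t)) * frac_ray q f t) \<partial>lborel) =
      \<mu> powr (- q) * (\<integral>t. indicator {0<..} t * (exp (- (\<mu> * t)) * f t) \<partial>lborel)"
proof -
  define \<phi> where "\<phi> s = indicator {0<..} s * (exp (- (\<mu> * s)) * f s)" for s
  define k where "k r = indicator {0<..} r * (r powr (q - 1) * exp (- (\<mu> * r)))" for r :: real
  define \<gamma> where "\<gamma> t = indicator {0<..} t * (exp (- (\<mu> * t)) * frac_ray q f t)" for t
  have \<mu>0: "\<mu> > 0" using \<omega> \<mu> by simp
  have G: "Gamma q > 0" by (rule Gamma_real_pos[OF q])
  have \<phi>m [measurable]: "\<phi> \<in> borel_measurable borel"
  proof -
    have "(\<lambda>s. indicator {0<..} s *\<^sub>R (exp (- (\<mu> * s)) * f s)) \<in> borel_measurable borel"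
      by (rule borel_measurable_continuous_on_indicator) (auto intro!: continuous_intros f)
    then show ?thesis unfolding \<phi>_def by simp
  qed
  have km [measurable]: "k \<in> borel_measurable borel" unfolding k_def by measurable
  have \<phi>0: "\<phi> s \<ge> 0" for s using pos[of s] by (simp add: \<phi>_def indicator_def)
  have "frac_ray q f t \<ge> 0" if "t > 0" for t
  proof -
    have "((\<lambda>u. (1 - u) powr (q - 1) *\<^sub>R f (u * t)) has_integral
        integral {0..1} (\<lambda>u. (1 - u) powr (q - 1) *\<^sub>R f (u * t))) {0<..<1}"
      using integrable_integral[OF frac_ray_integrable[OF f K c q that \<omega>]]
      by (simp only: has_integral_Icc_iff_Ioo)
    then have "0 \<le> integral {0..1} (\<lambda>u. (1 - u) powr (q - 1) *\<^sub>R f (u * t))"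
      by (rule has_integral_nonneg) (use that pos in auto)
    then show ?thesis unfolding frac_ray_def using G by simp
  qed
  then have \<gamma>0: "\<gamma> t \<ge> 0" for t by (simp add: \<gamma>_def indicator_def)
  have inner: "(\<integral>\<^sup>+s. ennreal (k (t - s)) * ennreal (\<phi> s) \<partial>lborel) = ennreal (Gamma q * \<gamma> t)" for t
  proof (cases "t > 0")
    case False
    then have "(\<integral>\<^sup>+s. ennreal (k (t - s)) * ennreal (\<phi> s) \<partial>lborel) = (\<integral>\<^sup>+(s::real). 0 \<partial>lborel)"
      by (intro nn_integral_cong) (simp add: k_def \<phi>_def indicator_def)
    then show ?thesis using False by (simp add: \<gamma>_def indicator_def)
  next
    case t: True
    have hi: "((\<lambda>u. (t powr (q - 1) * exp (- (\<mu> * t))) * ((1 - u) powr (q - 1) * f (u * t))) has_integral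
        (t powr (q - 1) * exp (- (\<mu> * t))) * integral {0..1} (\<lambda>u. (1 - u) powr (q - 1) *\<^sub>R f (u * t))) {0<..<1}"
      using integrable_integral[OF frac_ray_integrable[OF f K c q t \<omega>]]
      by (intro has_integral_mult_right) (simp add: has_integral_Icc_iff_Ioo)
    have "(\<integral>\<^sup>+s. ennreal (k (t - s)) * ennreal (\<phi> s) \<partial>lborel) =
        ennreal \<bar>t\<bar> * (\<integral>\<^sup>+u. ennreal (k (t - (0 + t * u))) * ennreal (\<phi> (0 + t * u)) \<partial>lborel)"
      using t by (intro nn_integral_real_affine) auto
    also have "(\<integral>\<^sup>+u. ennreal (k (t - (0 + t * u))) * ennreal (\<phi> (0 + t * u)) \<partial>lborel) =
       (\<integral>\<^sup>+u. ennreal ((t powr (q - 1) * exp (- (\<mu> * t))) * ((1 - u) powr (q - 1) * f (u * t))) * indicator {0<..<1} u \<partial>lborel)"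
    proof (rule nn_integral_cong)
      fix u :: real
      consider "0 < u" "u < 1" | "u \<le> 0" | "u \<ge> 1" by linarith
      then show "ennreal (k (t - (0 + t * u))) * ennreal (\<phi> (0 + t * u)) =
          ennreal ((t powr (q - 1) * exp (- (\<mu> * t))) * ((1 - u) powr (q - 1) * f (u * t))) * indicator {0<..<1} u"
      proof cases
        case 1
        have "t - t * u = t * (1 - u)" by (simp add: algebra_simps)
        then have k1: "k (t - t * u) = t powr (q - 1) * (1 - u) powr (q - 1) * exp (- (\<mu> * (t - t * u)))"
          using 1 t by (simp add: k_def indicator_def powr_mult)
        have p1: "\<phi> (t * u) = exp (- (\<mu> * (t * u))) * f (u * t)"
          using 1 t by (simp add: \<phi>_def indicator_def mult.commute)
        have e1: "exp (- (\<mu> * (t - t * u))) * exp (- (\<mu> * (t * u))) = exp (- (\<mu> * t))"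
          by (simp add: algebra_simps flip: exp_add)
        have "k (t - t * u) * \<phi> (t * u) = (t powr (q - 1) * exp (- (\<mu> * t))) * ((1 - u) powr (q - 1) * f (u * t))"
          unfolding k1 p1 e1[symmetric] by (simp only: mult_ac)
        then show ?thesis
          using 1 \<phi>0[of "t * u"] by (simp add: flip: ennreal_mult'')
      next
        case 2
        then have "\<phi> (t * u) = 0" using t by (simp add: \<phi>_def indicator_def zero_less_mult_iff)
        then show ?thesis using 2 by simp
      next
        case 3
        then have "k (t - t * u) = 0" using t by (simp add: k_def indicator_def)
        then show ?thesis using 3 by simp
      qed
    qed
    also have "\<dots> = ennreal ((t powr (q - 1) * exp (- (\<mu> * t))) * integral {0..1} (\<lambda>u. (1 - u) powr (q - 1) *\<^sub>R f (u * t)))"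
      by (rule nn_integral_has_integral_lebesgue'[OF _ hi]) (use pos t in auto)
    also have "ennreal \<bar>t\<bar> * \<dots> = ennreal (t * ((t powr (q - 1) * exp (- (\<mu> * t))) * integral {0..1} (\<lambda>u. (1 - u) powr (q - 1) *\<^sub>R f (u * t))))"
      using t by (simp flip: ennreal_mult')
    also have "t * ((t powr (q - 1) * exp (- (\<mu> * t))) * integral {0..1} (\<lambda>u. (1 - u) powr (q - 1) *\<^sub>R f (u * t))) = Gamma q * \<gamma> t"
      using t G powr_mult_base[of t "q - 1"] by (simp add: \<gamma>_def frac_ray_def indicator_def)
    finally show ?thesis .
  qed
  have conv: "(\<integral>\<^sup>+t. ennreal (Gamma q * \<gamma> t) \<partial>lborel) = (\<integral>\<^sup>+s. ennreal (\<phi> s) \<partial>lborel) * ennreal (Gamma q * \<mu> powr (- q))"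
  proof -
    have "(\<integral>\<^sup>+r. ennreal (k r) \<partial>lborel) = ennreal (Gamma q * \<mu> powr (- q))"
      unfolding k_def by (rule nn_integral_gamma_kernel[OF q \<mu>0])
    moreover have "(\<integral>\<^sup>+t. (\<integral>\<^sup>+s. ennreal (k (t - s)) * ennreal (\<phi> s) \<partial>lborel) \<partial>lborel) =
        (\<integral>\<^sup>+s. ennreal (\<phi> s) \<partial>lborel) * (\<integral>\<^sup>+r. ennreal (k r) \<partial>lborel)"
      by (rule nn_integral_convolution) measurable
    ultimately show ?thesis by (simp only: inner)
  qed
  have fin: "(\<integral>\<^sup>+s. ennreal (\<phi> s) \<partial>lborel) < \<infinity>"
  proof -
    have K0: "K \<ge> 0"
    proof -
      have "0 \<le> K * exp (\<omega> * 1) * 1 powr c" using K[of 1] norm_ge_zero[of "f 1"] by linarith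
      then show ?thesis by (simp add: zero_le_mult_iff)
    qed
    have "(\<integral>\<^sup>+s. ennreal (\<phi> s) \<partial>lborel) \<le>
        (\<integral>\<^sup>+s. ennreal K * ennreal (indicator {0<..} s * (s powr ((c + 1) - 1) * exp (- ((\<mu> - \<omega>) * s)))) \<partial>lborel)"
    proof (rule nn_integral_mono)
      fix s :: real
      have "\<phi> s \<le> K * (indicator {0<..} s * (s powr ((c + 1) - 1) * exp (- ((\<mu> - \<omega>) * s))))"
      proof (cases "s > 0")
        case True
        have "\<phi> s \<le> exp (- (\<mu> * s)) * (K * exp (\<omega> * s) * s powr c)"
          using True K[OF True] by (simp add: \<phi>_def)
        also have "\<dots> = K * (s powr c * (exp (- (\<mu> * s)) * exp (\<omega> * s)))" by (simp add: mult_ac)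
        also have "exp (- (\<mu> * s)) * exp (\<omega> * s) = exp (- ((\<mu> - \<omega>) * s))"
          by (simp add: algebra_simps flip: exp_add)
        finally show ?thesis using True by simp
      qed (simp add: \<phi>_def)
      then show "ennreal (\<phi> s) \<le> ennreal K * ennreal (indicator {0<..} s * (s powr ((c + 1) - 1) * exp (- ((\<mu> - \<omega>) * s))))"
        using K0 by (simp add: ennreal_leI flip: ennreal_mult')
    qed
    also have "\<dots> = ennreal K * (\<integral>\<^sup>+s. ennreal (indicator {0<..} s * (s powr ((c + 1) - 1) * exp (- ((\<mu> - \<omega>) * s)))) \<partial>lborel)"
      by (rule nn_integral_cmult) measurable
    also have "(\<integral>\<^sup>+s. ennreal (indicator {0<..} s * (s powr ((c + 1) - 1) * exp (- ((\<mu> - \<omega>) * s)))) \<partial>lborel) =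
        ennreal (Gamma (c + 1) * (\<mu> - \<omega>) powr (- (c + 1)))"
      by (rule nn_integral_gamma_kernel) (use c \<mu> in auto)
    also have "ennreal K * ennreal (Gamma (c + 1) * (\<mu> - \<omega>) powr (- (c + 1))) < \<infinity>"
      by (simp add: ennreal_mult_less_top)
    finally show ?thesis .
  qed
  show i1: "integrable lborel (\<lambda>t. indicator {0<..} t * (exp (- (\<mu> * t)) * f t))"
    unfolding \<phi>_def[symmetric] using fin \<phi>0 by (intro integrableI_nonneg) auto
  \<comment> \<open>Measurability of the fractional integral is read off from the inner integral in
    Tonelli's theorem, of which it is a multiple.\<close>
  have \<gamma>m: "\<gamma> \<in> borel_measurable lborel"
  proof -
    have "(\<lambda>t. \<integral>\<^sup>+s. ennreal (k (t - s)) * ennreal (\<phi> s) \<partial>lborel) \<in> borel_measurable borel" by measurable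
    then have m: "(\<lambda>t. ennreal (Gamma q * \<gamma> t)) \<in> borel_measurable borel" by (simp only: inner)
    have "(\<lambda>t. enn2real (ennreal (Gamma q * \<gamma> t)) / Gamma q) \<in> borel_measurable borel" using m by measurable
    moreover have "enn2real (ennreal (Gamma q * \<gamma> t)) / Gamma q = \<gamma> t" for t using G \<gamma>0[of t] by simp
    ultimately show ?thesis by simp
  qed
  have \<gamma>i: "integrable lborel (\<lambda>t. Gamma q * \<gamma> t)"
  proof (rule integrableI_nonneg)
    show "(\<integral>\<^sup>+t. ennreal (Gamma q * \<gamma> t) \<partial>lborel) < \<infinity>"
      unfolding conv using fin by (simp add: ennreal_mult_less_top)
  qed (use \<gamma>m \<gamma>0 G in auto)
  then show i2: "integrable lborel (\<lambda>t. indicator {0<..} t * (exp (- (\<mu> * t)) * frac_ray q f t))"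
    unfolding \<gamma>_def[symmetric] using G by simp
  have "ennreal (\<integral>t. Gamma q * \<gamma> t \<partial>lborel) = ennreal (\<integral>s. \<phi> s \<partial>lborel) * ennreal (Gamma q * \<mu> powr (- q))"
    using conv i1 \<gamma>i \<phi>0 \<gamma>0 G unfolding \<phi>_def[symmetric] by (simp add: nn_integral_eq_integral)
  also have "\<dots> = ennreal ((\<integral>s. \<phi> s \<partial>lborel) * (Gamma q * \<mu> powr (- q)))"
    using G by (simp add: ennreal_mult'')
  finally have "Gamma q * (\<integral>t. \<gamma> t \<partial>lborel) = (\<integral>s. \<phi> s \<partial>lborel) * (Gamma q * \<mu> powr (- q))"
    using G \<phi>0 \<gamma>0 by (subst (asm) ennreal_inj) (auto intro!: integral_nonneg_AE mult_nonneg_nonneg)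
  then show "(\<integral>t. indicator {0<..} t * (exp (- (\<mu> * t)) * frac_ray q f t) \<partial>lborel) =
      \<mu> powr (- q) * (\<integral>t. indicator {0<..} t * (exp (- (\<mu> * t)) * f t) \<partial>lborel)"
    unfolding \<phi>_def[symmetric] \<gamma>_def[symmetric] using G by (simp add: mult_ac)
qed

lemma laplace_frac_ray_real:
  fixes f :: "real \<Rightarrow> real"
  assumes f: "continuous_on {0<..} f"
    and K: "\<And>t. 0 < t \<Longrightarrow> norm (f t) \<le> K * exp (\<omega> * t) * t powr c"
    and c: "c > -1" and q: "q > 0" and \<omega>: "\<omega> \<ge> 0" and \<mu>: "\<mu> > \<omega>"
  shows "integrable lborel (\<lambda>t. indicator {0<..} t * (exp (- (\<mu> * t)) * f t))"
    and "integrable lborel (\<lambda>t. indicator {0<..} t * (exp (- (\<mu> * t)) * frac_ray q f t))"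
    and "(\<integral>t. indicator {0<..} t * (exp (- (\<mu> * t)) * frac_ray q f t) \<partial>lborel) =
      \<mu> powr (- q) * (\<integral>t. indicator {0<..} t * (exp (- (\<mu> * t)) * f t) \<partial>lborel)"
proof -
  define fp where "fp t = max (f t) 0" for t
  define fn where "fn t = max (- f t) 0" for t
  have cont: "continuous_on {0<..} fp" "continuous_on {0<..} fn"
    unfolding fp_def fn_def by (intro continuous_intros f)+
  have bd: "norm (fp t) \<le> K * exp (\<omega> * t) * t powr c" "norm (fn t) \<le> K * exp (\<omega> * t) * t powr c" if "0 < t" for t
    using K[OF that] by (auto simp: fp_def fn_def)
  have nn: "0 \<le> fp t" "0 \<le> fn t" for t by (auto simp: fp_def fn_def)
  note p = laplace_frac_ray_nonneg[OF cont(1) nn(1) bd(1) c q \<omega> \<mu>]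
  note n = laplace_frac_ray_nonneg[OF cont(2) nn(2) bd(2) c q \<omega> \<mu>]
  have feq: "f t = fp t - fn t" for t by (auto simp: fp_def fn_def)
  have geq: "frac_ray q f t = frac_ray q fp t - frac_ray q fn t" if "t > 0" for t
    unfolding frac_ray_def feq scaleR_diff_right
    using frac_ray_integrable[OF cont(1) bd(1) c q that \<omega>] frac_ray_integrable[OF cont(2) bd(2) c q that \<omega>]
    by (subst Henstock_Kurzweil_Integration.integral_diff) (auto simp: right_diff_distrib)
  have 1: "indicator {0<..} t * (exp (- (\<mu> * t)) * f t) =
     indicator {0<..} t * (exp (- (\<mu> * t)) * fp t) - indicator {0<..} t * (exp (- (\<mu> * t)) * fn t)" for t
    unfolding feq by (simp add: algebra_simps)
  have 2: "indicator {0<..} t * (exp (- (\<mu> * t)) * frac_ray q f t) =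
     indicator {0<..} t * (exp (- (\<mu> * t)) * frac_ray q fp t) - indicator {0<..} t * (exp (- (\<mu> * t)) * frac_ray q fn t)" for t
    by (cases "t > 0") (simp_all add: geq right_diff_distrib)
  show "integrable lborel (\<lambda>t. indicator {0<..} t * (exp (- (\<mu> * t)) * f t))"
    unfolding 1 by (intro Bochner_Integration.integrable_diff p n)
  show "integrable lborel (\<lambda>t. indicator {0<..} t * (exp (- (\<mu> * t)) * frac_ray q f t))"
    unfolding 2 by (intro Bochner_Integration.integrable_diff p n)
  show "(\<integral>t. indicator {0<..} t * (exp (- (\<mu> * t)) * frac_ray q f t) \<partial>lborel) =
      \<mu> powr (- q) * (\<integral>t. indicator {0<..} t * (exp (- (\<mu> * t)) * f t) \<partial>lborel)"
    unfolding 1 2 using p n by (simp add: Bochner_Integration.integral_diff right_diff_distrib)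
qed

lemma tendsto_integral_halfline:
  fixes h :: "real \<Rightarrow> real"
  assumes h: "integrable lborel (\<lambda>t. indicator {0<..} t * h t)"
  shows "((\<lambda>\<tau>. integral {0..\<tau>} h) \<longlongrightarrow> (\<integral>t. indicator {0<..} t * h t \<partial>lborel)) at_top"
proof -
  have "((\<lambda>\<tau>. \<integral>t. indicator {..\<tau>} t *\<^sub>R (indicator {0<..} t * h t) \<partial>lborel) \<longlongrightarrow> (\<integral>t. indicator {0<..} t * h t \<partial>lborel)) at_top"
    by (rule tendsto_integral_at_top[OF _ h]) simp
  moreover have "(\<integral>t. indicator {..\<tau>} t *\<^sub>R (indicator {0<..} t * h t) \<partial>lborel) = integral {0..\<tau>} h" for \<tau>
  proof -
    have eq: "indicator {..\<tau>} t *\<^sub>R (indicator {0<..} t * h t) = indicat_real {0<..\<tau>} t *\<^sub>R h t" for t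
      by (auto simp: indicator_def)
    have "integrable lborel (\<lambda>t. indicator {..\<tau>} t *\<^sub>R (indicator {0<..} t * h t))"
      by (rule integrable_mult_indicator[OF _ h]) simp
    then have "integrable lborel (\<lambda>t. indicat_real {0<..\<tau>} t *\<^sub>R h t)" by (simp only: eq)
    then have "set_integrable lborel {0<..\<tau>} h" by (simp only: set_integrable_def)
    from set_borel_integral_eq_integral(2)[OF this]
    show ?thesis by (simp only: set_lebesgue_integral_def eq integral_Ioc_eq)
  qed
  ultimately show ?thesis by simp
qed

text \<open>One real functional norming the difference of the two sides reduces the claim to
  scalars. There both transforms converge absolutely, so the improper integrals agree with Lebesgue
  integrals over the half-line.\<close>

lemma has_laplace_frac_ray:
  fixes f :: "real \<Rightarrow> 'b::banach"
  assumes f: "continuous_on {0<..} f"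
    and K: "\<And>t. 0 < t \<Longrightarrow> norm (f t) \<le> K * exp (\<omega> * t) * t powr c"
    and c: "c > -1" and q: "q > 0" and \<omega>: "\<omega> \<ge> 0" and \<mu>: "\<mu> > \<omega>"
    and y: "has_laplace f \<mu> y" and z: "has_laplace g \<mu> z"
    and g: "\<And>t. t > 0 \<Longrightarrow> g t = frac_ray q f t"
  shows "z = \<mu> powr (- q) *\<^sub>R y"
proof -
  obtain F :: "'b \<Rightarrow> real" where F: "linear F" "\<And>v. \<bar>F v\<bar> \<le> norm v" "F (z - \<mu> powr (- q) *\<^sub>R y) = norm (z - \<mu> powr (- q) *\<^sub>R y)"
    using norming_functional_real[of "z - \<mu> powr (- q) *\<^sub>R y"] by blast
  have bF: "bounded_linear F"
    using F(1,2) by (intro bounded_linear_intro[where K = 1]) (auto simp: linear_add linear_scale)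
  have fF: "continuous_on {0<..} (\<lambda>t. F (f t))"
    using bF f by (rule bounded_linear.continuous_on)
  have KF: "norm (F (f t)) \<le> K * exp (\<omega> * t) * t powr c" if "0 < t" for t
    using F(2)[of "f t"] K[OF that] by simp
  have gF: "F (g t) = frac_ray q (\<lambda>t. F (f t)) t" if t: "t > 0" for t
    unfolding g[OF t] frac_ray_def linear_scale[OF F(1)]
    using integral_linear[OF frac_ray_integrable[OF f K c q t \<omega>] bF]
    by (simp add: o_def linear_scale[OF F(1)])
  note L = laplace_frac_ray_real[OF fF KF c q \<omega> \<mu>]
  have lim: "((\<lambda>\<tau>. integral {0..\<tau>} (\<lambda>t. exp (- (\<mu> * t)) * F (h t))) \<longlongrightarrow> F w) at_top"
    if h: "has_laplace h \<mu> w" for h w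
  proof -
    have lh: "loc_bochner_integrable h" using h by (simp add: has_laplace_def)
    have "((\<lambda>\<tau>. F (integral {0..\<tau>} (\<lambda>t. exp (- (\<mu> * t)) *\<^sub>R h t))) \<longlongrightarrow> F w) at_top"
      using h by (intro bounded_linear.tendsto[OF bF]) (simp add: has_laplace_iff)
    then show ?thesis
      using integral_linear[OF loc_bochner_integrable_on[OF loc_bochner_exp[OF lh, of \<mu>] order_refl] bF]
      by (simp add: o_def linear_scale[OF F(1)])
  qed
  have "F y = (\<integral>t. indicator {0<..} t * (exp (- (\<mu> * t)) * F (f t)) \<partial>lborel)"
    using tendsto_unique[OF _ lim[OF y] tendsto_integral_halfline[OF L(1)]] by simp
  moreover have "F z = (\<integral>t. indicator {0<..} t * (exp (- (\<mu> * t)) * frac_ray q (\<lambda>t. F (f t)) t) \<partial>lborel)"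
  proof -
    have "integral {0..\<tau>} (\<lambda>t. exp (- (\<mu> * t)) * F (g t)) = integral {0..\<tau>} (\<lambda>t. exp (- (\<mu> * t)) * frac_ray q (\<lambda>t. F (f t)) t)" for \<tau>
      by (rule integral_spike[of "{0}"]) (auto simp: gF)
    then show ?thesis
      using tendsto_unique[OF _ lim[OF z]] tendsto_integral_halfline[OF L(2)] by simp
  qed
  ultimately have "F z = \<mu> powr (- q) * F y" using L(3) by simp
  then have "norm (z - \<mu> powr (- q) *\<^sub>R y) = 0"
    using F(3) by (simp add: linear_diff[OF F(1)] linear_scale[OF F(1)])
  then show ?thesis by simp
qed

section \<open>Uniqueness of Laplace transforms\<close>

text \<open>Lerch's theorem. With x = exp (-t) the values of the transform at equally spaced points
  are the moments of a continuous function on {0..1}. By Weierstrass it can be approximated by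
  polynomials, against which it integrates to 0, so its square integrates to 0.\<close>

lemma laplace_vanishing_real:
  fixes h :: "real \<Rightarrow> real"
  assumes h: "continuous_on {0..} h" and K: "\<And>t. 0 \<le> t \<Longrightarrow> \<bar>h t\<bar> \<le> K * exp (\<omega> * t)"
    and z: "\<And>\<mu>. \<mu> > \<theta> \<Longrightarrow> ((\<lambda>\<tau>. integral {0..\<tau>} (\<lambda>t. exp (- (\<mu> * t)) * h t)) \<longlongrightarrow> 0) at_top"
    and t: "0 \<le> t"
  shows "h t = 0"
proof -
  \<comment> \<open>One unit beyond \<omega> makes \<open>k\<close> decay like exp (-t), so that in
    the variable x it extends continuously by 0 to x = 0. Lying beyond \<theta> keeps all moments
    within the range of the hypothesis.\<close>
  define \<nu> where "\<nu> = max \<omega> \<theta> + 1"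
  define k where "k t = exp (- (\<nu> * t)) * h t" for t
  have ck: "continuous_on {0..} k" unfolding k_def by (intro continuous_intros h)
  have ck': "continuous_on {0..\<tau>} k" for \<tau> by (rule continuous_on_subset[OF ck]) auto
  have K0: "K \<ge> 0" using K[of 0] by simp
  have kb: "\<bar>k t\<bar> \<le> K * exp (- t)" if "0 \<le> t" for t
  proof -
    have "\<bar>k t\<bar> \<le> exp (- (\<nu> * t)) * (K * exp (\<omega> * t))"
      using K[OF that] by (simp add: k_def abs_mult)
    also have "\<dots> = K * exp ((\<omega> - \<nu>) * t)" by (simp add: algebra_simps flip: exp_add)
    also have "\<dots> \<le> K * exp (- 1 * t)"
    proof (intro mult_left_mono K0)
      have "\<omega> - \<nu> \<le> - 1" by (simp add: \<nu>_def)
      from mult_right_mono[OF this that] show "exp ((\<omega> - \<nu>) * t) \<le> exp (- 1 * t)" by simp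
    qed
    finally show ?thesis by simp
  qed
  have kj: "((\<lambda>\<tau>. integral {0..\<tau>} (\<lambda>t. exp (- t) * (exp (- t) ^ j * k t))) \<longlongrightarrow> 0) at_top" for j :: nat
  proof -
    have "exp (- t) * (exp (- t) ^ j * k t) = exp (- ((\<nu> + 1 + real j) * t)) * h t" for t
      by (simp add: k_def algebra_simps flip: exp_add exp_of_nat_mult)
    moreover have "\<nu> + 1 + real j > \<theta>" by (simp add: \<nu>_def)
    ultimately show ?thesis using z by simp
  qed
  define s where "s x = (if x = 0 then 0 else k (- ln x))" for x
  have cs: "continuous_on {0..1} s"
    unfolding continuous_on_eq_continuous_within
  proof
    fix x :: real assume x: "x \<in> {0..1}"
    show "continuous (at x within {0..1}) s"
    proof (cases "x = 0")
      case True
      have "(s \<longlongrightarrow> 0) (at 0 within {0..1})"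
      proof (rule Lim_null_comparison)
        show "\<forall>\<^sub>F x in at 0 within {0..1}. norm (s x) \<le> K * x"
          unfolding eventually_at_topological
        proof (intro exI[of _ UNIV] conjI ballI impI)
          fix x :: real assume "x \<noteq> 0" "x \<in> {0..1}"
          then show "norm (s x) \<le> K * x" using kb[of "- ln x"] by (simp add: s_def)
        qed auto
        have "((\<lambda>x. K * x) \<longlongrightarrow> K * 0) (at 0 within {0..1})" by (intro tendsto_intros)
        then show "((\<lambda>x. K * x) \<longlongrightarrow> 0) (at 0 within {0..1})" by simp
      qed
      then show ?thesis using True by (simp add: continuous_within s_def)
    next
      case False
      have "continuous_on {0<..1} s"
      proof (subst continuous_on_cong[OF refl])
        show "s y = k (- ln y)" if "y \<in> {0<..1}" for y using that by (simp add: s_def)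
        show "continuous_on {0<..1} (\<lambda>y. k (- ln y))"
          by (rule continuous_on_compose2[OF ck]) (auto intro!: continuous_intros)
      qed
      then have "continuous (at x within {0<..1}) s"
        using x False by (simp add: continuous_on_eq_continuous_within)
      moreover have "at x within {0<..1} = at x within {0..1}"
        using x False by (intro at_within_nhd[of _ "{0<..}"]) auto
      ultimately show ?thesis by (simp add: continuous_within)
    qed
  qed
  have le: "integral {0..\<tau>} (\<lambda>t. exp (- t) * (k t)\<^sup>2) \<le> e * K" if e: "e > 0" and \<tau>: "0 \<le> \<tau>" for e \<tau>
  proof -
    obtain p where p: "real_polynomial_function p" "\<And>x. x \<in> {0..1} \<Longrightarrow> \<bar>s x - p x\<bar> < e"
      by (rule Stone_Weierstrass_real_polynomial_function[OF compact_Icc cs e]) (rule that)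
    obtain a n where pa: "p = (\<lambda>x. \<Sum>i\<le>n. a i * x ^ i)" using p(1) real_polynomial_function_iff_sum by blast
    have kp: "\<bar>k t - p (exp (- t))\<bar> \<le> e" if "0 \<le> t" for t
      using p(2)[of "exp (- t)"] that by (simp add: s_def)
    define P where "P \<tau> = integral {0..\<tau>} (\<lambda>t. exp (- t) * (p (exp (- t)) * k t))" for \<tau>
    have cp: "continuous_on S (\<lambda>t. p (exp (- t)))" for S unfolding pa by (intro continuous_intros)
    have "P \<tau> = (\<Sum>i\<le>n. a i * integral {0..\<tau>} (\<lambda>t. exp (- t) * (exp (- t) ^ i * k t)))" for \<tau>
    proof -
      have "P \<tau> = integral {0..\<tau>} (\<lambda>t. \<Sum>i\<le>n. a i * (exp (- t) * (exp (- t) ^ i * k t)))"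
        unfolding P_def pa by (simp add: sum_distrib_left sum_distrib_right mult_ac)
      also have "\<dots> = (\<Sum>i\<le>n. integral {0..\<tau>} (\<lambda>t. a i * (exp (- t) * (exp (- t) ^ i * k t))))"
        by (intro Henstock_Kurzweil_Integration.integral_sum integrable_continuous_real continuous_intros ck') auto
      finally show ?thesis by simp
    qed
    moreover have "((\<lambda>\<tau>. \<Sum>i\<le>n. a i * integral {0..\<tau>} (\<lambda>t. exp (- t) * (exp (- t) ^ i * k t))) \<longlongrightarrow> (\<Sum>i\<le>n. a i * 0)) at_top"
      by (intro tendsto_intros kj)
    ultimately have P0: "((\<lambda>\<tau>. P \<tau>) \<longlongrightarrow> 0) at_top" by simp
    \<comment> \<open>Write k^2 = (k - p) k + p k. The first part is at most eK before weighting and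
      the weight exp (-t) has integral at most 1; the second part is \<open>P\<close>, which tends
      to 0.\<close>
    have main: "integral {0..\<sigma>} (\<lambda>t. exp (- t) * (k t)\<^sup>2) \<le> e * K + P \<sigma>" if \<sigma>: "\<sigma> \<ge> 0" for \<sigma>
    proof -
      have "integral {0..\<sigma>} (\<lambda>t. exp (- t) * (k t)\<^sup>2) \<le> integral {0..\<sigma>} (\<lambda>t. (e * K) * exp (- (1 * t)) + exp (- t) * (p (exp (- t)) * k t))"
      proof (intro integral_le integrable_continuous_real continuous_intros ck' cp)
        fix t assume t: "t \<in> {0..\<sigma>}"
        have "exp (- t) * ((k t - p (exp (- t))) * k t) \<le> exp (- t) * (e * (K * 1))"
        proof (intro mult_left_mono)
          have "(k t - p (exp (- t))) * k t \<le> \<bar>k t - p (exp (- t))\<bar> * \<bar>k t\<bar>" by (simp flip: abs_mult)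
          also have "\<dots> \<le> e * (K * exp (- t))" using kp[of t] kb[of t] t by (intro mult_mono) auto
          also have "\<dots> \<le> e * (K * 1)" using e K0 t by (intro mult_left_mono) auto
          finally show "(k t - p (exp (- t))) * k t \<le> e * (K * 1)" .
        qed simp
        then show "exp (- t) * (k t)\<^sup>2 \<le> (e * K) * exp (- (1 * t)) + exp (- t) * (p (exp (- t)) * k t)"
          by (simp add: algebra_simps power2_eq_square)
      qed
      also have "\<dots> = integral {0..\<sigma>} (\<lambda>t. (e * K) * exp (- (1 * t))) + P \<sigma>"
        unfolding P_def
        by (intro Henstock_Kurzweil_Integration.integral_add integrable_continuous_real continuous_intros ck' cp)
      also have "integral {0..\<sigma>} (\<lambda>t. (e * K) * exp (- (1 * t))) = (e * K) * ((exp (- (1 * 0)) - exp (- (1 * \<sigma>))) / 1)"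
        using \<sigma> by (intro integral_unique has_integral_mult_right has_integral_exp_neg) auto
      also have "\<dots> \<le> e * K * 1" using e K0 by (intro mult_left_mono) auto
      finally show ?thesis by simp
    qed
    have "integral {0..\<tau>} (\<lambda>t. exp (- t) * (k t)\<^sup>2) \<le> e * K + 0"
    proof (rule tendsto_lowerbound)
      show "((\<lambda>\<sigma>. e * K + P \<sigma>) \<longlongrightarrow> e * K + 0) at_top" by (intro tendsto_intros P0)
      show "\<forall>\<^sub>F \<sigma> in at_top. integral {0..\<tau>} (\<lambda>t. exp (- t) * (k t)\<^sup>2) \<le> e * K + P \<sigma>"
      proof (rule eventually_mono[OF eventually_ge_at_top[of \<tau>]])
        fix \<sigma> assume "\<tau> \<le> \<sigma>"
        then have "integral {0..\<tau>} (\<lambda>t. exp (- t) * (k t)\<^sup>2) \<le> integral {0..\<sigma>} (\<lambda>t. exp (- t) * (k t)\<^sup>2)"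
          by (intro integral_subset_le integrable_continuous_real continuous_intros ck') auto
        with main[of \<sigma>] \<open>\<tau> \<le> \<sigma>\<close> \<tau> show "integral {0..\<tau>} (\<lambda>t. exp (- t) * (k t)\<^sup>2) \<le> e * K + P \<sigma>" by simp
      qed
    qed simp
    then show ?thesis by simp
  qed
  have "integral {0..t+1} (\<lambda>t. exp (- t) * (k t)\<^sup>2) \<le> 0"
  proof (rule field_le_epsilon)
    fix e :: real assume e: "e > 0"
    have "integral {0..t+1} (\<lambda>t. exp (- t) * (k t)\<^sup>2) \<le> e / (K + 1) * K"
      using e K0 t by (intro le) auto
    also have "\<dots> \<le> e" using e K0 by (simp add: field_simps)
    finally show "integral {0..t+1} (\<lambda>t. exp (- t) * (k t)\<^sup>2) \<le> 0 + e" by simp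
  qed
  moreover have "integral {0..t+1} (\<lambda>t. exp (- t) * (k t)\<^sup>2) \<ge> 0"
    by (intro integral_nonneg integrable_continuous_real continuous_intros ck') auto
  ultimately have "integral {0..t+1} (\<lambda>t. exp (- t) * (k t)\<^sup>2) = 0" by simp
  moreover have "continuous_on {0..t+1} (\<lambda>t. exp (- t) * (k t)\<^sup>2)" by (intro continuous_intros ck')
  ultimately have "\<forall>x\<in>{0..t+1}. exp (- x) * (k x)\<^sup>2 = 0"
    using t integral_eq_0_iff[of 0 "t + 1" "\<lambda>t. exp (- t) * (k t)\<^sup>2"] by simp
  then have "k t = 0" using t by simp
  then show ?thesis by (simp add: k_def)
qed

lemma laplace_unique:
  fixes f g :: "real \<Rightarrow> 'b::banach"
  assumes f: "continuous_on {0..} f" and g: "continuous_on {0..} g"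
    and Kf: "\<And>t. 0 \<le> t \<Longrightarrow> norm (f t) \<le> Kf * exp (\<omega>f * t)"
    and Kg: "\<And>t. 0 \<le> t \<Longrightarrow> norm (g t) \<le> Kg * exp (\<omega>g * t)"
    and eq: "\<And>\<mu>. \<mu> > \<theta> \<Longrightarrow> \<exists>y. has_laplace f \<mu> y \<and> has_laplace g \<mu> y" and t: "0 \<le> t"
  shows "f t = g t"
proof -
  obtain F :: "'b \<Rightarrow> real" where F: "linear F" "\<And>v. \<bar>F v\<bar> \<le> norm v" "F (f t - g t) = norm (f t - g t)"
    using norming_functional_real[of "f t - g t"] by blast
  have bF: "bounded_linear F"
    using F(1,2) by (intro bounded_linear_intro[where K = 1]) (auto simp: linear_add linear_scale)
  have K0: "Kf \<ge> 0" "Kg \<ge> 0" using order_trans[OF norm_ge_zero Kf[of 0]] order_trans[OF norm_ge_zero Kg[of 0]] by simp_all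
  have F0: "F (f t - g t) = 0"
  proof (rule laplace_vanishing_real[where h = "\<lambda>t. F (f t - g t)" and K = "Kf + Kg" and \<omega> = "max \<omega>f \<omega>g" and \<theta> = \<theta>])
    show "continuous_on {0..} (\<lambda>t. F (f t - g t))"
      by (intro bounded_linear.continuous_on[OF bF] continuous_intros f g)
    fix x :: real assume x: "0 \<le> x"
    define E where "E = exp (max \<omega>f \<omega>g * x)"
    have E: "exp (\<omega>f * x) \<le> E" "exp (\<omega>g * x) \<le> E"
      using x by (auto simp: E_def intro!: mult_right_mono)
    have "\<bar>F (f x - g x)\<bar> \<le> norm (f x) + norm (g x)"
      using F(2)[of "f x - g x"] norm_triangle_ineq4[of "f x" "g x"] by linarith
    also have "\<dots> \<le> Kf * exp (\<omega>f * x) + Kg * exp (\<omega>g * x)"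
      by (intro add_mono Kf Kg x)
    also have "\<dots> \<le> Kf * E + Kg * E"
      by (intro add_mono mult_left_mono E K0)
    also have "\<dots> = (Kf + Kg) * E" by (simp add: distrib_right)
    finally show "\<bar>F (f x - g x)\<bar> \<le> (Kf + Kg) * exp (max \<omega>f \<omega>g * x)" unfolding E_def .
  next
    show "((\<lambda>\<tau>. integral {0..\<tau>} (\<lambda>t. exp (- (\<mu> * t)) * F (f t - g t))) \<longlongrightarrow> 0) at_top" if \<mu>: "\<mu> > \<theta>" for \<mu>
    proof -
      obtain y where y: "has_laplace f \<mu> y" "has_laplace g \<mu> y" using eq[OF \<mu>] by blast
      let ?f = "\<lambda>\<tau>. integral {0..\<tau>} (\<lambda>t. exp (- (\<mu> * t)) *\<^sub>R f t)"
      let ?g = "\<lambda>\<tau>. integral {0..\<tau>} (\<lambda>t. exp (- (\<mu> * t)) *\<^sub>R g t)"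
      have int: "(\<lambda>t. exp (- (\<mu> * t)) *\<^sub>R f t) integrable_on {0..\<tau>}"
        "(\<lambda>t. exp (- (\<mu> * t)) *\<^sub>R g t) integrable_on {0..\<tau>}" for \<tau>
        using y by (auto intro!: loc_bochner_integrable_on loc_bochner_exp simp: has_laplace_def)
      have "((\<lambda>\<tau>. F (?f \<tau> - ?g \<tau>)) \<longlongrightarrow> F (y - y)) at_top"
        using y by (intro bounded_linear.tendsto[OF bF] tendsto_diff) (auto simp: has_laplace_iff)
      moreover have "F (?f \<tau> - ?g \<tau>) = integral {0..\<tau>} (\<lambda>t. exp (- (\<mu> * t)) * F (f t - g t))" for \<tau>
      proof -
        have i: "(\<lambda>t. exp (- (\<mu> * t)) *\<^sub>R (f t - g t)) integrable_on {0..\<tau>}"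
          using integrable_diff[OF int] by (simp add: scaleR_diff_right)
        have "?f \<tau> - ?g \<tau> = integral {0..\<tau>} (\<lambda>t. exp (- (\<mu> * t)) *\<^sub>R (f t - g t))"
          by (simp add: scaleR_diff_right Henstock_Kurzweil_Integration.integral_diff int)
        then show ?thesis
          using integral_linear[OF i bF] by (simp add: o_def linear_scale[OF F(1)])
      qed
      ultimately show ?thesis by (simp add: linear_0[OF F(1)])
    qed
    show "0 \<le> t" by (rule t)
  qed
  show ?thesis using F(3) F0 by simp
qed

section \<open>Complex-linear operators\<close>

lemma blinfun_apply_scaleC: "blinfun_apply (c *\<^sub>C B) x = c *\<^sub>C blinfun_apply B x"
  by (simp add: scaleC_blinfun.rep_eq)

lemma cblin_ops_scaleC: "B \<in> cblin_ops \<Longrightarrow> c *\<^sub>C B \<in> cblin_ops"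
  by (simp add: cblin_ops_def blinfun_apply_scaleC scaleC_scaleC mult.commute)

lemma closed_cblin_ops: "closed (cblin_ops :: ('a::complex_banach \<Rightarrow>\<^sub>L 'a) set)"
proof -
  have "closed {B :: 'a \<Rightarrow>\<^sub>L 'a. blinfun_apply B (c *\<^sub>C x) = c *\<^sub>C blinfun_apply B x}" for c x
    by (intro closed_Collect_eq continuous_intros)
  then have "closed (\<Inter>c x. {B :: 'a \<Rightarrow>\<^sub>L 'a. blinfun_apply B (c *\<^sub>C x) = c *\<^sub>C blinfun_apply B x})" by blast
  moreover have "(\<Inter>c x. {B :: 'a \<Rightarrow>\<^sub>L 'a. blinfun_apply B (c *\<^sub>C x) = c *\<^sub>C blinfun_apply B x}) = cblin_ops"
    by (auto simp: cblin_ops_def)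
  ultimately show ?thesis by simp
qed

lemma has_integral_blinfun_apply:
  assumes "(f has_integral B) S"
  shows "((\<lambda>t. blinfun_apply (f t) x) has_integral blinfun_apply B x) S"
  using has_integral_linear[OF assms blinfun.bounded_linear_left[of x]] by (simp add: o_def)

lemma cblin_ops_integral:
  fixes f :: "real \<Rightarrow> 'a::complex_banach \<Rightarrow>\<^sub>L 'a"
  assumes f: "f integrable_on S" and cb: "\<And>t. t \<in> S - N \<Longrightarrow> f t \<in> cblin_ops" and N: "negligible N"
  shows "integral S f \<in> cblin_ops"
  unfolding cblin_ops_def
proof (intro CollectI allI)
  fix c x
  have "((\<lambda>t. c *\<^sub>C blinfun_apply (f t) x) has_integral c *\<^sub>C blinfun_apply (integral S f) x) S"
    using has_integral_linear[OF has_integral_blinfun_apply[OF integrable_integral[OF f]] bounded_linear_scaleC[of c]]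
    by (simp add: o_def)
  then have "((\<lambda>t. blinfun_apply (f t) (c *\<^sub>C x)) has_integral c *\<^sub>C blinfun_apply (integral S f) x) S"
    by (rule has_integral_spike[OF N, rotated]) (use cb in \<open>simp add: cblin_ops_def\<close>)
  with has_integral_blinfun_apply[OF integrable_integral[OF f], of "c *\<^sub>C x"]
  show "blinfun_apply (integral S f) (c *\<^sub>C x) = c *\<^sub>C blinfun_apply (integral S f) x"
    by (rule has_integral_unique)
qed

lemma cblin_ops_frac_int:
  fixes F :: "complex \<Rightarrow> 'a::complex_banach \<Rightarrow>\<^sub>L 'a"
  assumes "vholomorphic_on F rhp" "growth_bound F a b" "a \<ge> 0" "b \<ge> 0" "a - b > -1" "q > 0"
    and z: "0 < Re z" and cb: "\<And>z. 0 < Re z \<Longrightarrow> F z \<in> cblin_ops"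
  shows "frac_int q F z \<in> cblin_ops"
  unfolding frac_int_def
proof (rule cblin_ops_scaleC, rule cblin_ops_integral[where N = "{0}"])
  show "(\<lambda>u. (1 - u) powr (q - 1) *\<^sub>R F (of_real u * z)) integrable_on {0..1}"
    by (rule frac_integrable[OF assms(1-7)])
  show "(1 - u) powr (q - 1) *\<^sub>R F (of_real u * z) \<in> cblin_ops" if "u \<in> {0..1} - {0}" for u
    using cb[of "of_real u * z"] z that cblin_ops_scaleC[of "F (of_real u * z)" "of_real ((1 - u) powr (q - 1))"]
    by (simp only: scaleC_of_real) simp
qed simp

lemma cblin_ops_vderiv:
  fixes F :: "complex \<Rightarrow> 'a::complex_banach \<Rightarrow>\<^sub>L 'a"
  assumes hol: "vholomorphic_on F rhp" and cb: "\<And>z. 0 < Re z \<Longrightarrow> F z \<in> cblin_ops" and z: "0 < Re z"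
  shows "vderiv F z \<in> cblin_ops"
  unfolding cblin_ops_def
proof (intro CollectI allI)
  fix c and x :: 'a
  \<comment> \<open>\<open>L\<close> measures the failure of complex linearity at \<open>c\<close>
    and \<open>x\<close>. It annihilates all values of \<open>F\<close>, hence also the
    derivative.\<close>
  define L where "L B = blinfun_apply B (c *\<^sub>C x) - c *\<^sub>C blinfun_apply B x" for B :: "'a \<Rightarrow>\<^sub>L 'a"
  have bl: "bounded_linear L"
    unfolding L_def
    by (intro bounded_linear_sub blinfun.bounded_linear_left
        bounded_linear_compose[OF bounded_linear_scaleC blinfun.bounded_linear_left])
  have LC: "L (d *\<^sub>C B) = d *\<^sub>C L B" for d B
    by (simp add: L_def blinfun_apply_scaleC scaleC_diff_right scaleC_scaleC mult.commute)
  have "has_cderiv F (vderiv F z) z" using hol z by (simp add: vholomorphic_on_open[OF open_rhp])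
  from has_cderiv_linear[OF this bl LC] have 1: "has_cderiv (\<lambda>w. L (F w)) (L (vderiv F z)) z" .
  have "has_cderiv (\<lambda>w. L (F w)) 0 z"
  proof (rule has_cderiv_cong[OF open_rhp])
    show "0 = L (F w)" if "w \<in> rhp" for w using cb[of w] that by (simp add: L_def cblin_ops_def)
    show "has_cderiv (\<lambda>w. 0) 0 z" by (simp add: has_cderiv_def)
  qed (use z in simp)
  then have "L (vderiv F z) = 0" using 1 has_cderiv_unique by blast
  then show "blinfun_apply (vderiv F z) (c *\<^sub>C x) = c *\<^sub>C blinfun_apply (vderiv F z) x" by (simp add: L_def)
qed

section \<open>Boundary values\<close>

lemma has_integral_powr_pos:
  assumes "e \<noteq> 0" "0 < s" "s \<le> (t::real)"
  shows "((\<lambda>\<sigma>. \<sigma> powr (e - 1)) has_integral (t powr e - s powr e) / e) {s..t}"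
proof -
  have "((\<lambda>\<sigma>. \<sigma> powr (e - 1)) has_integral t powr e / e - s powr e / e) {s..t}"
  proof (rule fundamental_theorem_of_calculus[OF assms(3)])
    fix \<sigma> assume "\<sigma> \<in> {s..t}"
    then have "((\<lambda>\<sigma>. \<sigma> powr e / e) has_real_derivative \<sigma> powr (e - 1)) (at \<sigma>)"
      using assms by (auto intro!: derivative_eq_intros)
    then show "((\<lambda>\<sigma>. \<sigma> powr e / e) has_vector_derivative \<sigma> powr (e - 1)) (at \<sigma> within {s..t})"
      by (simp add: has_real_derivative_iff_has_vector_derivative has_vector_derivative_at_within)
  qed
  then show ?thesis by (simp add: diff_divide_distrib)
qed

text \<open>The real part to the power e - 1 is integrable along horizontal segments down to the
  imaginary axis. The shifts of \<open>G\<close> to the right by 1/(n + 1) are thus uniformly Cauchy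
  on bounded parts of the closed half-plane. The growth of the limit is found by comparison with the
  point z + |z|.\<close>

lemma boundary_extension:
  fixes G :: "complex \<Rightarrow> 'b::complex_banach"
  assumes hol: "vholomorphic_on G rhp" and gb': "growth_bound (vderiv G) a (1 - e)" and a: "a \<ge> 0" and e: "0 < e" "e < 1"
    and gb: "growth_bound G a' b'" "a' \<ge> 0" "b' \<ge> 0" "a' - b' = a + e"
  shows "\<exists>S. (\<forall>z. 0 < Re z \<longrightarrow> S z = G z) \<and> continuous_on {z. 0 \<le> Re z} S \<and>
    (\<forall>z. 0 \<le> Re z \<longrightarrow> (\<lambda>n. G (z + of_real (1 / (real n + 1)))) \<longlonglongrightarrow> S z) \<and>
    (\<exists>M\<ge>0. \<exists>\<omega>\<ge>0. \<forall>z. 0 \<le> Re z \<longrightarrow> norm (S z) \<le> M * exp (\<omega> * cmod z) * cmod z powr (a + e))"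
proof -
  obtain M \<omega> where M: "M \<ge> 0" "\<omega> \<ge> 0" and G': "\<And>z. 0 < Re z \<Longrightarrow>
     norm (vderiv G z) \<le> M * exp (\<omega> * cmod z) * (cmod z powr a * Re z powr (- (1 - e)))"
    using gb' unfolding growth_bound_def by blast
  obtain N \<nu> where N: "N \<ge> 0" "\<nu> \<ge> 0" and G: "\<And>z. 0 < Re z \<Longrightarrow>
     norm (G z) \<le> N * exp (\<nu> * cmod z) * (cmod z powr a' * Re z powr (- b'))"
    using gb(1) unfolding growth_bound_def by blast
  have diff: "norm (G (z + of_real t) - G (z + of_real s)) \<le>
      M * exp (\<omega> * (cmod z + t)) * (cmod z + t) powr a * (t powr e / e)"
    if z: "0 \<le> Re z" and st: "0 < s" "s \<le> t" for z s t
  proof -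
    define K where "K = M * exp (\<omega> * (cmod z + t)) * (cmod z + t) powr a"
    have K: "K \<ge> 0" using M by (simp add: K_def)
    have hi: "((\<lambda>\<sigma>. K * \<sigma> powr (e - 1)) has_integral K * ((t powr e - s powr e) / e)) {s..t}"
      using e st by (intro has_integral_mult_right has_integral_powr_pos) auto
    have "norm (G (z + of_real t) - G (z + of_real s)) \<le> integral {s..t} (\<lambda>\<sigma>. K * \<sigma> powr (e - 1))"
    proof (rule horizontal_difference[OF hol])
      fix \<sigma> :: real assume \<sigma>: "s < \<sigma>" "\<sigma> < t"
      have c: "cmod (z + of_real \<sigma>) \<le> cmod z + t"
        using norm_triangle_ineq[of z "of_real \<sigma>"] \<sigma> st by simp
      have "norm (vderiv G (z + of_real \<sigma>)) \<le> M * exp (\<omega> * cmod (z + of_real \<sigma>)) *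
          (cmod (z + of_real \<sigma>) powr a * Re (z + of_real \<sigma>) powr (- (1 - e)))"
        using z \<sigma> st by (intro G') simp
      also have "\<dots> \<le> M * exp (\<omega> * (cmod z + t)) * ((cmod z + t) powr a * \<sigma> powr (- (1 - e)))"
      proof (intro mult_mono)
        show "exp (\<omega> * cmod (z + of_real \<sigma>)) \<le> exp (\<omega> * (cmod z + t))"
          using mult_left_mono[OF c M(2)] by simp
        show "cmod (z + of_real \<sigma>) powr a \<le> (cmod z + t) powr a" using c a by (intro powr_mono2) auto
        show "Re (z + of_real \<sigma>) powr (- (1 - e)) \<le> \<sigma> powr (- (1 - e))"
          using z \<sigma> st e by (intro powr_mono2') auto
      qed (use M in auto)
      finally show "norm (vderiv G (z + of_real \<sigma>)) \<le> K * \<sigma> powr (e - 1)" by (simp add: K_def mult.assoc)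
    qed (use z st hi in auto)
    also have "\<dots> = K * ((t powr e - s powr e) / e)" by (rule integral_unique[OF hi])
    also have "\<dots> \<le> K * (t powr e / e)" using K e by (intro mult_left_mono divide_right_mono) auto
    finally show ?thesis unfolding K_def .
  qed
  define d where "d n = 1 / (real n + 1)" for n :: nat
  have d: "d n > 0" "d n \<le> 1" for n by (auto simp: d_def)
  have dmono: "d n \<le> d m" if "m \<le> n" for m n using that by (simp add: d_def frac_le)
  have d0: "d \<longlonglongrightarrow> 0" unfolding d_def by real_asymp
  have de: "(\<lambda>n. d n powr e) \<longlonglongrightarrow> 0"
    by (rule tendsto_zero_powrI[OF d0 tendsto_const _ e(1)]) (use d in \<open>simp add: less_imp_le\<close>)
  define C where "C R = M * exp (\<omega> * (R + 1)) * (R + 1) powr a / e" for R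
  have C: "C R \<ge> 0" for R using M e by (simp add: C_def)
  have cauchy: "norm (G (z + of_real (d m)) - G (z + of_real (d n))) \<le> C R * d m powr e"
    if "0 \<le> Re z" "cmod z \<le> R" "m \<le> n" for z R m n
  proof -
    have "norm (G (z + of_real (d m)) - G (z + of_real (d n))) \<le>
        M * exp (\<omega> * (cmod z + d m)) * (cmod z + d m) powr a * (d m powr e / e)"
      using that d dmono by (intro diff) auto
    also have "\<dots> \<le> M * exp (\<omega> * (R + 1)) * (R + 1) powr a * (d m powr e / e)"
    proof (intro mult_right_mono mult_mono)
      have c: "cmod z + d m \<le> R + 1" using that d[of m] by simp
      show "exp (\<omega> * (cmod z + d m)) \<le> exp (\<omega> * (R + 1))" using mult_left_mono[OF c M(2)] by simp
      show "(cmod z + d m) powr a \<le> (R + 1) powr a" using c a d(1)[of m] by (intro powr_mono2) (auto intro: add_nonneg_nonneg)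
    qed (use M e in auto)
    also have "\<dots> = C R * d m powr e" by (simp add: C_def)
    finally show ?thesis .
  qed
  have "\<exists>y. (\<lambda>n. G (z + of_real (d n))) \<longlonglongrightarrow> y" if z: "0 \<le> Re z" for z
  proof -
    have "Cauchy (\<lambda>n. G (z + of_real (d n)))"
    proof (rule metric_CauchyI)
      fix \<epsilon> :: real assume \<epsilon>: "\<epsilon> > 0"
      have "(\<lambda>n. C (cmod z) * d n powr e) \<longlonglongrightarrow> 0" using tendsto_mult_left[OF de] by simp
      then have "\<forall>\<^sub>F n in sequentially. C (cmod z) * d n powr e < \<epsilon> / 2"
        by (rule order_tendstoD(2)) (use \<epsilon> in simp)
      then obtain n0 where n0: "C (cmod z) * d n0 powr e < \<epsilon> / 2"
        by (auto simp: eventually_sequentially)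
      show "\<exists>n0. \<forall>m\<ge>n0. \<forall>n\<ge>n0. dist (G (z + of_real (d m))) (G (z + of_real (d n))) < \<epsilon>"
      proof (intro exI[of _ n0] allI impI)
        fix m n assume "n0 \<le> m" "n0 \<le> n"
        then have "dist (G (z + of_real (d m))) (G (z + of_real (d n0))) < \<epsilon> / 2"
          "dist (G (z + of_real (d n))) (G (z + of_real (d n0))) < \<epsilon> / 2"
          using cauchy[OF z order_refl, of n0 m] cauchy[OF z order_refl, of n0 n] n0
          by (auto simp: dist_norm norm_minus_commute)
        then show "dist (G (z + of_real (d m))) (G (z + of_real (d n))) < \<epsilon>" by (rule dist_triangle_half_l)
      qed
    qed
    then show ?thesis using Cauchy_convergent convergent_def by blast
  qed
  then obtain S where S: "\<And>z. 0 \<le> Re z \<Longrightarrow> (\<lambda>n. G (z + of_real (d n))) \<longlonglongrightarrow> S z" by metis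
  have unif: "norm (G (z + of_real (d m)) - S z) \<le> C R * d m powr e" if "0 \<le> Re z" "cmod z \<le> R" for z R m
  proof (rule LIMSEQ_le_const2)
    show "(\<lambda>n. norm (G (z + of_real (d m)) - G (z + of_real (d n)))) \<longlonglongrightarrow> norm (G (z + of_real (d m)) - S z)"
      by (intro tendsto_intros S that)
    show "\<exists>N. \<forall>n\<ge>N. norm (G (z + of_real (d m)) - G (z + of_real (d n))) \<le> C R * d m powr e"
      using cauchy[OF that] by blast
  qed
  have cG: "continuous_on rhp G" by (rule vholomorphic_on_imp_continuous_on[OF hol])
  have cont: "continuous_on ({z. 0 \<le> Re z} \<inter> cball 0 R) S" for R
  proof (rule uniform_limit_theorem[where f = "\<lambda>n z. G (z + of_real (d n))"])
    show "\<forall>\<^sub>F n in sequentially. continuous_on ({z. 0 \<le> Re z} \<inter> cball 0 R) (\<lambda>z. G (z + of_real (d n)))"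
      by (intro always_eventually allI continuous_on_compose2[OF cG] continuous_intros)
        (auto intro!: add_nonneg_pos d(1))
    show "uniform_limit ({z. 0 \<le> Re z} \<inter> cball 0 R) (\<lambda>n z. G (z + of_real (d n))) S sequentially"
    proof (rule uniform_limitI)
      fix \<epsilon> :: real assume \<epsilon>: "\<epsilon> > 0"
      have "(\<lambda>n. C R * d n powr e) \<longlonglongrightarrow> 0" using tendsto_mult_left[OF de] by simp
      then have "\<forall>\<^sub>F n in sequentially. C R * d n powr e < \<epsilon>"
        by (rule order_tendstoD(2)) (use \<epsilon> in simp)
      then show "\<forall>\<^sub>F n in sequentially. \<forall>z\<in>{z. 0 \<le> Re z} \<inter> cball 0 R. dist (G (z + of_real (d n))) (S z) < \<epsilon>"
      proof (rule eventually_mono, intro ballI)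
        fix n z assume "C R * d n powr e < \<epsilon>" "z \<in> {z. 0 \<le> Re z} \<inter> cball 0 R"
        then show "dist (G (z + of_real (d n))) (S z) < \<epsilon>" using unif[of z R n] by (simp add: dist_norm)
      qed
    qed
  qed simp
  have contS: "continuous_on {z. 0 \<le> Re z} S"
    unfolding continuous_on_eq_continuous_within
  proof
    fix z assume z: "z \<in> {z. 0 \<le> Re z}"
    let ?R = "cmod z + 1"
    have "continuous (at z within {z. 0 \<le> Re z} \<inter> cball 0 ?R) S"
      using cont[of ?R] z by (auto simp: continuous_on_eq_continuous_within)
    moreover have "at z within {z. 0 \<le> Re z} \<inter> cball 0 ?R = at z within {z. 0 \<le> Re z}"
      by (rule at_within_nhd[of _ "ball 0 ?R"]) auto
    ultimately show "continuous (at z within {z. 0 \<le> Re z}) S" by (simp add: continuous_within)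
  qed
  have SG: "S z = G z" if z: "0 < Re z" for z
  proof -
    have "isCont G z" using cG z open_rhp by (simp add: continuous_on_eq_continuous_at)
    moreover have "(\<lambda>n. z + of_real (d n)) \<longlonglongrightarrow> z + of_real 0" by (intro tendsto_intros d0)
    ultimately have "(\<lambda>n. G (z + of_real (d n))) \<longlonglongrightarrow> G z" by (auto intro: isCont_tendsto_compose)
    from LIMSEQ_unique[OF S this] z show ?thesis by simp
  qed
  define B where "B = N * 2 powr a' + M * 2 powr a / e"
  have B: "B \<ge> 0" using N M e by (simp add: B_def)
  have bound: "norm (S z) \<le> B * exp ((2 * \<nu> + 2 * \<omega>) * cmod z) * cmod z powr (a + e)" if z: "0 \<le> Re z" for z
  proof (cases "z = 0")
    \<comment> \<open>The claimed bound is 0 at the origin. The bound for \<open>G\<close> along the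
      positive axis has degree a + e > 0 and indeed forces S 0 = 0.\<close>
    case True
    have "(\<lambda>n. N * exp (\<nu> * d n) * d n powr (a + e)) \<longlonglongrightarrow> N * exp (\<nu> * 0) * 0"
      by (intro tendsto_intros d0 tendsto_zero_powrI[OF d0 tendsto_const]) (use d a e in \<open>auto simp: less_imp_le\<close>)
    then have lim0: "(\<lambda>n. N * exp (\<nu> * d n) * d n powr (a + e)) \<longlonglongrightarrow> 0" by simp
    have "norm (G (0 + of_real (d n))) \<le> N * exp (\<nu> * d n) * d n powr (a + e)" for n
      using G[of "of_real (d n)"] d(1)[of n] gb(4) by (simp flip: powr_add)
    then have "\<forall>\<^sub>F n in sequentially. norm (G (0 + of_real (d n))) \<le> N * exp (\<nu> * d n) * d n powr (a + e)"
      by (intro always_eventually allI)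
    from LIMSEQ_unique[OF S Lim_null_comparison[OF this lim0]] have "S 0 = 0" by simp
    then show ?thesis using True by simp
  next
    case False
    define r where "r = cmod z"
    have r: "r > 0" using False by (simp add: r_def)
    have "norm (G (z + of_real r)) \<le> N * exp (\<nu> * cmod (z + of_real r)) *
        (cmod (z + of_real r) powr a' * Re (z + of_real r) powr (- b'))"
      using z r by (intro G) simp
    also have "\<dots> \<le> N * exp (\<nu> * (2 * r)) * ((2 * r) powr a' * r powr (- b'))"
    proof (intro mult_mono)
      have c: "cmod (z + of_real r) \<le> 2 * r" using norm_triangle_ineq[of z "of_real r"] r by (simp add: r_def)
      show "exp (\<nu> * cmod (z + of_real r)) \<le> exp (\<nu> * (2 * r))" using mult_left_mono[OF c N(2)] by simp
      show "cmod (z + of_real r) powr a' \<le> (2 * r) powr a'" using c gb(2) by (intro powr_mono2) auto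
      show "Re (z + of_real r) powr (- b') \<le> r powr (- b')" using z r gb(3) by (intro powr_mono2') auto
    qed (use N in auto)
    also have "(2 * r) powr a' * r powr (- b') = 2 powr a' * r powr (a + e)"
      using r gb(4) by (simp add: powr_mult flip: powr_add)
    finally have 1: "norm (G (z + of_real r)) \<le> N * exp (\<nu> * (2 * r)) * (2 powr a' * r powr (a + e))" .
    have 2: "norm (G (z + of_real r) - G (z + of_real (d n))) \<le> M * exp (\<omega> * (2 * r)) * (2 powr a / e * r powr (a + e))"
      if "d n \<le> r" for n
    proof -
      have "norm (G (z + of_real r) - G (z + of_real (d n))) \<le>
          M * exp (\<omega> * (cmod z + r)) * (cmod z + r) powr a * (r powr e / e)"
        by (rule diff[OF z d(1) that])
      also have "\<dots> = M * exp (\<omega> * (2 * r)) * (2 powr a / e * r powr (a + e))"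
        using r by (simp add: r_def[symmetric] powr_mult powr_add mult_ac flip: mult_2)
      finally show ?thesis .
    qed
    let ?E = "exp ((2 * \<nu> + 2 * \<omega>) * r)" and ?P = "r powr (a + e)"
    have E: "exp (\<nu> * (2 * r)) \<le> ?E" "exp (\<omega> * (2 * r)) \<le> ?E" using N M r by (auto simp: algebra_simps)
    have 3: "norm (G (z + of_real (d n))) \<le> B * ?E * ?P" if "d n \<le> r" for n
    proof -
      have "norm (G (z + of_real (d n))) \<le> norm (G (z + of_real r)) + norm (G (z + of_real r) - G (z + of_real (d n)))"
        using norm_triangle_ineq4[of "G (z + of_real r)" "G (z + of_real r) - G (z + of_real (d n))"] by simp
      also have "\<dots> \<le> N * ?E * (2 powr a' * ?P) + M * ?E * (2 powr a / e * ?P)"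
      proof (rule add_mono)
        show "norm (G (z + of_real r)) \<le> N * ?E * (2 powr a' * ?P)"
          by (rule order_trans[OF 1], intro mult_right_mono mult_left_mono) (use N E in auto)
        show "norm (G (z + of_real r) - G (z + of_real (d n))) \<le> M * ?E * (2 powr a / e * ?P)"
          by (rule order_trans[OF 2[OF that]], intro mult_right_mono mult_left_mono) (use M e E in auto)
      qed
      also have "\<dots> = B * ?E * ?P" by (simp add: B_def algebra_simps)
      finally show ?thesis .
    qed
    have "\<forall>\<^sub>F n in sequentially. d n < r" by (rule order_tendstoD(2)[OF d0 r])
    then have "\<forall>\<^sub>F n in sequentially. norm (G (z + of_real (d n))) \<le> B * ?E * ?P"
      by (rule eventually_mono) (rule 3, simp)
    from tendsto_upperbound[OF tendsto_norm[OF S[OF z]] this]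
    show ?thesis by (simp add: r_def)
  qed
  have lim: "(\<lambda>n. G (z + of_real (1 / (real n + 1)))) \<longlonglongrightarrow> S z" if "0 \<le> Re z" for z
    using S[OF that] by (simp add: d_def)
  have "2 * \<nu> + 2 * \<omega> \<ge> 0" using N M by simp
  with B bound have "\<exists>M\<ge>0. \<exists>\<omega>\<ge>0. \<forall>z. 0 \<le> Re z \<longrightarrow> norm (S z) \<le> M * exp (\<omega> * cmod z) * cmod z powr (a + e)"
    by blast
  with SG contS lim show ?thesis by blast
qed

section \<open>From the semigroup to the integrated semigroup\<close>

lemma powr_le_exp: "0 \<le> t \<Longrightarrow> 0 \<le> c \<Longrightarrow> t powr c \<le> exp (c * t)" for t c :: real
proof (cases "t = 0")
  case False
  assume "0 \<le> t" "0 \<le> c"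
  moreover have "ln t \<le> t" using False \<open>0 \<le> t\<close> ln_le_minus_one[of t] by simp
  ultimately show ?thesis using False by (simp add: powr_def mult_left_mono)
qed simp

text \<open>Connects the operator-valued integral, taken in norm, with the orbits on which Laplace
  transforms are defined.\<close>

lemma frac_int_of_real:
  fixes F :: "complex \<Rightarrow> 'a::complex_banach \<Rightarrow>\<^sub>L 'a"
  assumes "vholomorphic_on F rhp" "growth_bound F a b" "a \<ge> 0" "b \<ge> 0" "a - b > -1" "q > 0" and t: "t > 0"
  shows "blinfun_apply (frac_int q F (of_real t)) x = frac_ray q (\<lambda>s. blinfun_apply (F (of_real s)) x) t"
proof -
  have "0 < Re (of_real t)" using t by simp
  note int = frac_integrable[OF assms(1-6) this]
  have "frac_int q F (of_real t) = (t powr q / Gamma q) *\<^sub>R integral {0..1} (\<lambda>u. (1 - u) powr (q - 1) *\<^sub>R F (of_real u * of_real t))"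
    unfolding frac_int_def using t by (simp add: powr_of_real flip: scaleC_of_real)
  then show ?thesis
    using integral_unique[OF has_integral_blinfun_apply[OF integrable_integral[OF int], of x]]
    by (simp add: frac_ray_def blinfun.scaleR_left)
qed

text \<open>The order q = b + e makes the derivative exponent b + 1 - q equal to 1 - e, integrable
  up to the imaginary axis, and makes the degree a + q - b equal to a + e, the growth exponent of
  the boundary extension.\<close>

lemma holomorphic_imp_integrated:
  fixes T :: "real \<Rightarrow> 'a::complex_banach \<Rightarrow>\<^sub>L 'a"
  assumes A: "mv_linear A" "closed A"
    and gen: "\<And>\<mu>. \<mu> > \<mu>0 \<Longrightarrow> complex_of_real \<mu> \<in> resolvent_set A \<and> op_has_laplace T \<mu> (resolvent A (complex_of_real \<mu>))"
    and hol: "vholomorphic_on U rhp" and cb: "\<And>z. 0 < Re z \<Longrightarrow> U z \<in> cblin_ops"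
    and UT: "\<And>t. t > 0 \<Longrightarrow> U (of_real t) = T t"
    and gb: "growth_bound U a b" and a: "a \<ge> 0" and b: "b \<ge> 0" "b - a < 1" "b \<ge> a" and e: "0 < e" "e < 1"
  shows "\<exists>S. generates_holomorphic_bv A (b + e) S \<and>
    (\<exists>M>0. \<exists>\<omega>>0. \<forall>z. 0 \<le> Re z \<longrightarrow> norm (S z) \<le> M * exp (\<omega> * cmod z) * cmod z powr (a + e))"
proof -
  define q where "q = b + e"
  define G where "G = frac_int q U"
  have ab: "a - b > -1" and q: "q > 0" "q < b + 1" using b e by (auto simp: q_def)
  note J = hol gb a b(1) ab q(1)
  have holG: "vholomorphic_on G rhp" unfolding G_def by (rule vholomorphic_frac_int[OF J])
  have gbG: "growth_bound G (a + q) b" unfolding G_def by (rule growth_bound_frac_int[OF J])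
  have "growth_bound (vderiv G) a (b + 1 - q)" unfolding G_def by (rule growth_bound_vderiv_frac_int[OF J q(2)])
  then have gbG': "growth_bound (vderiv G) a (1 - e)" by (simp add: q_def)
  have aq: "a + q \<ge> 0" "a + q - b = a + e" using a q by (auto simp: q_def)
  obtain S M \<omega> where SG: "\<And>z. 0 < Re z \<Longrightarrow> S z = G z" and cS: "continuous_on {z. 0 \<le> Re z} S"
    and lim: "\<And>z. 0 \<le> Re z \<Longrightarrow> (\<lambda>n. G (z + of_real (1 / (real n + 1)))) \<longlonglongrightarrow> S z"
    and M: "M \<ge> 0" "\<omega> \<ge> 0" and bd: "\<And>z. 0 \<le> Re z \<Longrightarrow> norm (S z) \<le> M * exp (\<omega> * cmod z) * cmod z powr (a + e)"
    using boundary_extension[OF holG gbG' a e gbG aq(1) b(1) aq(2)] by metis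
  \<comment> \<open>On the imaginary axis \<open>S\<close> is known only as a norm limit, so complex
    linearity is inherited from the closedness of \<open>cblin_ops\<close>.\<close>
  have cbS: "S z \<in> cblin_ops" if z: "0 \<le> Re z" for z
  proof (rule closed_sequentially[OF closed_cblin_ops _ lim[OF z]])
    show "G (z + of_real (1 / (real n + 1))) \<in> cblin_ops" for n
      unfolding G_def using z by (intro cblin_ops_frac_int[OF J _ cb]) (auto intro: add_nonneg_pos)
  qed
  obtain N \<nu> where N: "N \<ge> 0" "\<nu> \<ge> 0" and U: "\<And>z. 0 < Re z \<Longrightarrow>
     norm (U z) \<le> N * exp (\<nu> * cmod z) * (cmod z powr a * Re z powr (- b))"
    using gb unfolding growth_bound_def by blast
  have cSx: "continuous_on {0..} (\<lambda>t. blinfun_apply (S (of_real t)) x)" for x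
    by (intro continuous_intros continuous_on_compose2[OF cS]) auto
  define \<omega>' where "\<omega>' = \<omega> + (a + e)"
  have Sbd: "norm (blinfun_apply (S (of_real t)) x) \<le> (M * norm x) * exp (\<omega>' * t)" if t: "0 \<le> t" for t x
  proof -
    have "norm (S (of_real t)) \<le> M * exp (\<omega> * t) * t powr (a + e)" using bd[of "of_real t"] t by simp
    also have "\<dots> \<le> M * exp (\<omega> * t) * exp ((a + e) * t)"
      using t a e M by (intro mult_left_mono powr_le_exp) auto
    also have "\<dots> = M * exp (\<omega>' * t)" by (simp add: \<omega>'_def algebra_simps flip: exp_add)
    finally have "norm (S (of_real t)) * norm x \<le> M * exp (\<omega>' * t) * norm x" by (rule mult_right_mono) simp
    then show ?thesis using norm_blinfun[of "S (of_real t)" x] by (simp add: mult_ac)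
  qed
  define m where "m = max 0 (max \<mu>0 (max \<omega>' \<nu>))"
  have lap: "\<exists>L. op_has_laplace (\<lambda>t. S (of_real t)) \<mu> L \<and> resolvent A (complex_of_real \<mu>) = (\<mu> powr q) *\<^sub>R L"
    if \<mu>: "\<mu> > m" for \<mu>
  proof -
    have \<mu>': "\<mu> > 0" "\<mu> > \<mu>0" "\<mu> > \<omega>'" "\<mu> > \<nu>" using \<mu> by (auto simp: m_def)
    define R where "R = resolvent A (complex_of_real \<mu>)"
    have R: "op_has_laplace T \<mu> R" using gen[OF \<mu>'(2)] by (simp add: R_def)
    have ex: "\<exists>y. has_laplace (\<lambda>t. blinfun_apply (S (of_real t)) x) \<mu> y" for x
      by (rule laplace_exponential_bound[OF loc_bochner_continuous[OF cSx] Sbd \<mu>'(3)]) simp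
    obtain L where L: "op_has_laplace (\<lambda>t. S (of_real t)) \<mu> L"
      using laplace_op_exists[of "\<lambda>t. S (of_real t)" \<mu>] cbS ex by auto
    have "blinfun_apply R x = \<mu> powr q *\<^sub>R blinfun_apply L x" for x
    proof -
      have "blinfun_apply L x = \<mu> powr (- q) *\<^sub>R blinfun_apply R x"
      proof (rule has_laplace_frac_ray[where f = "\<lambda>t. blinfun_apply (T t) x" and c = "a - b" and K = "N * norm x"])
        have "continuous_on {0<..} (\<lambda>t. blinfun_apply (U (of_real t)) x)"
          by (intro continuous_intros continuous_on_compose2[OF vholomorphic_on_imp_continuous_on[OF hol]]) auto
        then show "continuous_on {0<..} (\<lambda>t. blinfun_apply (T t) x)"
          by (subst continuous_on_cong[OF refl, where g = "\<lambda>t. blinfun_apply (U (of_real t)) x"]) (auto simp: UT)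
        show "norm (blinfun_apply (T t) x) \<le> N * norm x * exp (\<nu> * t) * t powr (a - b)" if t: "0 < t" for t
        proof -
          have "norm (T t) \<le> N * exp (\<nu> * t) * t powr (a - b)"
            using U[of "of_real t"] t UT[OF t] by (simp flip: powr_add)
          then have "norm (T t) * norm x \<le> N * exp (\<nu> * t) * t powr (a - b) * norm x" by (rule mult_right_mono) simp
          then show ?thesis using norm_blinfun[of "T t" x] by (simp add: mult_ac)
        qed
        show "has_laplace (\<lambda>t. blinfun_apply (T t) x) \<mu> (blinfun_apply R x)" using R by (simp add: op_has_laplace_def)
        show "has_laplace (\<lambda>t. blinfun_apply (S (of_real t)) x) \<mu> (blinfun_apply L x)" using L by (simp add: op_has_laplace_def)
        fix t :: real assume t: "t > 0"
        have "blinfun_apply (S (of_real t)) x = frac_ray q (\<lambda>s. blinfun_apply (U (of_real s)) x) t"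
          using SG[of "of_real t"] frac_int_of_real[OF J t, of x] t by (simp add: G_def)
        also have "\<dots> = frac_ray q (\<lambda>s. blinfun_apply (T s) x) t"
          unfolding frac_ray_def
          by (intro arg_cong2[where f = scaleR] refl integral_spike[of "{0}"]) (use t in \<open>auto simp: UT simp flip: of_real_mult\<close>)
        finally show "blinfun_apply (S (of_real t)) x = frac_ray q (\<lambda>s. blinfun_apply (T s) x) t" .
      qed (use ab q N \<mu>' in auto)
      then show ?thesis using \<mu>'(1) by (simp add: powr_minus)
    qed
    then have "R = \<mu> powr q *\<^sub>R L" by (intro blinfun_eqI) (simp add: blinfun.scaleR_left)
    with L show ?thesis unfolding R_def by blast
  qed
  have "generates_integrated_semigroup A q (\<lambda>t. S (of_real t))"
    unfolding generates_integrated_semigroup_def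
  proof (intro conjI A allI impI exI[of _ m])
    have "complex_of_real (\<mu>0 + 1) \<in> resolvent_set A" using gen[of "\<mu>0 + 1"] by simp
    then show "resolvent_set A \<noteq> {}" by blast
    show "complex_of_real \<mu> \<in> resolvent_set A" if "\<mu> > m" for \<mu> using gen[of \<mu>] that by (simp add: m_def)
  qed (use cbS cSx lap in \<open>auto simp: m_def\<close>)
  moreover have "vholomorphic_on S rhp"
    using holG vholomorphic_on_cong[of rhp S G] SG by simp
  ultimately have "generates_holomorphic_bv A q S"
    unfolding generates_holomorphic_bv_def using cbS cS by simp
  moreover have "norm (S z) \<le> (M + 1) * exp ((\<omega> + 1) * cmod z) * cmod z powr (a + e)" if z: "0 \<le> Re z" for z
    by (rule order_trans[OF bd[OF z]], intro mult_right_mono mult_mono) (use M in \<open>auto simp: mult_right_mono\<close>)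
  moreover have "M + 1 > 0" "\<omega> + 1 > 0" using M by auto
  ultimately show ?thesis unfolding q_def by blast
qed

section \<open>From the integrated semigroup to the semigroup\<close>

text \<open>Measurability is the delicate point in a nonseparable space: \<open>g\<close> is first
  replaced by simple functions, and the difference is obtained as a pointwise limit.\<close>

lemma loc_bochner_diff_continuous:
  fixes f g :: "real \<Rightarrow> 'b::banach"
  assumes f: "loc_bochner_integrable f" and g: "continuous_on {0..} g"
  shows "loc_bochner_integrable (\<lambda>t. f t - g t)"
  unfolding loc_bochner_integrable_def
proof (intro allI impI)
  fix \<tau> :: real assume \<tau>: "\<tau> > 0"
  let ?M = "lebesgue_on {0<..\<tau>}"
  obtain x where x: "has_bochner_int ?M f x"
    using f \<tau> unfolding loc_bochner_integrable_def by blast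
  have fm: "f \<in> borel_measurable ?M" using x by (simp add: has_bochner_int_def)
  obtain s where s: "\<And>i. simple_function ?M (s i)"
    and int: "\<And>i. integrable ?M (\<lambda>t. norm (f t - s i t))"
    and n0: "(\<lambda>i. integral\<^sup>L ?M (\<lambda>t. norm (f t - s i t))) \<longlonglongrightarrow> 0"
    and "(\<lambda>i. Bochner_Integration.simple_bochner_integral ?M (s i)) \<longlonglongrightarrow> x"
    by (rule has_bochner_int_approx[OF x]) (rule that)
  have "\<forall>i. \<exists>e. simple_function ?M e \<and>
      (\<forall>t. 0 < t \<longrightarrow> t \<le> \<tau> \<longrightarrow> norm (g t - e t) \<le> inverse (real (Suc i)))"
    using g by (intro allI continuous_approx_simple) (auto intro: continuous_on_subset[OF g])
  then obtain e where e: "\<And>i. simple_function ?M (e i)"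
    "\<And>i t. 0 < t \<Longrightarrow> t \<le> \<tau> \<Longrightarrow> norm (g t - e i t) \<le> inverse (real (Suc i))" by metis
  have emeas: "(\<lambda>t. f t - e i t) \<in> borel_measurable ?M" for i
    by (rule measurable_simple_function_split[OF e(1)], rule measurable_compose[OF fm])
      (intro borel_measurable_continuous_onI continuous_intros)
  have elim: "(\<lambda>i. e i t) \<longlonglongrightarrow> g t" if "0 < t" "t \<le> \<tau>" for t
    by (rule LIM_zero_cancel, rule Lim_null_comparison[OF _ LIMSEQ_inverse_real_of_nat])
      (use e(2)[OF that] in \<open>simp add: norm_minus_commute\<close>)
  interpret finite_measure ?M by (rule finite_measure_lebesgue_on_Ioc)
  define h where "h i t = norm (f t - s i t) + inverse (real (Suc i))" for i t
  show "\<exists>x. has_bochner_int ?M (\<lambda>t. f t - g t) x"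
  proof (rule has_bochner_intI[where s = "\<lambda>i t. s i t - e i t" and h = h])
    show "(\<lambda>t. f t - g t) \<in> borel_measurable ?M"
      by (rule borel_measurable_LIMSEQ_metric[OF emeas])
        (use elim in \<open>auto intro!: tendsto_intros\<close>)
    show "simple_function ?M (\<lambda>t. s i t - e i t)" for i
      by (rule simple_function_compose2[OF s e(1)])
    show "integrable ?M (h i)" for i
      unfolding h_def by (intro Bochner_Integration.integrable_add int) simp
    show "norm (f t - g t - (s i t - e i t)) \<le> h i t" if t: "0 < t" "t \<le> \<tau>" for i t
    proof -
      have "f t - g t - (s i t - e i t) = (f t - s i t) - (g t - e i t)" by simp
      also have "norm \<dots> \<le> h i t"
        unfolding h_def using e(2)[OF t, of i] norm_triangle_ineq4[of "f t - s i t" "g t - e i t"] by linarith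
      finally show ?thesis .
    qed
    have "integral\<^sup>L ?M (h i) = integral\<^sup>L ?M (\<lambda>t. norm (f t - s i t)) + measure ?M {0<..\<tau>} * inverse (real (Suc i))" for i
      unfolding h_def using int[of i] by (subst Bochner_Integration.integral_add) auto
    moreover have "(\<lambda>i. integral\<^sup>L ?M (\<lambda>t. norm (f t - s i t)) + measure ?M {0<..\<tau>} * inverse (real (Suc i))) \<longlonglongrightarrow>
        0 + measure ?M {0<..\<tau>} * 0"
      by (intro tendsto_intros LIMSEQ_inverse_real_of_nat n0)
    ultimately show "(\<lambda>i. integral\<^sup>L ?M (h i)) \<longlonglongrightarrow> 0" by simp
  qed
qed

primrec iterated_integral :: "nat \<Rightarrow> (real \<Rightarrow> 'b::banach) \<Rightarrow> real \<Rightarrow> 'b" where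
  "iterated_integral 0 f = f"
| "iterated_integral (Suc n) f = (\<lambda>t. integral {0..t} (iterated_integral n f))"

lemma iterated_integral_laplace:
  fixes f :: "real \<Rightarrow> 'b::banach"
  assumes y: "\<And>\<mu>. \<mu> > m \<Longrightarrow> has_laplace f \<mu> (y \<mu>)" and m: "m \<ge> 0" and \<mu>: "\<mu> > m"
  shows "has_laplace (iterated_integral n f) \<mu> ((1 / \<mu>) ^ n *\<^sub>R y \<mu>)"
  using \<mu>
proof (induction n arbitrary: \<mu>)
  case (Suc n)
  \<comment> \<open>Dividing by \<mu> for one more integration needs convergence at a smaller
    positive point; the midpoint still lies beyond \<open>m\<close>.\<close>
  define \<mu>0 where "\<mu>0 = (m + \<mu>) / 2"
  have \<mu>0: "\<mu>0 > m" "\<mu>0 > 0" "\<mu> > \<mu>0" using Suc.prems m by (auto simp: \<mu>0_def)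
  from has_laplace_integral(2)[OF Suc.IH[OF \<mu>0(1)] \<mu>0(2,3) Suc.IH[OF Suc.prems]]
  show ?case by (simp add: mult.commute)
qed (use y in simp)

lemma iterated_integral_Suc:
  fixes f :: "real \<Rightarrow> 'b::banach"
  assumes y: "\<And>\<mu>. \<mu> > m \<Longrightarrow> has_laplace f \<mu> (y \<mu>)" and m: "m \<ge> 0"
  shows "continuous_on {0..} (iterated_integral (Suc n) f)"
    and "\<exists>K. \<forall>t\<ge>0. norm (iterated_integral (Suc n) f t) \<le> K * exp ((m + 1) * t)"
proof -
  have h: "has_laplace (iterated_integral n f) (m + 1) ((1 / (m + 1)) ^ n *\<^sub>R y (m + 1))"
    by (rule iterated_integral_laplace[OF y m]) simp_all
  then have l: "loc_bochner_integrable (iterated_integral n f)" by (simp add: has_laplace_def)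
  show "continuous_on {0..} (iterated_integral (Suc n) f)"
    using integral_loc_bochner_continuous[OF l] by simp
  show "\<exists>K. \<forall>t\<ge>0. norm (iterated_integral (Suc n) f t) \<le> K * exp ((m + 1) * t)"
    using has_laplace_integral(1)[OF h] m by simp
qed

lemma integral_has_vector_derivative_at:
  fixes f :: "real \<Rightarrow> 'b::banach"
  assumes f: "continuous_on {0..} f" and t: "t > 0"
  shows "((\<lambda>t. integral {0..t} f) has_vector_derivative f t) (at t)"
proof -
  have "((\<lambda>t. integral {0..t} f) has_vector_derivative f t) (at t within {0..t + 1})"
    using t by (intro integral_has_vector_derivative continuous_on_subset[OF f]) auto
  moreover have "at t within {0..t + 1} = at t"
    using t by (intro at_within_interior) simp
  ultimately show ?thesis by simp
qed

lemma cblin_vderiv_has_vector_derivative: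
  fixes V :: "complex \<Rightarrow> 'a::complex_banach \<Rightarrow>\<^sub>L 'a"
  assumes hol: "vholomorphic_on V rhp" and t: "t > 0"
  shows "((\<lambda>t. blinfun_apply (V (of_real t)) x) has_vector_derivative blinfun_apply (vderiv V (of_real t)) x) (at t)"
proof -
  have "has_cderiv V (vderiv V (0 + of_real t * 1)) (0 + of_real t * 1)"
    using hol t by (simp add: vholomorphic_on_open[OF open_rhp])
  from has_cderiv_line[OF this]
  have "((\<lambda>t. V (of_real t)) has_vector_derivative vderiv V (of_real t)) (at t)" by simp
  from bounded_linear.has_vector_derivative[OF blinfun.bounded_linear_left this] show ?thesis .
qed

text \<open>The orbits of \<open>T\<close> are not known to be continuous.  The function \<open>U\<close> agrees with \<open>T\<close> almost
  everywhere on each orbit, and agreement at some \<open>p < r\<close> propagates to \<open>r\<close> by the semigroup law.\<close>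

lemma semigroup_eq_derivative:
  fixes T :: "real \<Rightarrow> 'a::complex_banach \<Rightarrow>\<^sub>L 'a"
  assumes sg: "op_semigroup T" and loc: "\<And>x. loc_bochner_integrable (\<lambda>t. blinfun_apply (T t) x)"
    and hol: "vholomorphic_on V rhp"
    and VT: "\<And>t x. t > 0 \<Longrightarrow> blinfun_apply (V (of_real t)) x = integral {0..t} (\<lambda>s. blinfun_apply (T s) x)"
    and r: "r > 0"
  shows "vderiv V (of_real r) = T r"
proof (rule blinfun_eqI)
  fix x
  define J where "J t = integral {0..t} (\<lambda>s. blinfun_apply (T s) x)" for t
  define u where "u t = blinfun_apply (vderiv V (of_real t)) x" for t
  have Ju: "(J has_vector_derivative u t) (at t)" if t: "t > 0" for t
  proof (rule has_vector_derivative_transform_within_open[OF _ open_greaterThan[of 0]])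
    show "((\<lambda>t. blinfun_apply (V (of_real t)) x) has_vector_derivative u t) (at t)"
      unfolding u_def by (rule cblin_vderiv_has_vector_derivative[OF hol t])
  qed (use t VT in \<open>auto simp: J_def\<close>)
  have shift: "blinfun_apply (T s) (J t) = J (s + t) - J s" if st: "s > 0" "t > 0" for s t
  proof -
    have "blinfun_apply (T s) (J t) = integral {0..t} (\<lambda>\<sigma>. blinfun_apply (T s) (blinfun_apply (T \<sigma>) x))"
      unfolding J_def
      using integral_linear[OF loc_bochner_integrable_on[OF loc order_refl] blinfun.bounded_linear_right[of "T s"]]
      by (simp add: o_def)
    also have "\<dots> = integral {0..t} ((\<lambda>\<sigma>. blinfun_apply (T \<sigma>) x) \<circ> (+) s)"
    proof (rule integral_spike[of "{0}"])
      fix \<sigma> assume "\<sigma> \<in> {0..t} - {0}"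
      then have "T (s + \<sigma>) = T s o\<^sub>L T \<sigma>" using sg st by (auto simp: op_semigroup_def)
      then show "((\<lambda>\<sigma>. blinfun_apply (T \<sigma>) x) \<circ> (+) s) \<sigma> = blinfun_apply (T s) (blinfun_apply (T \<sigma>) x)" by simp
    qed simp
    also have "\<dots> = integral {s..t + s} (\<lambda>\<sigma>. blinfun_apply (T \<sigma>) x)"
      unfolding integral_shift_Icc_real by simp
    also have "\<dots> = J (t + s) - J s"
      unfolding J_def using st by (intro integral_diff_loc_bochner[symmetric] loc) auto
    finally show ?thesis by (simp add: add.commute)
  qed
  \<comment> \<open>Differentiate T(s) J(t) = J(s + t) - J(s) in \<open>t\<close> with
    \<open>s\<close> fixed. Both sides are differentiable because \<open>J\<close> is the
    restriction of a holomorphic orbit and T(s) is a bounded operator.\<close>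
  have Tu: "blinfun_apply (T s) (u t) = u (s + t)" if st: "s > 0" "t > 0" for s t
  proof (rule vector_derivative_unique_at)
    show "((\<lambda>t. blinfun_apply (T s) (J t)) has_vector_derivative blinfun_apply (T s) (u t)) (at t)"
      by (rule bounded_linear.has_vector_derivative[OF blinfun.bounded_linear_right Ju[OF st(2)]])
    have "((\<lambda>t. J (s + t) - J s) has_vector_derivative u (s + t)) (at t)"
    proof -
      have "((\<lambda>t. s + t) has_vector_derivative 1) (at t)" by (auto intro!: derivative_eq_intros)
      moreover have "(J has_vector_derivative u (s + t)) (at (s + t))" using st by (intro Ju) simp
      ultimately have "((J \<circ> (\<lambda>t. s + t)) has_vector_derivative 1 *\<^sub>R u (s + t)) (at t)"
        by (rule vector_diff_chain_at)
      then show ?thesis by (auto intro!: derivative_eq_intros simp: o_def)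
    qed
    then show "((\<lambda>t. blinfun_apply (T s) (J t)) has_vector_derivative u (s + t)) (at t)"
      by (rule has_vector_derivative_transform_within_open[OF _ open_greaterThan[of 0]])
        (use st shift in auto)
  qed
  \<comment> \<open>Nothing controls \<open>u\<close> near 0, so the orbit of T(\<delta>)x is
    compared with the translate of \<open>u\<close> by \<delta>, continuous up to 0. A zero of the
    difference before \<delta> gives agreement at a time below 2\<delta> = r.\<close>
  define \<delta> where "\<delta> = r / 2"
  have \<delta>: "\<delta> > 0" using r by (simp add: \<delta>_def)
  define f where "f t = blinfun_apply (T t) (blinfun_apply (T \<delta>) x) - u (t + \<delta>)" for t
  have cu: "continuous_on {0..} (\<lambda>t. u (t + \<delta>))"
    unfolding u_def using \<delta>
    by (intro continuous_intros continuous_on_compose2[OF vholomorphic_on_imp_continuous_on[OF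
            vholomorphic_on_vderiv[OF open_rhp hol]]]) auto
  have lf: "loc_bochner_integrable f" unfolding f_def by (rule loc_bochner_diff_continuous[OF loc cu])
  have "integral {0..t} f = 0" if t: "0 \<le> t" for t
  proof -
    have "((\<lambda>s. u (s + \<delta>)) has_integral J (t + \<delta>) - J (0 + \<delta>)) {0..t}"
    proof (rule fundamental_theorem_of_calculus[OF t])
      fix s assume s: "s \<in> {0..t}"
      have "((\<lambda>s. s + \<delta>) has_vector_derivative 1) (at s)" by (auto intro!: derivative_eq_intros)
      moreover have "(J has_vector_derivative u (s + \<delta>)) (at (s + \<delta>))" using s \<delta> by (intro Ju) simp
      ultimately have "((J \<circ> (\<lambda>s. s + \<delta>)) has_vector_derivative 1 *\<^sub>R u (s + \<delta>)) (at s)"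
        by (rule vector_diff_chain_at)
      then show "((\<lambda>s. J (s + \<delta>)) has_vector_derivative u (s + \<delta>)) (at s within {0..t})"
        by (simp add: o_def has_vector_derivative_at_within)
    qed
    moreover have "((\<lambda>s. blinfun_apply (T s) (blinfun_apply (T \<delta>) x)) has_integral J (t + \<delta>) - J \<delta>) {0..t}"
    proof -
      have "((\<lambda>\<sigma>. blinfun_apply (T \<sigma>) x) has_integral J (t + \<delta>) - J \<delta>) {0 + \<delta>..t + \<delta>}"
        using integral_diff_loc_bochner[OF loc, of \<delta> "t + \<delta>" x] t \<delta>
          integrable_integral[OF loc_bochner_integrable_on[OF loc, of \<delta> x "t + \<delta>"]]
        by (simp add: J_def)
      then have "((\<lambda>\<sigma>. blinfun_apply (T \<sigma>) x) \<circ> (+) \<delta> has_integral J (t + \<delta>) - J \<delta>) {0..t}"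
        by (simp only: has_integral_shift_Icc_real)
      then show ?thesis
      proof (rule has_integral_spike[of "{0}", rotated 2])
        fix s assume "s \<in> {0..t} - {0}"
        then have "T (s + \<delta>) = T s o\<^sub>L T \<delta>" using sg \<delta> by (auto simp: op_semigroup_def)
        then show "blinfun_apply (T s) (blinfun_apply (T \<delta>) x) = ((\<lambda>\<sigma>. blinfun_apply (T \<sigma>) x) \<circ> (+) \<delta>) s"
          by (simp add: add.commute)
      qed simp
    qed
    ultimately have "(f has_integral (J (t + \<delta>) - J \<delta>) - (J (t + \<delta>) - J (0 + \<delta>))) {0..t}"
      unfolding f_def by (intro has_integral_diff)
    then show ?thesis by (simp add: integral_unique)
  qed
  then obtain t where t: "0 < t" "t < \<delta>" "f t = 0"
    using loc_bochner_zero_integrals[OF lf \<delta>] by blast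
  define p where "p = t + \<delta>"
  have p: "0 < p" "p < r" using t by (auto simp: p_def \<delta>_def)
  have "T (t + \<delta>) = T t o\<^sub>L T \<delta>" using sg t \<delta> by (auto simp: op_semigroup_def)
  then have Tp: "blinfun_apply (T p) x = u p" using t(3) by (simp add: f_def p_def)
  have "T ((r - p) + p) = T (r - p) o\<^sub>L T p" using sg p unfolding op_semigroup_def by (metis diff_gt_0_iff_gt)
  then have "blinfun_apply (T r) x = blinfun_apply (T (r - p)) (u p)" using Tp by simp
  also have "\<dots> = u r" using Tu[of "r - p" p] p by simp
  finally show "blinfun_apply (vderiv V (of_real r)) x = blinfun_apply (T r) x" by (simp add: u_def)
qed

text \<open>For \<open>V\<close>, the fractional integral of \<open>S\<close> of order
  \<open>q\<close>, the derivative has exponents (a, 1 - q), and each of the \<open>n\<close>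
  further derivatives adds 1 to the second. As q = n + 1 - \<kappa>, the total is exactly
  \<kappa>.\<close>

lemma integrated_imp_holomorphic:
  fixes T :: "real \<Rightarrow> 'a::complex_banach \<Rightarrow>\<^sub>L 'a"
  assumes sg: "op_semigroup T"
    and gen: "\<And>\<mu>. \<mu> > \<mu>0 \<Longrightarrow> op_has_laplace T \<mu> (resolvent A (complex_of_real \<mu>))"
    and S: "generates_holomorphic_bv A \<kappa> S" and \<kappa>: "\<kappa> > 0" and a: "a \<ge> 0"
    and M: "M \<ge> 0" and \<omega>: "\<omega> \<ge> 0"
    and bd: "\<And>z. 0 \<le> Re z \<Longrightarrow> norm (S z) \<le> M * exp (\<omega> * cmod z) * cmod z powr a"
  shows "\<exists>U. (\<forall>z. 0 < Re z \<longrightarrow> U z \<in> cblin_ops) \<and> vholomorphic_on U rhp \<and>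
    (\<forall>t>0. U (of_real t) = T t) \<and> growth_bound U a \<kappa>"
proof -
  have gis: "generates_integrated_semigroup A \<kappa> (\<lambda>t. S (of_real t))"
    and cbS: "\<And>z. 0 \<le> Re z \<Longrightarrow> S z \<in> cblin_ops"
    and holS: "vholomorphic_on S rhp"
    using S by (auto simp: generates_holomorphic_bv_def)
  from gis obtain \<omega>1 where \<omega>1: "\<omega>1 \<ge> 0" "\<And>\<mu>. \<mu> > \<omega>1 \<Longrightarrow>
      \<exists>L. op_has_laplace (\<lambda>t. S (of_real t)) \<mu> L \<and> resolvent A (complex_of_real \<mu>) = (\<mu> powr \<kappa>) *\<^sub>R L"
    unfolding generates_integrated_semigroup_def by blast
  have cSx: "continuous_on {0..} (\<lambda>t. blinfun_apply (S (of_real t)) x)" for x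
    using gis by (simp add: generates_integrated_semigroup_def)
  have gbS: "growth_bound S a 0"
    by (rule growth_boundI[OF M \<omega>]) (use bd in auto)
  \<comment> \<open>With the floor, the order \<open>q\<close> lies in the half-open interval from 0
    to 1, and q = 1 occurs exactly for integer \<kappa>.\<close>
  define n where "n = nat \<lfloor>\<kappa>\<rfloor>"
  define q where "q = real (Suc n) - \<kappa>"
  have q: "0 < q" "q \<le> 1"
  proof -
    have "real n = of_int \<lfloor>\<kappa>\<rfloor>" using \<kappa> by (simp add: n_def)
    then show "0 < q" "q \<le> 1" unfolding q_def by linarith+
  qed
  have a0: "a - 0 > -1" using a by simp
  note J = holS gbS a order_refl a0 q(1)
  define V where "V = frac_int q S"
  have holV: "vholomorphic_on V rhp" unfolding V_def by (rule vholomorphic_frac_int[OF J])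
  have gbV: "growth_bound V (a + q) 0" unfolding V_def by (rule growth_bound_frac_int[OF J])
  \<comment> \<open>The general estimate needs q < b + 1 with b = 0. In the remaining case q = 1 the
    derivative is \<open>S\<close> itself.\<close>
  have gbV': "growth_bound (vderiv V) a (1 - q)"
  proof (cases "q = 1")
    case True
    have "vderiv (frac_int 1 S) z = S z" if "0 < Re z" for z
      by (rule vderiv_eq[OF frac_int_has_cderiv_1[OF J(1-5) that]])
    then have "growth_bound (vderiv (frac_int 1 S)) a 0" by (intro growth_bound_cong[OF gbS]) simp
    then show ?thesis using True by (simp add: V_def)
  next
    case False
    then have "growth_bound (vderiv (frac_int q S)) a (0 + 1 - q)"
      using q by (intro growth_bound_vderiv_frac_int[OF J]) simp
    then show ?thesis by (simp add: V_def)
  qed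
  define D where "D k = (vderiv ^^ k) V" for k
  have D_Suc: "D (Suc k) = vderiv (D k)" for k by (simp add: D_def)
  have holD: "vholomorphic_on (D k) rhp" for k
    unfolding D_def by (rule vholomorphic_on_funpow_vderiv[OF open_rhp holV])
  have cbD: "D k z \<in> cblin_ops" if "0 < Re z" for k z
    using that
  proof (induction k arbitrary: z)
    case 0
    then show ?case using cbS by (auto simp: D_def V_def intro: cblin_ops_frac_int[OF J])
  next
    case (Suc k)
    then show ?case unfolding D_Suc by (intro cblin_ops_vderiv[OF holD])
  qed
  have gbD: "growth_bound (D (Suc k)) a (1 - q + real k)" for k
  proof (induction k)
    case 0
    then show ?case using gbV' by (simp add: D_def)
  next
    case (Suc k)
    have "growth_bound (vderiv (D (Suc k))) a (1 - q + real k + 1)"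
      using q by (intro growth_bound_vderiv[OF holD Suc a]) simp
    then show ?case by (simp add: D_Suc add.assoc add.commute)
  qed
  have "growth_bound (D (Suc n)) a \<kappa>" using gbD[of n] by (simp add: q_def)
  moreover have "D (Suc n) (of_real t) = T t" if t: "t > 0" for t
    unfolding D_Suc
  proof (rule semigroup_eq_derivative[OF sg _ holD _ t])
    have "op_has_laplace T (\<mu>0 + 1) (resolvent A (complex_of_real (\<mu>0 + 1)))" by (rule gen) simp
    then show loc: "loc_bochner_integrable (\<lambda>t. blinfun_apply (T t) x)" for x
      by (auto simp: op_has_laplace_def has_laplace_def)
    fix t :: real and x assume t: "t > 0"
    define f where "f t = blinfun_apply (T t) x" for t
    define v where "v t = blinfun_apply (V (of_real t)) x" for t
    define \<omega>' where "\<omega>' = \<omega> + a"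
    define m where "m = max 0 (max \<mu>0 (max \<omega>1 \<omega>'))"
    have m: "m \<ge> 0" "m \<ge> \<mu>0" "m \<ge> \<omega>1" "m \<ge> \<omega>'" by (auto simp: m_def)
    define y where "y \<mu> = blinfun_apply (resolvent A (complex_of_real \<mu>)) x" for \<mu>
    have fy: "has_laplace f \<mu> (y \<mu>)" if "\<mu> > m" for \<mu>
      using gen[of \<mu>] that m unfolding f_def y_def op_has_laplace_def by auto
    obtain N \<nu> where N: "N \<ge> 0" "\<nu> \<ge> 0" and VN: "\<And>z. 0 < Re z \<Longrightarrow>
       norm (V z) \<le> N * exp (\<nu> * cmod z) * (cmod z powr (a + q) * Re z powr (- 0))"
      using gbV unfolding growth_bound_def by blast
    have v0: "v 0 = 0" by (simp add: v_def V_def frac_int_def)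
    have vle: "norm (v t) \<le> (N * norm x) * exp (\<nu> * t) * t powr (a + q)" if "0 \<le> t" for t
    proof (cases "t = 0")
      case False
      then have "norm (V (of_real t)) \<le> N * exp (\<nu> * t) * t powr (a + q)"
        using VN[of "of_real t"] that by simp
      then have "norm (V (of_real t)) * norm x \<le> N * exp (\<nu> * t) * t powr (a + q) * norm x"
        by (rule mult_right_mono) simp
      then show ?thesis using norm_blinfun[of "V (of_real t)" x] by (simp add: v_def mult_ac)
    qed (simp add: v0)
    have vbd: "norm (v t) \<le> (N * norm x) * exp ((\<nu> + (a + q)) * t)" if "0 \<le> t" for t
    proof -
      have "(N * norm x) * exp (\<nu> * t) * t powr (a + q) \<le> (N * norm x) * exp (\<nu> * t) * exp ((a + q) * t)"
        using that a q N by (intro mult_left_mono powr_le_exp) auto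
      then show ?thesis using vle[OF that] by (simp add: algebra_simps flip: exp_add)
    qed
    have cv: "continuous_on {0..} v"
      unfolding continuous_on_eq_continuous_within
    proof
      fix s :: real assume s: "s \<in> {0..}"
      show "continuous (at s within {0..}) v"
      proof (cases "s = 0")
        case False
        then have "(v has_vector_derivative blinfun_apply (vderiv V (of_real s)) x) (at s)"
          unfolding v_def using s by (intro cblin_vderiv_has_vector_derivative[OF holV]) auto
        then show ?thesis
          using has_vector_derivative_continuous continuous_at_imp_continuous_at_within by blast
      next
        case True
        have "(v \<longlongrightarrow> 0) (at 0 within {0..})"
        proof (rule Lim_null_comparison)
          show "\<forall>\<^sub>F t in at 0 within {0..}. norm (v t) \<le> (N * norm x) * exp (\<nu> * t) * t powr (a + q)"
            unfolding eventually_at_topological using vle by (intro exI[of _ UNIV]) auto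
          have "((\<lambda>t::real. t powr (a + q)) \<longlongrightarrow> 0) (at 0 within {0..})"
          proof (rule tendsto_zero_powrI[OF tendsto_ident_at tendsto_const])
            show "\<forall>\<^sub>F x in at (0::real) within {0..}. 0 \<le> x"
              unfolding eventually_at_topological by (intro exI[of _ UNIV]) auto
          qed (use a q in simp)
          then have "((\<lambda>t. (N * norm x) * exp (\<nu> * t) * t powr (a + q)) \<longlongrightarrow> (N * norm x) * exp (\<nu> * 0) * 0) (at 0 within {0..})"
            by (intro tendsto_intros)
          then show "((\<lambda>t. (N * norm x) * exp (\<nu> * t) * t powr (a + q)) \<longlongrightarrow> 0) (at 0 within {0..})" by simp
        qed
        then show ?thesis using True v0 by (simp add: continuous_within)
      qed
    qed
    define W where "W k = iterated_integral k f" for k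
    have cW: "continuous_on {0..} (W (Suc k))" for k
      unfolding W_def by (rule iterated_integral_Suc(1)[OF fy m(1)]) simp
    obtain K where K: "\<And>t. t \<ge> 0 \<Longrightarrow> norm (W (Suc n) t) \<le> K * exp ((m + 1) * t)"
      using iterated_integral_Suc(2)[OF fy m(1), of n] unfolding W_def by auto
    \<comment> \<open>Both transforms equal \<mu>^(-(n + 1)) R(\<mu>)x: on the left \<mu>^(-q) comes
      from the fractional integral and \<mu>^(-\<kappa>) from \<open>S\<close>, on the right each
      integration contributes 1/\<mu>.\<close>
    have vW: "v s = W (Suc n) s" if s: "0 \<le> s" for s
    proof (rule laplace_unique[OF cv cW vbd K _ s])
      fix \<mu> assume \<mu>: "\<mu> > max m (\<nu> + (a + q))"
      then have \<mu>': "\<mu> > 0" "\<mu> > m" "\<mu> > \<omega>" "\<mu> > \<omega>1" using m a by (auto simp: \<omega>'_def)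
      obtain L where L: "op_has_laplace (\<lambda>t. S (of_real t)) \<mu> L" "resolvent A (complex_of_real \<mu>) = (\<mu> powr \<kappa>) *\<^sub>R L"
        using \<omega>1(2)[OF \<mu>'(4)] by blast
      obtain z where z: "has_laplace v \<mu> z"
        using laplace_exponential_bound[OF loc_bochner_continuous[OF cv] vbd] \<mu> by force
      have "z = \<mu> powr (- q) *\<^sub>R blinfun_apply L x"
      proof (rule has_laplace_frac_ray[OF _ _ _ q(1) \<omega> \<mu>'(3) _ z])
        show "continuous_on {0<..} (\<lambda>t. blinfun_apply (S (of_real t)) x)"
          by (rule continuous_on_subset[OF cSx]) auto
        show "norm (blinfun_apply (S (of_real t)) x) \<le> (M * norm x) * exp (\<omega> * t) * t powr a" if "0 < t" for t
        proof -
          have "norm (S (of_real t)) \<le> M * exp (\<omega> * t) * t powr a" using bd[of "of_real t"] that by simp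
          then have "norm (S (of_real t)) * norm x \<le> M * exp (\<omega> * t) * t powr a * norm x" by (rule mult_right_mono) simp
          then show ?thesis using norm_blinfun[of "S (of_real t)" x] by (simp add: mult_ac)
        qed
        show "has_laplace (\<lambda>t. blinfun_apply (S (of_real t)) x) \<mu> (blinfun_apply L x)"
          using L(1) by (simp add: op_has_laplace_def)
        show "v t = frac_ray q (\<lambda>t. blinfun_apply (S (of_real t)) x) t" if "t > 0" for t
          unfolding v_def V_def by (rule frac_int_of_real[OF J that])
      qed (use a in simp)
      also have "\<dots> = (1 / \<mu>) ^ Suc n *\<^sub>R y \<mu>"
      proof -
        have "(1 / \<mu>) ^ Suc n = \<mu> powr (- real (Suc n))"
          using \<mu>'(1) by (simp add: powr_minus powr_realpow power_one_over del: power_Suc of_nat_Suc) (simp add: inverse_eq_divide)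
        also have "\<dots> = \<mu> powr (- q) * \<mu> powr (- \<kappa>)" by (simp add: q_def flip: powr_add)
        finally have "(1 / \<mu>) ^ Suc n *\<^sub>R y \<mu> = (\<mu> powr (- q) * (\<mu> powr (- \<kappa>) * \<mu> powr \<kappa>)) *\<^sub>R blinfun_apply L x"
          by (simp add: y_def L(2) blinfun.scaleR_left mult.assoc del: power_Suc)
        also have "\<mu> powr (- \<kappa>) * \<mu> powr \<kappa> = 1" using \<mu>'(1) by (simp flip: powr_add)
        finally show ?thesis by simp
      qed
      finally have "z = (1 / \<mu>) ^ Suc n *\<^sub>R y \<mu>" .
      moreover have "has_laplace (W (Suc n)) \<mu> ((1 / \<mu>) ^ Suc n *\<^sub>R y \<mu>)"
        unfolding W_def by (rule iterated_integral_laplace[OF fy m(1) \<mu>'(2)]) simp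
      ultimately show "\<exists>y. has_laplace v \<mu> y \<and> has_laplace (W (Suc n)) \<mu> y" using z by blast
    qed
    \<comment> \<open>Each derivative removes one integration. The induction stops at k = n with one
      integral left, since orbits of \<open>T\<close> are not known to be continuous and the last
      derivative needs the separate argument through the semigroup law.\<close>
    have "blinfun_apply (D k (of_real s)) x = W (Suc n - k) s" if "k \<le> n" "s > 0" for k s
      using that
    proof (induction k arbitrary: s)
      case 0
      then show ?case using vW[of s] by (simp add: D_def v_def)
    next
      case (Suc k)
      obtain j where "n = Suc k + j" using le_Suc_ex[OF Suc.prems(1)] by blast
      then have j: "Suc n - k = Suc (Suc j)" by simp
      show ?case unfolding D_Suc
      proof (rule vector_derivative_unique_at)
        show "((\<lambda>s. blinfun_apply (D k (of_real s)) x) has_vector_derivative blinfun_apply (vderiv (D k) (of_real s)) x) (at s)"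
          by (rule cblin_vderiv_has_vector_derivative[OF holD Suc.prems(2)])
        have "((\<lambda>s. integral {0..s} (W (Suc j))) has_vector_derivative W (Suc j) s) (at s)"
          by (rule integral_has_vector_derivative_at[OF cW Suc.prems(2)])
        moreover have "Suc n - Suc k = Suc j" using j by simp
        ultimately have "((\<lambda>s. integral {0..s} (W (Suc j))) has_vector_derivative W (Suc n - Suc k) s) (at s)" by simp
        then show "((\<lambda>s. blinfun_apply (D k (of_real s)) x) has_vector_derivative W (Suc n - Suc k) s) (at s)"
        proof (rule has_vector_derivative_transform_within_open[OF _ open_greaterThan[of 0]])
          show "integral {0..s} (W (Suc j)) = blinfun_apply (D k (of_real s)) x" if "s \<in> {0<..}" for s
            using Suc.IH[of s] Suc.prems that by (simp add: j W_def)
        qed (use Suc.prems in simp)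
      qed
    qed
    from this[of n t] t show "blinfun_apply (D n (of_real t)) x = integral {0..t} (\<lambda>s. blinfun_apply (T s) x)"
      by (simp add: W_def f_def[abs_def] Suc_diff_le)
  qed
  ultimately show ?thesis using holD cbD by blast
qed

section \<open>Choice of exponents and independence of the extension from \<alpha>\<close>

theorem theorem4p5:
  fixes T :: "real \<Rightarrow> 'a::complex_banach \<Rightarrow>\<^sub>L 'a"
  assumes "op_semigroup T"
    and "laplace_convergence_set T \<noteq> {}"
  shows "\<exists>A. mv_linear A \<and>
    (\<forall>\<mu>. laplace_abscissa T < ereal \<mu> \<longrightarrow>
       complex_of_real \<mu> \<in> resolvent_set A \<and>
       op_has_laplace T \<mu> (resolvent A (complex_of_real \<mu>))) \<and>
    (\<forall>\<gamma> \<beta> :: real. 0 \<le> \<gamma> \<longrightarrow> 0 \<le> \<beta> \<longrightarrow> \<beta> < 1 \<longrightarrow>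
       ((\<exists>U. (\<forall>z. 0 < Re z \<longrightarrow> U z \<in> cblin_ops) \<and>
             vholomorphic_on U {z. 0 < Re z} \<and>
             (\<forall>t>0. U (complex_of_real t) = T t) \<and>
             (\<forall>\<alpha>>\<gamma>. \<exists>M>0. \<exists>\<omega>\<ge>0. \<forall>z. 0 < Re z \<longrightarrow>
                norm (U z) \<le> M * exp (\<omega> * cmod z) * (cmod z powr \<alpha> / Re z powr (\<alpha> + \<beta>))))
        \<longleftrightarrow>
        (\<forall>\<alpha>>\<gamma>. \<exists>S. generates_holomorphic_bv A (\<alpha> + \<beta>) S \<and>
             (\<exists>M>0. \<exists>\<omega>>0. \<forall>z. 0 \<le> Re z \<longrightarrow>
                norm (S z) \<le> M * exp (\<omega> * cmod z) * cmod z powr \<alpha>))))"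
proof -
  obtain A where A: "mv_linear A" "closed A"
    and res: "\<And>\<mu>. laplace_abscissa T < ereal \<mu> \<Longrightarrow> complex_of_real \<mu> \<in> resolvent_set A \<and>
       op_has_laplace T \<mu> (resolvent A (complex_of_real \<mu>))"
    using semigroup_generator_exists[OF assms] by blast
  obtain \<mu>0 where \<mu>0: "\<mu>0 \<in> laplace_convergence_set T" using assms(2) by blast
  have gen: "complex_of_real \<mu> \<in> resolvent_set A \<and> op_has_laplace T \<mu> (resolvent A (complex_of_real \<mu>))"
    if "\<mu> > \<mu>0" for \<mu>
  proof (rule res)
    have "laplace_abscissa T \<le> ereal \<mu>0" unfolding laplace_abscissa_def by (rule INF_lower[OF \<mu>0])
    also have "\<dots> < ereal \<mu>" using that by simp
    finally show "laplace_abscissa T < ereal \<mu>" .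
  qed
  show ?thesis
  proof (intro exI[of _ A] conjI A(1) allI impI iffI)
    fix \<gamma> \<beta> \<alpha> :: real
    assume \<gamma>: "0 \<le> \<gamma>" and \<beta>: "0 \<le> \<beta>" "\<beta> < 1" and \<alpha>: "\<gamma> < \<alpha>"
      and "\<exists>U. (\<forall>z. 0 < Re z \<longrightarrow> U z \<in> cblin_ops) \<and> vholomorphic_on U {z. 0 < Re z} \<and>
             (\<forall>t>0. U (complex_of_real t) = T t) \<and>
             (\<forall>\<alpha>>\<gamma>. \<exists>M>0. \<exists>\<omega>\<ge>0. \<forall>z. 0 < Re z \<longrightarrow>
                norm (U z) \<le> M * exp (\<omega> * cmod z) * (cmod z powr \<alpha> / Re z powr (\<alpha> + \<beta>)))"
    then obtain U where cb: "\<And>z. 0 < Re z \<Longrightarrow> U z \<in> cblin_ops" and hol: "vholomorphic_on U rhp"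
      and UT: "\<And>t. t > 0 \<Longrightarrow> U (complex_of_real t) = T t"
      and bd: "\<And>\<alpha>. \<alpha> > \<gamma> \<Longrightarrow> \<exists>M>0. \<exists>\<omega>\<ge>0. \<forall>z. 0 < Re z \<longrightarrow>
                norm (U z) \<le> M * exp (\<omega> * cmod z) * (cmod z powr \<alpha> / Re z powr (\<alpha> + \<beta>))" by blast
    \<comment> \<open>Strictly between \<gamma> and \<alpha>, so that the hypothesis applies to
      \<open>a\<close>; the second entry of the maximum keeps e = \<alpha> - a below 1.\<close>
    define a where "a = max ((\<gamma> + \<alpha>) / 2) (\<alpha> - 1/2)"
    have a: "\<gamma> < a" "a < \<alpha>" "\<alpha> - a < 1" using \<alpha> by (auto simp: a_def less_max_iff_disj)
    have gb: "growth_bound U a (a + \<beta>)"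
      using bd[OF a(1)] unfolding growth_bound_def powr_minus_divide
      by (metis (no_types, lifting) less_imp_le mult.right_neutral times_divide_eq_right)
    have "\<exists>S. generates_holomorphic_bv A ((a + \<beta>) + (\<alpha> - a)) S \<and>
        (\<exists>M>0. \<exists>\<omega>>0. \<forall>z. 0 \<le> Re z \<longrightarrow> norm (S z) \<le> M * exp (\<omega> * cmod z) * cmod z powr (a + (\<alpha> - a)))"
      by (rule holomorphic_imp_integrated[OF A gen hol cb UT gb]) (use a \<beta> \<gamma> in auto)
    then show "\<exists>S. generates_holomorphic_bv A (\<alpha> + \<beta>) S \<and>
        (\<exists>M>0. \<exists>\<omega>>0. \<forall>z. 0 \<le> Re z \<longrightarrow> norm (S z) \<le> M * exp (\<omega> * cmod z) * cmod z powr \<alpha>)"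
      by (simp add: add.commute)
  next
    fix \<gamma> \<beta> :: real
    assume \<gamma>: "0 \<le> \<gamma>" and \<beta>: "0 \<le> \<beta>" "\<beta> < 1"
      and S: "\<forall>\<alpha>>\<gamma>. \<exists>S. generates_holomorphic_bv A (\<alpha> + \<beta>) S \<and>
             (\<exists>M>0. \<exists>\<omega>>0. \<forall>z. 0 \<le> Re z \<longrightarrow> norm (S z) \<le> M * exp (\<omega> * cmod z) * cmod z powr \<alpha>)"
    have ex: "\<exists>U. (\<forall>z. 0 < Re z \<longrightarrow> U z \<in> cblin_ops) \<and> vholomorphic_on U rhp \<and>
        (\<forall>t>0. U (of_real t) = T t) \<and> growth_bound U \<alpha> (\<alpha> + \<beta>)" if \<alpha>: "\<alpha> > \<gamma>" for \<alpha>
    proof -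
      obtain S M \<omega> where S1: "generates_holomorphic_bv A (\<alpha> + \<beta>) S" and M: "M > 0" "\<omega> > 0"
        and bd: "\<And>z. 0 \<le> Re z \<Longrightarrow> norm (S z) \<le> M * exp (\<omega> * cmod z) * cmod z powr \<alpha>"
        using S \<alpha> by blast
      have pos: "\<alpha> + \<beta> > 0" "\<alpha> \<ge> 0" "M \<ge> 0" "\<omega> \<ge> 0" using \<alpha> \<gamma> \<beta> M by auto
      show ?thesis by (rule integrated_imp_holomorphic[OF assms(1) _ S1 pos bd]) (use gen in blast)
    qed
    \<comment> \<open>One extension has to serve all exponents. The exponent \<gamma> + 1 is an
      arbitrary reference; extensions for other exponents coincide with this one because all of them
      equal \<open>T\<close> on the positive axis.\<close>
    obtain U where cb: "\<And>z. 0 < Re z \<Longrightarrow> U z \<in> cblin_ops" and hol: "vholomorphic_on U rhp"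
      and UT: "\<And>t. t > 0 \<Longrightarrow> U (complex_of_real t) = T t"
      using ex[of "\<gamma> + 1"] by auto
    have gb: "growth_bound U \<alpha> (\<alpha> + \<beta>)" if \<alpha>: "\<alpha> > \<gamma>" for \<alpha>
    proof -
      obtain U' where hol': "vholomorphic_on U' rhp"
        and UT': "\<And>t. t > 0 \<Longrightarrow> U' (complex_of_real t) = T t" and gb': "growth_bound U' \<alpha> (\<alpha> + \<beta>)"
        using ex[OF \<alpha>] by auto
      have "U z = U' z" if "0 < Re z" for z
      proof (rule vholomorphic_on_identity[OF open_rhp _ hol hol', where U = "complex_of_real ` {0<..}" and \<xi> = 1])
        show "connected rhp" using convex_halfspace_Re_gt[of 0] by (intro convex_connected) simp
        have lim: "(\<lambda>n. complex_of_real (1 + 1 / (real n + 1))) \<longlonglongrightarrow> complex_of_real (1 + 0)"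
          by (intro tendsto_of_real) real_asymp
        have mem: "complex_of_real (1 + 1 / (real n + 1)) \<in> complex_of_real ` {0<..} - {1}" for n
        proof -
          have pos: "1 / (real n + 1) > 0" by simp
          have "complex_of_real (1 + 1 / (real n + 1)) \<noteq> of_real 1"
            unfolding of_real_eq_iff using pos by linarith
          moreover have "1 + 1 / (real n + 1) \<in> {0<..}" using add_pos_pos[OF zero_less_one pos] by blast
          ultimately show ?thesis by (metis Diff_iff imageI of_real_1 singletonD)
        qed
        show "1 islimpt complex_of_real ` {0<..}"
          unfolding islimpt_sequential using mem lim
          by (intro exI[of _ "\<lambda>n. complex_of_real (1 + 1 / (real n + 1))"]) simp
      qed (use that UT UT' in auto)
      then show ?thesis by (intro growth_bound_cong[OF gb']) simp
    qed
    have "\<exists>M>0. \<exists>\<omega>\<ge>0. \<forall>z. 0 < Re z \<longrightarrow>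
        norm (U z) \<le> M * exp (\<omega> * cmod z) * (cmod z powr \<alpha> / Re z powr (\<alpha> + \<beta>))" if \<alpha>: "\<alpha> > \<gamma>" for \<alpha>
    proof -
      obtain M \<omega> where M: "M \<ge> 0" "\<omega> \<ge> 0" and U: "\<And>z. 0 < Re z \<Longrightarrow>
         norm (U z) \<le> M * exp (\<omega> * cmod z) * (cmod z powr \<alpha> * Re z powr (- (\<alpha> + \<beta>)))"
        using gb[OF \<alpha>] unfolding growth_bound_def by blast
      have "norm (U z) \<le> (M + 1) * exp (\<omega> * cmod z) * (cmod z powr \<alpha> / Re z powr (\<alpha> + \<beta>))" if z: "0 < Re z" for z
      proof -
        have "norm (U z) \<le> M * exp (\<omega> * cmod z) * (cmod z powr \<alpha> / Re z powr (\<alpha> + \<beta>))"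
          using U[OF z] unfolding powr_minus_divide by simp
        also have "\<dots> \<le> (M + 1) * exp (\<omega> * cmod z) * (cmod z powr \<alpha> / Re z powr (\<alpha> + \<beta>))"
          by (intro mult_right_mono) auto
        finally show ?thesis .
      qed
      moreover have "M + 1 > 0" using M by simp
      ultimately show ?thesis using M(2) by blast
    qed
    with cb hol UT show "\<exists>U. (\<forall>z. 0 < Re z \<longrightarrow> U z \<in> cblin_ops) \<and> vholomorphic_on U {z. 0 < Re z} \<and>
             (\<forall>t>0. U (complex_of_real t) = T t) \<and>
             (\<forall>\<alpha>>\<gamma>. \<exists>M>0. \<exists>\<omega>\<ge>0. \<forall>z. 0 < Re z \<longrightarrow>
                norm (U z) \<le> M * exp (\<omega> * cmod z) * (cmod z powr \<alpha> / Re z powr (\<alpha> + \<beta>)))"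
      by blast
  qed (use res in auto)
qed

end
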